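(* Let $G\rightrightarrows M$ be a Lie groupoid with Lie algebroid $A\to M$. The van Est map $V:C^\infty_\nu(G^{(q)})\to\bigwedge^q\Gamma(A^* )$ ($q\ge0$) is a homomorphism of differential algebras from the normalized groupoid cochains with product $*$ and differential $\delta$ to $\left(\bigwedge\Gamma(A^* ),\wedge,d_A\right)$, i.e. $V(f*g)=Vf\wedge Vg$ and $V(\delta f)=d_A(Vf)$, and it is equivariant with respect to the action of multiplicative vector fields, i.e. $V(\psi^{(q)}f)=\widetilde\psi_1(Vf)$ for every multiplicative vector field $\psi$ on $G$ and every $f\in C^\infty_\nu(G^{(q)})$.
   Context: $G$ has source and target $s,t$, identity $e:M\to G$, and $G^{(q)}=G\,{}_s\!\times_t\cdots{}_s\!\times_tG$ ($q$ factors), $G^{(0)}=M$, with projections $p_i^q:G^{(q)}\to G$. Face maps $\sigma_i^q:G^{(q)}\to G^{(q-1)}$: $\sigma_0^1=s$, $\sigma_1^1=t$; for $q>1$, $\sigma_0^q$ drops the first component, $\sigma_q^q$ the last, and $\sigma_i^q$ ($0<i<q$) multiplies components $i$ and $i+1$. Degeneracy maps $\Delta_i^q:G^{(q)}\to G^{(q+1)}$, $0\le i\le q$: $\Delta_0^0=e$ and $\Delta_i^q$ inserts a unit after the $i$th component. The coboundary is $\delta=\sum_{i=0}^q(-1)^i(\sigma_i^q)^*:C^\infty(G^{(q-1)})\to C^\infty(G^{(q)})$. For $f\in C^\infty(G^{(q)})$, $g\in C^\infty(G^{(q')})$, $f*g\in C^\infty(G^{(q+q')})$ is the restriction of $f\times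 g$. The normalized cochains $C^\infty_\nu(G^{(q)})$ are the $f$ with $(\Delta_i^{q-1})^*f=0$ for all $i$. Sections of $A=e^*(T_tG)$ ($T_tG$ the vectors tangent to the $t$-fibres) are identified with left-invariant vector fields $X$ on $G$, the bracket being the Lie bracket and the anchor $\rho(X)$ the vector field on $M$ that is $s$-related to $X$. For left-invariant $X$, $X_q^q$ is the vector field on $G^{(q)}$ acting as $X$ on the last component: it is $p_i^q$-related to $0$ for $i<q$ and $p_q^q$-related to $X$. Set $X^q=(\Delta_{q-1}^{q-1})^*X_q^q:C^\infty(G^{(q)})\to C^\infty(G^{(q-1)})$. For $f\in C^\infty_\nu(G^{(q)})$, $Vf\in\bigwedge^q\Gamma(A^* )$ is defined by $$\iota_{X_q}\cdots\iota_{X_1}Vf=\sum_{\gamma\in S_q}(\operatorname{sgn}\gamma)(X_{\gamma(1)})^1\cdots(X_{\gamma(q)})^qf$$ for $X_1,\dots,X_q\in\Gamma(A)$ (and $Vf=f$ for $q=0$). $d_A$ is the Lie algebroid differential on $\bigwedge\Gamma(A^* )$. A vector field $\psi$ on $G$ is multiplicative if there is a vector field on $G^{(2)}$ that is related to $\psi$ under both projections and under multiplication. It then has a base field $\phi$ on $M$ ($s$- and $t$-related to $\psi$), and lifts $\psi^{(q)}$ to $G^{(q)}$ acting as $\psi$ on each component ($\psi^{(0)}=\phi$). For left-invariant $X$, $[\psi,X]$ is left-invariant, and $\psi$ induces a derivation $\widetilde\psi_1$ of $\bigwedge\Gamma(A^* )$ (a vector field on the supermanifold $[-1]A$, commuting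 with $d_A$) given by $\iota_{X_q}\cdots\iota_{X_1}\widetilde\psi_1\omega=\phi(\iota_{X_q}\cdots\iota_{X_1}\omega)-\sum_{i=1}^q\iota_{X_q}\cdots\iota_{X_{i+1}}\iota_{[\psi,X_i]}\iota_{X_{i-1}}\cdots\iota_{X_1}\omega$. *)

theory Defs
  imports "HOL-Analysis.Analysis"
begin

section \<open>Smooth manifolds\<close>

text \<open>
  The dimension of \<open>G\<^sup>(\<^sup>q\<^sup>)\<close> varies with \<open>q\<close>, and zero-dimensional manifolds have to be allowed, so
  charts take their values in \<^const>\<open>Euclidean_space\<close> \<open>n\<close>, the \<open>n\<close>-dimensional Euclidean space of
  sequences that vanish from index \<open>n\<close> on.
\<close>

primrec Ck_on :: "nat \<Rightarrow> nat \<Rightarrow> (nat \<Rightarrow> real) set \<Rightarrow> ((nat \<Rightarrow> real) \<Rightarrow> real) \<Rightarrow> bool" where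
  "Ck_on n 0 U f \<longleftrightarrow> continuous_on U f"
| "Ck_on n (Suc k) U f \<longleftrightarrow> continuous_on U f \<and>
     (\<exists>D. \<forall>i<n. Ck_on n k U (D i) \<and>
        (\<forall>x\<in>U. ((\<lambda>t. f (x(i := t))) has_real_derivative D i x) (at (x i))))"

text \<open>Only meant for sets \<open>U\<close> that are open in \<^const>\<open>Euclidean_space\<close> \<open>n\<close>.\<close>

definition smooth_on :: "nat \<Rightarrow> (nat \<Rightarrow> real) set \<Rightarrow> ((nat \<Rightarrow> real) \<Rightarrow> real) \<Rightarrow> bool" where
  "smooth_on n U f \<longleftrightarrow> (\<forall>k. Ck_on n k U f)"

record 'a manifold =
  mtop :: "'a topology"
  mdim :: nat
  atlas :: "('a set \<times> ('a \<Rightarrow> nat \<Rightarrow> real)) set"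

definition is_manifold :: "'a manifold \<Rightarrow> bool" where
  "is_manifold M \<longleftrightarrow>
     Hausdorff_space (mtop M) \<and> second_countable (mtop M) \<and>
     (\<Union>(U, \<phi>)\<in>atlas M. U) = topspace (mtop M) \<and>
     (\<forall>(U, \<phi>)\<in>atlas M.
        openin (mtop M) U \<and> openin (Euclidean_space (mdim M)) (\<phi> ` U) \<and>
        homeomorphic_map (subtopology (mtop M) U)
          (subtopology (Euclidean_space (mdim M)) (\<phi> ` U)) \<phi>) \<and>
     (\<forall>(U, \<phi>)\<in>atlas M. \<forall>(V, \<psi>)\<in>atlas M. \<forall>i<mdim M.
        smooth_on (mdim M) (\<phi> ` (U \<inter> V)) (\<lambda>x. \<psi> (inv_into U \<phi> x) i))"

definition smooth_on_open :: "'a manifold \<Rightarrow> 'a set \<Rightarrow> ('a \<Rightarrow> real) \<Rightarrow> bool" where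
  "smooth_on_open M W f \<longleftrightarrow>
     (\<forall>(U, \<phi>)\<in>atlas M. smooth_on (mdim M) (\<phi> ` (U \<inter> W)) (\<lambda>x. f (inv_into U \<phi> x)))"

text \<open>
  Smoothness on an arbitrary subset means that there are local smooth extensions. On an embedded
  submanifold this is smoothness for the submanifold structure.
\<close>

definition smooth_fun :: "'a manifold \<Rightarrow> 'a set \<Rightarrow> ('a \<Rightarrow> real) \<Rightarrow> bool" where
  "smooth_fun M S f \<longleftrightarrow>
     (\<forall>p\<in>S. \<exists>W g. openin (mtop M) W \<and> p \<in> W \<and> smooth_on_open M W g \<and> (\<forall>x\<in>W \<inter> S. g x = f x))"

definition smooth_map :: "'a manifold \<Rightarrow> 'a set \<Rightarrow> 'b manifold \<Rightarrow> ('a \<Rightarrow> 'b) \<Rightarrow> bool" where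
  "smooth_map M S N F \<longleftrightarrow>
     continuous_map (subtopology (mtop M) S) (mtop N) F \<and>
     (\<forall>(V, \<psi>)\<in>atlas N. \<forall>i<mdim N. smooth_fun M {p\<in>S. F p \<in> V} (\<lambda>p. \<psi> (F p) i))"

text \<open>
  The \<open>q\<close>-fold Cartesian power. Its points are the lists of length \<open>q\<close>, and the coordinates of the
  \<open>j\<close>-th entry occupy the positions from \<open>j * n\<close> to \<open>j * n + (n - 1)\<close>.
\<close>

definition power_chart ::
    "nat \<Rightarrow> nat \<Rightarrow> ('a set \<times> ('a \<Rightarrow> nat \<Rightarrow> real)) list \<Rightarrow> 'a list set \<times> ('a list \<Rightarrow> nat \<Rightarrow> real)" where
  "power_chart n q cs =
     ({xs. length xs = q \<and> (\<forall>j<q. xs ! j \<in> fst (cs ! j))},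
      (\<lambda>xs k. if k < q * n then snd (cs ! (k div n)) (xs ! (k div n)) (k mod n) else 0))"

definition mpower :: "nat \<Rightarrow> 'a manifold \<Rightarrow> 'a list manifold" where
  "mpower q M =
     \<lparr> mtop = pullback_topology {xs. length xs = q} (\<lambda>xs. \<lambda>j\<in>{..<q}. xs ! j)
                (product_topology (\<lambda>_. mtop M) {..<q}),
       mdim = q * mdim M,
       atlas = power_chart (mdim M) q ` {cs. length cs = q \<and> set cs \<subseteq> atlas M} \<rparr>"


section \<open>Tangent vectors and vector fields as derivations\<close>

text \<open>
  A space together with its algebra of smooth functions. Functions are extended by zero outside the
  set of points, so that equality of functions is equality on the space.
\<close>

record 'a fspace =
  pts :: "'a set"
  fns :: "('a \<Rightarrow> real) set"

definition subspace_of :: "'a manifold \<Rightarrow> 'a set \<Rightarrow> 'a fspace" where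
  "subspace_of M S = \<lparr> pts = S, fns = {f. (\<forall>x. x \<notin> S \<longrightarrow> f x = 0) \<and> smooth_fun M S f} \<rparr>"

definition whole :: "'a manifold \<Rightarrow> 'a fspace" where
  "whole M = subspace_of M (topspace (mtop M))"

definition pullback :: "'a fspace \<Rightarrow> ('a \<Rightarrow> 'b) \<Rightarrow> ('b \<Rightarrow> real) \<Rightarrow> 'a \<Rightarrow> real" where
  "pullback N F h = (\<lambda>x. if x \<in> pts N then h (F x) else 0)"

definition tangent_vector :: "'a fspace \<Rightarrow> 'a \<Rightarrow> (('a \<Rightarrow> real) \<Rightarrow> real) \<Rightarrow> bool" where
  "tangent_vector N p v \<longleftrightarrow> p \<in> pts N \<and>
     (\<forall>f\<in>fns N. \<forall>g\<in>fns N. \<forall>a b. v (\<lambda>x. a * f x + b * g x) = a * v f + b * v g) \<and>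
     (\<forall>f\<in>fns N. \<forall>g\<in>fns N. v (\<lambda>x. f x * g x) = f p * v g + v f * g p)"

definition submersion :: "'a manifold \<Rightarrow> 'b manifold \<Rightarrow> ('a \<Rightarrow> 'b) \<Rightarrow> bool" where
  "submersion M N F \<longleftrightarrow> smooth_map M (topspace (mtop M)) N F \<and>
     (\<forall>p\<in>topspace (mtop M). \<forall>w. tangent_vector (whole N) (F p) w \<longrightarrow>
        (\<exists>v. tangent_vector (whole M) p v \<and>
             (\<forall>h\<in>fns (whole N). v (pullback (whole M) F h) = w h)))"

type_synonym 'a vfield = "('a \<Rightarrow> real) \<Rightarrow> 'a \<Rightarrow> real"

text \<open>The value zero on functions that are not smooth makes equality of vector fields extensional.\<close>

definition vector_fields :: "'a fspace \<Rightarrow> 'a vfield set" where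
  "vector_fields N = {D.
     (\<forall>f\<in>fns N. D f \<in> fns N) \<and> (\<forall>f. f \<notin> fns N \<longrightarrow> D f = (\<lambda>_. 0)) \<and>
     (\<forall>f\<in>fns N. \<forall>g\<in>fns N. \<forall>a b. D (\<lambda>x. a * f x + b * g x) = (\<lambda>x. a * D f x + b * D g x)) \<and>
     (\<forall>f\<in>fns N. \<forall>g\<in>fns N. D (\<lambda>x. f x * g x) = (\<lambda>x. f x * D g x + D f x * g x))}"

definition zero_field :: "'a vfield" where
  "zero_field = (\<lambda>f x. 0)"

definition lie_bracket :: "'a vfield \<Rightarrow> 'a vfield \<Rightarrow> 'a vfield" where
  "lie_bracket X Y = (\<lambda>f x. X (Y f) x - Y (X f) x)"

definition related ::
    "'a fspace \<Rightarrow> 'b fspace \<Rightarrow> ('a \<Rightarrow> 'b) \<Rightarrow> 'a vfield \<Rightarrow> 'b vfield \<Rightarrow> bool" where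
  "related N N' F D D' \<longleftrightarrow> (\<forall>h\<in>fns N'. D (pullback N F h) = pullback N F (D' h))"


section \<open>Lie groupoids and their nerves\<close>

record ('m, 'g) groupoid =
  Obj :: "'m manifold"
  Arr :: "'g manifold"
  src :: "'g \<Rightarrow> 'm"
  tgt :: "'g \<Rightarrow> 'm"
  idt :: "'m \<Rightarrow> 'g"
  mul :: "'g \<Rightarrow> 'g \<Rightarrow> 'g"
  ivs :: "'g \<Rightarrow> 'g"

abbreviation objs :: "('m, 'g) groupoid \<Rightarrow> 'm set" where
  "objs G \<equiv> topspace (mtop (Obj G))"

abbreviation arrows :: "('m, 'g) groupoid \<Rightarrow> 'g set" where
  "arrows G \<equiv> topspace (mtop (Arr G))"

definition strings :: "('m, 'g) groupoid \<Rightarrow> nat \<Rightarrow> 'g list set" where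
  "strings G q = {gs. length gs = q \<and> set gs \<subseteq> arrows G \<and>
                      (\<forall>i. Suc i < q \<longrightarrow> src G (gs ! i) = tgt G (gs ! Suc i))}"

definition lie_groupoid :: "('m, 'g) groupoid \<Rightarrow> bool" where
  "lie_groupoid G \<longleftrightarrow>
     is_manifold (Obj G) \<and> is_manifold (Arr G) \<and>
     submersion (Arr G) (Obj G) (src G) \<and> submersion (Arr G) (Obj G) (tgt G) \<and>
     smooth_map (Obj G) (objs G) (Arr G) (idt G) \<and>
     smooth_map (Arr G) (arrows G) (Arr G) (ivs G) \<and>
     smooth_map (mpower 2 (Arr G)) (strings G 2) (Arr G) (\<lambda>gs. mul G (gs ! 0) (gs ! 1)) \<and>
     (\<forall>x\<in>objs G. src G (idt G x) = x \<and> tgt G (idt G x) = x) \<and>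
     (\<forall>g\<in>arrows G. \<forall>h\<in>arrows G. src G g = tgt G h \<longrightarrow>
        src G (mul G g h) = src G h \<and> tgt G (mul G g h) = tgt G g) \<and>
     (\<forall>g\<in>arrows G. \<forall>h\<in>arrows G. \<forall>k\<in>arrows G. src G g = tgt G h \<longrightarrow> src G h = tgt G k \<longrightarrow>
        mul G (mul G g h) k = mul G g (mul G h k)) \<and>
     (\<forall>g\<in>arrows G. mul G (idt G (tgt G g)) g = g \<and> mul G g (idt G (src G g)) = g) \<and>
     (\<forall>g\<in>arrows G. src G (ivs G g) = tgt G g \<and> tgt G (ivs G g) = src G g \<and>
        mul G g (ivs G g) = idt G (tgt G g) \<and> mul G (ivs G g) g = idt G (src G g))"

text \<open>
  A point of \<open>G\<^sup>(\<^sup>q\<^sup>)\<close> is written \<open>(x, [g\<^sub>1, \<dots>, g\<^sub>q])\<close>, where \<open>x = t(g\<^sub>1)\<close> is redundant if \<open>q \<ge> 1\<close>,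
  and \<open>(x, [])\<close> stands for the point \<open>x\<close> of \<open>G\<^sup>(\<^sup>0\<^sup>) = M\<close>. For \<open>q \<ge> 1\<close> the smooth structure is that of
  the submanifold of composable strings in the \<open>q\<close>-fold power of \<open>G\<close>.
\<close>

type_synonym ('m, 'g) nsimplex = "'m \<times> 'g list"

definition nerve_pts :: "('m, 'g) groupoid \<Rightarrow> nat \<Rightarrow> ('m, 'g) nsimplex set" where
  "nerve_pts G q = (if q = 0 then {(x, []) | x. x \<in> objs G}
                    else {(tgt G (hd gs), gs) | gs. gs \<in> strings G q})"

definition nerve :: "('m, 'g) groupoid \<Rightarrow> nat \<Rightarrow> ('m, 'g) nsimplex fspace" where
  "nerve G q = \<lparr> pts = nerve_pts G q,
     fns = {f. (\<forall>z. z \<notin> nerve_pts G q \<longrightarrow> f z = 0) \<and>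
               (if q = 0 then smooth_fun (Obj G) (objs G) (\<lambda>x. f (x, []))
                else smooth_fun (mpower q (Arr G)) (strings G q) (\<lambda>gs. f (tgt G (hd gs), gs)))} \<rparr>"

text \<open>Components of a string are numbered from 0.\<close>

definition component :: "nat \<Rightarrow> ('m, 'g) nsimplex \<Rightarrow> 'g" where
  "component i z = snd z ! i"

text \<open>The last vertex is \<open>s(g\<^sub>q)\<close> if \<open>q \<ge> 1\<close>.\<close>

definition last_vertex :: "('m, 'g) groupoid \<Rightarrow> ('m, 'g) nsimplex \<Rightarrow> 'm" where
  "last_vertex G z = (if snd z = [] then fst z else src G (last (snd z)))"

text \<open>
  The first case covers \<open>\<sigma>\<^sub>0\<^sup>1 = s\<close>, and the second one \<open>\<sigma>\<^sub>1\<^sup>1 = t\<close>.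
\<close>

definition face :: "('m, 'g) groupoid \<Rightarrow> nat \<Rightarrow> ('m, 'g) nsimplex \<Rightarrow> ('m, 'g) nsimplex" where
  "face G i z = (let x = fst z; gs = snd z in
     if i = 0 then (src G (hd gs), tl gs)
     else if i = length gs then (x, butlast gs)
     else (x, take (i - 1) gs @ [mul G (gs ! (i - 1)) (gs ! i)] @ drop (i + 1) gs))"

definition degeneracy :: "('m, 'g) groupoid \<Rightarrow> nat \<Rightarrow> ('m, 'g) nsimplex \<Rightarrow> ('m, 'g) nsimplex" where
  "degeneracy G i z = (let x = fst z; gs = snd z in
     (x, take i gs @ [idt G (last_vertex G (x, take i gs))] @ drop i gs))"

text \<open>The coboundary of a \<open>q\<close>-cochain, a \<open>(q + 1)\<close>-cochain.\<close>

definition coboundary ::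
    "('m, 'g) groupoid \<Rightarrow> nat \<Rightarrow> (('m, 'g) nsimplex \<Rightarrow> real) \<Rightarrow> ('m, 'g) nsimplex \<Rightarrow> real" where
  "coboundary G q f =
     (\<lambda>z. \<Sum>i\<le>Suc q. (-1) ^ i * pullback (nerve G (Suc q)) (face G i) f z)"

definition cochain_prod ::
    "('m, 'g) groupoid \<Rightarrow> nat \<Rightarrow> nat \<Rightarrow> (('m, 'g) nsimplex \<Rightarrow> real) \<Rightarrow>
     (('m, 'g) nsimplex \<Rightarrow> real) \<Rightarrow> ('m, 'g) nsimplex \<Rightarrow> real" where
  "cochain_prod G q q' f g =
     (\<lambda>(x, gs). if (x, gs) \<in> nerve_pts G (q + q')
                then f (x, take q gs) * g (last_vertex G (x, take q gs), drop q gs) else 0)"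

definition cochain_unit :: "('m, 'g) groupoid \<Rightarrow> ('m, 'g) nsimplex \<Rightarrow> real" where
  "cochain_unit G = (\<lambda>z. if z \<in> nerve_pts G 0 then 1 else 0)"

definition normalized :: "('m, 'g) groupoid \<Rightarrow> nat \<Rightarrow> (('m, 'g) nsimplex \<Rightarrow> real) set" where
  "normalized G q =
     {f \<in> fns (nerve G q). \<forall>i<q. pullback (nerve G (q - 1)) (degeneracy G i) f = (\<lambda>_. 0)}"


section \<open>The Lie algebroid and its differential forms\<close>

definition tfibre :: "('m, 'g) groupoid \<Rightarrow> 'm \<Rightarrow> 'g fspace" where
  "tfibre G x = subspace_of (Arr G) {g\<in>arrows G. tgt G g = x}"

text \<open>
  Left-invariant vector fields: for composable \<open>g\<close>, \<open>h\<close>, the value of \<open>X\<close> at \<open>h\<close> is (the image under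
  the inclusion of) a vector \<open>v\<close> tangent to the \<open>t\<close>-fibre through \<open>h\<close>, and left translation by \<open>g\<close>,
  from the \<open>t\<close>-fibre over \<open>s(g)\<close> to \<open>G\<close>, maps \<open>v\<close> to the value of \<open>X\<close> at \<open>gh\<close>.
\<close>

definition left_invariant :: "('m, 'g) groupoid \<Rightarrow> 'g vfield set" where
  "left_invariant G = {X \<in> vector_fields (whole (Arr G)).
     \<forall>g\<in>arrows G. \<forall>h\<in>arrows G. src G g = tgt G h \<longrightarrow>
       (\<exists>v. tangent_vector (tfibre G (src G g)) h v \<and>
            (\<forall>f\<in>fns (whole (Arr G)). v (pullback (tfibre G (src G g)) id f) = X f h \<and>
               v (pullback (tfibre G (src G g)) (mul G g) f) = X f (mul G g h)))}"

definition anchor :: "('m, 'g) groupoid \<Rightarrow> 'g vfield \<Rightarrow> 'm vfield" where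
  "anchor G X = (THE Y. Y \<in> vector_fields (whole (Obj G)) \<and>
                        related (whole (Arr G)) (whole (Obj G)) (src G) X Y)"

text \<open>
  The module structure of \<open>\<Gamma>(A)\<close> over the functions on \<open>M\<close>: multiplying a section by a function \<open>a\<close>
  multiplies the corresponding left-invariant vector field by the function \<open>s\<^sup>*a\<close>.
\<close>

definition section_add :: "'g vfield \<Rightarrow> 'g vfield \<Rightarrow> 'g vfield" where
  "section_add X Y = (\<lambda>f g. X f g + Y f g)"

definition section_scale :: "('m, 'g) groupoid \<Rightarrow> ('m \<Rightarrow> real) \<Rightarrow> 'g vfield \<Rightarrow> 'g vfield" where
  "section_scale G a X = (\<lambda>f g. a (src G g) * X f g)"

text \<open>
  An element \<open>\<omega>\<close> of the \<open>q\<close>-th exterior power of \<open>\<Gamma>(A\<^sup>*)\<close> is an alternating \<open>q\<close>-linear map (over the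
  smooth functions on \<open>M\<close>) from \<open>\<Gamma>(A)\<close> to the smooth functions on \<open>M\<close>; the arguments form a list,
  and \<open>\<omega> [X\<^sub>1, \<dots>, X\<^sub>q]\<close> is the contraction \<open>\<iota>\<^bsub>X\<^sub>q\<^esub> \<dots> \<iota>\<^bsub>X\<^sub>1\<^esub> \<omega>\<close>.
  Forms are extended by zero to all other lists.
\<close>

type_synonym ('m, 'g) form = "'g vfield list \<Rightarrow> 'm \<Rightarrow> real"

definition sections :: "('m, 'g) groupoid \<Rightarrow> nat \<Rightarrow> 'g vfield list set" where
  "sections G q = {Xs. length Xs = q \<and> set Xs \<subseteq> left_invariant G}"

definition forms :: "('m, 'g) groupoid \<Rightarrow> nat \<Rightarrow> ('m, 'g) form set" where
  "forms G q = {\<omega>.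
     (\<forall>Xs. Xs \<notin> sections G q \<longrightarrow> \<omega> Xs = (\<lambda>_. 0)) \<and>
     (\<forall>Xs\<in>sections G q. \<omega> Xs \<in> fns (whole (Obj G))) \<and>
     (\<forall>Xs\<in>sections G q. \<forall>i<q. \<forall>X\<in>left_invariant G. \<forall>Y\<in>left_invariant G.
        \<omega> (Xs[i := section_add X Y]) = (\<lambda>x. \<omega> (Xs[i := X]) x + \<omega> (Xs[i := Y]) x)) \<and>
     (\<forall>Xs\<in>sections G q. \<forall>i<q. \<forall>X\<in>left_invariant G. \<forall>a\<in>fns (whole (Obj G)).
        \<omega> (Xs[i := section_scale G a X]) = (\<lambda>x. a x * \<omega> (Xs[i := X]) x)) \<and>
     (\<forall>Xs\<in>sections G q. \<forall>i<q. \<forall>j<q. i \<noteq> j \<longrightarrow> Xs ! i = Xs ! j \<longrightarrow> \<omega> Xs = (\<lambda>_. 0))}"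

text \<open>
  The factor makes this the sum over shuffles, for which \<open>\<iota>\<^sub>X\<close> is an antiderivation.
\<close>

definition wedge ::
    "('m, 'g) groupoid \<Rightarrow> nat \<Rightarrow> nat \<Rightarrow> ('m, 'g) form \<Rightarrow> ('m, 'g) form \<Rightarrow> ('m, 'g) form" where
  "wedge G p q \<omega> \<eta> = (\<lambda>Xs x.
     if Xs \<in> sections G (p + q)
     then (\<Sum>\<gamma> | \<gamma> permutes {..<p + q}.
             of_int (sign \<gamma>) * \<omega> (map (\<lambda>i. Xs ! \<gamma> i) [0..<p]) x
                             * \<eta> (map (\<lambda>i. Xs ! \<gamma> i) [p..<p + q]) x) / (fact p * fact q)
     else 0)"

definition form_unit :: "('m, 'g) groupoid \<Rightarrow> ('m, 'g) form" where
  "form_unit G = (\<lambda>Xs x. if Xs = [] \<and> x \<in> objs G then 1 else 0)"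

definition omit :: "nat \<Rightarrow> 'a list \<Rightarrow> 'a list" where
  "omit i xs = take i xs @ drop (Suc i) xs"

definition algebroid_diff :: "('m, 'g) groupoid \<Rightarrow> nat \<Rightarrow> ('m, 'g) form \<Rightarrow> ('m, 'g) form" where
  "algebroid_diff G q \<omega> = (\<lambda>Xs x.
     if Xs \<in> sections G (Suc q)
     then (\<Sum>i\<le>q. (-1) ^ i * anchor G (Xs ! i) (\<omega> (omit i Xs)) x) +
          (\<Sum>j\<le>q. \<Sum>i<j. (-1) ^ (i + j) *
             \<omega> (lie_bracket (Xs ! i) (Xs ! j) # omit i (omit j Xs)) x)
     else 0)"


section \<open>The van Est map\<close>

definition last_lift :: "('m, 'g) groupoid \<Rightarrow> nat \<Rightarrow> 'g vfield \<Rightarrow> ('m, 'g) nsimplex vfield" where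
  "last_lift G q X = (THE D. D \<in> vector_fields (nerve G q) \<and>
     (\<forall>i<q. related (nerve G q) (whole (Arr G)) (component i) D (if Suc i = q then X else zero_field)))"

text \<open>The operator \<open>X\<^sup>q\<close> from functions on \<open>G\<^sup>(\<^sup>q\<^sup>)\<close> to functions on \<open>G\<^sup>(\<^sup>q\<^sup>-\<^sup>1\<^sup>)\<close>, for \<open>q \<ge> 1\<close>.\<close>

definition restrict_last ::
    "('m, 'g) groupoid \<Rightarrow> nat \<Rightarrow> 'g vfield \<Rightarrow> (('m, 'g) nsimplex \<Rightarrow> real) \<Rightarrow> ('m, 'g) nsimplex \<Rightarrow> real" where
  "restrict_last G q X f = pullback (nerve G (q - 1)) (degeneracy G (q - 1)) (last_lift G q X f)"

primrec iterate_last ::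
    "('m, 'g) groupoid \<Rightarrow> nat \<Rightarrow> (nat \<Rightarrow> 'g vfield) \<Rightarrow> (('m, 'g) nsimplex \<Rightarrow> real) \<Rightarrow>
     ('m, 'g) nsimplex \<Rightarrow> real" where
  "iterate_last G 0 Y f = f"
| "iterate_last G (Suc q) Y f = iterate_last G q Y (restrict_last G (Suc q) (Y q) f)"

definition van_est :: "('m, 'g) groupoid \<Rightarrow> nat \<Rightarrow> (('m, 'g) nsimplex \<Rightarrow> real) \<Rightarrow> ('m, 'g) form" where
  "van_est G q f = (\<lambda>Xs x.
     if Xs \<in> sections G q
     then \<Sum>\<gamma> | \<gamma> permutes {..<q}.
            of_int (sign \<gamma>) * iterate_last G q (\<lambda>i. Xs ! \<gamma> i) f (x, [])
     else 0)"


section \<open>Multiplicative vector fields\<close>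

definition multiplicative :: "('m, 'g) groupoid \<Rightarrow> 'g vfield set" where
  "multiplicative G = {\<psi> \<in> vector_fields (whole (Arr G)).
     \<exists>D\<in>vector_fields (nerve G 2).
       related (nerve G 2) (whole (Arr G)) (component 0) D \<psi> \<and>
       related (nerve G 2) (whole (Arr G)) (component 1) D \<psi> \<and>
       related (nerve G 2) (whole (Arr G)) (\<lambda>z. mul G (component 0 z) (component 1 z)) D \<psi>}"

definition base_field :: "('m, 'g) groupoid \<Rightarrow> 'g vfield \<Rightarrow> 'm vfield" where
  "base_field G \<psi> = (THE \<phi>. \<phi> \<in> vector_fields (whole (Obj G)) \<and>
     related (whole (Arr G)) (whole (Obj G)) (src G) \<psi> \<phi> \<and>
     related (whole (Arr G)) (whole (Obj G)) (tgt G) \<psi> \<phi>)"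

text \<open>For \<open>q = 0\<close>, \<^const>\<open>fst\<close> is the identification of \<open>G\<^sup>(\<^sup>0\<^sup>)\<close> with \<open>M\<close>.\<close>

definition mult_lift :: "('m, 'g) groupoid \<Rightarrow> nat \<Rightarrow> 'g vfield \<Rightarrow> ('m, 'g) nsimplex vfield" where
  "mult_lift G q \<psi> = (THE D. D \<in> vector_fields (nerve G q) \<and>
     (if q = 0 then related (nerve G 0) (whole (Obj G)) fst D (base_field G \<psi>)
      else \<forall>i<q. related (nerve G q) (whole (Arr G)) (component i) D \<psi>))"

definition induced_derivation ::
    "('m, 'g) groupoid \<Rightarrow> nat \<Rightarrow> 'g vfield \<Rightarrow> ('m, 'g) form \<Rightarrow> ('m, 'g) form" where
  "induced_derivation G q \<psi> \<omega> = (\<lambda>Xs x.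
     if Xs \<in> sections G q
     then base_field G \<psi> (\<omega> Xs) x - (\<Sum>i<q. \<omega> (Xs[i := lie_bracket \<psi> (Xs ! i)]) x)
     else 0)"

end

(* A normalized cochain vanishes on degenerate strings, so contracting it with X, i.e. differentiating its last
   component at the unit, commutes with multiplication by functions on M and with products on the left. Moving the
   contractions past the coboundary produces, besides the anchor term, defects whose antisymmetrization in two
   neighbouring arguments is the contraction with the bracket [X, Y]; expanding the sum over permutations along the
   slots involved gives the differential of A. A multiplicative field acts on the last component by a commutator,
   whence equivariance. Function algebras are handled as differential spaces in the sense of Sikorski, so that vector
   fields on the nerve are determined, and constructed, by their effect on the components; the tangent vectors needed
   for this come from lifting curves through the submersions s and t. *)

theory Submission
  imports Defs "HOL-Computational_Algebra.Polynomial"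
begin

section \<open>Calculus on open subsets of Euclidean space\<close>

subsection \<open>Open sets\<close>

text \<open>The nerve occurs only as a subset of a power of \<open>Arr G\<close>, with the functions
  that extend smoothly near each point; no charts on it are constructed. Derivations of such an
  algebra are determined by their values on generators, but a derivation with prescribed values need
  not exist. Since the lifts, the anchor and the base field are definite descriptions, nothing can
  be said about them before existence and uniqueness are proved. For a left-invariant field,
  existence is read off from the vectors tangent to the \<open>t\<close>-fibres that left invariance
  provides. For a multiplicative field it takes curves of composable strings with prescribed
  velocity, hence the implicit function argument. In the algebraic part normalization has to survive
  every step. This dictates the form of \<open>lift_defect\<close>: the last lift of a normalized
  cochain is in general not normalized, whereas its difference from its value at the string whose
  last arrow is replaced by a unit is. Factors 2 arise by counting and cancel: two neighbouring
  slots are antisymmetrized in both orders, and the expansion over ordered pairs of arguments meets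
  each pair twice.\<close>

abbreviation (input) "\<E> \<equiv> Euclidean_space"
abbreviation (input) "mpoints M \<equiv> topspace (mtop M)"

text \<open>The balls of the sup norm in the zero-padded copy of n-dimensional space. Membership is
  a condition on single coordinates, and the segment from the centre to a point of a cube stays
  inside, as the chain rule and Hadamard's lemma require.\<close>

definition cube :: "nat \<Rightarrow> (nat \<Rightarrow> real) \<Rightarrow> real \<Rightarrow> (nat \<Rightarrow> real) set" where
  "cube n x e = {y. (\<forall>i<n. \<bar>y i - x i\<bar> < e) \<and> (\<forall>i\<ge>n. y i = 0)}"

lemma cube_mono: "d \<le> e \<Longrightarrow> cube n x d \<subseteq> cube n x e" unfolding cube_def by fastforce

lemma Euclidean_space_eq: "\<E> n = top_of_set {x. \<forall>i\<ge>n. x i = 0}" by (simp add: Euclidean_space_def euclidean_product_topology)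

lemma open_coordinate_Collect: "open {y::nat \<Rightarrow> real. \<bar>y i - a\<bar> < e}"
  by (intro open_Collect_less continuous_intros continuous_on_product_coordinates)

lemma openin_cube: "openin (\<E> n) (cube n x e)"
proof -
  have "open (\<Inter>i\<in>{..<n}. {y::nat \<Rightarrow> real. \<bar>y i - x i\<bar> < e})" by (intro open_INT ballI open_coordinate_Collect) auto
  moreover have "cube n x e = {x. \<forall>i\<ge>n. x i = 0} \<inter> (\<Inter>i\<in>{..<n}. {y. \<bar>y i - x i\<bar> < e})" unfolding cube_def by auto
  ultimately show ?thesis unfolding Euclidean_space_eq openin_open by blast
qed

text \<open>A basic neighbourhood in the product topology is a product of open sets. The coordinates
  from \<open>n\<close> on are held equal to those of \<open>x\<close>, so only \<open>n\<close>
  factors constrain \<open>y\<close>, and the least of their radii serves.\<close>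

lemma open_contains_cube:
  assumes "open T" "x \<in> T"
  obtains e where "e > 0" "\<And>y. (\<forall>i<n. \<bar>y i - x i\<bar> < e) \<Longrightarrow> (\<forall>i\<ge>n. y i = x i) \<Longrightarrow> y \<in> (T::(nat\<Rightarrow>real) set)"
proof -
  have "openin (powertop_real UNIV) T" using assms(1) by (simp add: euclidean_product_topology)
  from product_topology_open_contains_basis[OF this assms(2)]
  obtain X where X: "x \<in> (\<Pi>\<^sub>E i\<in>UNIV. X i)" "\<And>i. open (X i)" "(\<Pi>\<^sub>E i\<in>UNIV. X i) \<subseteq> T" by auto
  have "\<exists>e>0. \<forall>t. \<bar>t - x i\<bar> < e \<longrightarrow> t \<in> X i" for i
    using X(1,2) unfolding open_dist dist_real_def by (auto simp: PiE_iff)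
  then obtain d where d: "\<And>i. d i > 0" "\<And>i t. \<bar>t - x i\<bar> < d i \<Longrightarrow> t \<in> X i" by metis
  \<comment> \<open>The inserted 1 keeps the minimum defined for \<open>n = 0\<close>.\<close>
  define e where "e = Min (insert 1 (d ` {..<n}))"
  have e: "e > 0" "\<And>i. i < n \<Longrightarrow> e \<le> d i" unfolding e_def using d(1) by (auto intro!: Min_le)
  show ?thesis
  proof (rule that[OF e(1)])
    fix y assume y: "\<forall>i<n. \<bar>y i - x i\<bar> < e" "\<forall>i\<ge>n. y i = x i"
    have "y i \<in> X i" for i by (cases "i < n") (use y e d X(1) in \<open>fastforce simp: PiE_iff\<close>)+
    then show "y \<in> T" using X(3) by (auto simp: PiE_iff)
  qed
qed

lemma openin_Euclidean_space_iff:
  "openin (\<E> n) U \<longleftrightarrow>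
     U \<subseteq> {x. \<forall>i\<ge>n. x i = 0} \<and> (\<forall>x\<in>U. \<exists>e>0. cube n x e \<subseteq> U)" (is "?L \<longleftrightarrow> ?R")
proof
  assume ?L
  then obtain T where T: "open T" "U = {x. \<forall>i\<ge>n. x i = 0} \<inter> T" unfolding Euclidean_space_eq openin_open by blast
  show ?R
  proof (intro conjI ballI)
    show "U \<subseteq> {x. \<forall>i\<ge>n. x i = 0}" using T by auto
    fix x assume x: "x \<in> U"
    obtain e where "e > 0" "\<And>y. (\<forall>i<n. \<bar>y i - x i\<bar> < e) \<Longrightarrow> (\<forall>i\<ge>n. y i = x i) \<Longrightarrow> y \<in> T"
      using open_contains_cube[OF T(1), of x n] x T by blast
    then show "\<exists>e>0. cube n x e \<subseteq> U" using x T unfolding cube_def by (intro exI[of _ e]) auto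
  qed
next
  assume R: ?R
  have "\<exists>V. openin (\<E> n) V \<and> x \<in> V \<and> V \<subseteq> U" if "x \<in> U" for x
  proof -
    have "\<exists>e>0. cube n x e \<subseteq> U" using R that by (meson bspec)
    then obtain e where e: "e > 0" "cube n x e \<subseteq> U" by (elim exE conjE)
    moreover have "x \<in> cube n x e" using R that e(1) by (auto simp: cube_def)
    ultimately show ?thesis using openin_cube by blast
  qed
  then show ?L by (subst openin_subopen) blast
qed

lemma in_cube [simp]: "x \<in> cube n x e \<longleftrightarrow> (n = 0 \<or> e > 0) \<and> (\<forall>i\<ge>n. x i = 0)"
  unfolding cube_def by auto

lemma openE_D0: "openin (\<E> n) U \<Longrightarrow> x \<in> U \<Longrightarrow> i \<ge> n \<Longrightarrow> x i = 0"
  by (auto simp: openin_Euclidean_space_iff)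

lemma openE_cube:
  assumes "openin (\<E> n) U" "x \<in> U"
  obtains e where "e > 0" "cube n x e \<subseteq> U" "x \<in> cube n x e"
proof -
  have "\<exists>e>0. cube n x e \<subseteq> U" using assms unfolding openin_Euclidean_space_iff by (meson bspec)
  then obtain e where "e > 0" "cube n x e \<subseteq> U" by (elim exE conjE)
  moreover have "x \<in> cube n x e" using \<open>e > 0\<close> openE_D0[OF assms] by auto
  ultimately show ?thesis by (rule that)
qed

lemma tendsto_fun_iff:
  fixes c :: "'a \<Rightarrow> nat \<Rightarrow> real"
  shows "(c \<longlongrightarrow> x) F \<longleftrightarrow> (\<forall>i. ((\<lambda>t. c t i) \<longlongrightarrow> x i) F)"
  using limitin_componentwise[of "\<lambda>_::nat. euclideanreal" UNIV c x F] by (simp add: euclidean_product_topology limitin_canonical_iff)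

lemma eventually_in_openE:
  assumes U: "openin (\<E> n) U" "x \<in> U" and c: "\<And>i. i < n \<Longrightarrow> ((\<lambda>t. c t i) \<longlongrightarrow> x i) F"
    and z: "eventually (\<lambda>t. \<forall>i\<ge>n. c t i = 0) F"
  shows "eventually (\<lambda>t. c t \<in> U) F"
proof -
  obtain e where e: "e > 0" "cube n x e \<subseteq> U" by (rule openE_cube[OF U])
  have "eventually (\<lambda>t. \<forall>i\<in>{..<n}. \<bar>c t i - x i\<bar> < e) F"
    using c e(1) unfolding tendsto_iff dist_real_def by (subst eventually_ball_finite_distrib) auto
  with z show ?thesis by eventually_elim (use e(2) in \<open>auto simp: cube_def\<close>)
qed

lemma tendsto_continuous_on_openE:
  assumes f: "continuous_on U f" and U: "openin (\<E> n) U" "x \<in> U"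
    and c: "\<And>i. i < n \<Longrightarrow> ((\<lambda>t. c t i) \<longlongrightarrow> x i) F" and z: "eventually (\<lambda>t. \<forall>i\<ge>n. c t i = 0) F"
  shows "((\<lambda>t. f (c t)) \<longlongrightarrow> f x) F"
proof (rule continuous_on_tendsto_compose[OF f])
  have "((\<lambda>t. c t i) \<longlongrightarrow> x i) F" for i
  proof (cases "i < n")
    case False
    then have "eventually (\<lambda>t. x i = c t i) F" using z openE_D0[OF U, of i] by (auto elim: eventually_mono)
    then show ?thesis by (rule tendsto_eventually[OF eventually_mono]) simp
  qed (use c in auto)
  then show "(c \<longlongrightarrow> x) F" by (simp add: tendsto_fun_iff)
  show "eventually (\<lambda>t. c t \<in> U) F" by (rule eventually_in_openE[OF U c z])
qed (use U in auto)

lemma eventually_upd_in_openE: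
  assumes "openin (\<E> n) U" "x \<in> U" "i < n"
  shows "eventually (\<lambda>t. x(i := t) \<in> U) (nhds (x i))"
proof (rule eventually_in_openE[OF assms(1,2)])
  show "((\<lambda>t. (x(i := t)) j) \<longlongrightarrow> x j) (nhds (x i))" for j by (cases "j = i") (auto simp: filterlim_ident)
  show "\<forall>\<^sub>F t in nhds (x i). \<forall>j\<ge>n. (x(i := t)) j = 0" using assms openE_D0[OF assms(1,2)] by auto
qed

subsection \<open>Partial derivatives and smooth functions\<close>

text \<open>A total function, which means a partial derivative only where one exists. This canonical
  choice replaces the existentially quantified families \<open>D\<close> of \<open>Ck_on\<close>, so
  that derivatives found on different open sets can be compared.\<close>

definition pd :: "nat \<Rightarrow> ((nat \<Rightarrow> real) \<Rightarrow> real) \<Rightarrow> (nat \<Rightarrow> real) \<Rightarrow> real" where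
  "pd i f x = deriv (\<lambda>t. f (x(i := t))) (x i)"

lemma pd_eqI: "((\<lambda>t. f (x(i := t))) has_real_derivative d) (at (x i)) \<Longrightarrow> pd i f x = d"
  unfolding pd_def by (rule DERIV_imp_deriv)

lemma has_real_derivative_upd_cong:
  assumes "openin (\<E> n) U" "x \<in> U" "i < n" "\<And>y. y \<in> U \<Longrightarrow> f y = g y"
  shows "((\<lambda>t. f (x(i := t))) has_real_derivative d) (at (x i)) \<longleftrightarrow>
         ((\<lambda>t. g (x(i := t))) has_real_derivative d) (at (x i))"
  by (rule DERIV_cong_ev)
    (use eventually_upd_in_openE[OF assms(1-3)] assms(4) in \<open>auto elim!: eventually_mono\<close>)

lemma pd_cong:
  assumes "openin (\<E> n) U" "x \<in> U" "i < n" "\<And>y. y \<in> U \<Longrightarrow> f y = g y"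
  shows "pd i f x = pd i g x" unfolding pd_def deriv_def by (subst has_real_derivative_upd_cong[OF assms]) auto

lemma Ck_on_cong:
  assumes U: "openin (\<E> n) U" and eq: "\<And>y. y \<in> U \<Longrightarrow> f y = g y" and f: "Ck_on n k U f"
  shows "Ck_on n k U g"
proof (cases k)
  case 0
  then show ?thesis using f eq by (simp cong: continuous_on_cong)
next
  case (Suc m)
  from f obtain D where D: "\<forall>i<n. Ck_on n m U (D i) \<and>
        (\<forall>x\<in>U. ((\<lambda>t. f (x(i := t))) has_real_derivative D i x) (at (x i)))" by (auto simp: Suc)
  have "((\<lambda>t. g (x(i := t))) has_real_derivative D i x) (at (x i))" if "i < n" "x \<in> U" for i x
    using D that has_real_derivative_upd_cong[OF U that(2,1), of f g] eq by auto
  then show ?thesis using f eq D by (auto simp: Suc cong: continuous_on_cong intro!: exI[of _ D])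
qed

text \<open>On an open set the derivative family in \<open>Ck_on\<close> is unique, hence equal to
  \<open>pd\<close>, and \<open>Ck_on_cong\<close> carries its regularity over.\<close>

lemma Ck_on_Suc_iff:
  assumes U: "openin (\<E> n) U"
  shows "Ck_on n (Suc k) U f \<longleftrightarrow> continuous_on U f \<and> (\<forall>i<n. Ck_on n k U (pd i f) \<and>
     (\<forall>x\<in>U. ((\<lambda>t. f (x(i := t))) has_real_derivative pd i f x) (at (x i))))" (is "?L \<longleftrightarrow> ?R")
proof
  assume ?L
  then obtain D where D: "\<forall>i<n. Ck_on n k U (D i) \<and>
        (\<forall>x\<in>U. ((\<lambda>t. f (x(i := t))) has_real_derivative D i x) (at (x i)))" by auto
  have eq: "pd i f x = D i x" if "i < n" "x \<in> U" for i x using D that by (auto intro: pd_eqI)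
  have "Ck_on n k U (pd i f)" if "i < n" for i by (rule Ck_on_cong[OF U, of "D i"]) (use D that eq in auto)
  then show ?R using \<open>?L\<close> D eq by auto
next
  assume ?R
  then show ?L by (auto intro!: exI[of _ "\<lambda>i. pd i f"])
qed

declare Ck_on.simps(2) [simp del]

lemma Ck_on_continuous: "Ck_on n k U f \<Longrightarrow> continuous_on U f" by (cases k) (auto simp: Ck_on.simps(2))

lemma Ck_on_SucI:
  assumes "continuous_on U f"
    "\<And>i. i < n \<Longrightarrow> \<exists>D. Ck_on n k U D \<and> (\<forall>x\<in>U. ((\<lambda>t. f (x(i := t))) has_real_derivative D x) (at (x i)))"
  shows "Ck_on n (Suc k) U f" unfolding Ck_on.simps(2) using assms by metis

lemma Ck_on_SucE:
  assumes "Ck_on n (Suc k) U f" "i < n"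
  obtains D where "Ck_on n k U D" "\<And>x. x \<in> U \<Longrightarrow> ((\<lambda>t. f (x(i := t))) has_real_derivative D x) (at (x i))"
  using assms unfolding Ck_on.simps(2) by (elim conjE exE allE[of _ i]) auto

lemma Ck_on_mono: "Ck_on n k U f \<Longrightarrow> V \<subseteq> U \<Longrightarrow> Ck_on n k V f"
proof (induction k arbitrary: f)
  case (Suc k)
  show ?case
  proof (rule Ck_on_SucI)
    show "continuous_on V f" using Suc.prems Ck_on_continuous continuous_on_subset by blast
    fix i assume "i < n"
    with Suc.prems(1) obtain D where "Ck_on n k U D" "\<And>x. x \<in> U \<Longrightarrow> ((\<lambda>t. f (x(i := t))) has_real_derivative D x) (at (x i))"
      by (rule Ck_on_SucE) blast
    then show "\<exists>D. Ck_on n k V D \<and> (\<forall>x\<in>V. ((\<lambda>t. f (x(i := t))) has_real_derivative D x) (at (x i)))"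
      using Suc.prems(2) by (intro exI[of _ D] conjI Suc.IH ballI) auto
  qed
qed (auto intro: continuous_on_subset)

lemma Ck_on_Suc_imp: "Ck_on n (Suc k) U f \<Longrightarrow> Ck_on n k U f"
proof (induction k arbitrary: f)
  case (Suc k)
  show ?case
  proof (rule Ck_on_SucI)
    show "continuous_on U f" using Suc.prems Ck_on_continuous by blast
    fix i assume "i < n"
    with Suc.prems(1) obtain D where D: "Ck_on n (Suc k) U D" "\<And>x. x \<in> U \<Longrightarrow> ((\<lambda>t. f (x(i := t))) has_real_derivative D x) (at (x i))"
      by (rule Ck_on_SucE) blast
    then show "\<exists>D. Ck_on n k U D \<and> (\<forall>x\<in>U. ((\<lambda>t. f (x(i := t))) has_real_derivative D x) (at (x i)))"
      by (intro exI[of _ D] conjI Suc.IH ballI) auto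
  qed
qed (auto simp: Ck_on.simps(2))

lemma Ck_on_le: "Ck_on n k U f \<Longrightarrow> j \<le> k \<Longrightarrow> Ck_on n j U f"
  by (induction k) (metis le_zero_eq, metis Ck_on_Suc_imp le_Suc_eq)

text \<open>Continuity and differentiability are local on open sets, and the derivative families
  belonging to different neighbourhoods glue because each of them is \<open>pd\<close>.\<close>

lemma Ck_on_local:
  assumes U: "openin (\<E> n) U" and loc: "\<And>x. x \<in> U \<Longrightarrow> \<exists>V. openin (\<E> n) V \<and> x \<in> V \<and> Ck_on n k V f"
  shows "Ck_on n k U f" using loc
proof (induction k arbitrary: f)
  case 0
  show ?case
  proof (simp add: continuous_on_def, intro ballI)
    fix x assume "x \<in> U"
    with 0 obtain V where V: "openin (\<E> n) V" "x \<in> V" "continuous_on V f" by auto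
    then obtain T where T: "open T" "V = {x. \<forall>i\<ge>n. x i = 0} \<inter> T" unfolding Euclidean_space_eq openin_open by blast
    have "(f \<longlongrightarrow> f x) (at x within V)" using V by (simp add: continuous_on_def)
    moreover have "at x within V = at x within {x. \<forall>i\<ge>n. x i = 0}" using V T by (intro at_within_nhd[of _ T]) auto
    ultimately have "(f \<longlongrightarrow> f x) (at x within {x. \<forall>i\<ge>n. x i = 0})" by simp
    then show "(f \<longlongrightarrow> f x) (at x within U)" by (rule tendsto_within_subset) (use openE_D0[OF U] in auto)
  qed
next
  case (Suc k)
  have loc: "\<exists>V. openin (\<E> n) V \<and> x \<in> V \<and> continuous_on V f \<and> (\<forall>i<n. Ck_on n k V (pd i f) \<and>
     (\<forall>x\<in>V. ((\<lambda>t. f (x(i := t))) has_real_derivative pd i f x) (at (x i))))" if "x \<in> U" for x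
  proof -
    from Suc.prems[OF that] obtain V where V: "openin (\<E> n) V" "x \<in> V" "Ck_on n (Suc k) V f" by (elim exE conjE) (rule that)
    have "continuous_on V f \<and> (\<forall>i<n. Ck_on n k V (pd i f) \<and>
     (\<forall>x\<in>V. ((\<lambda>t. f (x(i := t))) has_real_derivative pd i f x) (at (x i))))"
      using V(3) unfolding Ck_on_Suc_iff[OF V(1)] .
    with V(1,2) show ?thesis by (intro exI[of _ V] conjI) simp_all
  qed
  have "Ck_on n k U f"
  proof (rule Suc.IH)
    fix x assume "x \<in> U"
    from Suc.prems[OF this] show "\<exists>V. openin (\<E> n) V \<and> x \<in> V \<and> Ck_on n k V f" using Ck_on_Suc_imp by metis
  qed
  then have "continuous_on U f" by (rule Ck_on_continuous)
  moreover have "Ck_on n k U (pd i f)" if "i < n" for i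
  proof (rule Suc.IH)
    fix x assume "x \<in> U"
    from loc[OF this] show "\<exists>V. openin (\<E> n) V \<and> x \<in> V \<and> Ck_on n k V (pd i f)" using that by metis
  qed
  moreover have "((\<lambda>t. f (x(i := t))) has_real_derivative pd i f x) (at (x i))" if "i < n" "x \<in> U" for i x
    using loc[OF that(2)] that(1) by (elim exE conjE) auto
  ultimately show ?case unfolding Ck_on_Suc_iff[OF U] by simp
qed

lemma smooth_on_cong:
  "openin (\<E> n) U \<Longrightarrow> (\<And>y. y \<in> U \<Longrightarrow> f y = g y) \<Longrightarrow> smooth_on n U f \<Longrightarrow> smooth_on n U g"
  unfolding smooth_on_def by (intro allI Ck_on_cong[of n U f g]) auto

lemma smooth_on_mono: "smooth_on n U f \<Longrightarrow> V \<subseteq> U \<Longrightarrow> smooth_on n V f"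
  unfolding smooth_on_def by (auto intro: Ck_on_mono)

lemma smooth_on_local:
  assumes U: "openin (\<E> n) U" and loc: "\<And>x. x \<in> U \<Longrightarrow> \<exists>V. openin (\<E> n) V \<and> x \<in> V \<and> smooth_on n V f"
  shows "smooth_on n U f" using loc unfolding smooth_on_def by (intro allI Ck_on_local[OF U]) meson

lemma smooth_on_continuous: "smooth_on n U f \<Longrightarrow> continuous_on U f" unfolding smooth_on_def by (drule spec[of _ 0]) simp

lemma smooth_on_pd:
  assumes "openin (\<E> n) U" "smooth_on n U f" "i < n"
  shows "smooth_on n U (pd i f)" unfolding smooth_on_def
proof
  fix k
  have "Ck_on n (Suc k) U f" using assms(2) unfolding smooth_on_def ..
  then show "Ck_on n k U (pd i f)" unfolding Ck_on_Suc_iff[OF assms(1)] using assms(3) by simp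
qed

lemma smooth_on_has_pd:
  assumes "openin (\<E> n) U" "smooth_on n U f" "i < n" "x \<in> U"
  shows "((\<lambda>t. f (x(i := t))) has_real_derivative pd i f x) (at (x i))"
proof -
  have "Ck_on n (Suc 0) U f" using assms(2) unfolding smooth_on_def ..
  then show ?thesis unfolding Ck_on_Suc_iff[OF assms(1)] using assms(3,4) by simp
qed

lemma Ck_on_const [simp]: "Ck_on n k U (\<lambda>x. c)" by (induction k arbitrary: c) (auto intro!: Ck_on_SucI exI[of _ "\<lambda>_. 0"])

lemma Ck_on_coordinate: "Ck_on n k U (\<lambda>x. x j)"
proof -
  have cont: "continuous_on U (\<lambda>x::nat\<Rightarrow>real. x j)" by (rule continuous_on_subset[OF continuous_on_product_coordinates]) simp
  show ?thesis
  proof (cases k)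
    case 0
    then show ?thesis using cont by simp
  next
    case (Suc m)
    have *: "((\<lambda>t. (x(i := t)) j) has_real_derivative (if i = j then 1 else 0)) (at (x i))" for x::"nat\<Rightarrow>real" and i
      by (cases "i = j") (auto intro!: derivative_eq_intros)
    show ?thesis unfolding Suc
    proof (rule Ck_on_SucI[OF cont])
      fix i
      show "\<exists>D. Ck_on n m U D \<and> (\<forall>x\<in>U. ((\<lambda>t. (x(i := t)) j) has_real_derivative D x) (at (x i)))"
        by (rule exI[of _ "\<lambda>_. if i = j then 1 else 0"]) (intro conjI ballI Ck_on_const *)
    qed
  qed
qed

lemma Ck_on_add: "Ck_on n k U f \<Longrightarrow> Ck_on n k U g \<Longrightarrow> Ck_on n k U (\<lambda>x. f x + g x)"
proof (induction k arbitrary: f g)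
  case 0 then show ?case by (auto intro: continuous_intros)
next
  case (Suc k)
  show ?case
  proof (rule Ck_on_SucI)
    show "continuous_on U (\<lambda>x. f x + g x)" using Suc.prems[THEN Ck_on_continuous] by (intro continuous_intros)
    fix i assume i: "i < n"
    from Suc.prems(1) i obtain D where D: "Ck_on n k U D"
      "\<And>x. x \<in> U \<Longrightarrow> ((\<lambda>t. f (x(i := t))) has_real_derivative D x) (at (x i))" by (rule Ck_on_SucE) blast
    from Suc.prems(2) i obtain D' where D': "Ck_on n k U D'"
      "\<And>x. x \<in> U \<Longrightarrow> ((\<lambda>t. g (x(i := t))) has_real_derivative D' x) (at (x i))" by (rule Ck_on_SucE) blast
    show "\<exists>D. Ck_on n k U D \<and> (\<forall>x\<in>U. ((\<lambda>t. f (x(i := t)) + g (x(i := t))) has_real_derivative D x) (at (x i)))"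
      by (intro exI[of _ "\<lambda>x. D x + D' x"] conjI ballI Suc.IH D D' DERIV_add)
  qed
qed

lemma Ck_on_mult: "Ck_on n k U f \<Longrightarrow> Ck_on n k U g \<Longrightarrow> Ck_on n k U (\<lambda>x. f x * g x)"
proof (induction k arbitrary: f g)
  case 0 then show ?case by (auto intro: continuous_intros)
next
  case (Suc k)
  show ?case
  proof (rule Ck_on_SucI)
    show "continuous_on U (\<lambda>x. f x * g x)" using Suc.prems[THEN Ck_on_continuous] by (intro continuous_intros)
    fix i assume i: "i < n"
    from Suc.prems(1) i obtain D where D: "Ck_on n k U D"
      "\<And>x. x \<in> U \<Longrightarrow> ((\<lambda>t. f (x(i := t))) has_real_derivative D x) (at (x i))" by (rule Ck_on_SucE) blast
    from Suc.prems(2) i obtain D' where D': "Ck_on n k U D'"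
      "\<And>x. x \<in> U \<Longrightarrow> ((\<lambda>t. g (x(i := t))) has_real_derivative D' x) (at (x i))" by (rule Ck_on_SucE) blast
    have "((\<lambda>t. f (x(i := t)) * g (x(i := t))) has_real_derivative D x * g x + D' x * f x) (at (x i))"
      if "x \<in> U" for x using DERIV_mult[OF D(2)[OF that] D'(2)[OF that]] by simp
    then show "\<exists>D. Ck_on n k U D \<and> (\<forall>x\<in>U. ((\<lambda>t. f (x(i := t)) * g (x(i := t))) has_real_derivative D x) (at (x i)))"
      using Suc.prems[THEN Ck_on_Suc_imp] by (intro exI[of _ "\<lambda>x. D x * g x + D' x * f x"] conjI ballI Ck_on_add Suc.IH D D')
  qed
qed

lemma Ck_on_sum: "(\<And>i. i \<in> I \<Longrightarrow> Ck_on n k U (f i)) \<Longrightarrow> Ck_on n k U (\<lambda>x. \<Sum>i\<in>I. f i x)"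
proof (induction I rule: infinite_finite_induct)
  case (insert i I)
  then have "Ck_on n k U (\<lambda>x. f i x + (\<Sum>i\<in>I. f i x))" by (intro Ck_on_add) simp_all
  then show ?case using insert.hyps by simp
qed simp_all

lemma smooth_on_const [simp]: "smooth_on n U (\<lambda>x. c)" by (simp add: smooth_on_def)

lemma smooth_on_coordinate: "smooth_on n U (\<lambda>x. x j)" by (simp add: smooth_on_def Ck_on_coordinate)

lemma smooth_on_add: "smooth_on n U f \<Longrightarrow> smooth_on n U g \<Longrightarrow> smooth_on n U (\<lambda>x. f x + g x)"
  by (simp add: smooth_on_def Ck_on_add)

lemma smooth_on_mult: "smooth_on n U f \<Longrightarrow> smooth_on n U g \<Longrightarrow> smooth_on n U (\<lambda>x. f x * g x)"
  by (simp add: smooth_on_def Ck_on_mult)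

lemma smooth_on_sum: "(\<And>i. i \<in> I \<Longrightarrow> smooth_on n U (h i)) \<Longrightarrow> smooth_on n U (\<lambda>x. \<Sum>i\<in>I. h i x)"
  by (simp add: smooth_on_def Ck_on_sum)

lemma smooth_on_diff: "smooth_on n U f \<Longrightarrow> smooth_on n U g \<Longrightarrow> smooth_on n U (\<lambda>x. f x - g x)"
  using smooth_on_add[of n U f "\<lambda>x. - 1 * g x"] smooth_on_mult[of n U "\<lambda>_. - 1" g] by simp

subsection \<open>The chain rule\<close>

text \<open>The mean value theorem along one coordinate. The intermediate point is controlled only
  by its distance from \<open>a\<close>; this treats \<open>a < b\<close>, \<open>b < a\<close> and
  \<open>a = b\<close> alike and makes it converge to \<open>a\<close> together with
  \<open>b\<close>.\<close>

lemma MVT_upd: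
  assumes "openin (\<E> n) U" "Ck_on n (Suc 0) U f" "k < n" and seg: "\<And>s. \<bar>s - a\<bar> \<le> \<bar>b - a\<bar> \<Longrightarrow> y(k := s) \<in> U"
  shows "\<exists>s. \<bar>s - a\<bar> \<le> \<bar>b - a\<bar> \<and> f (y(k := b)) - f (y(k := a)) = (b - a) * pd k f (y(k := s))"
proof -
  have d: "((\<lambda>t. f (y(k := t))) has_real_derivative pd k f (y(k := s))) (at s)"
    if "\<bar>s - a\<bar> \<le> \<bar>b - a\<bar>" for s
  proof -
    have "\<forall>x\<in>U. ((\<lambda>t. f (x(k := t))) has_real_derivative pd k f x) (at (x k))" using assms(2,3) unfolding Ck_on_Suc_iff[OF assms(1)] by simp
    from bspec[OF this seg[OF that]] show ?thesis by simp
  qed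
  consider "a < b" | "b < a" | "a = b" by linarith
  then show ?thesis
  proof cases
    case 1
    from MVT2[OF 1, of "\<lambda>t. f (y(k := t))" "\<lambda>s. pd k f (y(k := s))"] d 1
    obtain z where "z > a" "z < b" "f (y(k := b)) - f (y(k := a)) = (b - a) * pd k f (y(k := z))" by auto
    then show ?thesis by (intro exI[of _ z]) auto
  next
    case 2
    from MVT2[OF 2, of "\<lambda>t. f (y(k := t))" "\<lambda>s. pd k f (y(k := s))"] d 2
    obtain z where "z > b" "z < a" "f (y(k := a)) - f (y(k := b)) = (a - b) * pd k f (y(k := z))" by auto
    then show ?thesis by (intro exI[of _ z]) (auto simp: algebra_simps)
  qed auto
qed

text \<open>Passing from \<open>c t0\<close> to \<open>c t\<close> one coordinate at a time writes
  the increment of \<open>f\<close> as a telescoping sum of mean values; the intermediate points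
  tend to \<open>c t0\<close>, and continuity of the partial derivatives gives the limit. The curve
  is differentiable at the single parameter \<open>t0\<close>, which is all that lifted curves
  offer.\<close>

lemma has_derivative_curve:
  assumes U: "openin (\<E> n) U" and f: "Ck_on n (Suc 0) U f" and c0: "c t0 \<in> U" and z: "eventually (\<lambda>t. \<forall>i\<ge>n. c t i = 0) (nhds t0)"
    and c: "\<And>i. i < n \<Longrightarrow> ((\<lambda>t. c t i) has_real_derivative c' i) (at t0)"
  shows "((\<lambda>t. f (c t)) has_real_derivative (\<Sum>i<n. pd i f (c t0) * c' i)) (at t0)"
proof -
  define x where "x = c t0"
  have x: "x \<in> U" "\<And>i. i \<ge> n \<Longrightarrow> x i = 0" using c0 openE_D0[OF U c0] by (auto simp: x_def)
  obtain e where e: "e > 0" "cube n x e \<subseteq> U" by (rule openE_cube[OF U x(1)])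
  have z': "eventually (\<lambda>t. \<forall>i\<ge>n. c t i = 0) (at t0)" using z by (simp add: eventually_at_filter eventually_mono)
  have lim: "((\<lambda>t. c t i) \<longlongrightarrow> x i) (at t0)" if "i < n" for i using DERIV_isCont[OF c[OF that]] by (simp add: isCont_def x_def)
  \<comment> \<open>For \<open>t\<close> near \<open>t0\<close> this interpolates between
    \<open>m 0 t = c t0\<close> and \<open>m n t = c t\<close>, changing one coordinate at a
    time.\<close>
  define m where "m k t = (\<lambda>i. if i < k then c t i else x i)" for k t
  have mSuc: "m (Suc k) t = (m k t)(k := c t k)" for k t by (auto simp: m_def fun_eq_iff less_Suc_eq)
  have mk: "m k t = (m k t)(k := x k)" for k t by (auto simp: m_def)
  have near: "eventually (\<lambda>t. \<forall>i<n. \<bar>c t i - x i\<bar> < e) (at t0)"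
  proof -
    have "eventually (\<lambda>t. \<forall>i\<in>{..<n}. \<bar>c t i - x i\<bar> < e) (at t0)"
      using lim e(1) unfolding tendsto_iff dist_real_def by (subst eventually_ball_finite_distrib) auto
    then show ?thesis by eventually_elim auto
  qed
  define P where "P k t s \<longleftrightarrow> \<bar>s - x k\<bar> \<le> \<bar>c t k - x k\<bar> \<and>
      f (m (Suc k) t) - f (m k t) = (c t k - x k) * pd k f ((m k t)(k := s))" for k t s
  have P: "P k t (SOME s. P k t s)" if t: "\<forall>i<n. \<bar>c t i - x i\<bar> < e" and k: "k < n" for k t
  proof -
    have seg: "(m k t)(k := s) \<in> U" if "\<bar>s - x k\<bar> \<le> \<bar>c t k - x k\<bar>" for s
    proof -
      have "(m k t)(k := s) \<in> cube n x e" unfolding cube_def mem_Collect_eq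
      proof (intro conjI allI impI)
        fix i assume "i < n"
        then show "\<bar>((m k t)(k := s)) i - x i\<bar> < e" using le_less_trans[OF that] t k e(1) by (cases "i = k") (simp_all add: m_def)
      next
        fix i assume "n \<le> i"
        then show "((m k t)(k := s)) i = 0" using k x(2) by (simp add: m_def)
      qed
      then show ?thesis using e(2) by (rule subsetD[rotated])
    qed
    from MVT_upd[OF U f k seg, of "x k" "c t k"] have "\<exists>s. P k t s" unfolding P_def mSuc mk[of k t, symmetric] .
    then show ?thesis by (rule someI_ex)
  qed
  define \<xi> where "\<xi> k t = (SOME s. P k t s)" for k t
  have pdlim: "((\<lambda>t. pd k f ((m k t)(k := \<xi> k t))) \<longlongrightarrow> pd k f x) (at t0)" if k: "k < n" for k
  proof (rule tendsto_continuous_on_openE[OF _ U x(1)])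
    show "continuous_on U (pd k f)" using f k unfolding Ck_on_Suc_iff[OF U] by simp
    have "((\<lambda>t. \<xi> k t - x k) \<longlongrightarrow> 0) (at t0)"
    proof (rule Lim_null_comparison)
      show "eventually (\<lambda>t. norm (\<xi> k t - x k) \<le> \<bar>c t k - x k\<bar>) (at t0)"
        using near by eventually_elim (use P[OF _ k] in \<open>simp add: P_def \<xi>_def\<close>)
      show "((\<lambda>t. \<bar>c t k - x k\<bar>) \<longlongrightarrow> 0) (at t0)" using tendsto_rabs[OF LIM_zero[OF lim[OF k]]] by simp
    qed
    then have "((\<lambda>t. \<xi> k t) \<longlongrightarrow> x k) (at t0)" by (rule LIM_zero_cancel)
    then show "((\<lambda>t. ((m k t)(k := \<xi> k t)) i) \<longlongrightarrow> x i) (at t0)" if "i < n" for i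
      using lim[OF that] by (cases "i = k"; cases "i < k") (simp_all add: m_def)
    show "\<forall>\<^sub>F t in at t0. \<forall>i\<ge>n. ((m k t)(k := \<xi> k t)) i = 0" using k x(2) by (simp add: m_def)
  qed
  have "((\<lambda>t. \<Sum>k<n. pd k f ((m k t)(k := \<xi> k t)) * ((c t k - c t0 k) / (t - t0))) \<longlongrightarrow> (\<Sum>i<n. pd i f x * c' i)) (at t0)"
    using c[unfolded has_field_derivative_iff] by (intro tendsto_sum tendsto_mult pdlim) simp_all
  moreover have "eventually (\<lambda>t. (\<Sum>k<n. pd k f ((m k t)(k := \<xi> k t)) * ((c t k - c t0 k) / (t - t0))) = (f (c t) - f (c t0)) / (t - t0)) (at t0)"
    using near z'
  proof eventually_elim
    fix t assume t: "\<forall>i<n. \<bar>c t i - x i\<bar> < e" "\<forall>i\<ge>n. c t i = 0"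
    have "(\<Sum>k<n. pd k f ((m k t)(k := \<xi> k t)) * ((c t k - c t0 k) / (t - t0))) = (\<Sum>k<n. (f (m (Suc k) t) - f (m k t)) / (t - t0))"
    proof (rule sum.cong[OF refl])
      fix k assume "k \<in> {..<n}"
      then have "P k t (\<xi> k t)" using P[OF t(1)] by (simp add: \<xi>_def)
      then show "pd k f ((m k t)(k := \<xi> k t)) * ((c t k - c t0 k) / (t - t0)) = (f (m (Suc k) t) - f (m k t)) / (t - t0)" by (simp add: P_def x_def)
    qed
    also have "\<dots> = (\<Sum>k<n. f (m (Suc k) t) - f (m k t)) / (t - t0)" by (simp add: sum_divide_distrib)
    also have "(\<Sum>k<n. f (m (Suc k) t) - f (m k t)) = f (m n t) - f (m 0 t)" by (rule sum_lessThan_telescope)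
    also have "m n t = c t" using t(2) x(2) by (auto simp: m_def fun_eq_iff)
    also have "m 0 t = c t0" by (auto simp: m_def x_def)
    finally show "(\<Sum>k<n. pd k f ((m k t)(k := \<xi> k t)) * ((c t k - c t0 k) / (t - t0))) = (f (c t) - f (c t0)) / (t - t0)" .
  qed
  ultimately show ?thesis unfolding has_field_derivative_iff x_def by (rule Lim_transform_eventually)
qed

lemma continuous_on_fun_openE:
  assumes "\<And>i. i < n \<Longrightarrow> continuous_on U (\<lambda>x. \<Phi> x i)" "\<And>x i. x \<in> U \<Longrightarrow> i \<ge> n \<Longrightarrow> \<Phi> x i = (0::real)"
  shows "continuous_on U (\<Phi> :: 'a::topological_space \<Rightarrow> nat \<Rightarrow> real)"
proof (rule continuous_on_coordinatewise_then_product)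
  fix i show "continuous_on U (\<lambda>x. \<Phi> x i)"
  proof (cases "i < n")
    case False
    then have "continuous_on U (\<lambda>x. \<Phi> x i) = continuous_on U (\<lambda>x. 0)" using assms(2)[of _ i] by (simp cong: continuous_on_cong_simp)
    then show ?thesis by simp
  qed (rule assms(1))
qed

text \<open>The partial derivatives of the composite are sums of products of \<open>pd i f\<close>,
  taken along \<open>\<Phi>\<close>, with partial derivatives of \<open>\<Phi>\<close>. The
  induction on the order keeps \<open>f\<close> general because it is applied to
  \<open>pd i f\<close>.\<close>

lemma Ck_on_compose:
  assumes U: "openin (\<E> m) U" and V: "openin (\<E> n) V" and im: "\<And>x. x \<in> U \<Longrightarrow> \<Phi> x \<in> V"
  shows "(\<And>i. i < n \<Longrightarrow> Ck_on m k U (\<lambda>x. \<Phi> x i)) \<Longrightarrow> Ck_on n k V f \<Longrightarrow> Ck_on m k U (\<lambda>x. f (\<Phi> x))"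
proof (induction k arbitrary: f)
  case 0
  have "continuous_on U \<Phi>" by (rule continuous_on_fun_openE[of n]) (use 0 openE_D0[OF V im] in auto)
  then show ?case using 0(2) im continuous_on_compose2[of V f U \<Phi>] by auto
next
  case (Suc k)
  have 1: "Ck_on n (Suc 0) V f" using Suc.prems(2) by (rule Ck_on_le) simp
  have 2: "Ck_on m k U (\<lambda>x. \<Phi> x i)" if "i < n" for i using Suc.prems(1)[OF that] by (rule Ck_on_Suc_imp)
  have IH: "Ck_on m k U (\<lambda>x. g (\<Phi> x))" if "Ck_on n k V g" for g
  proof (rule Suc.IH)
    show "Ck_on m k U (\<lambda>x. \<Phi> x i)" if "i < n" for i using that by (rule 2)
  qed (rule that)
  show ?case
  proof (rule Ck_on_SucI)
    show "continuous_on U (\<lambda>x. f (\<Phi> x))" by (rule Ck_on_continuous[OF IH[OF Ck_on_Suc_imp[OF Suc.prems(2)]]])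
    fix j assume j: "j < m"
    have "Ck_on m k U (\<lambda>x. \<Sum>i<n. pd i f (\<Phi> x) * pd j (\<lambda>x. \<Phi> x i) x)"
    proof (rule Ck_on_sum, rule Ck_on_mult)
      fix i assume "i \<in> {..<n}"
      then have i: "i < n" by simp
      have "Ck_on n k V (pd i f)" using Suc.prems(2) i unfolding Ck_on_Suc_iff[OF V] by simp
      then show "Ck_on m k U (\<lambda>x. pd i f (\<Phi> x))" by (rule IH)
      show "Ck_on m k U (pd j (\<lambda>x. \<Phi> x i))" using Suc.prems(1)[OF i] j unfolding Ck_on_Suc_iff[OF U] by simp
    qed
    moreover have "((\<lambda>t. f (\<Phi> (x(j := t)))) has_real_derivative
        (\<Sum>i<n. pd i f (\<Phi> x) * pd j (\<lambda>x. \<Phi> x i) x)) (at (x j))" if x: "x \<in> U" for x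
    proof -
      have "((\<lambda>t. f (\<Phi> (x(j := t)))) has_real_derivative
        (\<Sum>i<n. pd i f (\<Phi> (x(j := x j))) * pd j (\<lambda>x. \<Phi> x i) x)) (at (x j))"
      proof (rule has_derivative_curve[OF V 1])
        show "\<Phi> (x(j := x j)) \<in> V" using x im by simp
        show "\<forall>\<^sub>F t in nhds (x j). \<forall>i\<ge>n. \<Phi> (x(j := t)) i = 0" using eventually_upd_in_openE[OF U x j]
          by eventually_elim (use im openE_D0[OF V] in auto)
        show "((\<lambda>t. \<Phi> (x(j := t)) i) has_real_derivative pd j (\<lambda>x. \<Phi> x i) x) (at (x j))" if "i < n" for i
          using Suc.prems(1)[OF that] x j unfolding Ck_on_Suc_iff[OF U] by simp
      qed
      then show ?thesis by simp
    qed
    ultimately show "\<exists>D. Ck_on m k U D \<and> (\<forall>x\<in>U. ((\<lambda>t. f (\<Phi> (x(j := t)))) has_real_derivative D x) (at (x j)))"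
      by (intro exI[of _ "\<lambda>x. \<Sum>i<n. pd i f (\<Phi> x) * pd j (\<lambda>x. \<Phi> x i) x"] conjI ballI)
  qed
qed

lemma smooth_on_compose:
  assumes "openin (\<E> m) U" "openin (\<E> n) V" "\<And>x. x \<in> U \<Longrightarrow> \<Phi> x \<in> V"
    and "\<And>i. i < n \<Longrightarrow> smooth_on m U (\<lambda>x. \<Phi> x i)" "smooth_on n V f"
  shows "smooth_on m U (\<lambda>x. f (\<Phi> x))" unfolding smooth_on_def
proof
  fix k show "Ck_on m k U (\<lambda>x. f (\<Phi> x))" by (rule Ck_on_compose[OF assms(1-3)]) (simp_all add: assms(4,5)[unfolded smooth_on_def])
qed

text \<open>\<open>Z\<close> lists a function together with all its derivatives; the induction on
  the order moves from \<open>Z j\<close> to \<open>Z (Suc j)\<close>.\<close>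

lemma Ck_on_compose_real:
  assumes Z: "\<And>j t. (Z j has_real_derivative Z (Suc j) t) (at t)"
  shows "Ck_on n k U f \<Longrightarrow> Ck_on n k U (\<lambda>x. Z j (f x))"
proof (induction k arbitrary: j f)
  case 0
  have "continuous_on UNIV (Z j)" by (rule continuous_at_imp_continuous_on) (simp add: DERIV_isCont[OF Z])
  then show ?case using 0 continuous_on_compose2[of UNIV "Z j" U f] by auto
next
  case (Suc k)
  show ?case
  proof (rule Ck_on_SucI)
    show "continuous_on U (\<lambda>x. Z j (f x))" by (rule Ck_on_continuous[OF Suc.IH[OF Ck_on_Suc_imp[OF Suc.prems]]])
    fix i assume "i < n"
    from Suc.prems this obtain D where D: "Ck_on n k U D"
      "\<And>x. x \<in> U \<Longrightarrow> ((\<lambda>t. f (x(i := t))) has_real_derivative D x) (at (x i))" by (rule Ck_on_SucE) blast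
    have "((\<lambda>t. Z j (f (x(i := t)))) has_real_derivative Z (Suc j) (f x) * D x) (at (x i))" if "x \<in> U" for x
    proof -
      have "(Z j has_real_derivative Z (Suc j) (f x)) (at (f (x(i := x i))))" using Z by simp
      from DERIV_chain2[OF this D(2)[OF that]] show ?thesis .
    qed
    moreover have "Ck_on n k U (\<lambda>x. Z (Suc j) (f x) * D x)" by (intro Ck_on_mult Suc.IH D Ck_on_Suc_imp[OF Suc.prems])
    ultimately show "\<exists>D. Ck_on n k U D \<and> (\<forall>x\<in>U. ((\<lambda>t. Z j (f (x(i := t)))) has_real_derivative D x) (at (x i)))"
      by (intro exI[of _ "\<lambda>x. Z (Suc j) (f x) * D x"] conjI ballI)
  qed
qed

subsection \<open>Hadamard's lemma\<close>

definition segment_point :: "(nat \<Rightarrow> real) \<Rightarrow> (nat \<Rightarrow> real) \<Rightarrow> real \<Rightarrow> nat \<Rightarrow> real" where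
  "segment_point p x \<theta> = (\<lambda>i. p i + \<theta> * (x i - p i))"

lemma segment_point_in_cube:
  assumes "x \<in> cube n p e" "\<forall>i\<ge>n. p i = 0" "0 \<le> \<theta>" "\<theta> \<le> 1"
  shows "segment_point p x \<theta> \<in> cube n p e"
proof -
  have "\<bar>\<theta> * (x i - p i)\<bar> < e" if "i < n" for i
  proof -
    have "\<bar>\<theta> * (x i - p i)\<bar> \<le> \<bar>x i - p i\<bar>" using assms(3,4) by (simp add: abs_mult mult_left_le_one_le)
    also have "\<dots> < e" using assms(1) that by (simp add: cube_def)
    finally show ?thesis .
  qed
  then show ?thesis using assms unfolding cube_def segment_point_def by simp
qed

lemma segment_point_upd:
  "segment_point p (x(i := t)) \<theta> = (segment_point p x \<theta>)(i := p i + \<theta> * (t - p i))" by (auto simp: segment_point_def)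

lemma continuous_on_segment_point:
  assumes g: "continuous_on (cube n p e) g" and p: "\<forall>i\<ge>n. p i = 0"
    and x: "continuous_on S x" "\<And>s. s \<in> S \<Longrightarrow> x s \<in> cube n p e"
    and r: "continuous_on S r" "\<And>s. s \<in> S \<Longrightarrow> 0 \<le> r s \<and> r s \<le> 1"
  shows "continuous_on S (\<lambda>s. g (segment_point p (x s) (r s)))"
proof (rule continuous_on_compose2[OF g])
  show "continuous_on S (\<lambda>s. segment_point p (x s) (r s))" unfolding segment_point_def by (rule continuous_on_coordinatewise_then_product)
       (intro continuous_intros r continuous_on_product_then_coordinatewise[OF x(1)])
  show "(\<lambda>s. segment_point p (x s) (r s)) ` S \<subseteq> cube n p e" using segment_point_in_cube[OF x(2) p] r(2) by auto
qed

text \<open>Differentiation under the integral sign produces a factor \<open>\<theta>\<close>, the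
  inner derivative of the segment. The power \<open>\<theta> ^ a\<close> is carried along so that
  the induction hypothesis applies to the derivative.\<close>

lemma Ck_on_integral_segment:
  assumes p: "\<forall>i\<ge>n. p i = 0"
  shows "Ck_on n k (cube n p e) F \<Longrightarrow>
    Ck_on n k (cube n p e) (\<lambda>x. integral {0..1} (\<lambda>\<theta>. \<theta> ^ a * F (segment_point p x \<theta>)))"
proof (induction k arbitrary: F a)
  case 0
  have "continuous_on (cube n p e \<times> cbox 0 1) (\<lambda>(x, \<theta>). \<theta> ^ a * F (segment_point p x \<theta>))" unfolding split_beta
  proof (intro continuous_on_mult continuous_on_power continuous_on_snd continuous_on_id)
    show "continuous_on (cube n p e \<times> cbox 0 1) (\<lambda>s. F (segment_point p (fst s) (snd s)))" using 0 by (intro continuous_on_segment_point[OF _ p])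
        (auto intro!: continuous_on_fst continuous_on_snd continuous_on_id)
  qed
  from integral_continuous_on_param[OF this] show ?case by simp
next
  case (Suc k)
  show ?case
  proof (rule Ck_on_SucI)
    show "continuous_on (cube n p e) (\<lambda>x. integral {0..1} (\<lambda>\<theta>. \<theta> ^ a * F (segment_point p x \<theta>)))"
      by (rule Ck_on_continuous[OF Suc.IH[OF Ck_on_Suc_imp[OF Suc.prems]]])
    fix i assume i: "i < n"
    from Suc.prems this obtain D where D: "Ck_on n k (cube n p e) D"
      "\<And>x. x \<in> cube n p e \<Longrightarrow> ((\<lambda>t. F (x(i := t))) has_real_derivative D x) (at (x i))" by (rule Ck_on_SucE) blast
    have "((\<lambda>t. integral {0..1} (\<lambda>\<theta>. \<theta> ^ a * F (segment_point p (x(i := t)) \<theta>))) has_real_derivative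
        integral {0..1} (\<lambda>\<theta>. \<theta> ^ Suc a * D (segment_point p x \<theta>))) (at (x i))" if x: "x \<in> cube n p e" for x
    proof -
      let ?I = "{p i - e<..<p i + e}"
      have I: "x(i := t) \<in> cube n p e" if "t \<in> ?I" for t using x that i unfolding cube_def by (auto simp: abs_less_iff)
      have xI: "x i \<in> ?I" using x i unfolding cube_def by (auto simp: abs_less_iff)
      have cu: "continuous_on S (\<lambda>t. x(i := h t))" if "continuous_on S h" for S :: "'b::topological_space set" and h
      proof (rule continuous_on_coordinatewise_then_product)
        show "continuous_on S (\<lambda>t. (x(i := h t)) j)" for j using that by (cases "j = i") simp_all
      qed
      have "((\<lambda>t. integral (cbox 0 1) (\<lambda>\<theta>. \<theta> ^ a * F (segment_point p (x(i := t)) \<theta>))) has_real_derivative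
        integral (cbox 0 1) (\<lambda>\<theta>. \<theta> ^ Suc a * D (segment_point p (x(i := x i)) \<theta>))) (at (x i) within ?I)"
      proof (rule leibniz_rule_field_derivative)
        fix t \<theta> :: real assume t: "t \<in> ?I" and th: "\<theta> \<in> cbox 0 1"
        let ?y = "segment_point p (x(i := t)) \<theta>"
        have y: "?y \<in> cube n p e" using I[OF t] th p by (intro segment_point_in_cube) auto
        have yi: "?y i = p i + \<theta> * (t - p i)" by (simp add: segment_point_def)
        have "((\<lambda>s. F (?y(i := s))) has_real_derivative D ?y) (at (p i + \<theta> * (t - p i)))" using D(2)[OF y] by (simp add: yi)
        moreover have "((\<lambda>t. p i + \<theta> * (t - p i)) has_real_derivative \<theta>) (at t within ?I)" by (auto intro!: derivative_eq_intros)
        ultimately have "((\<lambda>t. F (?y(i := p i + \<theta> * (t - p i)))) has_real_derivative D ?y * \<theta>) (at t within ?I)" by (rule DERIV_chain2)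
        then have "((\<lambda>t. F (segment_point p (x(i := t)) \<theta>)) has_real_derivative D ?y * \<theta>) (at t within ?I)"
          by (simp add: segment_point_upd)
        from DERIV_cmult[OF this, of "\<theta> ^ a"]
        show "((\<lambda>t. \<theta> ^ a * F (segment_point p (x(i := t)) \<theta>)) has_real_derivative \<theta> ^ Suc a * D ?y) (at t within ?I)"
          by (simp add: mult_ac)
      next
        fix t assume t: "t \<in> ?I"
        show "(\<lambda>\<theta>. \<theta> ^ a * F (segment_point p (x(i := t)) \<theta>)) integrable_on cbox 0 1"
        proof (rule integrable_continuous, rule continuous_on_mult)
          show "continuous_on (cbox 0 1) (\<lambda>\<theta>. F (segment_point p (x(i := t)) \<theta>))"
            by (rule continuous_on_segment_point[OF Ck_on_continuous[OF Suc.prems] p continuous_on_const I[OF t] continuous_on_id]) simp_all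
        qed (intro continuous_intros)
      next
        show "continuous_on (?I \<times> cbox 0 1) (\<lambda>(t, \<theta>). \<theta> ^ Suc a * D (segment_point p (x(i := t)) \<theta>))" unfolding split_beta
        proof (rule continuous_on_mult)
          show "continuous_on (?I \<times> cbox (0::real) 1) (\<lambda>s. snd s ^ Suc a)"
            by (rule continuous_on_power[OF continuous_on_snd[OF continuous_on_id]])
          show "continuous_on (?I \<times> cbox 0 1) (\<lambda>s. D (segment_point p (x(i := fst s)) (snd s)))"
          proof (rule continuous_on_segment_point[OF Ck_on_continuous[OF D(1)] p])
            show "continuous_on (?I \<times> cbox (0::real) 1) (\<lambda>s. x(i := fst s))" by (rule cu) (rule continuous_on_fst[OF continuous_on_id])
            show "continuous_on (?I \<times> cbox (0::real) 1) snd" by (rule continuous_on_snd[OF continuous_on_id])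
            fix s assume s: "s \<in> ?I \<times> cbox (0::real) 1"
            show "x(i := fst s) \<in> cube n p e" by (rule I) (use s in auto)
            show "0 \<le> snd s \<and> snd s \<le> 1" using s by auto
          qed
        qed
      qed (use xI in auto)
      then show ?thesis using xI by (simp add: at_within_open[OF xI])
    qed
    then show "\<exists>D. Ck_on n k (cube n p e) D \<and> (\<forall>x\<in>cube n p e.
       ((\<lambda>t. integral {0..1} (\<lambda>\<theta>. \<theta> ^ a * F (segment_point p (x(i := t)) \<theta>))) has_real_derivative D x) (at (x i)))"
      using Suc.IH[OF D(1), of "Suc a"]
      by (intro exI[of _ "\<lambda>x. integral {0..1} (\<lambda>\<theta>. \<theta> ^ Suc a * D (segment_point p x \<theta>))"] conjI ballI)
  qed
qed

text \<open>\<open>H i\<close> is the average of the i-th partial derivative over the segment from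
  \<open>p\<close> to \<open>x\<close>; the expansion is the fundamental theorem of calculus along
  that segment.\<close>

lemma hadamard:
  assumes U: "openin (\<E> n) U" and f: "smooth_on n U f" and p: "p \<in> U"
  obtains e H where "e > 0" "cube n p e \<subseteq> U" "\<And>i. i < n \<Longrightarrow> smooth_on n (cube n p e) (H i)"
    "\<And>i. i < n \<Longrightarrow> H i p = pd i f p"
    "\<And>x. x \<in> cube n p e \<Longrightarrow> f x = f p + (\<Sum>i<n. (x i - p i) * H i x)"
proof -
  obtain e where e: "e > 0" "cube n p e \<subseteq> U" by (rule openE_cube[OF U p])
  have p0: "\<forall>i\<ge>n. p i = 0" using openE_D0[OF U p] by blast
  define H where "H i x = integral {0..1} (\<lambda>\<theta>. \<theta> ^ 0 * pd i f (segment_point p x \<theta>))" for i x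
  have sm: "smooth_on n (cube n p e) (pd i f)" if "i < n" for i using smooth_on_mono[OF smooth_on_pd[OF U f that] e(2)] .
  have "f x = f p + (\<Sum>i<n. (x i - p i) * H i x)" if x: "x \<in> cube n p e" for x
  proof -
    have int: "(\<lambda>\<theta>. pd i f (segment_point p x \<theta>)) integrable_on {0..1}" if "i < n" for i
      by (rule integrable_continuous_real, rule continuous_on_segment_point[OF smooth_on_continuous[OF sm[OF that]] p0])
        (use x in auto)
    have d: "((\<lambda>\<theta>. f (segment_point p x \<theta>)) has_real_derivative
        (\<Sum>i<n. pd i f (segment_point p x \<theta>) * (x i - p i))) (at \<theta>)" if "0 \<le> \<theta>" "\<theta> \<le> 1" for \<theta>
    proof (rule has_derivative_curve[OF U])
      show "Ck_on n (Suc 0) U f" using f unfolding smooth_on_def by blast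
      show "segment_point p x \<theta> \<in> U" using segment_point_in_cube[OF x p0 that] e(2) by blast
      show "\<forall>\<^sub>F t in nhds \<theta>. \<forall>i\<ge>n. segment_point p x t i = 0" using x p0 by (simp add: segment_point_def cube_def)
      show "((\<lambda>t. segment_point p x t i) has_real_derivative x i - p i) (at \<theta>)" for i
        unfolding segment_point_def by (auto intro!: derivative_eq_intros)
    qed
    have "((\<lambda>\<theta>. \<Sum>i<n. pd i f (segment_point p x \<theta>) * (x i - p i)) has_integral
        f (segment_point p x 1) - f (segment_point p x 0)) {0..1}"
      by (rule fundamental_theorem_of_calculus)
        (auto simp: has_real_derivative_iff_has_vector_derivative[symmetric] intro: DERIV_subset[OF d])
    moreover have "((\<lambda>\<theta>. \<Sum>i<n. pd i f (segment_point p x \<theta>) * (x i - p i)) has_integral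
        (\<Sum>i<n. H i x * (x i - p i))) {0..1}"
      unfolding H_def using int by (intro has_integral_sum has_integral_mult_left) (auto simp: integrable_integral)
    ultimately have "f (segment_point p x 1) - f (segment_point p x 0) = (\<Sum>i<n. H i x * (x i - p i))" by (rule has_integral_unique)
    then show ?thesis by (simp add: segment_point_def mult.commute)
  qed
  moreover have "H i p = pd i f p" for i by (simp add: H_def segment_point_def)
  moreover have "smooth_on n (cube n p e) (H i)" if "i < n" for i
    using sm[OF that] unfolding smooth_on_def H_def by (intro allI Ck_on_integral_segment[OF p0]) auto
  ultimately show ?thesis using that[OF e, of H] by blast
qed

subsection \<open>Cutoff functions\<close>

text \<open>With u = 1/t, differentiating P(u) exp(-u) with respect to t multiplies it by u^2 and
  replaces P by P - P', since du/dt = -u^2.\<close>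

primrec flat_poly :: "nat \<Rightarrow> real poly" where
  "flat_poly 0 = 1"
| "flat_poly (Suc j) = [:0, 0, 1:] * (flat_poly j - pderiv (flat_poly j))"

text \<open>The function \<open>exp (- 1 / t)\<close>, extended by zero, together with its derivatives.\<close>

definition flat :: "nat \<Rightarrow> real \<Rightarrow> real" where
  "flat j t = (if t > 0 then poly (flat_poly j) (1 / t) * exp (- (1 / t)) else 0)"

lemma tendsto_poly_exp_0: "((\<lambda>u. poly p u * exp (- u)) \<longlongrightarrow> (0::real)) at_top"
proof -
  have "((\<lambda>u. \<Sum>i\<le>degree p. coeff p i * (u ^ i / exp u)) \<longlongrightarrow> (\<Sum>i\<le>degree p. coeff p i * 0)) at_top"
    by (intro tendsto_sum tendsto_mult tendsto_const tendsto_power_div_exp_0)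
  then show ?thesis by (simp add: poly_altdef sum_distrib_right sum_distrib_left exp_minus divide_inverse mult_ac)
qed

lemma flat_has_derivative: "(flat j has_real_derivative flat (Suc j) t) (at t)"
proof -
  consider "t > 0" | "t < 0" | "t = 0" by linarith
  then show ?thesis
  proof cases
    case 1
    have "((\<lambda>t. poly (flat_poly j) (1 / t) * exp (- (1 / t))) has_real_derivative flat (Suc j) t) (at t)"
      using 1 by (auto simp: flat_def field_simps power2_eq_square intro!: derivative_eq_intros DERIV_chain2[OF poly_DERIV])
    moreover have "eventually (\<lambda>s. s \<in> {0<..}) (nhds t)" by (rule eventually_nhds_in_open) (use 1 in auto)
    ultimately show ?thesis by (subst DERIV_cong_ev[OF refl _ refl, where g = "\<lambda>t. poly (flat_poly j) (1 / t) * exp (- (1 / t))"])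
         (auto simp: flat_def elim: eventually_mono)
  next
    case 2
    have "eventually (\<lambda>s. s \<in> {..<0}) (nhds t)" by (rule eventually_nhds_in_open) (use 2 in auto)
    then show ?thesis using 2 by (subst DERIV_cong_ev[OF refl _ refl, where g = "\<lambda>t. 0"]) (auto simp: flat_def elim: eventually_mono)
  next
    case 3
    have r: "((\<lambda>h. flat j h / h) \<longlongrightarrow> 0) (at_right 0)"
    proof -
      \<comment> \<open>The difference quotient at 0 from the right is u P(u) exp(-u) with u = 1/h,
        again of the form that tends to 0; \<open>pCons 0\<close> is multiplication by the
        variable.\<close>
      have "((\<lambda>u. poly (pCons 0 (flat_poly j)) u * exp (- u)) \<longlongrightarrow> 0) at_top" by (rule tendsto_poly_exp_0)
      from filterlim_compose[OF this filterlim_inverse_at_top_right]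
      have "((\<lambda>h. poly (pCons 0 (flat_poly j)) (inverse h) * exp (- inverse h)) \<longlongrightarrow> 0) (at_right 0)" .
      moreover have "eventually (\<lambda>h. poly (pCons 0 (flat_poly j)) (inverse h) * exp (- inverse h) = flat j h / h) (at_right 0)"
        using eventually_at_right_less[of "0::real"] by eventually_elim (simp add: flat_def field_simps)
      ultimately show ?thesis by (rule Lim_transform_eventually)
    qed
    have l: "((\<lambda>h. flat j h / h) \<longlongrightarrow> 0) (at_left 0)"
    proof (rule tendsto_eventually)
      show "eventually (\<lambda>h. flat j h / h = 0) (at_left 0)" by (auto simp: flat_def eventually_at_left_field intro: exI[of _ "-1"])
    qed
    have "((\<lambda>h. flat j h / h) \<longlongrightarrow> 0) (at 0)" using l r filterlim_split_at by blast
    then show ?thesis by (simp add: 3 has_field_derivative_iff flat_def)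
  qed
qed

lemma smooth_on_flat: "smooth_on n U f \<Longrightarrow> smooth_on n U (\<lambda>x. flat j (f x))"
  unfolding smooth_on_def using Ck_on_compose_real[of flat, OF flat_has_derivative] by blast

lemma flat_0_le: "t \<le> 0 \<Longrightarrow> flat 0 t = 0" by (simp add: flat_def)

lemma flat_0_pos: "t > 0 \<Longrightarrow> flat 0 t > 0" by (simp add: flat_def)

lemma flat_0_mono: "s \<le> t \<Longrightarrow> flat 0 s \<le> flat 0 t" by (auto simp: flat_def intro!: divide_left_mono)

text \<open>With r the squared distance from \<open>p\<close>, \<open>flat 0 (e^2 - r)\<close>
  vanishes for r >= e^2 and is at least c = \<open>flat 0 (e^2 / 2)\<close> for r <= e^2 / 2. A
  second application of \<open>flat 0\<close>, to c minus this function, is divided by its maximal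
  value \<open>flat 0 c\<close> and subtracted from 1; the result is 0 in the first range and 1 in
  the second.\<close>

lemma cutoff_exists:
  fixes p :: "nat \<Rightarrow> real"
  assumes e: "e > 0"
  obtains \<beta> d where "d > 0" "\<And>U. smooth_on n U \<beta>" "\<And>y. y \<in> cube n p d \<Longrightarrow> \<beta> y = 1"
    "\<And>y i. i < n \<Longrightarrow> \<bar>y i - p i\<bar> \<ge> e \<Longrightarrow> \<beta> y = (0::real)"
proof -
  define r where "r y = (\<Sum>i<n. (y i - p i) * (y i - p i))" for y
  define c where "c = flat 0 (e\<^sup>2 / 2)"
  define \<beta> where "\<beta> y = 1 - flat 0 (c - flat 0 (e\<^sup>2 - r y)) * (1 / flat 0 c)" for y
  have c: "c > 0" unfolding c_def using e by (intro flat_0_pos) auto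
  \<comment> \<open>Chosen so that \<open>n * d^2 \<le> e^2 / 2\<close>; the summand 1 in the
    denominator covers \<open>n = 0\<close>.\<close>
  define d where "d = e / (2 * (real n + 1))"
  have d: "d > 0" using e by (auto simp: d_def)
  show ?thesis
  proof (rule that[OF d, of \<beta>])
    show "smooth_on n U \<beta>" for U unfolding \<beta>_def r_def
      by (intro smooth_on_diff smooth_on_mult smooth_on_const smooth_on_flat smooth_on_sum smooth_on_coordinate)
    fix y
    {
      assume y: "y \<in> cube n p d"
      have "(y i - p i) * (y i - p i) \<le> d\<^sup>2" if "i < n" for i
        using y that d unfolding cube_def power2_eq_square[symmetric] by (intro abs_le_square_iff[THEN iffD1]) fastforce
      then have "r y \<le> (\<Sum>i<n. d\<^sup>2)" unfolding r_def by (intro sum_mono) auto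
      also have "\<dots> = real n * e\<^sup>2 / (4 * (real n + 1)\<^sup>2)" unfolding d_def power_divide power_mult_distrib by simp
      also have "\<dots> \<le> e\<^sup>2 / 2"
      proof -
        have "real n * e\<^sup>2 * 2 \<le> e\<^sup>2 * (4 * (real n + 1)\<^sup>2)"
          using mult_right_mono[of "real n * 2" "4 * (real n + 1)\<^sup>2" "e\<^sup>2"] by (simp add: power2_eq_square algebra_simps)
        then show ?thesis by (simp add: divide_simps)
      qed
      finally have "e\<^sup>2 / 2 \<le> e\<^sup>2 - r y" by simp
      then have "c \<le> flat 0 (e\<^sup>2 - r y)" unfolding c_def by (rule flat_0_mono)
      then show "\<beta> y = 1" unfolding \<beta>_def by (simp add: flat_0_le)
    }
    fix i assume i: "i < n" "\<bar>y i - p i\<bar> \<ge> e"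
    have "e\<^sup>2 \<le> (y i - p i) * (y i - p i)" using i(2) e unfolding power2_eq_square[symmetric] by (metis abs_le_square_iff abs_of_pos)
    also have "\<dots> \<le> r y" unfolding r_def by (rule member_le_sum) (use i in auto)
    finally have "flat 0 (e\<^sup>2 - r y) = 0" by (intro flat_0_le) simp
    then show "\<beta> y = 0" using flat_0_pos[OF c] by (simp add: \<beta>_def)
  qed
qed

lemma openin_Collect_coordinate_gt:
  "openin (\<E> n) {y. (\<forall>i\<ge>n. y i = 0) \<and> \<bar>y i - p i\<bar> > e}"
proof -
  have "open {y::nat\<Rightarrow>real. \<bar>y i - p i\<bar> > e}" by (intro open_Collect_less continuous_intros continuous_on_product_coordinates)
  then show ?thesis unfolding Euclidean_space_eq openin_open by (intro exI[of _ "{y. \<bar>y i - p i\<bar> > e}"]) auto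
qed

text \<open>The product with a cutoff that vanishes from radius \<open>e / 2\<close> on is extended
  by zero. The gap between \<open>e / 2\<close> and \<open>e\<close> makes the cube and the open
  sets on which the product is zero cover the whole space.\<close>

lemma smooth_extension:
  assumes e: "e > 0" and h: "smooth_on n (cube n p e) h"
  obtains h' d where "d > 0" "smooth_on n (topspace (\<E> n)) h'"
    "\<And>y. y \<in> cube n p d \<Longrightarrow> y \<in> cube n p e \<and> h' y = h y" "\<And>y i. i < n \<Longrightarrow> \<bar>y i - p i\<bar> \<ge> e / 2 \<Longrightarrow> h' y = 0"
proof -
  have e2: "e / 2 > 0" using e by simp
  obtain \<beta> d where b: "d > 0" "\<And>U. smooth_on n U \<beta>" "\<And>y. y \<in> cube n p d \<Longrightarrow> \<beta> y = 1"
    "\<And>y i. i < n \<Longrightarrow> \<bar>y i - p i\<bar> \<ge> e / 2 \<Longrightarrow> \<beta> y = 0" by (rule cutoff_exists[OF e2, of n p]) blast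
  define h' where "h' y = (if y \<in> cube n p e then \<beta> y * h y else 0)" for y
  have 0: "h' y = 0" if "i < n" "\<bar>y i - p i\<bar> \<ge> e / 2" for y i using b(4)[of i y] that by (simp add: h'_def)
  have "smooth_on n (topspace (\<E> n)) h'"
  proof (rule smooth_on_local[OF openin_topspace])
    fix x assume x: "x \<in> topspace (\<E> n)"
    show "\<exists>V. openin (\<E> n) V \<and> x \<in> V \<and> smooth_on n V h'"
    proof (cases "x \<in> cube n p e")
      case True
      have "smooth_on n (cube n p e) h'" by (rule smooth_on_cong[OF openin_cube _ smooth_on_mult[OF b(2) h]]) (simp add: h'_def)
      then show ?thesis using True openin_cube by (intro exI[of _ "cube n p e"] conjI)
    next
      case False
      have "\<exists>i<n. \<bar>x i - p i\<bar> \<ge> e" using False x unfolding cube_def topspace_Euclidean_space mem_Collect_eq by (meson not_less)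
      then obtain i where i: "i < n" "\<bar>x i - p i\<bar> \<ge> e" by (elim exE conjE)
      let ?V = "{y. (\<forall>i\<ge>n. y i = 0) \<and> \<bar>y i - p i\<bar> > e / 2}"
      have "smooth_on n ?V h'" by (rule smooth_on_cong[OF openin_Collect_coordinate_gt _ smooth_on_const[of n _ 0]])
           (use 0[of i] i(1) in auto)
      moreover have "x \<in> ?V" using x i e by (auto simp: topspace_Euclidean_space)
      ultimately show ?thesis using openin_Collect_coordinate_gt by (intro exI[of _ ?V] conjI)
    qed
  qed
  moreover have "y \<in> cube n p e \<and> h' y = h y" if "y \<in> cube n p (min d e)" for y
  proof -
    have "y \<in> cube n p d" "y \<in> cube n p e" using that cube_mono[of "min d e" d n p] cube_mono[of "min d e" e n p] by (simp_all add: subset_iff)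
    then show ?thesis using b(3) by (simp add: h'_def)
  qed
  moreover have "min d e > 0" using e b(1) by simp
  ultimately show ?thesis using 0 by (intro that[of "min d e" h'])
qed

text \<open>The coefficients are extended to the whole space because composing them with a tuple of
  functions must again give functions that are defined and smooth on the entire differential space,
  so that a derivation can be applied to them.\<close>

lemma hadamard_global:
  assumes V: "openin (\<E> n) V" and G: "smooth_on n V G" and p: "p \<in> V"
  obtains d H where "d > 0" "cube n p d \<subseteq> V"
    "\<And>i. i < n \<Longrightarrow> smooth_on n (topspace (\<E> n)) (H i)" "\<And>i. i < n \<Longrightarrow> H i p = pd i G p"
    "\<And>x. x \<in> cube n p d \<Longrightarrow> G x = G p + (\<Sum>i<n. (x i - p i) * H i x)"
proof -
  obtain e H where H: "e > 0" "cube n p e \<subseteq> V" "\<And>i. i < n \<Longrightarrow> smooth_on n (cube n p e) (H i)"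
    "\<And>i. i < n \<Longrightarrow> H i p = pd i G p"
    "\<And>x. x \<in> cube n p e \<Longrightarrow> G x = G p + (\<Sum>i<n. (x i - p i) * H i x)" by (rule hadamard[OF V G p]) blast
  have "\<exists>h' d. d > 0 \<and> smooth_on n (topspace (\<E> n)) h' \<and> (\<forall>y\<in>cube n p d. h' y = H i y)" if "i < n" for i
    by (rule smooth_extension[OF H(1) H(3)[OF that]]) blast
  then obtain H' d where H': "\<And>i. i < n \<Longrightarrow> d i > 0" "\<And>i. i < n \<Longrightarrow> smooth_on n (topspace (\<E> n)) (H' i)"
     "\<And>i y. i < n \<Longrightarrow> y \<in> cube n p (d i) \<Longrightarrow> H' i y = H i y" by metis
  define c where "c = Min (insert e (d ` {..<n}))"
  have c: "c > 0" "c \<le> e" "\<And>i. i < n \<Longrightarrow> c \<le> d i" unfolding c_def using H(1) H'(1) by (auto intro!: Min_le)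
  have pc: "p \<in> cube n p c" using c(1) openE_D0[OF V p] by simp
  have eq: "H' i y = H i y" if "i < n" "y \<in> cube n p c" for i y using H'(3)[OF that(1)] cube_mono[OF c(3)[OF that(1)]] that(2) by blast
  show ?thesis
  proof (rule that[of c H'])
    show "cube n p c \<subseteq> V" using cube_mono[OF c(2)] H(2) by blast
    show "H' i p = pd i G p" if "i < n" for i using eq[OF that pc] H(4)[OF that] by simp
    show "G x = G p + (\<Sum>i<n. (x i - p i) * H' i x)" if "x \<in> cube n p c" for x using H(5)[of x] that cube_mono[OF c(2)] eq by fastforce
  qed (use c H' in auto)
qed

section \<open>Differential spaces\<close>

subsection \<open>Locally generated function algebras\<close>

definition tuple :: "nat \<Rightarrow> (nat \<Rightarrow> 'a \<Rightarrow> real) \<Rightarrow> 'a \<Rightarrow> nat \<Rightarrow> real" where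
  "tuple n h x = (\<lambda>k. if k < n then h k x else 0)"

lemma tuple_less: "k < n \<Longrightarrow> tuple n h x k = h k x" and tuple_ge: "k \<ge> n \<Longrightarrow> tuple n h x k = 0"
  by (simp_all add: tuple_def)

lemma tuple_in_topspace: "tuple n h x \<in> topspace (\<E> n)" by (simp add: tuple_def topspace_Euclidean_space)

text \<open>Neighbourhoods of \<open>p\<close> are the sets on which finitely many members of
  \<open>B\<close> take values in an open set, so no topology has to accompany an
  \<open>fspace\<close>.\<close>

definition locally_generated :: "'a fspace \<Rightarrow> ('a \<Rightarrow> real) set \<Rightarrow> 'a \<Rightarrow> ('a \<Rightarrow> real) \<Rightarrow> bool" where
  "locally_generated N B p f \<longleftrightarrow> (\<exists>n V G h. (\<forall>k<n. h k \<in> B) \<and> openin (\<E> n) V \<and>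
     smooth_on n V G \<and> tuple n h p \<in> V \<and> (\<forall>x\<in>pts N. tuple n h x \<in> V \<longrightarrow> f x = G (tuple n h x)))"

lemma locally_generatedI:
  assumes "\<And>k. k < n \<Longrightarrow> h k \<in> B" "openin (\<E> n) V" "smooth_on n V G" "tuple n h p \<in> V"
    "\<And>x. x \<in> pts N \<Longrightarrow> tuple n h x \<in> V \<Longrightarrow> f x = G (tuple n h x)"
  shows "locally_generated N B p f" unfolding locally_generated_def by (intro exI[of _ n] exI[of _ V] exI[of _ G] exI[of _ h] conjI allI impI ballI assms)

lemma locally_generatedE:
  assumes "locally_generated N B p f"
  obtains n V G h where "\<And>k. k < n \<Longrightarrow> h k \<in> B" "openin (\<E> n) V" "smooth_on n V G" "tuple n h p \<in> V"
    "\<And>x. x \<in> pts N \<Longrightarrow> tuple n h x \<in> V \<Longrightarrow> f x = G (tuple n h x)"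
proof -
  from assms obtain n V G h where *: "\<forall>k<n. h k \<in> B" "openin (\<E> n) V" "smooth_on n V G"
    "tuple n h p \<in> V" "\<forall>x\<in>pts N. tuple n h x \<in> V \<longrightarrow> f x = G (tuple n h x)"
    unfolding locally_generated_def by (elim exE conjE)
  show ?thesis by (rule that[of n h V G]) (use * in auto)
qed

text \<open>Differential spaces in the sense of Sikorski; the generating functions also define the topology.\<close>

definition differential_space :: "'a fspace \<Rightarrow> bool" where
  "differential_space N \<longleftrightarrow> (\<forall>f\<in>fns N. \<forall>x. x \<notin> pts N \<longrightarrow> f x = 0) \<and>
     (\<forall>f. (\<forall>x. x \<notin> pts N \<longrightarrow> f x = 0) \<longrightarrow> (\<forall>p\<in>pts N. locally_generated N (fns N) p f) \<longrightarrow> f \<in> fns N)"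

definition generated_by :: "'a fspace \<Rightarrow> ('a \<Rightarrow> real) set \<Rightarrow> bool" where
  "generated_by N B \<longleftrightarrow> B \<subseteq> fns N \<and> (\<forall>p\<in>pts N. \<forall>f\<in>fns N. locally_generated N B p f)"

lemma fns_outside: "differential_space N \<Longrightarrow> f \<in> fns N \<Longrightarrow> x \<notin> pts N \<Longrightarrow> f x = 0"
  by (simp add: differential_space_def)

lemma fnsI:
  assumes "differential_space N" "\<And>x. x \<notin> pts N \<Longrightarrow> f x = 0" "\<And>p. p \<in> pts N \<Longrightarrow> locally_generated N (fns N) p f"
  shows "f \<in> fns N" using assms unfolding differential_space_def by simp

lemma locally_generated_self: "f \<in> B \<Longrightarrow> locally_generated N B p f"
  by (rule locally_generatedI[where n = 1 and h = "\<lambda>_. f" and V = "topspace (\<E> 1)" and G = "\<lambda>y. y 0"])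
    (simp_all add: tuple_in_topspace smooth_on_coordinate tuple_less)

lemma generated_by_fns: "generated_by N (fns N)" by (simp add: generated_by_def locally_generated_self)

lemma fns_compose:
  assumes N: "differential_space N" and h: "\<And>k. k < n \<Longrightarrow> h k \<in> fns N"
    and V: "openin (\<E> n) V" "smooth_on n V G" "\<And>x. x \<in> pts N \<Longrightarrow> tuple n h x \<in> V"
  shows "(\<lambda>x. if x \<in> pts N then G (tuple n h x) else 0) \<in> fns N" by (rule fnsI[OF N], simp, rule locally_generatedI[OF h V(1,2) V(3)]) simp_all

lemma fns_lincomb:
  assumes N: "differential_space N" and f: "f \<in> fns N" "g \<in> fns N"
  shows "(\<lambda>x. a * f x + b * g x) \<in> fns N"
proof -
  let ?h = "\<lambda>k::nat. if k = 0 then f else g"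
  have "(\<lambda>x. if x \<in> pts N then a * tuple 2 ?h x 0 + b * tuple 2 ?h x 1 else 0) \<in> fns N"
    by (rule fns_compose[OF N _ openin_topspace, where G = "\<lambda>y. a * y 0 + b * y 1"])
      (simp_all add: f tuple_in_topspace smooth_on_add smooth_on_mult smooth_on_coordinate)
  also have "(\<lambda>x. if x \<in> pts N then a * tuple 2 ?h x 0 + b * tuple 2 ?h x 1 else 0) = (\<lambda>x. a * f x + b * g x)"
    using fns_outside[OF N f(1)] fns_outside[OF N f(2)] by (simp add: fun_eq_iff tuple_less)
  finally show ?thesis .
qed

lemma fns_mult:
  assumes N: "differential_space N" and f: "f \<in> fns N" "g \<in> fns N"
  shows "(\<lambda>x. f x * g x) \<in> fns N"
proof -
  let ?h = "\<lambda>k::nat. if k = 0 then f else g"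
  have "(\<lambda>x. if x \<in> pts N then tuple 2 ?h x 0 * tuple 2 ?h x 1 else 0) \<in> fns N"
    by (rule fns_compose[OF N _ openin_topspace, where G = "\<lambda>y. y 0 * y 1"])
      (simp_all add: f tuple_in_topspace smooth_on_mult smooth_on_coordinate)
  also have "(\<lambda>x. if x \<in> pts N then tuple 2 ?h x 0 * tuple 2 ?h x 1 else 0) = (\<lambda>x. f x * g x)"
    using fns_outside[OF N f(1)] by (simp add: fun_eq_iff tuple_less)
  finally show ?thesis .
qed

lemma fns_const: "differential_space N \<Longrightarrow> (\<lambda>x. if x \<in> pts N then c else 0) \<in> fns N"
  using fns_compose[of N 0 "\<lambda>_ _. 0" "topspace (\<E> 0)" "\<lambda>_. c"] by (simp add: tuple_in_topspace)

lemma fns_zero: "differential_space N \<Longrightarrow> (\<lambda>x. 0) \<in> fns N" using fns_const[of N 0] by simp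

lemma fns_add: "differential_space N \<Longrightarrow> f \<in> fns N \<Longrightarrow> g \<in> fns N \<Longrightarrow> (\<lambda>x. f x + g x) \<in> fns N"
  using fns_lincomb[of N f g 1 1] by simp

lemma fns_diff: "differential_space N \<Longrightarrow> f \<in> fns N \<Longrightarrow> g \<in> fns N \<Longrightarrow> (\<lambda>x. f x - g x) \<in> fns N"
  using fns_lincomb[of N f g 1 "- 1"] by simp

lemma fns_scale: "differential_space N \<Longrightarrow> f \<in> fns N \<Longrightarrow> (\<lambda>x. a * f x) \<in> fns N"
  using fns_lincomb[of N f f a 0] by simp

lemma fns_sum:
  assumes "differential_space N" "\<And>i. i \<in> I \<Longrightarrow> f i \<in> fns N"
  shows "(\<lambda>x. \<Sum>i\<in>I. f i x) \<in> fns N" using assms(2)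
proof (induction I rule: infinite_finite_induct)
  case (insert i I)
  then show ?case using fns_add[OF assms(1), of "f i" "\<lambda>x. \<Sum>i\<in>I. f i x"] by simp
qed (simp_all add: fns_zero assms(1))

subsection \<open>Smooth maps\<close>

definition smooth_between :: "'a fspace \<Rightarrow> 'b fspace \<Rightarrow> ('a \<Rightarrow> 'b) \<Rightarrow> bool" where
  "smooth_between N N' F \<longleftrightarrow> (\<forall>x\<in>pts N. F x \<in> pts N') \<and> (\<forall>h\<in>fns N'. pullback N F h \<in> fns N)"

lemma smooth_between_pts: "smooth_between N N' F \<Longrightarrow> x \<in> pts N \<Longrightarrow> F x \<in> pts N'"
  and smooth_between_fns: "smooth_between N N' F \<Longrightarrow> h \<in> fns N' \<Longrightarrow> pullback N F h \<in> fns N"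
  by (simp_all add: smooth_between_def)

lemma smooth_between_cong:
  assumes "smooth_between N N' F" "\<And>x. x \<in> pts N \<Longrightarrow> F x = F' x"
  shows "smooth_between N N' F'"
proof -
  have "pullback N F' h = pullback N F h" for h using assms(2) by (simp add: pullback_def fun_eq_iff)
  then show ?thesis using assms by (simp add: smooth_between_def)
qed

lemma pullback_comp:
  "(\<And>x. x \<in> pts N \<Longrightarrow> F x \<in> pts N') \<Longrightarrow> pullback N F (pullback N' F' h) = pullback N (\<lambda>x. F' (F x)) h"
  by (simp add: pullback_def fun_eq_iff)

lemma smooth_between_comp:
  assumes "smooth_between N N' F" "smooth_between N' N'' F'"
  shows "smooth_between N N'' (\<lambda>x. F' (F x))" unfolding smooth_between_def
proof (intro conjI ballI)
  show "F' (F x) \<in> pts N''" if "x \<in> pts N" for x using that assms by (simp add: smooth_between_def)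
  show "pullback N (\<lambda>x. F' (F x)) h \<in> fns N" if "h \<in> fns N''" for h
    using smooth_between_fns[OF assms(1) smooth_between_fns[OF assms(2) that]] by (simp add: pullback_comp smooth_between_pts[OF assms(1)])
qed

lemma pullback_lincomb: "pullback N F (\<lambda>x. a * f x + b * g x) = (\<lambda>x. a * pullback N F f x + b * pullback N F g x)"
  and pullback_mult: "pullback N F (\<lambda>x. f x * g x) = (\<lambda>x. pullback N F f x * pullback N F g x)"
  and pullback_add: "pullback N F (\<lambda>x. f x + g x) = (\<lambda>x. pullback N F f x + pullback N F g x)"
  and pullback_diff: "pullback N F (\<lambda>x. f x - g x) = (\<lambda>x. pullback N F f x - pullback N F g x)"
  and pullback_scale: "pullback N F (\<lambda>x. a * f x) = (\<lambda>x. a * pullback N F f x)"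
  and pullback_zero: "pullback N F (\<lambda>x. 0) = (\<lambda>x. 0)" by (simp_all add: pullback_def fun_eq_iff)

lemma pullback_sum: "pullback N F (\<lambda>x. \<Sum>i\<in>I. f i x) = (\<lambda>x. \<Sum>i\<in>I. pullback N F (f i) x)"
  by (simp add: pullback_def fun_eq_iff)

lemma pullback_apply: "x \<in> pts N \<Longrightarrow> pullback N F h x = h (F x)" by (simp add: pullback_def)

lemma pullback_outside: "x \<notin> pts N \<Longrightarrow> pullback N F h x = 0" by (simp add: pullback_def)

text \<open>A local expression of a function by generators is pulled back to the same expression in
  the pulled-back generators.\<close>

lemma smooth_between_generated:
  assumes N: "differential_space N" and gen: "generated_by N' B" and im: "\<And>x. x \<in> pts N \<Longrightarrow> F x \<in> pts N'"
    and B: "\<And>h. h \<in> B \<Longrightarrow> pullback N F h \<in> fns N"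
  shows "smooth_between N N' F" unfolding smooth_between_def
proof (intro conjI ballI)
  show "F x \<in> pts N'" if "x \<in> pts N" for x using that by (rule im)
  show "pullback N F f \<in> fns N" if f: "f \<in> fns N'" for f
  proof (rule fnsI[OF N])
    show "pullback N F f x = 0" if "x \<notin> pts N" for x using that by (simp add: pullback_def)
    fix p assume p: "p \<in> pts N"
    have "locally_generated N' B (F p) f" using gen f im[OF p] by (simp add: generated_by_def)
    then obtain n V G h where *: "\<And>k. k < n \<Longrightarrow> h k \<in> B" "openin (\<E> n) V" "smooth_on n V G"
      "tuple n h (F p) \<in> V" "\<And>x. x \<in> pts N' \<Longrightarrow> tuple n h x \<in> V \<Longrightarrow> f x = G (tuple n h x)"
      by (rule locally_generatedE) blast
    have t: "tuple n (\<lambda>k. pullback N F (h k)) x = tuple n h (F x)" if "x \<in> pts N" for x using that by (simp add: tuple_def pullback_def fun_eq_iff)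
    show "locally_generated N (fns N) p (pullback N F f)"
    proof (rule locally_generatedI[where n = n and h = "\<lambda>k. pullback N F (h k)", OF _ *(2,3)])
      show "pullback N F (h k) \<in> fns N" if "k < n" for k using B *(1) that by simp
      show "tuple n (\<lambda>k. pullback N F (h k)) p \<in> V" using *(4) t[OF p] by simp
      fix x assume x: "x \<in> pts N" "tuple n (\<lambda>k. pullback N F (h k)) x \<in> V"
      then show "pullback N F f x = G (tuple n (\<lambda>k. pullback N F (h k)) x)" using *(5)[OF im[OF x(1)]] t[OF x(1)] by (simp add: pullback_apply)
    qed
  qed
qed

subsection \<open>Tangent vectors\<close>

lemma tangent_vector_pts: "tangent_vector N p v \<Longrightarrow> p \<in> pts N" by (simp add: tangent_vector_def)

lemma tangent_vector_lincomb:
  "tangent_vector N p v \<Longrightarrow> f \<in> fns N \<Longrightarrow> g \<in> fns N \<Longrightarrow> v (\<lambda>x. a * f x + b * g x) = a * v f + b * v g"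
  by (simp add: tangent_vector_def)

lemma tangent_vector_mult:
  "tangent_vector N p v \<Longrightarrow> f \<in> fns N \<Longrightarrow> g \<in> fns N \<Longrightarrow> v (\<lambda>x. f x * g x) = f p * v g + v f * g p"
  by (simp add: tangent_vector_def)

lemma tangent_vectorI:
  assumes "p \<in> pts N" "\<And>f g a b. f \<in> fns N \<Longrightarrow> g \<in> fns N \<Longrightarrow> v (\<lambda>x. a * f x + b * g x) = a * v f + b * v g"
    "\<And>f g. f \<in> fns N \<Longrightarrow> g \<in> fns N \<Longrightarrow> v (\<lambda>x. f x * g x) = f p * v g + v f * g p"
  shows "tangent_vector N p v" using assms by (simp add: tangent_vector_def)

lemma tangent_vector_add:
  "tangent_vector N p v \<Longrightarrow> tangent_vector N p w \<Longrightarrow> tangent_vector N p (\<lambda>f. a * v f + b * w f)" by (rule tangent_vectorI)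
    (simp_all add: tangent_vector_pts tangent_vector_lincomb tangent_vector_mult algebra_simps)

context
  fixes N :: "'a fspace" and p v
  assumes N: "differential_space N" and v: "tangent_vector N p v"
begin

lemma tangent_vector_at_0: "v (\<lambda>x. 0) = 0" using tangent_vector_lincomb[OF v fns_zero[OF N] fns_zero[OF N], of 0 0] by simp

lemma tangent_vector_at_add: "f \<in> fns N \<Longrightarrow> g \<in> fns N \<Longrightarrow> v (\<lambda>x. f x + g x) = v f + v g"
  using tangent_vector_lincomb[OF v, of f g 1 1] by simp

lemma tangent_vector_at_diff: "f \<in> fns N \<Longrightarrow> g \<in> fns N \<Longrightarrow> v (\<lambda>x. f x - g x) = v f - v g"
  using tangent_vector_lincomb[OF v, of f g 1 "- 1"] by simp

lemma tangent_vector_at_scale: "f \<in> fns N \<Longrightarrow> v (\<lambda>x. a * f x) = a * v f"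
  using tangent_vector_lincomb[OF v, of f f a 0] by simp

lemma tangent_vector_at_sum: "(\<And>i. i \<in> I \<Longrightarrow> f i \<in> fns N) \<Longrightarrow> v (\<lambda>x. \<Sum>i\<in>I. f i x) = (\<Sum>i\<in>I. v (f i))"
proof (induction I rule: infinite_finite_induct)
  case (insert i I)
  then show ?case using tangent_vector_at_add[of "f i" "\<lambda>x. \<Sum>i\<in>I. f i x"] by (simp add: fns_sum[OF N])
qed (simp_all add: tangent_vector_at_0)

lemma tangent_vector_at_const: "v (\<lambda>x. if x \<in> pts N then c else 0) = 0"
proof -
  let ?one = "\<lambda>x. if x \<in> pts N then 1 else (0::real)"
  have "v (\<lambda>x. ?one x * ?one x) = v ?one + v ?one"
    using tangent_vector_mult[OF v fns_const[OF N] fns_const[OF N], of 1 1] tangent_vector_pts[OF v] by simp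
  moreover have "(\<lambda>x. ?one x * ?one x) = ?one" by (simp add: fun_eq_iff)
  ultimately have "v ?one = 0" by simp
  moreover have "(\<lambda>x. if x \<in> pts N then c else 0) = (\<lambda>x. c * ?one x)" by (simp add: fun_eq_iff)
  ultimately show ?thesis using tangent_vector_at_scale[OF fns_const[OF N], of c 1] by simp
qed

text \<open>A function \<open>?b\<close> with value 1 at \<open>p\<close> that vanishes wherever
  \<open>f\<close> and \<open>g\<close> may differ satisfies \<open>?b * (f - g) = 0\<close>.
  Applying \<open>v\<close> and the product rule leaves \<open>v f - v g = 0\<close>, since
  \<open>f - g\<close> vanishes at \<open>p\<close>.\<close>

lemma tangent_vector_local:
  assumes h: "\<And>k. k < n \<Longrightarrow> h k \<in> fns N" and V: "openin (\<E> n) V" "tuple n h p \<in> V"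
    and f: "f \<in> fns N" "g \<in> fns N" and eq: "\<And>x. x \<in> pts N \<Longrightarrow> tuple n h x \<in> V \<Longrightarrow> f x = g x"
  shows "v f = v g"
proof -
  obtain e where e: "e > 0" "cube n (tuple n h p) e \<subseteq> V" by (rule openE_cube[OF V])
  obtain \<beta> d where b: "d > 0" "\<And>U. smooth_on n U \<beta>" "\<And>y. y \<in> cube n (tuple n h p) d \<Longrightarrow> \<beta> y = 1"
    "\<And>y i. i < n \<Longrightarrow> \<bar>y i - tuple n h p i\<bar> \<ge> e \<Longrightarrow> \<beta> y = 0"
    by (rule cutoff_exists[OF e(1), of n "tuple n h p"]) blast
  let ?b = "\<lambda>x. if x \<in> pts N then \<beta> (tuple n h x) else 0"
  have bf: "?b \<in> fns N" by (rule fns_compose[OF N h openin_topspace b(2) tuple_in_topspace]) simp_all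
  have "?b x * (f x - g x) = 0" for x
  proof (cases "x \<in> pts N \<and> tuple n h x \<notin> V")
    case True
    then have "tuple n h x \<notin> cube n (tuple n h p) e" using e(2) by (meson subsetD)
    moreover have "\<forall>i\<ge>n. tuple n h x i = 0" by (simp add: tuple_ge)
    ultimately have "\<exists>i<n. \<bar>tuple n h x i - tuple n h p i\<bar> \<ge> e" unfolding cube_def mem_Collect_eq by (meson not_less)
    then have "\<beta> (tuple n h x) = 0" using b(4) by (elim exE conjE)
    then show ?thesis by simp
  next
    case False then show ?thesis using eq[of x] by (cases "x \<in> pts N") simp_all
  qed
  then have "(\<lambda>x. ?b x * (f x - g x)) = (\<lambda>x. 0)" by (rule ext)
  then have "v (\<lambda>x. ?b x * (f x - g x)) = 0" using tangent_vector_at_0 by (simp only:)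
  moreover have "v (\<lambda>x. ?b x * (f x - g x)) = ?b p * v (\<lambda>x. f x - g x) + v ?b * (f p - g p)"
    by (rule tangent_vector_mult[OF v bf fns_diff[OF N f]])
  moreover have "f p - g p = 0" using eq[OF tangent_vector_pts[OF v] V(2)] by simp
  moreover have "?b p = 1" using tangent_vector_pts[OF v] b(1) by (simp, intro b(3)) (simp add: tuple_ge)
  ultimately show ?thesis using tangent_vector_at_diff[OF f] by simp
qed

text \<open>By Hadamard's lemma \<open>f\<close> agrees near \<open>p\<close> with a constant plus
  the sum of \<open>(h k - h k p) * K k\<close>, where the \<open>K k\<close> belong to the algebra
  and take the values of the partial derivatives at \<open>p\<close>. A derivation kills the
  constant, and the product rule at \<open>p\<close> leaves one term per summand.\<close>

lemma tangent_vector_chain: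
  assumes h: "\<And>k. k < n \<Longrightarrow> h k \<in> fns N" and V: "openin (\<E> n) V" "tuple n h p \<in> V" and G: "smooth_on n V G" and f: "f \<in> fns N"
    and eq: "\<And>x. x \<in> pts N \<Longrightarrow> tuple n h x \<in> V \<Longrightarrow> f x = G (tuple n h x)"
  shows "v f = (\<Sum>k<n. pd k G (tuple n h p) * v (h k))"
proof -
  let ?y = "tuple n h p"
  have p: "p \<in> pts N" by (rule tangent_vector_pts[OF v])
  obtain d H where H: "d > 0" "cube n ?y d \<subseteq> V" "\<And>i. i < n \<Longrightarrow> smooth_on n (topspace (\<E> n)) (H i)"
    "\<And>i. i < n \<Longrightarrow> H i ?y = pd i G ?y"
    "\<And>x. x \<in> cube n ?y d \<Longrightarrow> G x = G ?y + (\<Sum>i<n. (x i - ?y i) * H i x)" by (rule hadamard_global[OF V(1) G V(2)]) blast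
  define K where "K k = (\<lambda>x. if x \<in> pts N then H k (tuple n h x) else 0)" for k
  define c where "c a = (\<lambda>x. if x \<in> pts N then a else (0::real))" for a
  have K: "K k \<in> fns N" if "k < n" for k unfolding K_def by (rule fns_compose[OF N h openin_topspace H(3)[OF that] tuple_in_topspace])
  have c: "c a \<in> fns N" for a unfolding c_def by (rule fns_const[OF N])
  have hc: "(\<lambda>x. h k x - c (?y k) x) \<in> fns N" if "k < n" for k by (rule fns_diff[OF N h[OF that] c])
  define g where "g = (\<lambda>x. c (G ?y) x + (\<Sum>k<n. (h k x - c (?y k) x) * K k x))"
  have s: "(\<lambda>x. \<Sum>k<n. (h k x - c (?y k) x) * K k x) \<in> fns N" by (rule fns_sum[OF N], rule fns_mult[OF N]) (simp_all add: hc K)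
  have g: "g \<in> fns N" unfolding g_def by (rule fns_add[OF N c s])
  have "v f = v g"
  proof (rule tangent_vector_local[OF h openin_cube _ f g])
    show "?y \<in> cube n ?y d" using H(1) by (simp add: tuple_ge)
    fix x assume x: "x \<in> pts N" "tuple n h x \<in> cube n ?y d"
    have "tuple n h x \<in> V" using x(2) H(2) by (rule subsetD[rotated])
    from eq[OF x(1) this] H(5)[OF x(2)] have "f x = G ?y + (\<Sum>i<n. (tuple n h x i - ?y i) * H i (tuple n h x))" by simp
    also have "\<dots> = g x" using x(1) by (simp add: g_def c_def K_def tuple_less)
    finally show "f x = g x" .
  qed
  also have "v g = v (c (G ?y)) + (\<Sum>k<n. v (\<lambda>x. (h k x - c (?y k) x) * K k x))" unfolding g_def tangent_vector_at_add[OF c s]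
    by (subst tangent_vector_at_sum) (simp_all add: fns_mult[OF N hc K])
  also have "v (c (G ?y)) = 0" unfolding c_def by (rule tangent_vector_at_const)
  also have "(\<Sum>k<n. v (\<lambda>x. (h k x - c (?y k) x) * K k x)) = (\<Sum>k<n. pd k G ?y * v (h k))"
  proof (rule sum.cong[OF refl])
    fix k assume "k \<in> {..<n}"
    then have k: "k < n" by simp
    have "v (\<lambda>x. (h k x - c (?y k) x) * K k x) = (h k p - c (?y k) p) * v (K k) + v (\<lambda>x. h k x - c (?y k) x) * K k p"
      by (rule tangent_vector_mult[OF v hc[OF k] K[OF k]])
    also have "h k p - c (?y k) p = 0" using p k by (simp add: c_def tuple_less)
    also have "v (\<lambda>x. h k x - c (?y k) x) = v (h k)" unfolding tangent_vector_at_diff[OF h[OF k] c] by (simp add: c_def tangent_vector_at_const)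
    also have "K k p = pd k G ?y" using p H(4)[OF k] by (simp add: K_def)
    finally show "v (\<lambda>x. (h k x - c (?y k) x) * K k x) = pd k G ?y * v (h k)" by simp
  qed
  finally show ?thesis by simp
qed

lemma tangent_vector_push:
  assumes "smooth_between N N' F"
  shows "tangent_vector N' (F p) (\<lambda>f. v (pullback N F f))"
proof (rule tangent_vectorI)
  show "F p \<in> pts N'" using assms tangent_vector_pts[OF v] by (rule smooth_between_pts)
  fix f g assume f: "f \<in> fns N'" "g \<in> fns N'"
  note F = smooth_between_fns[OF assms f(1)] smooth_between_fns[OF assms f(2)]
  show "v (pullback N F (\<lambda>x. a * f x + b * g x)) = a * v (pullback N F f) + b * v (pullback N F g)" for a b
    unfolding pullback_lincomb by (rule tangent_vector_lincomb[OF v F])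
  show "v (pullback N F (\<lambda>x. f x * g x)) = f (F p) * v (pullback N F g) + v (pullback N F f) * g (F p)"
    unfolding pullback_mult tangent_vector_mult[OF v F] by (simp add: pullback_apply tangent_vector_pts[OF v])
qed

end

text \<open>The chain rule computes \<open>v f\<close> from the values of \<open>v\<close> on
  finitely many generators and from partial derivatives that do not involve
  \<open>v\<close>.\<close>

lemma tangent_vector_eqI:
  assumes N: "differential_space N" and gen: "generated_by N B" and v: "tangent_vector N p v" and w: "tangent_vector N p w"
    and eq: "\<And>h. h \<in> B \<Longrightarrow> v h = w h" and f: "f \<in> fns N"
  shows "v f = w f"
proof -
  have lg: "locally_generated N B p f" and B: "B \<subseteq> fns N" using gen f tangent_vector_pts[OF v] by (simp_all add: generated_by_def)
  from lg obtain n V G h where *: "\<And>k. k < n \<Longrightarrow> h k \<in> B" "openin (\<E> n) V" "smooth_on n V G"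
      "tuple n h p \<in> V" "\<And>x. x \<in> pts N \<Longrightarrow> tuple n h x \<in> V \<Longrightarrow> f x = G (tuple n h x)"
      by (rule locally_generatedE) blast
  have h: "h k \<in> fns N" if "k < n" for k using *(1)[OF that] B by (rule subsetD[rotated])
  have "v f = (\<Sum>k<n. pd k G (tuple n h p) * v (h k))" by (rule tangent_vector_chain[OF N v h *(2,4,3) f *(5)])
  also have "\<dots> = (\<Sum>k<n. pd k G (tuple n h p) * w (h k))" by (rule sum.cong[OF refl]) (use eq[OF *(1)] in simp)
  also have "\<dots> = w f" by (rule tangent_vector_chain[OF N w h *(2,4,3) f *(5), symmetric])
  finally show ?thesis .
qed

subsection \<open>Vector fields\<close>

lemma vfield_fns: "D \<in> vector_fields N \<Longrightarrow> f \<in> fns N \<Longrightarrow> D f \<in> fns N"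
  and vfield_not_fns: "D \<in> vector_fields N \<Longrightarrow> f \<notin> fns N \<Longrightarrow> D f = (\<lambda>_. 0)"
  and vfield_lincomb: "D \<in> vector_fields N \<Longrightarrow> f \<in> fns N \<Longrightarrow> g \<in> fns N \<Longrightarrow>
     D (\<lambda>x. a * f x + b * g x) = (\<lambda>x. a * D f x + b * D g x)"
  and vfield_mult: "D \<in> vector_fields N \<Longrightarrow> f \<in> fns N \<Longrightarrow> g \<in> fns N \<Longrightarrow>
     D (\<lambda>x. f x * g x) = (\<lambda>x. f x * D g x + D f x * g x)"
  by (simp_all add: vector_fields_def)

lemma vfield_tangent_vector:
  "D \<in> vector_fields N \<Longrightarrow> p \<in> pts N \<Longrightarrow> tangent_vector N p (\<lambda>f. D f p)"
  by (rule tangent_vectorI) (simp_all add: vfield_lincomb vfield_mult)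

lemma vfield_outside:
  "differential_space N \<Longrightarrow> D \<in> vector_fields N \<Longrightarrow> p \<notin> pts N \<Longrightarrow> D f p = 0"
  by (cases "f \<in> fns N") (simp_all add: vfield_not_fns fns_outside[OF _ vfield_fns])

lemma vfield_eqI:
  assumes N: "differential_space N" and gen: "generated_by N B"
    and D: "D \<in> vector_fields N" "D' \<in> vector_fields N" and eq: "\<And>h. h \<in> B \<Longrightarrow> D h = D' h"
  shows "D = D'"
proof (intro ext)
  fix f p
  show "D f p = D' f p"
  proof (cases "f \<in> fns N \<and> p \<in> pts N")
    case True
    then show ?thesis using tangent_vector_eqI[OF N gen vfield_tangent_vector[OF D(1)] vfield_tangent_vector[OF D(2)], of p f] eq by simp
  next
    case False
    then show ?thesis using D N by (cases "f \<in> fns N") (simp_all add: vfield_not_fns vfield_outside)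
  qed
qed

lemma vfield_sum:
  assumes "differential_space N" "D \<in> vector_fields N" "\<And>i. i \<in> I \<Longrightarrow> f i \<in> fns N"
  shows "D (\<lambda>x. \<Sum>i\<in>I. f i x) = (\<lambda>x. \<Sum>i\<in>I. D (f i) x)"
proof
  fix p show "D (\<lambda>x. \<Sum>i\<in>I. f i x) p = (\<Sum>i\<in>I. D (f i) p)"
  proof (cases "p \<in> pts N")
    case True
    show ?thesis using tangent_vector_at_sum[OF assms(1) vfield_tangent_vector[OF assms(2) True], of I f] assms(3) by simp
  next
    case False
    then show ?thesis using assms by (simp add: vfield_outside)
  qed
qed

text \<open>Smooth dependence on the point has to be checked on generators only: by the chain rule
  the derivative of any \<open>f\<close> is locally a smooth function of generators
  \<open>h k\<close> and of their derivatives \<open>T x (h k)\<close>.\<close>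

lemma vfield_of_tangent_vectors:
  assumes N: "differential_space N" and gen: "generated_by N B" and T: "\<And>p. p \<in> pts N \<Longrightarrow> tangent_vector N p (T p)"
    and B: "\<And>h. h \<in> B \<Longrightarrow> (\<lambda>p. if p \<in> pts N then T p h else 0) \<in> fns N"
  shows "(\<lambda>f p. if f \<in> fns N \<and> p \<in> pts N then T p f else 0) \<in> vector_fields N" (is "?D \<in> _")
proof -
  have *: "(\<lambda>p. if p \<in> pts N then T p f else 0) \<in> fns N" if f: "f \<in> fns N" for f
  proof (rule fnsI[OF N])
    show "(if x \<in> pts N then T x f else 0) = 0" if "x \<notin> pts N" for x using that by simp
    fix p assume p: "p \<in> pts N"
    have lg: "locally_generated N B p f" and BN: "B \<subseteq> fns N" using gen f p by (simp_all add: generated_by_def)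
    from lg obtain n V G h where *: "\<And>k. k < n \<Longrightarrow> h k \<in> B" "openin (\<E> n) V" "smooth_on n V G"
        "tuple n h p \<in> V" "\<And>x. x \<in> pts N \<Longrightarrow> tuple n h x \<in> V \<Longrightarrow> f x = G (tuple n h x)"
        by (rule locally_generatedE) blast
    have h: "h k \<in> fns N" if "k < n" for k using *(1)[OF that] BN by (rule subsetD[rotated])
    let ?tr = "\<lambda>y::nat\<Rightarrow>real. \<lambda>i. if i < n then y i else 0"
    \<comment> \<open>The first \<open>n\<close> entries are the generators, the other
      \<open>n\<close> their derivatives; \<open>?G\<close> is the chain rule read as a smooth
      function of these \<open>2 n\<close> arguments.\<close>
    let ?h = "\<lambda>k. if k < n then h k else (\<lambda>p. if p \<in> pts N then T p (h (k - n)) else 0)"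
    let ?V = "{y. (\<forall>i\<ge>n+n. y i = 0) \<and> ?tr y \<in> V}"
    let ?G = "\<lambda>y. \<Sum>k<n. pd k G (?tr y) * y (n + k)"
    have tr: "?tr (tuple (n+n) ?h x) = tuple n h x" for x by (simp add: tuple_def fun_eq_iff)
    have V': "openin (\<E> (n+n)) ?V" unfolding openin_Euclidean_space_iff
    proof (intro conjI ballI)
      fix y assume y: "y \<in> ?V"
      then have "?tr y \<in> V" by simp
      then obtain e where e: "e > 0" "cube n (?tr y) e \<subseteq> V" by (rule openE_cube[OF *(2)])
      have "cube (n+n) y e \<subseteq> ?V"
      proof
        fix z assume z: "z \<in> cube (n+n) y e"
        then have "?tr z \<in> cube n (?tr y) e" by (simp add: cube_def)
        then show "z \<in> ?V" using z e(2) by (simp add: cube_def subset_iff)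
      qed
      then show "\<exists>e>0. cube (n+n) y e \<subseteq> ?V" using e(1) by (intro exI[of _ e] conjI)
    qed blast
    show "locally_generated N (fns N) p (\<lambda>p. if p \<in> pts N then T p f else 0)"
    proof (rule locally_generatedI[where n = "n+n" and h = ?h and V = ?V and G = ?G])
      show "?h k \<in> fns N" if "k < n + n" for k
      proof (cases "k < n")
        case False
        then have "h (k - n) \<in> B" using *(1) that by simp
        from B[OF this] False show ?thesis by simp
      qed (simp add: h)
      show "smooth_on (n+n) ?V ?G"
      proof (rule smooth_on_sum, rule smooth_on_mult[OF _ smooth_on_coordinate])
        fix k assume "k \<in> {..<n}"
        then have k: "k < n" by simp
        show "smooth_on (n+n) ?V (\<lambda>y. pd k G (?tr y))" by (rule smooth_on_compose[OF V' *(2) _ _ smooth_on_pd[OF *(2,3) k]])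
            (simp_all add: smooth_on_coordinate)
      qed
      show "tuple (n+n) ?h p \<in> ?V" using *(4) tr by (simp add: tuple_ge)
      fix x assume x: "x \<in> pts N" "tuple (n+n) ?h x \<in> ?V"
      then have "tuple n h x \<in> V" using tr by simp
      from tangent_vector_chain[OF N T[OF x(1)] h *(2) this *(3) f *(5)]
      have "T x f = (\<Sum>k<n. pd k G (tuple n h x) * T x (h k))" .
      also have "\<dots> = ?G (tuple (n+n) ?h x)" unfolding tr using x(1) by (simp add: tuple_less)
      finally show "(if x \<in> pts N then T x f else 0) = ?G (tuple (n+n) ?h x)" using x(1) by simp
    qed (rule V')
  qed
  show ?thesis unfolding vector_fields_def mem_Collect_eq
  proof (intro conjI ballI allI impI)
    show "?D f \<in> fns N" if "f \<in> fns N" for f using *[OF that] that by simp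
    show "?D f = (\<lambda>_. 0)" if "f \<notin> fns N" for f using that by simp
    fix f g assume f: "f \<in> fns N" "g \<in> fns N"
    show "?D (\<lambda>x. a * f x + b * g x) = (\<lambda>x. a * ?D f x + b * ?D g x)" for a b
      using f fns_lincomb[OF N f] by (simp add: fun_eq_iff tangent_vector_lincomb[OF T])
    show "?D (\<lambda>x. f x * g x) = (\<lambda>x. f x * ?D g x + ?D f x * g x)" using f fns_mult[OF N f] by (simp add: fun_eq_iff tangent_vector_mult[OF T])
  qed
qed

lemma lie_bracket_vfield:
  assumes N: "differential_space N" and X: "X \<in> vector_fields N" and Y: "Y \<in> vector_fields N"
  shows "lie_bracket X Y \<in> vector_fields N"
proof -
  note F = vfield_fns[OF X] vfield_fns[OF Y]
  have z: "Z (\<lambda>x. 0) = (\<lambda>x. 0)" if "Z \<in> vector_fields N" for Z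
    using vfield_lincomb[OF that fns_zero[OF N] fns_zero[OF N], of 0 0] by simp
  have add: "Z (\<lambda>x. f x + g x) = (\<lambda>x. Z f x + Z g x)" if "Z \<in> vector_fields N" "f \<in> fns N" "g \<in> fns N" for Z f g
    using vfield_lincomb[OF that, of 1 1] by simp
  show ?thesis unfolding vector_fields_def mem_Collect_eq lie_bracket_def by (intro conjI ballI allI impI)
      (simp_all add: fns_diff[OF N] F vfield_not_fns[OF X] vfield_not_fns[OF Y] z[OF X] z[OF Y]
       vfield_lincomb[OF X] vfield_lincomb[OF Y] vfield_mult[OF X] vfield_mult[OF Y]
       add[OF X] add[OF Y] fns_mult[OF N] algebra_simps)
qed

lemma related_lie_bracket:
  assumes "related N N' F X X'" "related N N' F Y Y'" "X' \<in> vector_fields N'" "Y' \<in> vector_fields N'"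
  shows "related N N' F (lie_bracket X Y) (lie_bracket X' Y')" unfolding related_def
proof
  fix h assume h: "h \<in> fns N'"
  have X: "X (pullback N F g) = pullback N F (X' g)" and Y: "Y (pullback N F g) = pullback N F (Y' g)"
    if "g \<in> fns N'" for g using assms(1,2) that by (simp_all add: related_def)
  show "lie_bracket X Y (pullback N F h) = pullback N F (lie_bracket X' Y' h)" unfolding lie_bracket_def pullback_diff
    using X Y h vfield_fns[OF assms(3) h] vfield_fns[OF assms(4) h] by simp
qed

subsection \<open>Velocities of curves\<close>

lemma curve_differentiable:
  fixes c :: "real \<Rightarrow> 'a"
  assumes N: "differential_space N" and gen: "generated_by N B" and c: "c t0 \<in> pts N" "eventually (\<lambda>t. c t \<in> pts N) (nhds t0)"
    and d: "\<And>h. h \<in> B \<Longrightarrow> (\<lambda>t. h (c t)) differentiable (at t0)" and f: "f \<in> fns N"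
  shows "(\<lambda>t. f (c t)) differentiable (at t0)"
proof -
  have lg: "locally_generated N B (c t0) f" using gen f c by (simp add: generated_by_def)
  from lg obtain n V G h where *: "\<And>k. k < n \<Longrightarrow> h k \<in> B" "openin (\<E> n) V" "smooth_on n V G"
      "tuple n h (c t0) \<in> V" "\<And>x. x \<in> pts N \<Longrightarrow> tuple n h x \<in> V \<Longrightarrow> f x = G (tuple n h x)"
      by (rule locally_generatedE) blast
  have hd: "((\<lambda>t. tuple n h (c t) k) has_real_derivative deriv (\<lambda>t. h k (c t)) t0) (at t0)" if "k < n" for k
    using d[OF *(1)[OF that]] that by (simp add: tuple_less DERIV_deriv_iff_real_differentiable)
  have "Ck_on n (Suc 0) V G" using *(3) by (simp only: smooth_on_def)
  from has_derivative_curve[OF *(2) this *(4) _ hd]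
  obtain D where D: "((\<lambda>t. G (tuple n h (c t))) has_real_derivative D) (at t0)" by (simp add: tuple_ge)
  have "eventually (\<lambda>t. tuple n h (c t) \<in> V) (nhds t0)"
  proof (rule eventually_in_openE[OF *(2,4)])
    show "((\<lambda>t. tuple n h (c t) k) \<longlongrightarrow> tuple n h (c t0) k) (nhds t0)" if "k < n" for k
      using DERIV_isCont[OF hd[OF that]] tendsto_at_iff_tendsto_nhds[of "\<lambda>t. tuple n h (c t) k" t0] by (simp add: isCont_def)
  qed (simp add: tuple_ge)
  with c(2) have "eventually (\<lambda>t. f (c t) = G (tuple n h (c t))) (nhds t0)" by eventually_elim (rule *(5))
  then have "((\<lambda>t. f (c t)) has_real_derivative D) (at t0)" using D by (subst DERIV_cong_ev[OF refl _ refl])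
  then show ?thesis unfolding real_differentiable_def by blast
qed

text \<open>Differentiability along the curve is tested on generators, and the curve has to lie in
  the space only near \<open>t0\<close>. This is how tangent vectors of a space without charts, such
  as the nerve, are produced.\<close>

lemma tangent_vector_curve:
  fixes c :: "real \<Rightarrow> 'a"
  assumes N: "differential_space N" and gen: "generated_by N B" and c: "c t0 \<in> pts N" "eventually (\<lambda>t. c t \<in> pts N) (nhds t0)"
    and d: "\<And>h. h \<in> B \<Longrightarrow> (\<lambda>t. h (c t)) differentiable (at t0)"
  shows "tangent_vector N (c t0) (\<lambda>f. deriv (\<lambda>t. f (c t)) t0)"
proof (rule tangent_vectorI[OF c(1)])
  fix f g assume f: "f \<in> fns N" "g \<in> fns N"
  have df: "((\<lambda>t. f (c t)) has_real_derivative deriv (\<lambda>t. f (c t)) t0) (at t0)"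
    using curve_differentiable[OF N gen c d f(1)] by (simp add: DERIV_deriv_iff_real_differentiable)
  have dg: "((\<lambda>t. g (c t)) has_real_derivative deriv (\<lambda>t. g (c t)) t0) (at t0)"
    using curve_differentiable[OF N gen c d f(2)] by (simp add: DERIV_deriv_iff_real_differentiable)
  show "deriv (\<lambda>t. a * f (c t) + b * g (c t)) t0 = a * deriv (\<lambda>t. f (c t)) t0 + b * deriv (\<lambda>t. g (c t)) t0" for a b
    by (rule DERIV_imp_deriv[OF DERIV_add[OF DERIV_cmult[OF df] DERIV_cmult[OF dg]]])
  show "deriv (\<lambda>t. f (c t) * g (c t)) t0 = f (c t0) * deriv (\<lambda>t. g (c t)) t0 + deriv (\<lambda>t. f (c t)) t0 * g (c t0)"
    using DERIV_imp_deriv[OF DERIV_mult[OF df dg]] by simp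
qed

section \<open>Manifolds as differential spaces\<close>

subsection \<open>Charts\<close>

text \<open>The conditions of \<open>is_manifold\<close> on single charts. These are what is proved
  for powers of a manifold in \<open>charted_mpower\<close>, and what the arguments about local
  smoothness use.\<close>

definition charted :: "'a manifold \<Rightarrow> bool" where
  "charted M \<longleftrightarrow> (\<Union>(U, \<phi>)\<in>atlas M. U) = mpoints M \<and> (\<forall>(U, \<phi>)\<in>atlas M.
        openin (mtop M) U \<and> openin (\<E> (mdim M)) (\<phi> ` U) \<and> homeomorphic_map (subtopology (mtop M) U)
          (subtopology (\<E> (mdim M)) (\<phi> ` U)) \<phi>)"

lemma is_manifold_charted: "is_manifold M \<Longrightarrow> charted M" by (simp add: is_manifold_def charted_def)

lemma charted_obtain:
  assumes "charted M" "p \<in> mpoints M"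
  obtains U \<phi> where "(U, \<phi>) \<in> atlas M" "p \<in> U"
proof -
  have "p \<in> (\<Union>(U, \<phi>)\<in>atlas M. U)" using assms by (simp only: charted_def)
  then show ?thesis using that by blast
qed

context
  fixes M :: "'a manifold" and U \<phi>
  assumes M: "charted M" and U: "(U, \<phi>) \<in> atlas M"
begin

lemma chart_open: "openin (mtop M) U"
  and chart_image_open: "openin (\<E> (mdim M)) (\<phi> ` U)" and chart_homeomorphic: "homeomorphic_map (subtopology (mtop M) U)
          (subtopology (\<E> (mdim M)) (\<phi> ` U)) \<phi>"
  using bspec[OF conjunct2[OF M[unfolded charted_def]] U] by simp_all

lemma chart_subset: "U \<subseteq> mpoints M" by (rule openin_subset[OF chart_open])

lemma chart_inj: "inj_on \<phi> U" using homeomorphic_imp_injective_map[OF chart_homeomorphic] chart_subset by (simp add: Int_absorb1)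

lemma chart_inv: "x \<in> U \<Longrightarrow> inv_into U \<phi> (\<phi> x) = x" by (rule inv_into_f_f[OF chart_inj])

lemma chart_Int_image_open:
  assumes "openin (mtop M) W" shows "openin (\<E> (mdim M)) (\<phi> ` (U \<inter> W))"
proof -
  have "openin (subtopology (mtop M) U) (U \<inter> W)" using chart_open assms by (simp add: openin_open_subtopology openin_Int)
  then have "openin (subtopology (\<E> (mdim M)) (\<phi> ` U)) (\<phi> ` (U \<inter> W))"
    using homeomorphic_imp_open_map[OF chart_homeomorphic] by (simp add: open_map_def)
  then show ?thesis by (rule openin_trans_full[OF _ chart_image_open])
qed

lemma chart_preimage_open:
  assumes "openin (\<E> (mdim M)) V" shows "openin (mtop M) {x \<in> U. \<phi> x \<in> V}"
proof -
  have "openin (subtopology (\<E> (mdim M)) (\<phi> ` U)) (\<phi> ` U \<inter> V)"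
    using chart_image_open assms by (simp add: openin_open_subtopology openin_Int)
  from openin_continuous_map_preimage[OF homeomorphic_imp_continuous_map[OF chart_homeomorphic] this]
  have "openin (subtopology (mtop M) U) {x \<in> topspace (subtopology (mtop M) U). \<phi> x \<in> \<phi> ` U \<inter> V}" .
  moreover have "{x \<in> topspace (subtopology (mtop M) U). \<phi> x \<in> \<phi> ` U \<inter> V} = {x \<in> U. \<phi> x \<in> V}" using chart_subset by auto
  ultimately show ?thesis using openin_trans_full[OF _ chart_open] by simp
qed

lemma chart_coordinate_ge: "x \<in> U \<Longrightarrow> i \<ge> mdim M \<Longrightarrow> \<phi> x i = 0"
  by (rule openE_D0[OF chart_image_open]) auto

end

lemma openin_preimage_E:
  assumes A: "openin (\<E> m) A" and V: "openin (\<E> n) V"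
    and c: "\<And>i. i < n \<Longrightarrow> continuous_on A (\<lambda>x. \<Phi> x i)" and z: "\<And>x i. x \<in> A \<Longrightarrow> i \<ge> n \<Longrightarrow> \<Phi> x i = 0"
  shows "openin (\<E> m) {x \<in> A. \<Phi> x \<in> V}"
proof -
  have c': "continuous_on A \<Phi>" by (rule continuous_on_fun_openE[OF c z])
  obtain T where T: "open T" "V = {x. \<forall>i\<ge>n. x i = 0} \<inter> T" using V unfolding Euclidean_space_eq openin_open by (elim exE conjE) (rule that)
  have "openin (top_of_set A) (A \<inter> \<Phi> -` T)" by (rule continuous_openin_preimage_gen[OF c' T(1)])
  moreover have "A \<inter> \<Phi> -` T = {x \<in> A. \<Phi> x \<in> V}" using T(2) z by auto
  moreover have "top_of_set A = subtopology (\<E> m) A" unfolding Euclidean_space_eq subtopology_subtopology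
    using A by (simp add: Int_absorb1 openin_Euclidean_space_iff)
  ultimately show ?thesis using openin_trans_full[OF _ A] by simp
qed

subsection \<open>Local smoothness\<close>

definition smooth_at :: "'a manifold \<Rightarrow> 'a set \<Rightarrow> 'a \<Rightarrow> ('a \<Rightarrow> real) \<Rightarrow> bool" where
  "smooth_at M S p f \<longleftrightarrow>
     (\<exists>W g. openin (mtop M) W \<and> p \<in> W \<and> smooth_on_open M W g \<and> (\<forall>x\<in>W \<inter> S. g x = f x))"

lemma smooth_fun_iff: "smooth_fun M S f \<longleftrightarrow> (\<forall>p\<in>S. smooth_at M S p f)"
  by (simp add: smooth_fun_def smooth_at_def)

lemma smooth_atI:
  "openin (mtop M) W \<Longrightarrow> p \<in> W \<Longrightarrow> smooth_on_open M W g \<Longrightarrow> (\<And>x. x \<in> W \<Longrightarrow> x \<in> S \<Longrightarrow> g x = f x) \<Longrightarrow> smooth_at M S p f"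
  unfolding smooth_at_def by (intro exI[of _ W] exI[of _ g]) simp

lemma smooth_atE:
  assumes "smooth_at M S p f"
  obtains W g where "openin (mtop M) W" "p \<in> W" "smooth_on_open M W g" "\<And>x. x \<in> W \<Longrightarrow> x \<in> S \<Longrightarrow> g x = f x"
proof -
  from assms obtain W g where "openin (mtop M) W" "p \<in> W" "smooth_on_open M W g" "\<forall>x\<in>W \<inter> S. g x = f x"
    unfolding smooth_at_def by (elim exE conjE)
  then show ?thesis by (intro that[of W g]) auto
qed

lemma smooth_on_openD:
  "smooth_on_open M W f \<Longrightarrow> (U, \<phi>) \<in> atlas M \<Longrightarrow> smooth_on (mdim M) (\<phi> ` (U \<inter> W)) (\<lambda>x. f (inv_into U \<phi> x))"
  unfolding smooth_on_open_def by (drule (1) bspec) simp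

lemma smooth_on_openI:
  "(\<And>U \<phi>. (U, \<phi>) \<in> atlas M \<Longrightarrow> smooth_on (mdim M) (\<phi> ` (U \<inter> W)) (\<lambda>x. f (inv_into U \<phi> x))) \<Longrightarrow> smooth_on_open M W f"
  unfolding smooth_on_open_def by (rule ballI) (simp add: split_beta)

lemma smooth_on_open_mono: "smooth_on_open M W f \<Longrightarrow> W' \<subseteq> W \<Longrightarrow> smooth_on_open M W' f"
  by (rule smooth_on_openI, rule smooth_on_mono, erule (1) smooth_on_openD) auto

lemma smooth_on_open_const: "smooth_on_open M W (\<lambda>x. c)" by (rule smooth_on_openI) simp

lemma tuple_preimage_open:
  assumes M: "charted M" and W: "openin (mtop M) W" and h: "\<And>k. k < n \<Longrightarrow> smooth_on_open M W (h k)" and V: "openin (\<E> n) V"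
  shows "openin (mtop M) {x \<in> W. tuple n h x \<in> V}"
proof (subst openin_subopen, intro ballI)
  fix x assume x: "x \<in> {x \<in> W. tuple n h x \<in> V}"
  then have "x \<in> mpoints M" using openin_subset[OF W] by auto
  from charted_obtain[OF M this] obtain U \<phi> where U: "(U, \<phi>) \<in> atlas M" "x \<in> U" .
  note inv = chart_inv[OF M U(1)]
  let ?V = "{y \<in> \<phi> ` (U \<inter> W). tuple n h (inv_into U \<phi> y) \<in> V}"
  have "openin (\<E> (mdim M)) ?V"
  proof (rule openin_preimage_E[OF chart_Int_image_open[OF M U(1) W] V])
    show "continuous_on (\<phi> ` (U \<inter> W)) (\<lambda>y. tuple n h (inv_into U \<phi> y) k)" if "k < n" for k
      using smooth_on_continuous[OF smooth_on_openD[OF h[OF that] U(1)]] that by (simp add: tuple_less)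
  qed (simp add: tuple_ge)
  from chart_preimage_open[OF M U(1) this] have o: "openin (mtop M) {z \<in> U. \<phi> z \<in> ?V}" .
  have "x \<in> {z \<in> U. \<phi> z \<in> ?V}" using x U(2) inv by auto
  moreover have "{z \<in> U. \<phi> z \<in> ?V} \<subseteq> {x \<in> W. tuple n h x \<in> V}"
  proof
    fix z assume z: "z \<in> {z \<in> U. \<phi> z \<in> ?V}"
    then obtain w where w: "w \<in> U" "w \<in> W" "\<phi> z = \<phi> w" by auto
    then have "z = w" using z inj_onD[OF chart_inj[OF M U(1)]] by auto
    then show "z \<in> {x \<in> W. tuple n h x \<in> V}" using w z inv by auto
  qed
  ultimately show "\<exists>T. openin (mtop M) T \<and> x \<in> T \<and> T \<subseteq> {x \<in> W. tuple n h x \<in> V}"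
    using o by (intro exI[of _ "{z \<in> U. \<phi> z \<in> ?V}"] conjI)
qed

lemma smooth_on_open_compose:
  assumes M: "charted M" and W: "openin (mtop M) W"
    and h: "\<And>k. k < n \<Longrightarrow> smooth_on_open M W (h k)" and V: "openin (\<E> n) V" "smooth_on n V G"
    and t: "\<And>x. x \<in> W \<Longrightarrow> tuple n h x \<in> V"
  shows "smooth_on_open M W (\<lambda>x. G (tuple n h x))"
proof (rule smooth_on_openI)
  fix U \<phi> assume U: "(U, \<phi>) \<in> atlas M"
  show "smooth_on (mdim M) (\<phi> ` (U \<inter> W)) (\<lambda>x. G (tuple n h (inv_into U \<phi> x)))"
  proof (rule smooth_on_compose[OF chart_Int_image_open[OF M U W] V(1) _ _ V(2)])
    show "tuple n h (inv_into U \<phi> y) \<in> V" if "y \<in> \<phi> ` (U \<inter> W)" for y using that t chart_inv[OF M U] by auto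
    show "smooth_on (mdim M) (\<phi> ` (U \<inter> W)) (\<lambda>x. tuple n h (inv_into U \<phi> x) i)" if "i < n" for i
      using smooth_on_openD[OF h[OF that] U] that by (simp add: tuple_less)
  qed
qed

text \<open>The finitely many local extensions have a common open domain; on the part of it where
  their tuple lies in \<open>V\<close>, composition with \<open>G\<close> extends
  \<open>f\<close>.\<close>

lemma smooth_at_compose:
  assumes M: "charted M" and p: "p \<in> S" and h: "\<And>k. k < n \<Longrightarrow> smooth_at M S p (h k)"
    and V: "openin (\<E> n) V" "smooth_on n V G" "tuple n h p \<in> V" and W0: "openin (mtop M) W0" "p \<in> W0"
    and eq: "\<And>x. x \<in> S \<Longrightarrow> x \<in> W0 \<Longrightarrow> tuple n h x \<in> V \<Longrightarrow> f x = G (tuple n h x)"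
  shows "smooth_at M S p f"
proof -
  have "\<forall>k. k < n \<longrightarrow> (\<exists>W g. openin (mtop M) W \<and> p \<in> W \<and> smooth_on_open M W g \<and> (\<forall>x\<in>W \<inter> S. g x = h k x))"
    using h by (simp add: smooth_at_def)
  then obtain W g where Wg: "\<And>k. k < n \<Longrightarrow> openin (mtop M) (W k) \<and> p \<in> W k \<and> smooth_on_open M (W k) (g k) \<and> (\<forall>x\<in>W k \<inter> S. g k x = h k x)"
    by metis
  define W1 where "W1 = W0 \<inter> ((\<Inter>k\<in>{..<n}. W k) \<inter> mpoints M)"
  have W1: "openin (mtop M) W1" unfolding W1_def by (intro openin_Int W0(1) openin_INT) (use Wg in auto)
  have pW1: "p \<in> W1" unfolding W1_def using W0(2) Wg openin_subset[OF W0(1)] by auto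
  have W1k: "x \<in> W k" if "x \<in> W1" "k < n" for x k using that by (simp add: W1_def)
  have g: "smooth_on_open M W1 (g k)" if "k < n" for k by (rule smooth_on_open_mono[of _ "W k"]) (use Wg[OF that] W1k[OF _ that] in auto)
  have gh: "tuple n g x = tuple n h x" if "x \<in> W1" "x \<in> S" for x using Wg W1k[OF that(1)] that(2) by (auto simp: tuple_def fun_eq_iff)
  let ?W = "{x \<in> W1. tuple n g x \<in> V}"
  have W: "openin (mtop M) ?W" by (rule tuple_preimage_open[OF M W1 g V(1)])
  show ?thesis
  proof (rule smooth_atI[OF W])
    show "p \<in> ?W" using pW1 gh[OF pW1 p] V(3) by simp
    show "smooth_on_open M ?W (\<lambda>x. G (tuple n g x))" by (rule smooth_on_open_compose[OF M W _ V(1,2)]) (auto intro: smooth_on_open_mono[OF g])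
    fix x assume x: "x \<in> ?W" "x \<in> S"
    then have "tuple n g x = tuple n h x" "x \<in> W0" by (simp_all add: gh W1_def)
    then show "G (tuple n g x) = f x" using eq[of x] x by simp
  qed
qed

lemma smooth_at_subset:
  assumes "smooth_at M S' p f" "openin (mtop M) W0" "p \<in> W0" "S \<inter> W0 \<subseteq> S'"
  shows "smooth_at M S p f"
proof -
  from assms(1) obtain W g where "openin (mtop M) W" "p \<in> W" "smooth_on_open M W g" "\<And>x. x \<in> W \<Longrightarrow> x \<in> S' \<Longrightarrow> g x = f x"
    by (rule smooth_atE) blast
  then show ?thesis using assms(2-4) by (intro smooth_atI[of _ "W \<inter> W0" _ g]) (auto intro: smooth_on_open_mono)
qed

subsection \<open>Presentations of function algebras\<close>

text \<open>\<open>N\<close> is the copy under \<open>\<iota>\<close> of a subset \<open>S\<close>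
  of a manifold, with the functions that extend locally. This covers whole manifolds and fibres of
  the target map with \<open>\<iota>\<close> the identity, and the nerve, where
  \<open>\<iota>\<close> adds the base point to a string or turns an object into an empty
  string.\<close>

definition presented :: "'b fspace \<Rightarrow> 'a manifold \<Rightarrow> 'a set \<Rightarrow> ('a \<Rightarrow> 'b) \<Rightarrow> bool" where
  "presented N M S \<iota> \<longleftrightarrow> S \<subseteq> mpoints M \<and> pts N = \<iota> ` S \<and>
     fns N = {f. (\<forall>z. z \<notin> pts N \<longrightarrow> f z = 0) \<and> smooth_fun M S (\<lambda>x. f (\<iota> x))}"

lemma presentedD:
  assumes "presented N M S \<iota>"
  shows "S \<subseteq> mpoints M" "pts N = \<iota> ` S"
    "f \<in> fns N \<longleftrightarrow> (\<forall>z. z \<notin> pts N \<longrightarrow> f z = 0) \<and> smooth_fun M S (\<lambda>x. f (\<iota> x))"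
  using assms by (simp_all add: presented_def)

lemma presented_pts: "presented N M S \<iota> \<Longrightarrow> x \<in> S \<Longrightarrow> \<iota> x \<in> pts N"
  by (simp add: presentedD(2))

lemma presented_smooth_at:
  "presented N M S \<iota> \<Longrightarrow> f \<in> fns N \<Longrightarrow> p \<in> S \<Longrightarrow> smooth_at M S p (\<lambda>x. f (\<iota> x))"
  by (simp add: presentedD(3) smooth_fun_iff)

lemma presented_fnsI:
  "presented N M S \<iota> \<Longrightarrow> (\<And>z. z \<notin> pts N \<Longrightarrow> f z = 0) \<Longrightarrow> (\<And>p. p \<in> S \<Longrightarrow> smooth_at M S p (\<lambda>x. f (\<iota> x))) \<Longrightarrow> f \<in> fns N"
  by (simp add: presentedD(3) smooth_fun_iff)

lemma presented_subspace: "S \<subseteq> mpoints M \<Longrightarrow> presented (subspace_of M S) M S (\<lambda>x. x)"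
  by (simp add: presented_def subspace_of_def)

lemma presented_whole: "presented (whole M) M (mpoints M) (\<lambda>x. x)" unfolding whole_def by (rule presented_subspace) simp

lemma pts_subspace [simp]: "pts (subspace_of M S) = S" by (simp add: subspace_of_def)

lemma pts_whole [simp]: "pts (whole M) = mpoints M" by (simp add: whole_def)

lemma presented_differential_space:
  assumes M: "charted M" and N: "presented N M S \<iota>"
  shows "differential_space N" unfolding differential_space_def
proof (intro conjI ballI allI impI)
  show "f x = 0" if "f \<in> fns N" "x \<notin> pts N" for f x using that by (simp add: presentedD(3)[OF N])
  fix f assume f: "\<forall>x. x \<notin> pts N \<longrightarrow> f x = 0" "\<forall>p\<in>pts N. locally_generated N (fns N) p f"
  show "f \<in> fns N"
  proof (rule presented_fnsI[OF N])
    show "f z = 0" if "z \<notin> pts N" for z using f(1) that by simp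
    fix p assume p: "p \<in> S"
    have lg: "locally_generated N (fns N) (\<iota> p) f" using f(2) presented_pts[OF N p] by simp
    obtain n V G h where *: "\<And>k. k < n \<Longrightarrow> h k \<in> fns N" "openin (\<E> n) V" "smooth_on n V G"
      "tuple n h (\<iota> p) \<in> V" "\<And>x. x \<in> pts N \<Longrightarrow> tuple n h x \<in> V \<Longrightarrow> f x = G (tuple n h x)"
      using lg by (rule locally_generatedE) blast
    have t: "tuple n (\<lambda>k x. h k (\<iota> x)) x = tuple n h (\<iota> x)" for x by (simp add: tuple_def)
    show "smooth_at M S p (\<lambda>x. f (\<iota> x))"
    proof (rule smooth_at_compose[OF M p _ *(2,3), of "\<lambda>k x. h k (\<iota> x)"])
      show "smooth_at M S p (\<lambda>x. h k (\<iota> x))" if "k < n" for k by (rule presented_smooth_at[OF N *(1)[OF that] p])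
      show "p \<in> mpoints M" using p presentedD(1)[OF N] by auto
    qed (use *(4,5) presented_pts[OF N] in \<open>simp_all add: t\<close>)
  qed
qed

text \<open>Passes from \<open>smooth_map\<close>, which speaks of chart coordinates of the target,
  to pullbacks: near \<open>p\<close> a function on the target is a smooth function of the
  coordinates of \<open>F\<close>, and continuity of \<open>F\<close> supplies a neighbourhood that
  is mapped into one chart.\<close>

lemma smooth_map_smooth_between:
  assumes M: "charted M" and N: "presented N M S \<iota>" and M': "charted M'"
    and F: "smooth_map M S M' F" and F': "\<And>x. x \<in> S \<Longrightarrow> F' (\<iota> x) = F x"
  shows "smooth_between N (whole M') F'" unfolding smooth_between_def
proof (intro conjI ballI)
  note S = presentedD(1)[OF N]
  have cont: "continuous_map (subtopology (mtop M) S) (mtop M') F" using F by (simp add: smooth_map_def)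
  have FS: "F x \<in> topspace (mtop M')" if "x \<in> S" for x using continuous_map_image_subset_topspace[OF cont] S that by auto
  show "F' z \<in> pts (whole M')" if "z \<in> pts N" for z using that presentedD(2)[OF N] F' FS by auto
  fix f assume f: "f \<in> fns (whole M')"
  show "pullback N F' f \<in> fns N"
  proof (rule presented_fnsI[OF N])
    show "pullback N F' f z = 0" if "z \<notin> pts N" for z using that by (rule pullback_outside)
    fix p assume p: "p \<in> S"
    from charted_obtain[OF M' FS[OF p]] obtain V \<psi> where V: "(V, \<psi>) \<in> atlas M'" "F p \<in> V" .
    have "smooth_at M' (topspace (mtop M')) (F p) f" using presented_smooth_at[OF presented_whole f FS[OF p]] .
    then obtain W g where W: "openin (mtop M') W" "F p \<in> W" "smooth_on_open M' W g"
      "\<And>x. x \<in> W \<Longrightarrow> x \<in> topspace (mtop M') \<Longrightarrow> g x = f x" by (rule smooth_atE) blast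
    have "openin (subtopology (mtop M) S) {x \<in> topspace (subtopology (mtop M) S). F x \<in> V \<inter> W}"
      by (rule openin_continuous_map_preimage[OF cont openin_Int[OF chart_open[OF M' V(1)] W(1)]])
    then obtain W0 where W0: "openin (mtop M) W0" "{x \<in> S. F x \<in> V \<inter> W} = W0 \<inter> S"
      using S unfolding openin_subtopology by (auto simp: Int_absorb1)
    have pW0: "p \<in> W0" using W0(2) p V(2) W(2) by blast
    have W0D: "F x \<in> V" "F x \<in> W" if "x \<in> S" "x \<in> W0" for x using W0(2) that by blast+
    let ?h = "\<lambda>k x. \<psi> (F x) k"
    have t: "tuple (mdim M') ?h x = \<psi> (F x)" if "F x \<in> V" for x using chart_coordinate_ge[OF M' V(1) that] by (auto simp: tuple_def fun_eq_iff)
    show "smooth_at M S p (\<lambda>x. pullback N F' f (\<iota> x))"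
    proof (rule smooth_at_compose[OF M p _ chart_Int_image_open[OF M' V(1) W(1)] smooth_on_openD[OF W(3) V(1)] _ W0(1) pW0, of ?h])
      show "smooth_at M S p (?h k)" if k: "k < mdim M'" for k
      proof (rule smooth_at_subset[OF _ W0(1) pW0])
        show "S \<inter> W0 \<subseteq> {x \<in> S. F x \<in> V}" using W0D by auto
        have "smooth_fun M {p \<in> S. F p \<in> V} (\<lambda>p. \<psi> (F p) k)" using F V(1) k unfolding smooth_map_def by auto
        then show "smooth_at M {x \<in> S. F x \<in> V} p (?h k)" using p V(2) by (simp add: smooth_fun_iff)
      qed
      show "tuple (mdim M') ?h p \<in> \<psi> ` (V \<inter> W)" using t[OF V(2)] V(2) W(2) by auto
      fix x assume x: "x \<in> S" "x \<in> W0"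
      show "pullback N F' f (\<iota> x) = g (inv_into V \<psi> (tuple (mdim M') ?h x))"
        using W0D[OF x] W(4)[of "F x"] FS[OF x(1)] presented_pts[OF N x(1)] F'[OF x(1)] by (simp add: t chart_inv[OF M' V(1)] pullback_apply)
    qed
  qed
qed

lemma smooth_between_subspace:
  assumes M: "charted M" and S: "S \<subseteq> mpoints M"
  shows "smooth_between (subspace_of M S) (whole M) (\<lambda>x. x)" unfolding smooth_between_def
proof (intro conjI ballI)
  note N = presented_subspace[OF S]
  show "x \<in> pts (whole M)" if "x \<in> pts (subspace_of M S)" for x using that S by auto
  fix f assume f: "f \<in> fns (whole M)"
  show "pullback (subspace_of M S) (\<lambda>x. x) f \<in> fns (subspace_of M S)"
  proof (rule presented_fnsI[OF N])
    fix p assume p: "p \<in> S"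
    have "smooth_at M (mpoints M) p f" using presented_smooth_at[OF presented_whole f] S p by auto
    then obtain W g where W: "openin (mtop M) W" "p \<in> W" "smooth_on_open M W g"
      "\<And>x. x \<in> W \<Longrightarrow> x \<in> mpoints M \<Longrightarrow> g x = f x" by (rule smooth_atE) blast
    then show "smooth_at M S p (\<lambda>x. pullback (subspace_of M S) (\<lambda>x. x) f x)" using S by (intro smooth_atI[OF W(1-3)]) (auto simp: pullback_def)
  qed (simp add: pullback_def)
qed

subsection \<open>Smooth functions with support in a chart\<close>

text \<open>A product of closed intervals and singletons is compact. In a Hausdorff manifold the
  corresponding subset of a chart domain is then closed, which permits extension by zero.\<close>

lemma compactin_closed_cube:
  "compactin (\<E> n) {y. (\<forall>i<n. \<bar>y i - q i\<bar> \<le> e) \<and> (\<forall>i\<ge>n. y i = 0)}" (is "compactin _ ?C")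
proof -
  let ?S = "\<lambda>i. if i < n then {q i - e..q i + e} else {0::real}"
  have "compactin (powertop_real UNIV) (Pi\<^sub>E UNIV ?S)" unfolding compactin_PiE by simp
  moreover have "Pi\<^sub>E UNIV ?S = ?C"
  proof (intro set_eqI iffI)
    fix y assume y: "y \<in> Pi\<^sub>E UNIV ?S"
    have "\<bar>y i - q i\<bar> \<le> e" if "i < n" for i using PiE_mem[OF y, of i] that by (simp add: abs_le_iff)
    moreover have "y i = 0" if "i \<ge> n" for i using PiE_mem[OF y, of i] that by simp
    ultimately show "y \<in> ?C" by simp
  next
    fix y assume y: "y \<in> ?C"
    have "y i \<in> ?S i" for i
    proof (cases "i < n")
      case True
      then have "\<bar>y i - q i\<bar> \<le> e" using y by simp
      then show ?thesis using True by (simp add: abs_le_iff)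
    qed (use y in simp)
    then show "y \<in> Pi\<^sub>E UNIV ?S" by (simp add: PiE_iff)
  qed
  ultimately have "compactin (powertop_real UNIV) ?C" by (simp only:)
  then show ?thesis unfolding Euclidean_space_def compactin_subtopology by auto
qed

text \<open>Outside the preimage \<open>?K\<close> of a compact cube the function is zero, and
  \<open>?K\<close> is closed because the manifold is Hausdorff. On \<open>U\<close> smoothness in
  other charts comes from the transition maps, and \<open>U\<close> together with the complement of
  \<open>?K\<close> covers the manifold.\<close>

lemma chart_extension_by_zero:
  assumes M: "is_manifold M" and U: "(U, \<phi>) \<in> atlas M" and F: "smooth_on (mdim M) (topspace (\<E> (mdim M))) F"
    and C: "{y. (\<forall>i<mdim M. \<bar>y i - q i\<bar> \<le> e) \<and> (\<forall>i\<ge>mdim M. y i = 0)} \<subseteq> \<phi> ` U"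
    and z: "\<And>y i. i < mdim M \<Longrightarrow> \<bar>y i - q i\<bar> \<ge> e \<Longrightarrow> F y = 0"
  shows "(\<lambda>x. if x \<in> U then F (\<phi> x) else 0) \<in> fns (whole M)" (is "?f \<in> _")
proof -
  note cM = is_manifold_charted[OF M]
  let ?C = "{y. (\<forall>i<mdim M. \<bar>y i - q i\<bar> \<le> e) \<and> (\<forall>i\<ge>mdim M. y i = 0)}"
  let ?K = "{x \<in> U. \<phi> x \<in> ?C}"
  have "compactin (subtopology (mtop M) U) ?K"
  proof (subst homeomorphic_map_compactness[OF chart_homeomorphic[OF cM U], symmetric])
    show "?K \<subseteq> topspace (subtopology (mtop M) U)" using chart_subset[OF cM U] by auto
    have "\<phi> ` ?K = ?C" using C by blast
    then show "compactin (subtopology (\<E> (mdim M)) (\<phi> ` U)) (\<phi> ` ?K)" using compactin_closed_cube C by (simp add: compactin_subtopology)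
  qed
  then have "compactin (mtop M) ?K" by (simp add: compactin_subtopology)
  then have K: "closedin (mtop M) ?K" using M compactin_imp_closedin unfolding is_manifold_def by auto
  have 0: "?f x = 0" if "x \<notin> ?K" for x
  proof (cases "x \<in> U")
    case True
    then have "\<phi> x \<notin> ?C" using that by auto
    then have "\<exists>i<mdim M. \<bar>\<phi> x i - q i\<bar> \<ge> e" using chart_coordinate_ge[OF cM U True] by (auto simp: not_le intro: less_imp_le)
    then show ?thesis using z by auto
  qed simp
  have sU: "smooth_on_open M U ?f"
  proof (rule smooth_on_openI)
    fix V \<psi> assume V: "(V, \<psi>) \<in> atlas M"
    have o: "openin (\<E> (mdim M)) (\<psi> ` (V \<inter> U))" by (rule chart_Int_image_open[OF cM V chart_open[OF cM U]])
    have inv: "inv_into V \<psi> y \<in> U" if "y \<in> \<psi> ` (V \<inter> U)" for y using that chart_inv[OF cM V] by auto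
    have tr: "\<forall>i<mdim M. smooth_on (mdim M) (\<psi> ` (V \<inter> U)) (\<lambda>x. \<phi> (inv_into V \<psi> x) i)"
      using M U V unfolding is_manifold_def by fast
    have "smooth_on (mdim M) (\<psi> ` (V \<inter> U)) (\<lambda>x. F (\<phi> (inv_into V \<psi> x)))"
    proof (rule smooth_on_compose[OF o openin_topspace _ _ F])
      show "\<phi> (inv_into V \<psi> y) \<in> topspace (\<E> (mdim M))" if "y \<in> \<psi> ` (V \<inter> U)" for y
        using chart_coordinate_ge[OF cM U inv[OF that]] by (simp add: topspace_Euclidean_space)
    qed (use tr in simp)
    then show "smooth_on (mdim M) (\<psi> ` (V \<inter> U)) (\<lambda>x. ?f (inv_into V \<psi> x))" by (rule smooth_on_cong[OF o, rotated]) (simp add: inv)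
  qed
  show ?thesis
  proof (rule presented_fnsI[OF presented_whole])
    show "?f x = 0" if "x \<notin> pts (whole M)" for x using that chart_subset[OF cM U] by auto
    fix p assume p: "p \<in> mpoints M"
    show "smooth_at M (mpoints M) p ?f"
    proof (cases "p \<in> U")
      case True
      then show ?thesis by (rule smooth_atI[OF chart_open[OF cM U] _ sU]) simp
    next
      case False
      have "openin (mtop M) (mpoints M - ?K)" using K by (simp add: closedin_def)
      then show ?thesis
      proof (rule smooth_atI[OF _ _ smooth_on_open_const[of _ _ 0]])
        show "p \<in> mpoints M - ?K" using p False by simp
        fix x assume "x \<in> mpoints M - ?K"
        then show "0 = ?f x" using 0[of x] by simp
      qed
    qed
  qed
qed

text \<open>Global functions that do the work of a chart: \<open>b\<close> certifies by a nonzero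
  value that a point lies in the chart domain, and wherever it does so the \<open>xs\<close> are the
  coordinates. They result from two nested cutoffs, \<open>\<beta>\<close> multiplying the
  coordinates and the narrower \<open>\<gamma>\<close> giving \<open>b\<close>.\<close>

lemma chart_functions:
  assumes M: "is_manifold M" and U: "(U, \<phi>) \<in> atlas M" and W: "openin (mtop M) W" "p \<in> U" "p \<in> W"
  obtains b xs where "b \<in> fns (whole M)" "\<And>k. k < mdim M \<Longrightarrow> xs k \<in> fns (whole M)" "b p = 1"
    "\<And>x. b x \<noteq> 0 \<Longrightarrow> x \<in> U \<and> x \<in> W \<and> (\<forall>k<mdim M. xs k x = \<phi> x k)"
proof -
  note cM = is_manifold_charted[OF M]
  let ?n = "mdim M" and ?q = "\<phi> p"
  have "?q \<in> \<phi> ` (U \<inter> W)" using W by auto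
  then obtain e where e: "e > 0" "cube ?n ?q e \<subseteq> \<phi> ` (U \<inter> W)" by (rule openE_cube[OF chart_Int_image_open[OF cM U W(1)]])
  have e2: "e / 2 > 0" using e by simp
  obtain \<beta> d where \<beta>: "d > 0" "\<And>U. smooth_on ?n U \<beta>" "\<And>y. y \<in> cube ?n ?q d \<Longrightarrow> \<beta> y = 1"
    "\<And>y i. i < ?n \<Longrightarrow> \<bar>y i - ?q i\<bar> \<ge> e / 2 \<Longrightarrow> \<beta> y = 0" by (rule cutoff_exists[OF e2, of ?n ?q]) blast
  \<comment> \<open>Where \<open>\<gamma>\<close> is nonzero the point lies in the cube of radius
    \<open>d'\<close>, hence both in the cube on which \<open>\<beta>\<close> is 1 and in the chart
    image of \<open>U \<inter> W\<close>.\<close>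
  define d' where "d' = min d (e / 2)"
  have d': "d' > 0" "d' \<le> d" "d' \<le> e / 2" using \<beta>(1) e2 by (simp_all add: d'_def)
  obtain \<gamma> c where \<gamma>: "c > 0" "\<And>U. smooth_on ?n U \<gamma>" "\<And>y. y \<in> cube ?n ?q c \<Longrightarrow> \<gamma> y = 1"
    "\<And>y i. i < ?n \<Longrightarrow> \<bar>y i - ?q i\<bar> \<ge> d' \<Longrightarrow> \<gamma> y = 0" by (rule cutoff_exists[OF d'(1), of ?n ?q]) blast
  let ?C = "\<lambda>r. {y. (\<forall>i<?n. \<bar>y i - ?q i\<bar> \<le> r) \<and> (\<forall>i\<ge>?n. y i = 0)}"
  have C: "?C r \<subseteq> \<phi> ` U" if "r \<le> e / 2" for r
  proof -
    have "?C r \<subseteq> cube ?n ?q e" unfolding cube_def using that e(1) by (auto intro: le_less_trans)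
    then show ?thesis using e(2) by blast
  qed
  let ?b = "\<lambda>x. if x \<in> U then \<gamma> (\<phi> x) else 0"
  let ?x = "\<lambda>k x. if x \<in> U then \<beta> (\<phi> x) * \<phi> x k else 0"
  show ?thesis
  proof (rule that[of ?b ?x])
    show "?b \<in> fns (whole M)" by (rule chart_extension_by_zero[OF M U \<gamma>(2) C[OF d'(3)] \<gamma>(4)])
    show "?x k \<in> fns (whole M)" for k by (rule chart_extension_by_zero[OF M U smooth_on_mult[OF \<beta>(2) smooth_on_coordinate] C[OF order_refl]])
        (simp add: \<beta>(4))
    have "?q \<in> cube ?n ?q c" using \<gamma>(1) chart_coordinate_ge[OF cM U W(2)] by simp
    then show "?b p = 1" using W(2) \<gamma>(3) by simp
    fix x assume x: "?b x \<noteq> 0"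
    then have xU: "x \<in> U" and g: "\<gamma> (\<phi> x) \<noteq> 0" by (auto split: if_splits)
    have "\<bar>\<phi> x i - ?q i\<bar> < d'" if "i < ?n" for i using \<gamma>(4)[OF that, of "\<phi> x"] g by (meson not_le)
    then have xd: "\<phi> x \<in> cube ?n ?q d'" using chart_coordinate_ge[OF cM U xU] by (simp add: cube_def)
    then have "\<phi> x \<in> cube ?n ?q d" and "\<phi> x \<in> cube ?n ?q e" using cube_mono[OF d'(2)] cube_mono[of d' e] d'(3) e(1) by (auto simp: subset_iff)
    then have "\<beta> (\<phi> x) = 1" and "\<phi> x \<in> \<phi> ` (U \<inter> W)" using \<beta>(3) e(2) by auto
    then show "x \<in> U \<and> x \<in> W \<and> (\<forall>k<?n. ?x k x = \<phi> x k)" using xU inj_onD[OF chart_inj[OF cM U]] by auto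
  qed
qed

text \<open>Among the generators there are, for each point, the coordinates of a chart followed by
  \<open>m\<close> functions whose joint nonvanishing certifies that a point lies in the chart
  domain. On the open set of tuples that start in the chart image and have nonzero last entries,
  \<open>f\<close> is then its local extension read in the chart. Subsets of a manifold use one
  certificate, powers one for each factor.\<close>

lemma generated_by_charts:
  assumes M: "charted M" and N: "presented N M S \<iota>" and B: "B \<subseteq> fns N"
    and ch: "\<And>p. p \<in> S \<Longrightarrow> \<exists>U \<phi> m h. (U, \<phi>) \<in> atlas M \<and> p \<in> U \<and> (\<forall>k<mdim M + m. h k \<in> B) \<and>
       (\<forall>j<m. h (mdim M + j) (\<iota> p) \<noteq> 0) \<and>
       (\<forall>x\<in>S. (\<forall>j<m. h (mdim M + j) (\<iota> x) \<noteq> 0) \<longrightarrow> x \<in> U \<and> (\<forall>k<mdim M. h k (\<iota> x) = \<phi> x k))"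
  shows "generated_by N B" unfolding generated_by_def
proof (intro conjI ballI)
  show "B \<subseteq> fns N" by (rule B)
  fix z f assume z: "z \<in> pts N" and f: "f \<in> fns N"
  then obtain p where p: "p \<in> S" "z = \<iota> p" by (auto simp: presentedD(2)[OF N])
  let ?n = "mdim M"
  obtain U \<phi> m h where U: "(U, \<phi>) \<in> atlas M" "p \<in> U" and h: "\<forall>k<?n + m. h k \<in> B"
    "\<forall>j<m. h (?n + j) (\<iota> p) \<noteq> 0"
    "\<forall>x\<in>S. (\<forall>j<m. h (?n + j) (\<iota> x) \<noteq> 0) \<longrightarrow> x \<in> U \<and> (\<forall>k<?n. h k (\<iota> x) = \<phi> x k)"
    using ch[OF p(1)] by (elim exE conjE)
  obtain W g where W: "openin (mtop M) W" "p \<in> W" "smooth_on_open M W g" "\<And>x. x \<in> W \<Longrightarrow> x \<in> S \<Longrightarrow> g x = f (\<iota> x)"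
    by (rule smooth_atE[OF presented_smooth_at[OF N f p(1)]]) blast
  let ?tr = "\<lambda>y::nat\<Rightarrow>real. \<lambda>i. if i < ?n then y i else 0"
  let ?A = "{y \<in> topspace (\<E> (?n + m)). ?tr y \<in> \<phi> ` (U \<inter> W)}"
  let ?V = "{y \<in> ?A. \<forall>j<m. y (?n + j) \<noteq> 0}"
  note o = chart_Int_image_open[OF M U(1) W(1)]
  have cc: "continuous_on T (\<lambda>y::nat\<Rightarrow>real. y i)" for T i by (rule continuous_on_subset[OF continuous_on_product_coordinates]) simp
  have A: "openin (\<E> (?n + m)) ?A" by (rule openin_preimage_E[OF openin_topspace o]) (simp_all add: cc)
  have V: "openin (\<E> (?n + m)) ?V"
  proof -
    have "open (\<Inter>j\<in>{..<m}. {y::nat\<Rightarrow>real. y (?n + j) \<noteq> 0})" by (intro open_INT ballI open_Collect_neq cc) simp_all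
    then have "openin (\<E> (?n + m)) ({x. \<forall>i\<ge>?n+m. x i = 0} \<inter> (\<Inter>j\<in>{..<m}. {y::nat\<Rightarrow>real. y (?n + j) \<noteq> 0}))"
      unfolding Euclidean_space_eq openin_open by blast
    from openin_Int[OF A this] show ?thesis by (rule back_subst[where P = "openin (\<E> (?n + m))"]) (auto simp: topspace_Euclidean_space)
  qed
  have tr: "?tr (tuple (?n + m) h (\<iota> x)) = \<phi> x" if "x \<in> S" "\<forall>j<m. h (?n + j) (\<iota> x) \<noteq> 0" for x
    using h(3) that chart_coordinate_ge[OF M U(1), of x] by (auto simp: fun_eq_iff tuple_def)
  show "locally_generated N B z f"
  proof (rule locally_generatedI[where n = "?n + m" and h = h and V = ?V and G = "\<lambda>y. g (inv_into U \<phi> (?tr y))"])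
    show "h k \<in> B" if "k < ?n + m" for k using h(1) that by simp
    show "smooth_on (?n + m) ?V (\<lambda>y. g (inv_into U \<phi> (?tr y)))" by (rule smooth_on_compose[OF V o _ _ smooth_on_openD[OF W(3) U(1)]])
        (simp_all add: smooth_on_coordinate)
    show "tuple (?n + m) h z \<in> ?V" using tr[OF p(1) h(2)] h(2) U(2) W(2) p(2) by (simp add: tuple_in_topspace tuple_less)
    fix w assume w: "w \<in> pts N" "tuple (?n + m) h w \<in> ?V"
    then obtain x where x: "x \<in> S" "w = \<iota> x" by (auto simp: presentedD(2)[OF N])
    have nz: "\<forall>j<m. h (?n + j) (\<iota> x) \<noteq> 0" using w(2) x(2) by (simp add: tuple_less)
    have xU: "x \<in> U" using h(3) x(1) nz by blast
    have "\<phi> x \<in> \<phi> ` (U \<inter> W)" using w(2) tr[OF x(1) nz] x(2) by simp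
    then have xW: "x \<in> W" using xU inj_onD[OF chart_inj[OF M U(1)]] by auto
    show "f w = g (inv_into U \<phi> (?tr (tuple (?n + m) h w)))" unfolding x(2) tr[OF x(1) nz] chart_inv[OF M U(1) xU] by (rule W(4)[OF xW x(1), symmetric])
  qed (rule V)
qed

lemma generated_by_restrictions:
  assumes M: "is_manifold M" and S: "S \<subseteq> mpoints M"
  shows "generated_by (subspace_of M S) (pullback (subspace_of M S) (\<lambda>x. x) ` fns (whole M))"
proof (rule generated_by_charts[OF is_manifold_charted[OF M] presented_subspace[OF S]])
  note cM = is_manifold_charted[OF M]
  show "pullback (subspace_of M S) (\<lambda>x. x) ` fns (whole M) \<subseteq> fns (subspace_of M S)"
    using smooth_between_fns[OF smooth_between_subspace[OF cM S]] by blast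
  fix p assume p: "p \<in> S"
  then have pM: "p \<in> mpoints M" using S by auto
  from charted_obtain[OF cM this] obtain U \<phi> where U: "(U, \<phi>) \<in> atlas M" "p \<in> U" .
  obtain b xs where b: "b \<in> fns (whole M)" "\<And>k. k < mdim M \<Longrightarrow> xs k \<in> fns (whole M)" "b p = 1"
    "\<And>x. b x \<noteq> 0 \<Longrightarrow> x \<in> U \<and> x \<in> mpoints M \<and> (\<forall>k<mdim M. xs k x = \<phi> x k)"
    by (rule chart_functions[OF M U(1) openin_topspace U(2) pM]) blast
  let ?h = "\<lambda>k. pullback (subspace_of M S) (\<lambda>x. x) (if k < mdim M then xs k else b)"
  show "\<exists>U \<phi> m h. (U, \<phi>) \<in> atlas M \<and> p \<in> U \<and> (\<forall>k<mdim M + m. h k \<in> pullback (subspace_of M S) (\<lambda>x. x) ` fns (whole M)) \<and>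
       (\<forall>j<m. h (mdim M + j) p \<noteq> 0) \<and>
       (\<forall>x\<in>S. (\<forall>j<m. h (mdim M + j) x \<noteq> 0) \<longrightarrow> x \<in> U \<and> (\<forall>k<mdim M. h k x = \<phi> x k))"
  proof (rule exI[of _ U], rule exI[of _ \<phi>], rule exI[of _ 1], rule exI[of _ ?h], intro conjI U allI ballI impI)
    show "?h k \<in> pullback (subspace_of M S) (\<lambda>x. x) ` fns (whole M)" for k using b(1,2) by (intro imageI) simp
    show "?h (mdim M + j) p \<noteq> 0" for j using p b(3) by (simp add: pullback_def)
    fix x assume x: "x \<in> S" "\<forall>j<1. ?h (mdim M + j) x \<noteq> 0"
    then have "b x \<noteq> 0" by (simp add: pullback_def)
    note * = b(4)[OF this]
    show "x \<in> U" using * by simp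
    fix k assume "k < mdim M"
    then show "?h k x = \<phi> x k" using * x(1) by (simp add: pullback_def)
  qed
qed

subsection \<open>Powers of a manifold\<close>

lemma topspace_mpower:
  "topspace (mtop (mpower q A)) = {xs. length xs = q \<and> set xs \<subseteq> topspace (mtop A)}"
proof (intro set_eqI iffI)
  fix xs assume "xs \<in> topspace (mtop (mpower q A))"
  then have l: "length xs = q" and m: "(\<lambda>j\<in>{..<q}. xs ! j) \<in> Pi\<^sub>E {..<q} (\<lambda>_. topspace (mtop A))"
    by (simp_all add: mpower_def topspace_pullback_topology)
  have "xs ! j \<in> topspace (mtop A)" if "j < q" for j using PiE_mem[OF m, of j] that by simp
  then show "xs \<in> {xs. length xs = q \<and> set xs \<subseteq> topspace (mtop A)}" using l by (auto simp: in_set_conv_nth)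
next
  fix xs assume xs: "xs \<in> {xs. length xs = q \<and> set xs \<subseteq> topspace (mtop A)}"
  then have "xs ! j \<in> topspace (mtop A)" if "j < q" for j using that by auto
  then show "xs \<in> topspace (mtop (mpower q A))" using xs by (simp add: mpower_def topspace_pullback_topology PiE_iff)
qed

lemma nth_mpower: "xs \<in> topspace (mtop (mpower q A)) \<Longrightarrow> i < q \<Longrightarrow> xs ! i \<in> topspace (mtop A)"
  unfolding topspace_mpower by (simp add: subset_iff)

lemma mdim_mpower [simp]: "mdim (mpower q A) = q * mdim A" by (simp add: mpower_def)

lemma continuous_map_nth_mpower:
  assumes "i < q"
  shows "continuous_map (mtop (mpower q A)) (mtop A) (\<lambda>xs. xs ! i)"
proof -
  have "continuous_map (product_topology (\<lambda>_. mtop A) {..<q}) (mtop A) (\<lambda>f. f i)"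
    by (rule continuous_map_product_projection) (use assms in simp)
  from continuous_map_pullback[OF this, of "{xs. length xs = q}" "\<lambda>xs. \<lambda>j\<in>{..<q}. xs ! j"]
  show ?thesis using assms by (simp add: mpower_def comp_def)
qed

lemma continuous_map_into_mpower:
  assumes l: "\<And>x. x \<in> topspace X \<Longrightarrow> length (F x) = q"
    and c: "\<And>i. i < q \<Longrightarrow> continuous_map X (mtop A) (\<lambda>x. F x ! i)"
  shows "continuous_map X (mtop (mpower q A)) F"
proof -
  have "continuous_map X (product_topology (\<lambda>_. mtop A) {..<q}) ((\<lambda>xs. \<lambda>j\<in>{..<q}. xs ! j) \<circ> F)"
    unfolding continuous_map_componentwise using c by (auto simp: comp_def)
  moreover have "topspace X \<subseteq> F -` {xs. length xs = q}" using l by auto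
  ultimately show ?thesis unfolding mpower_def by (simp add: continuous_map_pullback')
qed

lemma continuous_on_coordinate: "continuous_on T (\<lambda>y::nat\<Rightarrow>real. y i)"
  by (rule continuous_on_subset[OF continuous_on_product_coordinates]) simp

definition block :: "nat \<Rightarrow> nat \<Rightarrow> (nat \<Rightarrow> real) \<Rightarrow> nat \<Rightarrow> real" where
  "block n j y = (\<lambda>i. if i < n then y (j * n + i) else 0)"

lemma block_index: assumes "j < q" "i < n" shows "j * n + i < q * (n::nat)"
proof -
  have "j * n + i < j * n + n" using assms(2) by simp
  also have "\<dots> \<le> q * n" using mult_le_mono1[of "Suc j" q n] assms(1) by simp
  finally show ?thesis .
qed

lemma block_unindex: assumes "k < q * n" shows "k div n < q" "k mod n < (n::nat)" "(k div n) * n + k mod n = k"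
proof -
  have "n > 0" using assms by (cases n) simp_all
  then show "k div n < q" "k mod n < n" "(k div n) * n + k mod n = k" using assms by (simp_all add: less_mult_imp_div_less)
qed

context
  fixes A :: "'a manifold" and q :: nat and cs :: "('a set \<times> ('a \<Rightarrow> nat \<Rightarrow> real)) list"
  assumes A: "charted A" and cs: "length cs = q" "set cs \<subseteq> atlas A"
begin

private abbreviation (input) "cdom j \<equiv> fst (cs ! j)"
private abbreviation (input) "crd j \<equiv> snd (cs ! j)"
private abbreviation (input) "n \<equiv> mdim A"
private abbreviation (input) "PU \<equiv> fst (power_chart n q cs)"
private abbreviation (input) "P\<phi> \<equiv> snd (power_chart n q cs)"

lemma power_chart_factor: "j < q \<Longrightarrow> (cdom j, crd j) \<in> atlas A" using cs by auto

lemma power_chart_dom: "PU = {xs. length xs = q \<and> (\<forall>j<q. xs ! j \<in> cdom j)}" by (simp add: power_chart_def)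

lemma power_chart_coord: "P\<phi> xs = (\<lambda>k. if k < q * n then crd (k div n) (xs ! (k div n)) (k mod n) else 0)"
  by (simp add: power_chart_def)

lemma block_power_chart:
  assumes "xs \<in> PU" "j < q" shows "block n j (P\<phi> xs) = crd j (xs ! j)"
proof
  fix i
  have "xs ! j \<in> cdom j" using assms by (simp add: power_chart_dom)
  then show "block n j (P\<phi> xs) i = crd j (xs ! j) i"
    using chart_coordinate_ge[OF A power_chart_factor[OF assms(2)], of "xs ! j" i] block_index[OF assms(2), of i n] by (simp add: block_def power_chart_coord)
qed

lemma power_chart_subset: "PU \<subseteq> topspace (mtop (mpower q A))" unfolding topspace_mpower power_chart_dom
  using chart_subset[OF A power_chart_factor] by (fastforce simp: in_set_conv_nth)

lemma power_chart_open: "openin (mtop (mpower q A)) PU"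
proof -
  have "openin (mtop (mpower q A)) ((\<Inter>j\<in>{..<q}. {xs \<in> topspace (mtop (mpower q A)). xs ! j \<in> cdom j}) \<inter> topspace (mtop (mpower q A)))"
    by (rule openin_INT)
      (auto intro!: openin_continuous_map_preimage continuous_map_nth_mpower chart_open[OF A power_chart_factor])
  moreover have "(\<Inter>j\<in>{..<q}. {xs \<in> topspace (mtop (mpower q A)). xs ! j \<in> cdom j}) \<inter> topspace (mtop (mpower q A)) = PU"
  proof (rule set_eqI)
    fix xs
    show "xs \<in> (\<Inter>j\<in>{..<q}. {xs \<in> topspace (mtop (mpower q A)). xs ! j \<in> cdom j}) \<inter> topspace (mtop (mpower q A)) \<longleftrightarrow> xs \<in> PU"
      using power_chart_subset by (auto simp: power_chart_dom topspace_mpower)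
  qed
  ultimately show ?thesis by simp
qed

definition power_chart_inv :: "(nat \<Rightarrow> real) \<Rightarrow> 'a list" where
  "power_chart_inv y = map (\<lambda>j. inv_into (cdom j) (crd j) (block n j y)) [0..<q]"

lemma power_chart_inv_left: "xs \<in> PU \<Longrightarrow> power_chart_inv (P\<phi> xs) = xs" by (rule nth_equalityI)
    (simp_all add: power_chart_inv_def block_power_chart chart_inv[OF A power_chart_factor] power_chart_dom)

lemma power_chart_inv_right:
  assumes "y \<in> topspace (\<E> (q * n))" "\<And>j. j < q \<Longrightarrow> block n j y \<in> crd j ` cdom j"
  shows "power_chart_inv y \<in> PU" "P\<phi> (power_chart_inv y) = y"
proof -
  show "power_chart_inv y \<in> PU" using inv_into_into[OF assms(2)] by (simp add: power_chart_dom power_chart_inv_def)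
  show "P\<phi> (power_chart_inv y) = y"
  proof
    fix k
    show "P\<phi> (power_chart_inv y) k = y k"
    proof (cases "k < q * n")
      case True
      note k = block_unindex[OF True]
      have "P\<phi> (power_chart_inv y) k = block n (k div n) y (k mod n)"
        using True k(1) f_inv_into_f[OF assms(2)[OF k(1)]] by (simp add: power_chart_coord power_chart_inv_def)
      also have "\<dots> = y k" using k by (simp add: block_def)
      finally show ?thesis .
    qed (use assms(1) in \<open>simp add: power_chart_coord topspace_Euclidean_space\<close>)
  qed
qed

lemma power_chart_image:
  "P\<phi> ` PU = {y \<in> topspace (\<E> (q * n)). \<forall>j<q. block n j y \<in> crd j ` cdom j}"
proof (intro set_eqI iffI)
  fix y assume "y \<in> P\<phi> ` PU"
  then obtain xs where xs: "xs \<in> PU" "y = P\<phi> xs" by auto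
  show "y \<in> {y \<in> topspace (\<E> (q * n)). \<forall>j<q. block n j y \<in> crd j ` cdom j}"
    using xs(1) unfolding xs(2) by (simp add: block_power_chart) (simp add: power_chart_coord power_chart_dom topspace_Euclidean_space)
next
  fix y assume y: "y \<in> {y \<in> topspace (\<E> (q * n)). \<forall>j<q. block n j y \<in> crd j ` cdom j}"
  then show "y \<in> P\<phi> ` PU" using power_chart_inv_right[of y] by (intro image_eqI[of _ _ "power_chart_inv y"]) simp_all
qed

lemma block_preimage_open:
  assumes "openin (\<E> n) V"
  shows "openin (\<E> m) {y \<in> topspace (\<E> m). block n j y \<in> V}"
  by (rule openin_preimage_E[OF openin_topspace assms]) (simp_all add: block_def continuous_on_coordinate)

lemma power_chart_image_open: "openin (\<E> (q * n)) (P\<phi> ` PU)"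
proof -
  have "openin (\<E> (q * n)) ((\<Inter>j\<in>{..<q}. {y \<in> topspace (\<E> (q * n)). block n j y \<in> crd j ` cdom j}) \<inter> topspace (\<E> (q * n)))"
    by (rule openin_INT) (auto intro!: block_preimage_open chart_image_open[OF A power_chart_factor])
  moreover have "(\<Inter>j\<in>{..<q}. {y \<in> topspace (\<E> (q * n)). block n j y \<in> crd j ` cdom j}) \<inter> topspace (\<E> (q * n)) = P\<phi> ` PU"
    unfolding power_chart_image by auto
  ultimately show ?thesis by simp
qed

text \<open>The chart is continuous coordinate by coordinate and its inverse factor by factor, the
  latter because \<open>inv_into\<close> coincides on each chart image with the continuous inverse
  of the factor's chart.\<close>

lemma power_chart_homeomorphic:
  "homeomorphic_map (subtopology (mtop (mpower q A)) PU) (subtopology (\<E> (q * n)) (P\<phi> ` PU)) P\<phi>"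
proof -
  let ?X = "subtopology (mtop (mpower q A)) PU" and ?Y = "subtopology (\<E> (q * n)) (P\<phi> ` PU)"
  have tX: "topspace ?X = PU" using power_chart_subset by auto
  have tY: "topspace ?Y = P\<phi> ` PU" using openin_subset[OF power_chart_image_open] by auto
  have 1: "continuous_map ?X ?Y P\<phi>" unfolding continuous_map_in_subtopology tX
  proof
    have "continuous_map ?X euclideanreal (\<lambda>xs. crd (k div n) (xs ! (k div n)) (k mod n))" if k: "k < q * n" for k
    proof -
      note k' = block_unindex[OF k]
      have "continuous_map ?X (subtopology (mtop A) (cdom (k div n))) (\<lambda>xs. xs ! (k div n))" unfolding continuous_map_in_subtopology tX using k'(1)
        by (auto simp: power_chart_dom intro!: continuous_map_from_subtopology continuous_map_nth_mpower)
      from continuous_map_compose[OF this homeomorphic_imp_continuous_map[OF chart_homeomorphic[OF A power_chart_factor[OF k'(1)]]]]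
      have "continuous_map ?X (\<E> n) (\<lambda>xs. crd (k div n) (xs ! (k div n)))" by (simp add: comp_def continuous_map_in_subtopology)
      moreover have "continuous_map (\<E> n) euclideanreal (\<lambda>y. y (k mod n))"
        unfolding continuous_map_Euclidean_space_iff by (rule continuous_on_coordinate)
      ultimately show ?thesis by (rule continuous_map_compose[unfolded comp_def])
    qed
    then have "continuous_map ?X (\<E> (q * n)) (\<lambda>xs k. if k < q * n then crd (k div n) (xs ! (k div n)) (k mod n) else 0)"
      unfolding continuous_map_componentwise_Euclidean_space by blast
    then show "continuous_map ?X (\<E> (q * n)) P\<phi>" by (simp only: power_chart_coord[abs_def])
  qed auto
  have 2: "continuous_map ?Y ?X power_chart_inv" unfolding continuous_map_in_subtopology tY
  proof
    show "continuous_map ?Y (mtop (mpower q A)) power_chart_inv"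
    proof (rule continuous_map_into_mpower)
      show "length (power_chart_inv y) = q" for y by (simp add: power_chart_inv_def)
      fix j assume j: "j < q"
      let ?Z = "subtopology (\<E> n) (crd j ` cdom j)"
      have tZ: "topspace ?Z = crd j ` cdom j" using openin_subset[OF chart_image_open[OF A power_chart_factor[OF j]]] by auto
      have b: "continuous_map ?Y ?Z (block n j)" unfolding continuous_map_in_subtopology tY
      proof
        have "continuous_map (\<E> (q * n)) (\<E> n) (\<lambda>y i. if i < n then y (j * n + i) else 0)"
          unfolding continuous_map_componentwise_Euclidean_space continuous_map_Euclidean_space_iff by (simp add: continuous_on_coordinate)
        then show "continuous_map ?Y (\<E> n) (block n j)" unfolding block_def[abs_def] by (rule continuous_map_from_subtopology)
      qed (use j in \<open>auto simp: power_chart_image\<close>)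
      obtain g where g: "homeomorphic_maps (subtopology (mtop A) (cdom j)) ?Z (crd j) g"
        using chart_homeomorphic[OF A power_chart_factor[OF j]] unfolding homeomorphic_map_maps by (elim exE)
      have gc: "continuous_map ?Z (mtop A) g" using g unfolding homeomorphic_maps_def continuous_map_in_subtopology by simp
      have "g y = inv_into (cdom j) (crd j) y" if "y \<in> crd j ` cdom j" for y
      proof -
        from that obtain x where x: "x \<in> cdom j" "y = crd j x" by auto
        have "g (crd j x) = x" using g x(1) chart_subset[OF A power_chart_factor[OF j]] unfolding homeomorphic_maps_def by auto
        then show ?thesis using x chart_inv[OF A power_chart_factor[OF j]] by simp
      qed
      then have "continuous_map ?Z (mtop A) (inv_into (cdom j) (crd j))" by (intro continuous_map_eq[OF gc]) (simp add: tZ)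
      from continuous_map_compose[OF b this]
      show "continuous_map ?Y (mtop A) (\<lambda>y. power_chart_inv y ! j)" using j by (simp add: power_chart_inv_def comp_def)
    qed
  qed (use power_chart_inv_left in auto)
  have "homeomorphic_maps ?X ?Y P\<phi> power_chart_inv" unfolding homeomorphic_maps_def tX tY using 1 2 power_chart_inv_left by auto
  then show ?thesis unfolding homeomorphic_map_maps by blast
qed

lemma inv_into_power_chart:
  "y \<in> P\<phi> ` PU \<Longrightarrow> inv_into PU P\<phi> y = power_chart_inv y"
proof -
  assume "y \<in> P\<phi> ` PU"
  then obtain xs where xs: "xs \<in> PU" "y = P\<phi> xs" by auto
  have "inj_on P\<phi> PU" by (rule inj_on_inverseI[of _ power_chart_inv]) (rule power_chart_inv_left)
  then show ?thesis using xs by (simp add: power_chart_inv_left)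
qed

end

lemma atlas_mpower: "(U, \<phi>) \<in> atlas (mpower q A) \<Longrightarrow>
    \<exists>cs. length cs = q \<and> set cs \<subseteq> atlas A \<and> U = fst (power_chart (mdim A) q cs) \<and> \<phi> = snd (power_chart (mdim A) q cs)"
  by (auto simp: mpower_def) (metis fst_conv snd_conv)

lemma atlas_mpowerI: "length cs = q \<Longrightarrow> set cs \<subseteq> atlas A \<Longrightarrow>
    (fst (power_chart (mdim A) q cs), snd (power_chart (mdim A) q cs)) \<in> atlas (mpower q A)"
  by (simp add: mpower_def)

lemma charted_mpower:
  assumes A: "charted A" shows "charted (mpower q A)" unfolding charted_def
proof
  show "\<forall>(U, \<phi>)\<in>atlas (mpower q A). openin (mtop (mpower q A)) U \<and> openin (\<E> (mdim (mpower q A))) (\<phi> ` U) \<and>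
       homeomorphic_map (subtopology (mtop (mpower q A)) U) (subtopology (\<E> (mdim (mpower q A))) (\<phi> ` U)) \<phi>"
  proof (intro ballI, clarify)
    fix U \<phi> assume "(U, \<phi>) \<in> atlas (mpower q A)"
    from atlas_mpower[OF this] obtain cs where cs: "length cs = q" "set cs \<subseteq> atlas A"
      and U: "U = fst (power_chart (mdim A) q cs)" "\<phi> = snd (power_chart (mdim A) q cs)" by (elim exE conjE)
    show "openin (mtop (mpower q A)) U \<and> openin (\<E> (mdim (mpower q A))) (\<phi> ` U) \<and>
       homeomorphic_map (subtopology (mtop (mpower q A)) U) (subtopology (\<E> (mdim (mpower q A))) (\<phi> ` U)) \<phi>"
      unfolding U mdim_mpower by (intro conjI power_chart_open[OF A cs] power_chart_image_open[OF A cs] power_chart_homeomorphic[OF A cs])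
  qed
  show "(\<Union>(U, \<phi>)\<in>atlas (mpower q A). U) = topspace (mtop (mpower q A))"
  proof
    show "(\<Union>(U, \<phi>)\<in>atlas (mpower q A). U) \<subseteq> topspace (mtop (mpower q A))"
      using power_chart_subset[OF A] by (fastforce dest: atlas_mpower)
    show "topspace (mtop (mpower q A)) \<subseteq> (\<Union>(U, \<phi>)\<in>atlas (mpower q A). U)"
    proof
      fix xs assume xs: "xs \<in> topspace (mtop (mpower q A))"
      then have l: "length xs = q" and s: "set xs \<subseteq> topspace (mtop A)" by (simp_all add: topspace_mpower)
      have "\<exists>c. c \<in> atlas A \<and> xs ! j \<in> fst c" if j: "j < q" for j
      proof -
        have "xs ! j \<in> topspace (mtop A)" using j l s by auto
        from charted_obtain[OF A this] obtain V \<psi> where "(V, \<psi>) \<in> atlas A" "xs ! j \<in> V" .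
        then show ?thesis by (intro exI[of _ "(V, \<psi>)"]) simp
      qed
      then obtain c where c: "\<And>j. j < q \<Longrightarrow> c j \<in> atlas A \<and> xs ! j \<in> fst (c j)" by metis
      let ?cs = "map c [0..<q]"
      have cs: "length ?cs = q" "set ?cs \<subseteq> atlas A" using c by auto
      have "xs \<in> fst (power_chart (mdim A) q ?cs)" using c l by (simp add: power_chart_def)
      then show "xs \<in> (\<Union>(U, \<phi>)\<in>atlas (mpower q A). U)" using atlas_mpowerI[OF cs] by blast
    qed
  qed
qed

lemma smooth_at_component:
  assumes A: "charted A" and S: "S \<subseteq> topspace (mtop (mpower q A))" and i: "i < q" and p: "p \<in> S" and h: "h \<in> fns (whole A)"
  shows "smooth_at (mpower q A) S p (\<lambda>xs. h (xs ! i))"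
proof -
  have pi: "p ! i \<in> topspace (mtop A)" using nth_mpower[OF subsetD[OF S p] i] .
  obtain W g where W: "openin (mtop A) W" "p ! i \<in> W" "smooth_on_open A W g"
    "\<And>x. x \<in> W \<Longrightarrow> x \<in> topspace (mtop A) \<Longrightarrow> g x = h x"
    by (rule smooth_atE[OF presented_smooth_at[OF presented_whole h pi]]) blast
  let ?W = "{xs \<in> topspace (mtop (mpower q A)). xs ! i \<in> W}"
  have oW: "openin (mtop (mpower q A)) ?W" by (rule openin_continuous_map_preimage[OF continuous_map_nth_mpower[OF i] W(1)])
  have "smooth_on_open (mpower q A) ?W (\<lambda>xs. g (xs ! i))"
  proof (rule smooth_on_openI)
    fix U \<phi> assume Uat: "(U, \<phi>) \<in> atlas (mpower q A)"
    from atlas_mpower[OF this] obtain cs where cs: "length cs = q" "set cs \<subseteq> atlas A"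
      and U: "U = fst (power_chart (mdim A) q cs)" "\<phi> = snd (power_chart (mdim A) q cs)" by (elim exE conjE)
    note f = power_chart_factor[OF A cs i]
    have o: "openin (\<E> (mdim (mpower q A))) (\<phi> ` (U \<inter> ?W))" by (rule chart_Int_image_open[OF charted_mpower[OF A] Uat oW])
    have y: "block (mdim A) i y = snd (cs ! i) (inv_into U \<phi> y ! i) \<and> inv_into U \<phi> y ! i \<in> fst (cs ! i) \<inter> W"
      if "y \<in> \<phi> ` (U \<inter> ?W)" for y
    proof -
      from that obtain xs where xs: "xs \<in> U" "xs \<in> ?W" "y = \<phi> xs" by auto
      have "inv_into U \<phi> y = xs" using xs inv_into_power_chart[OF A cs] power_chart_inv_left[OF A cs] by (simp add: U)
      then show ?thesis using xs block_power_chart[OF A cs _ i, of xs] i by (simp add: U power_chart_dom[OF A cs])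
    qed
    have "smooth_on (mdim (mpower q A)) (\<phi> ` (U \<inter> ?W)) (\<lambda>y. g (inv_into (fst (cs ! i)) (snd (cs ! i)) (block (mdim A) i y)))"
    proof (rule smooth_on_compose[OF o chart_Int_image_open[OF A f W(1)] _ _ smooth_on_openD[OF W(3) f]])
      show "block (mdim A) i y \<in> snd (cs ! i) ` (fst (cs ! i) \<inter> W)" if "y \<in> \<phi> ` (U \<inter> ?W)" for y using y[OF that] by auto
      show "smooth_on (mdim (mpower q A)) (\<phi> ` (U \<inter> ?W)) (\<lambda>y. block (mdim A) i y k)" if "k < mdim A" for k
        using that by (simp add: block_def smooth_on_coordinate)
    qed
    then show "smooth_on (mdim (mpower q A)) (\<phi> ` (U \<inter> ?W)) (\<lambda>y. g (inv_into U \<phi> y ! i))"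
      by (rule smooth_on_cong[OF o, rotated]) (use y chart_inv[OF A f] in auto)
  qed
  then show ?thesis
  proof (rule smooth_atI[OF oW, rotated])
    show "p \<in> ?W" using p S W(2) by auto
    fix xs assume xs: "xs \<in> ?W" "xs \<in> S"
    show "g (xs ! i) = h (xs ! i)" using W(4)[of "xs ! i"] xs(1) nth_mpower[of xs q A i] i by simp
  qed
qed

lemma smooth_between_component:
  assumes A: "charted A" and N: "presented N (mpower q A) S \<iota>" and r: "\<And>x. x \<in> S \<Longrightarrow> r (\<iota> x) = x" and i: "i < q"
  shows "smooth_between N (whole A) (\<lambda>z. r z ! i)" unfolding smooth_between_def
proof (intro conjI ballI)
  note S = presentedD(1)[OF N]
  show "r z ! i \<in> pts (whole A)" if "z \<in> pts N" for z
  proof -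
    from that obtain x where "x \<in> S" "z = \<iota> x" by (auto simp: presentedD(2)[OF N])
    then show ?thesis using nth_mpower[OF subsetD[OF S] i] r by simp
  qed
  fix h assume h: "h \<in> fns (whole A)"
  show "pullback N (\<lambda>z. r z ! i) h \<in> fns N"
  proof (rule presented_fnsI[OF N])
    show "pullback N (\<lambda>z. r z ! i) h z = 0" if "z \<notin> pts N" for z using that by (rule pullback_outside)
    fix p assume p: "p \<in> S"
    show "smooth_at (mpower q A) S p (\<lambda>x. pullback N (\<lambda>z. r z ! i) h (\<iota> x))"
    proof (rule smooth_atE[OF smooth_at_component[OF A S i p h]])
      fix W g assume "openin (mtop (mpower q A)) W" "p \<in> W" "smooth_on_open (mpower q A) W g"
        "\<And>x. x \<in> W \<Longrightarrow> x \<in> S \<Longrightarrow> g x = h (x ! i)"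
      then show ?thesis using presented_pts[OF N] r by (intro smooth_atI[of _ W _ g]) (simp_all add: pullback_apply)
    qed
  qed
qed

text \<open>The product chart at \<open>p\<close> is described by functions of single components:
  index \<open>k < q * n\<close> gives coordinate \<open>k mod n\<close> of component
  \<open>k div n\<close>, and the last \<open>q\<close> indices give one certifying function per
  component.\<close>

lemma generated_by_components:
  assumes A: "is_manifold A" and N: "presented N (mpower q A) S \<iota>" and r: "\<And>x. x \<in> S \<Longrightarrow> r (\<iota> x) = x"
  shows "generated_by N {pullback N (\<lambda>z. r z ! i) h | i h. i < q \<and> h \<in> fns (whole A)}" (is "generated_by N ?B")
proof (rule generated_by_charts[OF charted_mpower[OF is_manifold_charted[OF A]] N])
  note cA = is_manifold_charted[OF A] and S = presentedD(1)[OF N]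
  let ?n = "mdim A"
  show "?B \<subseteq> fns N" using smooth_between_fns[OF smooth_between_component[OF cA N r]] by blast
  fix p assume p: "p \<in> S"
  then have l: "length p = q" and s: "set p \<subseteq> topspace (mtop A)" using S by (auto simp: topspace_mpower)
  have "\<exists>c b xs. c \<in> atlas A \<and> p ! j \<in> fst c \<and> b \<in> fns (whole A) \<and> (\<forall>k<?n. xs k \<in> fns (whole A)) \<and> b (p ! j) = 1 \<and>
     (\<forall>x. b x \<noteq> 0 \<longrightarrow> x \<in> fst c \<and> (\<forall>k<?n. xs k x = snd c x k))" if j: "j < q" for j
  proof -
    have pj: "p ! j \<in> topspace (mtop A)" using j l s by auto
    from charted_obtain[OF cA this] obtain V \<psi> where V: "(V, \<psi>) \<in> atlas A" "p ! j \<in> V" .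
    obtain b xs where b: "b \<in> fns (whole A)" "\<And>k. k < ?n \<Longrightarrow> xs k \<in> fns (whole A)" "b (p ! j) = 1"
      "\<And>x. b x \<noteq> 0 \<Longrightarrow> x \<in> V \<and> x \<in> topspace (mtop A) \<and> (\<forall>k<?n. xs k x = \<psi> x k)"
      by (rule chart_functions[OF A V(1) openin_topspace V(2) pj]) blast
    show ?thesis by (rule exI[of _ "(V, \<psi>)"], rule exI[of _ b], rule exI[of _ xs]) (use V b in auto)
  qed
  then obtain c b xs where c: "\<And>j. j < q \<Longrightarrow> c j \<in> atlas A \<and> p ! j \<in> fst (c j) \<and> b j \<in> fns (whole A) \<and>
     (\<forall>k<?n. xs j k \<in> fns (whole A)) \<and> b j (p ! j) = 1 \<and>
     (\<forall>x. b j x \<noteq> 0 \<longrightarrow> x \<in> fst (c j) \<and> (\<forall>k<?n. xs j k x = snd (c j) x k))"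
    by metis
  let ?cs = "map c [0..<q]"
  have cs: "length ?cs = q" "set ?cs \<subseteq> atlas A" using c by auto
  let ?h = "\<lambda>k. if k < q * ?n then pullback N (\<lambda>z. r z ! (k div ?n)) (xs (k div ?n) (k mod ?n))
                 else pullback N (\<lambda>z. r z ! (k - q * ?n)) (b (k - q * ?n))"
  let ?U = "fst (power_chart ?n q ?cs)" and ?\<phi> = "snd (power_chart ?n q ?cs)"
  show "\<exists>U \<phi> m h. (U, \<phi>) \<in> atlas (mpower q A) \<and> p \<in> U \<and> (\<forall>k<mdim (mpower q A) + m. h k \<in> ?B) \<and>
       (\<forall>j<m. h (mdim (mpower q A) + j) (\<iota> p) \<noteq> 0) \<and>
       (\<forall>x\<in>S. (\<forall>j<m. h (mdim (mpower q A) + j) (\<iota> x) \<noteq> 0) \<longrightarrow> x \<in> U \<and> (\<forall>k<mdim (mpower q A). h k (\<iota> x) = \<phi> x k))"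
  proof (rule exI[of _ ?U], rule exI[of _ ?\<phi>], rule exI[of _ q], rule exI[of _ ?h], unfold mdim_mpower,
      intro conjI allI ballI impI)
    show "(?U, ?\<phi>) \<in> atlas (mpower q A)" by (rule atlas_mpowerI[OF cs])
    show "p \<in> ?U" using c l by (simp add: power_chart_def)
    fix k assume k: "k < q * ?n + q"
    show "?h k \<in> ?B"
    proof (cases "k < q * ?n")
      case True
      note k' = block_unindex[OF True]
      have "xs (k div ?n) (k mod ?n) \<in> fns (whole A)" using c[OF k'(1)] k'(2) by simp
      then show ?thesis using True k'(1) by auto
    next
      case False
      then have "k - q * ?n < q" using k by linarith
      then show ?thesis using False c by auto
    qed
  next
    fix j assume j: "j < q"
    then show "?h (q * ?n + j) (\<iota> p) \<noteq> 0" using c[OF j] r[OF p] presented_pts[OF N p] by (simp add: pullback_apply)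
  next
    fix x assume x: "x \<in> S" "\<forall>j<q. ?h (q * ?n + j) (\<iota> x) \<noteq> 0"
    have bx: "b j (x ! j) \<noteq> 0" if "j < q" for j using x(2) that r[OF x(1)] presented_pts[OF N x(1)] by (simp add: pullback_apply)
    have lx: "length x = q" using x(1) S by (auto simp: topspace_mpower)
    show "x \<in> ?U" using c bx lx by (simp add: power_chart_def)
    fix k assume k: "k < q * ?n"
    note k' = block_unindex[OF k]
    have "xs (k div ?n) (k mod ?n) (x ! (k div ?n)) = snd (c (k div ?n)) (x ! (k div ?n)) (k mod ?n)" using c[OF k'(1)] bx[OF k'(1)] k'(2) by blast
    then show "?h k (\<iota> x) = ?\<phi> x k" using k k'(1) r[OF x(1)] presented_pts[OF N x(1)] by (simp add: pullback_apply power_chart_def)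
  qed
qed

section \<open>Lifting curves through submersions\<close>

subsection \<open>A quantitative implicit function argument\<close>

text \<open>Banach's iteration from 0 for the sup norm on the first \<open>m\<close> coordinates.
  \<open>D\<close> is any bound on the coordinate distances, so no maximum over a possibly empty
  index set is formed. That the fixed point is bounded by twice the first step is what later makes
  the correction of a curve small.\<close>

lemma sup_contraction_fixpoint:
  fixes g :: "(nat \<Rightarrow> real) \<Rightarrow> nat \<Rightarrow> real"
  assumes \<delta>: "0 \<le> \<delta>" "2 * \<delta> < \<rho>"
    and contr: "\<And>u u' D j. j < m \<Longrightarrow> (\<And>l. l < m \<Longrightarrow> \<bar>u l\<bar> < \<rho>) \<Longrightarrow> (\<And>l. l < m \<Longrightarrow> \<bar>u' l\<bar> < \<rho>) \<Longrightarrow>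
        (\<And>l. l < m \<Longrightarrow> \<bar>u l - u' l\<bar> \<le> D) \<Longrightarrow> \<bar>g u j - g u' j\<bar> \<le> D / 2"
    and g0: "\<And>j. j < m \<Longrightarrow> \<bar>g (\<lambda>_. 0) j\<bar> \<le> \<delta>"
  shows "\<exists>u. \<forall>j<m. \<bar>u j\<bar> \<le> 2 * \<delta> \<and> g u j = u j"
proof -
  define a where "a i = (g ^^ i) (\<lambda>_. 0)" for i
  have aSuc: "a (Suc i) = g (a i)" for i by (simp add: a_def)
  \<comment> \<open>The steps shrink like \<open>\<delta> / 2 ^ i\<close>, and
    \<open>2 * \<delta> * (1 - (1/2)^i)\<close> is the sum of the steps made so far.\<close>
  have step: "(\<forall>l<m. \<bar>a i l\<bar> \<le> 2 * \<delta> * (1 - (1/2)^i) \<and> \<bar>a (Suc i) l - a i l\<bar> \<le> \<delta> * (1/2)^i)" for i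
  proof (induction i)
    case 0
    then show ?case using g0 by (simp add: a_def)
  next
    case (Suc i)
    have 1: "\<bar>a (Suc i) l\<bar> \<le> 2 * \<delta> * (1 - (1/2)^Suc i)" if "l < m" for l
    proof -
      have "\<bar>a i l\<bar> \<le> 2 * \<delta> * (1 - (1/2)^i)" "\<bar>a (Suc i) l - a i l\<bar> \<le> \<delta> * (1/2)^i" using Suc.IH that by blast+
      then have "\<bar>a (Suc i) l\<bar> \<le> 2 * \<delta> * (1 - (1/2)^i) + \<delta> * (1/2)^i" by linarith
      also have "\<dots> = 2 * \<delta> * (1 - (1/2)^Suc i)" by (simp add: algebra_simps)
      finally show ?thesis .
    qed
    have lt: "\<bar>a k l\<bar> < \<rho>" if "\<bar>a k l\<bar> \<le> 2 * \<delta> * (1 - (1/2)^k)" for k l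
    proof -
      have "2 * \<delta> * (1 - (1/2)^k) \<le> 2 * \<delta> * 1" by (rule mult_left_mono) (use \<delta>(1) in simp_all)
      then show ?thesis using that \<delta>(2) by linarith
    qed
    have "\<bar>g (a (Suc i)) l - g (a i) l\<bar> \<le> \<delta> * (1/2)^i / 2" if "l < m" for l
    proof (rule contr[OF that])
      fix l assume l: "l < m"
      show "\<bar>a (Suc i) l\<bar> < \<rho>" by (rule lt[OF 1[OF l]])
      show "\<bar>a i l\<bar> < \<rho>" by (rule lt) (use Suc.IH l in blast)
      show "\<bar>a (Suc i) l - a i l\<bar> \<le> \<delta> * (1/2)^i" using Suc.IH l by blast
    qed
    then show ?case using 1 by (simp add: aSuc[symmetric])
  qed
  have bnd: "\<bar>a i l\<bar> \<le> 2 * \<delta>" if "l < m" for i l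
  proof -
    have "2 * \<delta> * (1 - (1/2)^i) \<le> 2 * \<delta> * 1" by (rule mult_left_mono) (use \<delta>(1) in simp_all)
    then show ?thesis using step[of i] that by fastforce
  qed
  have "\<exists>L. (\<lambda>i. a i l) \<longlonglongrightarrow> L" if "l < m" for l
  proof -
    have "summable (\<lambda>i. a (Suc i) l - a i l)"
    proof (rule summable_comparison_test')
      show "summable (\<lambda>i. \<delta> * (1/2)^i)" by (intro summable_mult summable_geometric) simp
      show "norm (a (Suc i) l - a i l) \<le> \<delta> * (1/2)^i" if "i \<ge> 0" for i using step \<open>l < m\<close> by simp
    qed
    from summable_LIMSEQ[OF this] have "(\<lambda>i. a i l - a 0 l) \<longlonglongrightarrow> (\<Sum>i. a (Suc i) l - a i l)"
      by (simp add: sum_lessThan_telescope[of "\<lambda>i. a i l"])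
    from tendsto_add[OF this tendsto_const[of "a 0 l"]] show ?thesis by auto
  qed
  then obtain u where u: "\<And>l. l < m \<Longrightarrow> (\<lambda>i. a i l) \<longlonglongrightarrow> u l" by metis
  have ub: "\<bar>u l\<bar> \<le> 2 * \<delta>" if "l < m" for l by (rule LIMSEQ_le_const2[OF tendsto_rabs[OF u[OF that]]]) (use bnd that in blast)
  have "g u j = u j" if j: "j < m" for j
  proof -
    \<comment> \<open>As \<open>D\<close> the sum of all coordinate distances is taken: it dominates
      each of them and tends to 0.\<close>
    have le: "\<bar>g (a i) j - g u j\<bar> \<le> (\<Sum>l<m. \<bar>a i l - u l\<bar>) / 2" for i
    proof (rule contr[OF j])
      fix l assume l: "l < m"
      show "\<bar>a i l\<bar> < \<rho>" "\<bar>u l\<bar> < \<rho>" using bnd[OF l, of i] ub[OF l] \<delta>(2) by linarith+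
      show "\<bar>a i l - u l\<bar> \<le> (\<Sum>l<m. \<bar>a i l - u l\<bar>)"
        using member_le_sum[of l "{..<m}" "\<lambda>l. \<bar>a i l - u l\<bar>"] l by simp
    qed
    have "(\<lambda>i. (\<Sum>l<m. \<bar>a i l - u l\<bar>) / 2) \<longlonglongrightarrow> (\<Sum>l<m. \<bar>u l - u l\<bar>) / 2"
      using u by (intro tendsto_divide tendsto_sum tendsto_rabs tendsto_diff tendsto_const) simp_all
    then have "(\<lambda>i. (\<Sum>l<m. \<bar>a i l - u l\<bar>) / 2) \<longlonglongrightarrow> 0" by simp
    then have "(\<lambda>i. g (a i) j - g u j) \<longlonglongrightarrow> 0" by (rule Lim_null_comparison[rotated]) (use le in simp)
    then have "(\<lambda>i. a (Suc i) j) \<longlonglongrightarrow> g u j" unfolding aSuc by (rule LIM_zero_cancel)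
    moreover have "(\<lambda>i. a (Suc i) j) \<longlonglongrightarrow> u j" using u[OF j] by (rule LIMSEQ_Suc)
    ultimately show ?thesis by (rule LIMSEQ_unique)
  qed
  then show ?thesis using ub by blast
qed

text \<open>A function that vanishes at 0 with derivative 0 is of smaller order than the parameter,
  and so is everything bounded by a multiple of it.\<close>

lemma has_derivative_zero_of_bound:
  fixes u v :: "real \<Rightarrow> real"
  assumes v: "(v has_real_derivative 0) (at 0)" "v 0 = 0" and le: "eventually (\<lambda>t. \<bar>u t\<bar> \<le> C * \<bar>v t\<bar>) (nhds 0)"
  shows "(u has_real_derivative 0) (at 0)"
proof -
  have u0: "u 0 = 0" using eventually_nhds_x_imp_x[OF le] v(2) by simp
  have "((\<lambda>t. v t / t) \<longlongrightarrow> 0) (at 0)" using v by (simp add: has_field_derivative_iff)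
  from tendsto_mult[OF tendsto_const[of C] tendsto_rabs[OF this]]
  have "((\<lambda>t. C * \<bar>v t / t\<bar>) \<longlongrightarrow> 0) (at 0)" by simp
  moreover have "eventually (\<lambda>t. norm (u t / t) \<le> C * \<bar>v t / t\<bar>) (at 0)" using le unfolding eventually_at_filter
    by eventually_elim (simp add: abs_divide divide_right_mono)
  ultimately have "((\<lambda>t. u t / t) \<longlongrightarrow> 0) (at 0)" by (rule Lim_null_comparison[rotated])
  then show ?thesis by (simp add: has_field_derivative_iff u0)
qed

text \<open>A curve in the target whose velocity is the image of \<open>w\<close> is lifted by correcting the straight line in
  direction \<open>w\<close> with the right inverse \<open>B\<close> of the derivative; the correction is of second order.\<close>

lemma lift_curve_Euclidean:
  fixes \<Phi> :: "(nat \<Rightarrow> real) \<Rightarrow> nat \<Rightarrow> real" and \<eta> :: "real \<Rightarrow> nat \<Rightarrow> real"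
  assumes U: "openin (\<E> n) U" "p \<in> U" and \<Phi>: "\<And>j. j < m \<Longrightarrow> smooth_on n U (\<lambda>x. \<Phi> x j)"
    and B: "\<And>i j. i < m \<Longrightarrow> j < m \<Longrightarrow> (\<Sum>k<n. pd k (\<lambda>x. \<Phi> x i) p * B k j) = (if i = j then 1 else 0)"
    and \<eta>0: "\<And>j. j < m \<Longrightarrow> \<eta> 0 j = \<Phi> p j"
    and \<eta>: "\<And>j. j < m \<Longrightarrow> ((\<lambda>\<tau>. \<eta> \<tau> j) has_real_derivative (\<Sum>k<n. pd k (\<lambda>x. \<Phi> x j) p * w k)) (at 0)"
  shows "\<exists>x. x 0 = p \<and> (\<forall>\<tau>. \<forall>k\<ge>n. x \<tau> k = 0) \<and> eventually (\<lambda>\<tau>. x \<tau> \<in> U \<and> (\<forall>j<m. \<Phi> (x \<tau>) j = \<eta> \<tau> j)) (nhds 0) \<and>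
    (\<forall>k<n. ((\<lambda>\<tau>. x \<tau> k) has_real_derivative w k) (at 0))"
proof -
  have p0: "p i = 0" if "i \<ge> n" for i using openE_D0[OF U that] .
  \<comment> \<open>The straight line in direction \<open>w\<close>, displaced by the image under
    \<open>B\<close> of a correction \<open>u\<close> that lives in the target.\<close>
  define pt where "pt \<tau> u = (\<lambda>k. if k < n then p k + \<tau> * w k + (\<Sum>l<m. B k l * u l) else 0)" for \<tau> and u :: "nat \<Rightarrow> real"
  define J where "J x i l = (\<Sum>k<n. pd k (\<lambda>x. \<Phi> x i) x * B k l)" for x i l
  have pdc: "continuous_on U (pd k (\<lambda>x. \<Phi> x i))" if "i < m" "k < n" for i k
    by (rule smooth_on_continuous[OF smooth_on_pd[OF U(1) \<Phi>[OF that(1)] that(2)]])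
  have Jc: "continuous_on U (\<lambda>x. J x i l)" if "i < m" for i l unfolding J_def using pdc[OF that] by (intro continuous_intros) simp
  \<comment> \<open>If all entries of \<open>J\<close> are within \<open>K\<close> of the identity
    matrix, then \<open>m * K < 1 / 2\<close> bounds the row sums of the difference, which is the
    contraction factor asked for.\<close>
  define K where "K = 1 / (2 * (real m + 1))"
  have K: "K > 0" by (simp add: K_def)
  have "\<exists>r>0. cube n p r \<subseteq> U \<and> (\<forall>x\<in>cube n p r. \<bar>J x i l - (if i = l then 1 else 0)\<bar> \<le> K)" if "i < m" "l < m" for i l
  proof -
    let ?d = "if i = l then 1 else (0::real)"
    have "openin (\<E> n) {x \<in> U. (\<lambda>k. if k < (1::nat) then J x i l - ?d else 0) \<in> cube 1 (\<lambda>_. 0) K}"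
      by (rule openin_preimage_E[OF U(1) openin_cube]) (use Jc[OF that(1)] in \<open>auto intro!: continuous_intros\<close>)
    moreover have "p \<in> {x \<in> U. (\<lambda>k. if k < (1::nat) then J x i l - ?d else 0) \<in> cube 1 (\<lambda>_. 0) K}"
      using U(2) B[OF that] K by (simp add: J_def cube_def)
    ultimately obtain r where r: "r > 0" "cube n p r \<subseteq> {x \<in> U. (\<lambda>k. if k < (1::nat) then J x i l - ?d else 0) \<in> cube 1 (\<lambda>_. 0) K}"
      by (rule openE_cube)
    have "x \<in> U \<and> \<bar>J x i l - ?d\<bar> \<le> K" if "x \<in> cube n p r" for x using subsetD[OF r(2) that] by (simp add: cube_def)
    then show ?thesis using r(1) by (intro exI[of _ r]) (simp add: subset_iff)
  qed
  then obtain R where R: "\<And>i l. i < m \<Longrightarrow> l < m \<Longrightarrow> R i l > 0 \<and> cube n p (R i l) \<subseteq> U \<and>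
      (\<forall>x\<in>cube n p (R i l). \<bar>J x i l - (if i = l then 1 else 0)\<bar> \<le> K)" by metis
  obtain r0 where r0: "r0 > 0" "cube n p r0 \<subseteq> U" by (rule openE_cube[OF U])
  define r where "r = Min (insert r0 ((\<lambda>(i,l). R i l) ` ({..<m} \<times> {..<m})))"
  have r: "r > 0" "r \<le> r0" "\<And>i l. i < m \<Longrightarrow> l < m \<Longrightarrow> r \<le> R i l"
  proof -
    have f: "finite (insert r0 ((\<lambda>(i,l). R i l) ` ({..<m} \<times> {..<m})))" by simp
    show "r > 0" unfolding r_def using r0(1) R by (subst Min_gr_iff[OF f]) auto
    show "r \<le> r0" unfolding r_def by (rule Min_le[OF f]) simp
    show "r \<le> R i l" if "i < m" "l < m" for i l unfolding r_def by (rule Min_le[OF f]) (use that in auto)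
  qed
  have rU: "cube n p r \<subseteq> U" using cube_mono[OF r(2)] r0(2) by blast
  have rJ: "\<bar>J x i l - (if i = l then 1 else 0)\<bar> \<le> K" if "x \<in> cube n p r" "i < m" "l < m" for x i l
    using R[OF that(2,3)] cube_mono[OF r(3)[OF that(2,3)]] that(1) by blast
  \<comment> \<open>Bounds how fast a coordinate of \<open>pt\<close> can move: with time and
    correction below \<open>\<rho> = r / C\<close> it changes by less than \<open>r\<close>. The
    summand 1 makes \<open>C\<close> positive and the inequality strict.\<close>
  define C where "C = 1 + (\<Sum>k<n. \<bar>w k\<bar> + (\<Sum>l<m. \<bar>B k l\<bar>))"
  have C1: "C \<ge> 1" unfolding C_def by (simp add: sum_nonneg)
  define \<rho> where "\<rho> = r / C"
  have \<rho>: "\<rho> > 0" "\<rho> * C = r" using r(1) C1 by (simp_all add: \<rho>_def)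
  have ptr: "pt \<tau> u \<in> cube n p r" if \<tau>: "\<bar>\<tau>\<bar> < \<rho>" and u: "\<And>l. l < m \<Longrightarrow> \<bar>u l\<bar> < \<rho>" for \<tau> u
    unfolding cube_def mem_Collect_eq
  proof (intro conjI allI impI)
    fix k assume k: "k < n"
    have "\<bar>\<tau> * w k + (\<Sum>l<m. B k l * u l)\<bar> \<le> \<bar>\<tau>\<bar> * \<bar>w k\<bar> + (\<Sum>l<m. \<bar>B k l\<bar> * \<bar>u l\<bar>)"
      using sum_abs[of "\<lambda>l. B k l * u l" "{..<m}"] abs_triangle_ineq[of "\<tau> * w k" "\<Sum>l<m. B k l * u l"] by (simp add: abs_mult)
    also have "\<dots> \<le> \<rho> * \<bar>w k\<bar> + (\<Sum>l<m. \<bar>B k l\<bar> * \<rho>)"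
      by (intro add_mono mult_right_mono sum_mono mult_left_mono) (use \<tau> u in \<open>auto intro: less_imp_le\<close>)
    also have "\<dots> = \<rho> * (\<bar>w k\<bar> + (\<Sum>l<m. \<bar>B k l\<bar>))" by (simp add: distrib_left sum_distrib_left mult.commute)
    also have "\<dots> < \<rho> * C"
    proof (rule mult_strict_left_mono[OF _ \<rho>(1)])
      have "\<bar>w k\<bar> + (\<Sum>l<m. \<bar>B k l\<bar>) \<le> (\<Sum>k<n. \<bar>w k\<bar> + (\<Sum>l<m. \<bar>B k l\<bar>))"
        using member_le_sum[of k "{..<n}" "\<lambda>k. \<bar>w k\<bar> + (\<Sum>l<m. \<bar>B k l\<bar>)"] k by (simp add: sum_nonneg)
      then show "\<bar>w k\<bar> + (\<Sum>l<m. \<bar>B k l\<bar>) < C" by (simp add: C_def)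
    qed
    finally show "\<bar>pt \<tau> u k - p k\<bar> < r" using \<rho>(2) k by (simp add: pt_def)
  qed (simp add: pt_def)
  \<comment> \<open>A fixed point \<open>u\<close> of \<open>g \<tau>\<close> is a solution of
    \<open>\<Phi> (pt \<tau> u) = \<eta> \<tau>\<close>. Its derivative in \<open>u\<close> is the
    identity minus \<open>J\<close>, which is small near \<open>p\<close>.\<close>
  define g where "g \<tau> u j = u j - (\<Phi> (pt \<tau> u) j - \<eta> \<tau> j)" for \<tau> and u :: "nat \<Rightarrow> real" and j
  have C1on: "Ck_on n (Suc 0) U (\<lambda>x. \<Phi> x j)" if "j < m" for j using \<Phi>[OF that] by (simp only: smooth_on_def)
  have contr: "\<bar>g \<tau> u j - g \<tau> u' j\<bar> \<le> D / 2"
    if \<tau>: "\<bar>\<tau>\<bar> < \<rho>" and j: "j < m" and u: "\<And>l. l < m \<Longrightarrow> \<bar>u l\<bar> < \<rho>" and u': "\<And>l. l < m \<Longrightarrow> \<bar>u' l\<bar> < \<rho>"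
      and D: "\<And>l. l < m \<Longrightarrow> \<bar>u l - u' l\<bar> \<le> D" for \<tau> j u u' D
  proof -
    define c where "c \<theta> l = u' l + \<theta> * (u l - u' l)" for \<theta> l
    have cb: "\<bar>c \<theta> l\<bar> < \<rho>" if "0 \<le> \<theta>" "\<theta> \<le> 1" "l < m" for \<theta> l
    proof -
      have "c \<theta> l = (1 - \<theta>) * u' l + \<theta> * u l" by (simp add: c_def algebra_simps)
      also have "\<bar>\<dots>\<bar> \<le> (1 - \<theta>) * \<bar>u' l\<bar> + \<theta> * \<bar>u l\<bar>"
        using abs_triangle_ineq[of "(1 - \<theta>) * u' l" "\<theta> * u l"] that by (simp add: abs_mult)
      also have "\<dots> < \<rho>" by (rule convex_bound_lt) (use u u' that in auto)
      finally show ?thesis .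
    qed
    define ptc where "ptc \<theta> = pt \<tau> (c \<theta>)" for \<theta>
    let ?d = "\<lambda>k. \<Sum>l<m. B k l * (u l - u' l)"
    let ?S = "\<lambda>\<theta>. \<Sum>k<n. pd k (\<lambda>x. \<Phi> x j) (ptc \<theta>) * ?d k"
    have inU: "ptc \<theta> \<in> cube n p r" if "0 \<le> \<theta>" "\<theta> \<le> 1" for \<theta> unfolding ptc_def by (rule ptr[OF \<tau> cb[OF that]])
    have d: "((\<lambda>\<theta>. g \<tau> (c \<theta>) j) has_real_derivative (u j - u' j) - ?S \<theta>) (at \<theta>)"
      if "0 \<le> \<theta>" "\<theta> \<le> 1" for \<theta>
    proof -
      have "((\<lambda>\<theta>. \<Phi> (ptc \<theta>) j) has_real_derivative ?S \<theta>) (at \<theta>)"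
      proof (rule has_derivative_curve[OF U(1) C1on[OF j]])
        show "ptc \<theta> \<in> U" using inU[OF that] rU by (rule subsetD[rotated])
        show "((\<lambda>\<theta>. ptc \<theta> k) has_real_derivative ?d k) (at \<theta>)" if "k < n" for k
        proof -
          have "((\<lambda>\<theta>. \<Sum>l<m. B k l * c \<theta> l) has_real_derivative ?d k) (at \<theta>)"
            unfolding c_def by (intro DERIV_sum DERIV_cmult) (auto intro!: derivative_eq_intros)
          from DERIV_add[OF DERIV_const[of "p k + \<tau> * w k"] this] show ?thesis using that by (simp add: ptc_def pt_def)
        qed
      qed (simp add: ptc_def pt_def)
      from DERIV_diff[OF this DERIV_const[of "\<eta> \<tau> j"]] have "((\<lambda>\<theta>. \<Phi> (ptc \<theta>) j - \<eta> \<tau> j) has_real_derivative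
        ?S \<theta>) (at \<theta>)" by simp
      moreover have "((\<lambda>\<theta>. c \<theta> j) has_real_derivative u j - u' j) (at \<theta>)" unfolding c_def by (auto intro!: derivative_eq_intros)
      ultimately show ?thesis unfolding g_def ptc_def[symmetric] by (rule DERIV_diff[rotated])
    qed
    from MVT2[OF zero_less_one d] obtain \<theta> where \<theta>: "0 < \<theta>" "\<theta> < 1" and
      eq: "g \<tau> (c 1) j - g \<tau> (c 0) j = (1 - 0) * ((u j - u' j) - ?S \<theta>)" by blast
    have c1: "c 1 = u" "c 0 = u'" by (simp_all add: c_def fun_eq_iff)
    have D0: "D \<ge> 0" using D[OF j] by linarith
    have "?S \<theta> = (\<Sum>l<m. J (ptc \<theta>) j l * (u l - u' l))"
      unfolding J_def sum_distrib_left sum_distrib_right by (subst sum.swap) (simp add: mult_ac)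
    moreover have "u j - u' j = (\<Sum>l<m. (if j = l then 1 else 0) * (u l - u' l))"
      using j by (simp add: sum.delta if_distrib[of "\<lambda>x. x * _"] cong: if_cong)
    ultimately have "g \<tau> u j - g \<tau> u' j = (\<Sum>l<m. ((if j = l then 1 else 0) - J (ptc \<theta>) j l) * (u l - u' l))"
      using eq by (simp add: c1 sum_subtractf[symmetric] left_diff_distrib)
    also have "\<bar>\<dots>\<bar> \<le> (\<Sum>l<m. K * D)"
    proof (rule order_trans[OF sum_abs sum_mono])
      fix l assume "l \<in> {..<m}"
      then have l: "l < m" by simp
      have "\<bar>J (ptc \<theta>) j l - (if j = l then 1 else 0)\<bar> \<le> K" using rJ[OF inU j l] \<theta> by simp
      then have "\<bar>(if j = l then 1 else 0) - J (ptc \<theta>) j l\<bar> \<le> K" by (simp only: abs_minus_commute)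
      from mult_mono[OF this D[OF l]] K show "\<bar>((if j = l then 1 else 0) - J (ptc \<theta>) j l) * (u l - u' l)\<bar> \<le> K * D" by (simp add: abs_mult)
    qed
    also have "\<dots> = (real m / (real m + 1)) * (D / 2)" by (simp add: K_def field_simps)
    also have "\<dots> \<le> 1 * (D / 2)" by (rule mult_right_mono) (use D0 in simp_all)
    finally show ?thesis by simp
  qed
  \<comment> \<open>The size of the first step of the iteration, hence half a bound for the
    correction.\<close>
  define v where "v \<tau> = (\<Sum>j<m. \<bar>g \<tau> (\<lambda>_. 0) j\<bar>)" for \<tau>
  have g0: "(\<lambda>\<tau>. g \<tau> (\<lambda>_. 0) j) 0 = 0" if "j < m" for j
  proof -
    have "pt 0 (\<lambda>_. 0) = p" using p0 by (auto simp: pt_def fun_eq_iff)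
    then show ?thesis using \<eta>0[OF that] by (simp add: g_def)
  qed
  \<comment> \<open>The image of the straight line and \<open>\<eta>\<close> have the same velocity
    at 0, so the error that is to be corrected has derivative 0.\<close>
  have gd: "((\<lambda>\<tau>. g \<tau> (\<lambda>_. 0) j) has_real_derivative 0) (at 0)" if j: "j < m" for j
  proof -
    have "pt 0 (\<lambda>_. 0) = p" using p0 by (auto simp: pt_def fun_eq_iff)
    have "((\<lambda>\<tau>. \<Phi> (pt \<tau> (\<lambda>_. 0)) j) has_real_derivative (\<Sum>k<n. pd k (\<lambda>x. \<Phi> x j) (pt 0 (\<lambda>_. 0)) * w k)) (at 0)"
    proof (rule has_derivative_curve[OF U(1) C1on[OF j]])
      show "pt 0 (\<lambda>_. 0) \<in> U" using \<open>pt 0 (\<lambda>_. 0) = p\<close> U(2) by simp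
      show "((\<lambda>\<tau>. pt \<tau> (\<lambda>_. 0) k) has_real_derivative w k) (at 0)" if "k < n" for k
        unfolding pt_def using that by (auto intro!: derivative_eq_intros)
    qed (simp add: pt_def)
    from DERIV_diff[OF \<eta>[OF j] this] show ?thesis using \<open>pt 0 (\<lambda>_. 0) = p\<close> by (simp add: g_def)
  qed
  have vd: "(v has_real_derivative 0) (at 0)"
  proof -
    have "((\<lambda>\<tau>. \<bar>g \<tau> (\<lambda>_. 0) j\<bar>) has_real_derivative 0) (at 0)" if "j < m" for j
      by (rule has_derivative_zero_of_bound[OF gd[OF that] g0[OF that], of _ 1]) simp
    then have "((\<lambda>\<tau>. \<Sum>j<m. \<bar>g \<tau> (\<lambda>_. 0) j\<bar>) has_real_derivative (\<Sum>j<m. 0)) (at 0)" by (intro DERIV_sum) simp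
    then show ?thesis by (simp add: v_def[abs_def])
  qed
  have v0: "v 0 = 0" using g0 by (simp add: v_def)
  have vpos: "v \<tau> \<ge> 0" for \<tau> by (simp add: v_def sum_nonneg)
  have fix': "\<exists>u. \<forall>j<m. \<bar>u j\<bar> \<le> 2 * v \<tau> \<and> g \<tau> u j = u j" if "\<bar>\<tau>\<bar> < \<rho>" "2 * v \<tau> < \<rho>" for \<tau>
  proof (rule sup_contraction_fixpoint[OF vpos that(2)])
    show "\<bar>g \<tau> (\<lambda>_. 0) j\<bar> \<le> v \<tau>" if "j < m" for j
      unfolding v_def using member_le_sum[of j "{..<m}" "\<lambda>j. \<bar>g \<tau> (\<lambda>_. 0) j\<bar>"] that by simp
  qed (rule contr[OF that(1)])
  define u where "u \<tau> = (SOME u. \<forall>j<m. \<bar>u j\<bar> \<le> 2 * v \<tau> \<and> g \<tau> u j = u j)" for \<tau>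
  have u: "\<forall>j<m. \<bar>u \<tau> j\<bar> \<le> 2 * v \<tau> \<and> g \<tau> (u \<tau>) j = u \<tau> j" if "\<bar>\<tau>\<bar> < \<rho>" "2 * v \<tau> < \<rho>" for \<tau>
    unfolding u_def by (rule someI_ex[OF fix'[OF that]])
  have ev: "eventually (\<lambda>\<tau>. \<bar>\<tau>\<bar> < \<rho> \<and> 2 * v \<tau> < \<rho>) (nhds 0)"
  proof -
    have "(v \<longlongrightarrow> 0) (nhds 0)" using DERIV_isCont[OF vd] tendsto_at_iff_tendsto_nhds[of v 0] v0 by (simp add: isCont_def)
    then have "eventually (\<lambda>\<tau>. v \<tau> < \<rho> / 2) (nhds 0)" by (rule order_tendstoD(2)) (use \<rho>(1) in simp)
    moreover have "eventually (\<lambda>\<tau>. \<tau> \<in> {-\<rho><..<\<rho>}) (nhds 0)" by (rule eventually_nhds_in_open) (use \<rho>(1) in simp_all)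
    ultimately show ?thesis by eventually_elim auto
  qed
  have u0: "u 0 l = 0" if "l < m" for l using u[of 0] eventually_nhds_x_imp_x[OF ev] v0 that by simp
  have ud: "((\<lambda>\<tau>. u \<tau> l) has_real_derivative 0) (at 0)" if "l < m" for l
    by (rule has_derivative_zero_of_bound[OF vd v0, of _ 2], rule eventually_mono[OF ev]) (use u that vpos in auto)
  have x0: "pt 0 (u 0) = p" using p0 u0 by (auto simp: pt_def fun_eq_iff)
  have xd: "((\<lambda>\<tau>. pt \<tau> (u \<tau>) k) has_real_derivative w k) (at 0)" if k: "k < n" for k
  proof -
    have "((\<lambda>\<tau>. \<Sum>l<m. B k l * u \<tau> l) has_real_derivative (\<Sum>l<m. B k l * 0)) (at 0)" by (intro DERIV_sum DERIV_cmult ud) simp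
    moreover have "((\<lambda>\<tau>. p k + \<tau> * w k) has_real_derivative w k) (at 0)" by (auto intro!: derivative_eq_intros)
    ultimately have "((\<lambda>\<tau>. p k + \<tau> * w k + (\<Sum>l<m. B k l * u \<tau> l)) has_real_derivative w k + (\<Sum>l<m. B k l * 0)) (at 0)"
      by (rule DERIV_add[rotated])
    then show ?thesis using k by (simp add: pt_def)
  qed
  have "eventually (\<lambda>\<tau>. pt \<tau> (u \<tau>) \<in> U \<and> (\<forall>j<m. \<Phi> (pt \<tau> (u \<tau>)) j = \<eta> \<tau> j)) (nhds 0)" using ev
  proof eventually_elim
    fix \<tau> assume \<tau>: "\<bar>\<tau>\<bar> < \<rho> \<and> 2 * v \<tau> < \<rho>"
    note u' = u[OF conjunct1[OF \<tau>] conjunct2[OF \<tau>]]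
    have "\<bar>u \<tau> l\<bar> < \<rho>" if "l < m" for l using u' that \<tau> by fastforce
    then have "pt \<tau> (u \<tau>) \<in> cube n p r" by (intro ptr) (use \<tau> in auto)
    moreover have "\<Phi> (pt \<tau> (u \<tau>)) j = \<eta> \<tau> j" if "j < m" for j using u' that by (simp add: g_def)
    ultimately show "pt \<tau> (u \<tau>) \<in> U \<and> (\<forall>j<m. \<Phi> (pt \<tau> (u \<tau>)) j = \<eta> \<tau> j)" using rU by blast
  qed
  moreover have "\<forall>\<tau>. \<forall>k\<ge>n. pt \<tau> (u \<tau>) k = 0" by (simp add: pt_def)
  ultimately show ?thesis using x0 xd by (intro exI[of _ "\<lambda>\<tau>. pt \<tau> (u \<tau>)"] conjI) simp_all
qed

subsection \<open>Tangent vectors in charts\<close>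

lemma whole_smooth_on_open:
  assumes M: "charted M" and h: "h \<in> fns (whole M)"
  shows "smooth_on_open M (mpoints M) h"
proof (rule smooth_on_openI)
  fix U \<phi> assume U: "(U, \<phi>) \<in> atlas M"
  show "smooth_on (mdim M) (\<phi> ` (U \<inter> mpoints M)) (\<lambda>x. h (inv_into U \<phi> x))"
  proof (rule smooth_on_local[OF chart_Int_image_open[OF M U openin_topspace]])
    fix y assume "y \<in> \<phi> ` (U \<inter> mpoints M)"
    then obtain p where p: "p \<in> U" "p \<in> mpoints M" "y = \<phi> p" by auto
    obtain W g where W: "openin (mtop M) W" "p \<in> W" "smooth_on_open M W g"
      "\<And>x. x \<in> W \<Longrightarrow> x \<in> mpoints M \<Longrightarrow> g x = h x"
      by (rule smooth_atE[OF presented_smooth_at[OF presented_whole h p(2)]]) blast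
    note o = chart_Int_image_open[OF M U W(1)]
    have "g (inv_into U \<phi> z) = h (inv_into U \<phi> z)" if "z \<in> \<phi> ` (U \<inter> W)" for z
    proof -
      from that obtain x where x: "x \<in> U" "x \<in> W" "z = \<phi> x" by auto
      then show ?thesis using W(4)[OF x(2)] openin_subset[OF W(1)] by (auto simp: chart_inv[OF M U])
    qed
    then have "smooth_on (mdim M) (\<phi> ` (U \<inter> W)) (\<lambda>x. h (inv_into U \<phi> x))" by (rule smooth_on_cong[OF o _ smooth_on_openD[OF W(3) U]])
    moreover have "y \<in> \<phi> ` (U \<inter> W)" using p W(2) by auto
    ultimately show "\<exists>V. openin (\<E> (mdim M)) V \<and> y \<in> V \<and> smooth_on (mdim M) V (\<lambda>x. h (inv_into U \<phi> x))"
      using o by (intro exI[of _ "\<phi> ` (U \<inter> W)"] conjI)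
  qed
qed

lemma whole_smooth_on_chart:
  assumes M: "charted M" and h: "h \<in> fns (whole M)" and U: "(U, \<phi>) \<in> atlas M"
  shows "smooth_on (mdim M) (\<phi> ` U) (\<lambda>x. h (inv_into U \<phi> x))"
  using smooth_on_openD[OF whole_smooth_on_open[OF M h] U] chart_subset[OF M U] by (simp add: Int_absorb2)

lemma openin_nonzero_preimage:
  assumes M: "charted M" and h: "h \<in> fns (whole M)"
  shows "openin (mtop M) {x \<in> mpoints M. h x \<noteq> 0}"
proof -
  have "open {y::nat\<Rightarrow>real. y 0 \<noteq> 0}" by (intro open_Collect_neq continuous_on_coordinate continuous_on_const)
  then have V: "openin (\<E> 1) ({x. \<forall>i\<ge>1. x i = 0} \<inter> {y. y 0 \<noteq> 0})" unfolding Euclidean_space_eq openin_open by blast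
  have "openin (mtop M) {x \<in> mpoints M. tuple 1 (\<lambda>_. h) x \<in> {x. \<forall>i\<ge>1. x i = 0} \<inter> {y. y 0 \<noteq> 0}}"
    by (rule tuple_preimage_open[OF M openin_topspace whole_smooth_on_open[OF M h] V])
  then show ?thesis by (simp add: tuple_def)
qed

lemma chart_partial_tangent_vector:
  assumes M: "charted M" and U: "(U, \<phi>) \<in> atlas M" "p \<in> U" and l: "l < mdim M"
  shows "tangent_vector (whole M) p (\<lambda>h. pd l (\<lambda>x. h (inv_into U \<phi> x)) (\<phi> p))"
proof (rule tangent_vectorI)
  show "p \<in> pts (whole M)" using U(2) chart_subset[OF M U(1)] by auto
  have d: "((\<lambda>t. h (inv_into U \<phi> ((\<phi> p)(l := t)))) has_real_derivative pd l (\<lambda>x. h (inv_into U \<phi> x)) (\<phi> p)) (at (\<phi> p l))"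
    if "h \<in> fns (whole M)" for h by (rule smooth_on_has_pd[OF chart_image_open[OF M U(1)] whole_smooth_on_chart[OF M that U(1)] l]) (use U(2) in simp)
  fix f g assume f: "f \<in> fns (whole M)" and g: "g \<in> fns (whole M)"
  show "pd l (\<lambda>x. a * f (inv_into U \<phi> x) + b * g (inv_into U \<phi> x)) (\<phi> p) =
     a * pd l (\<lambda>x. f (inv_into U \<phi> x)) (\<phi> p) + b * pd l (\<lambda>x. g (inv_into U \<phi> x)) (\<phi> p)" for a b
    by (rule pd_eqI[OF DERIV_add[OF DERIV_cmult[OF d[OF f]] DERIV_cmult[OF d[OF g]]]])
  show "pd l (\<lambda>x. f (inv_into U \<phi> x) * g (inv_into U \<phi> x)) (\<phi> p) =
     f p * pd l (\<lambda>x. g (inv_into U \<phi> x)) (\<phi> p) + pd l (\<lambda>x. f (inv_into U \<phi> x)) (\<phi> p) * g p"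
    using pd_eqI[OF DERIV_mult[OF d[OF f] d[OF g]]] by (simp add: chart_inv[OF M U])
qed

text \<open>The chain rule for the coordinates followed by \<open>b\<close> as one more argument. A
  nonzero \<open>b\<close> keeps the point in the chart domain; the function being differentiated is
  constant in that argument, so its partial derivative contributes 0.\<close>

lemma tangent_vector_chart:
  assumes M: "charted M" and U: "(U, \<phi>) \<in> atlas M" "p \<in> U"
    and b: "b \<in> fns (whole M)" "\<And>k. k < mdim M \<Longrightarrow> xs k \<in> fns (whole M)" "b p = 1"
      "\<And>x. b x \<noteq> 0 \<Longrightarrow> x \<in> U \<and> x \<in> mpoints M \<and> (\<forall>k<mdim M. xs k x = \<phi> x k)"
    and v: "tangent_vector (whole M) p v" and h: "h \<in> fns (whole M)"
  shows "v h = (\<Sum>k<mdim M. pd k (\<lambda>x. h (inv_into U \<phi> x)) (\<phi> p) * v (xs k))"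
proof -
  let ?n = "mdim M" and ?H = "\<lambda>x. h (inv_into U \<phi> x)"
  let ?tr = "\<lambda>y::nat\<Rightarrow>real. \<lambda>i. if i < ?n then y i else 0"
  let ?f = "\<lambda>k. if k < ?n then xs k else b"
  let ?V = "{y \<in> topspace (\<E> (Suc ?n)). ?tr y \<in> \<phi> ` U} \<inter> {y. y ?n \<noteq> 0}"
  note o = chart_image_open[OF M U(1)] and sH = whole_smooth_on_chart[OF M h U(1)]
  have N: "differential_space (whole M)" by (rule presented_differential_space[OF M presented_whole])
  have V: "openin (\<E> (Suc ?n)) ?V"
  proof -
    have "openin (\<E> (Suc ?n)) {y \<in> topspace (\<E> (Suc ?n)). ?tr y \<in> \<phi> ` U}"
      by (rule openin_preimage_E[OF openin_topspace o]) (simp_all add: continuous_on_coordinate)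
    moreover have "open {y::nat\<Rightarrow>real. y ?n \<noteq> 0}" by (intro open_Collect_neq continuous_on_coordinate continuous_on_const)
    then have "openin (\<E> (Suc ?n)) ({x. \<forall>i\<ge>Suc ?n. x i = 0} \<inter> {y. y ?n \<noteq> 0})" unfolding Euclidean_space_eq openin_open by blast
    ultimately have "openin (\<E> (Suc ?n)) ({y \<in> topspace (\<E> (Suc ?n)). ?tr y \<in> \<phi> ` U} \<inter>
       ({x. \<forall>i\<ge>Suc ?n. x i = 0} \<inter> {y. y ?n \<noteq> 0}))" by (rule openin_Int)
    then show ?thesis by (rule back_subst[where P = "openin (\<E> (Suc ?n))"]) (auto simp: topspace_Euclidean_space)
  qed
  have tr: "?tr (tuple (Suc ?n) ?f x) = \<phi> x" if "b x \<noteq> 0" for x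
    using b(4)[OF that] chart_coordinate_ge[OF M U(1), of x] by (auto simp: fun_eq_iff tuple_def)
  have trp: "?tr (tuple (Suc ?n) ?f p) = \<phi> p" by (rule tr) (simp add: b(3))
  have "v h = (\<Sum>k<Suc ?n. pd k (\<lambda>y. ?H (?tr y)) (tuple (Suc ?n) ?f p) * v (?f k))"
  proof (rule tangent_vector_chain[OF N v _ V _ _ h])
    show "?f k \<in> fns (whole M)" if "k < Suc ?n" for k using b(1,2) that by simp
    show "tuple (Suc ?n) ?f p \<in> ?V" using trp b(3) U(2) by (simp add: tuple_in_topspace tuple_less)
    show "smooth_on (Suc ?n) ?V (\<lambda>y. ?H (?tr y))" by (rule smooth_on_compose[OF V o _ _ sH]) (simp_all add: smooth_on_coordinate)
    fix x assume x: "x \<in> pts (whole M)" "tuple (Suc ?n) ?f x \<in> ?V"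
    then have "b x \<noteq> 0" by (simp add: tuple_less)
    then show "h x = ?H (?tr (tuple (Suc ?n) ?f x))" unfolding tr[OF \<open>b x \<noteq> 0\<close>] using b(4) by (simp add: chart_inv[OF M U(1)])
  qed
  moreover have "pd k (\<lambda>y. ?H (?tr y)) (tuple (Suc ?n) ?f p) = pd k ?H (\<phi> p)" if k: "k < ?n" for k
  proof -
    have "?tr ((tuple (Suc ?n) ?f p)(k := t)) = (\<phi> p)(k := t)" for t
    proof
      fix i show "?tr ((tuple (Suc ?n) ?f p)(k := t)) i = ((\<phi> p)(k := t)) i" using fun_cong[OF trp, of i] k by (cases "i = k"; cases "i < ?n") simp_all
    qed
    then have "(\<lambda>t. ?H (?tr ((tuple (Suc ?n) ?f p)(k := t)))) = (\<lambda>t. ?H ((\<phi> p)(k := t)))" by (simp only:)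
    moreover have "tuple (Suc ?n) ?f p k = \<phi> p k" using fun_cong[OF trp, of k] k by simp
    ultimately show ?thesis unfolding pd_def by (rule arg_cong2[where f = deriv])
  qed
  moreover have "pd ?n (\<lambda>y. ?H (?tr y)) (tuple (Suc ?n) ?f p) = 0"
  proof (rule pd_eqI)
    have "?tr ((tuple (Suc ?n) ?f p)(?n := t)) = \<phi> p" for t
    proof
      fix i show "?tr ((tuple (Suc ?n) ?f p)(?n := t)) i = \<phi> p i" using fun_cong[OF trp, of i] by (cases "i < ?n") simp_all
    qed
    then have "(\<lambda>t. ?H (?tr ((tuple (Suc ?n) ?f p)(?n := t)))) = (\<lambda>t. ?H (\<phi> p))" by (simp only:)
    then show "((\<lambda>t. ?H (?tr ((tuple (Suc ?n) ?f p)(?n := t)))) has_real_derivative 0) (at (tuple (Suc ?n) ?f p ?n))"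
      using DERIV_const[of "?H (\<phi> p)"] by (rule ssubst[where P = "\<lambda>f. (f has_real_derivative 0) (at _)"])
  qed
  ultimately show ?thesis by simp
qed

lemma chart_curve_velocity:
  assumes M: "charted M" and U: "(U, \<phi>) \<in> atlas M" "p \<in> U"
    and b: "b \<in> fns (whole M)" "\<And>k. k < mdim M \<Longrightarrow> xs k \<in> fns (whole M)" "b p = 1"
      "\<And>x. b x \<noteq> 0 \<Longrightarrow> x \<in> U \<and> x \<in> mpoints M \<and> (\<forall>k<mdim M. xs k x = \<phi> x k)"
    and v: "tangent_vector (whole M) p v" and h: "h \<in> fns (whole M)"
    and x: "x 0 = \<phi> p" "\<And>\<tau> k. k \<ge> mdim M \<Longrightarrow> x \<tau> k = 0"
      "\<And>k. k < mdim M \<Longrightarrow> ((\<lambda>\<tau>. x \<tau> k) has_real_derivative v (xs k)) (at 0)"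
  shows "((\<lambda>\<tau>. h (inv_into U \<phi> (x \<tau>))) has_real_derivative v h) (at 0)"
proof -
  have "Ck_on (mdim M) (Suc 0) (\<phi> ` U) (\<lambda>y. h (inv_into U \<phi> y))" using whole_smooth_on_chart[OF M h U(1)] by (simp only: smooth_on_def)
  from has_derivative_curve[OF chart_image_open[OF M U(1)] this, of x 0 "\<lambda>k. v (xs k)"]
  have "((\<lambda>\<tau>. h (inv_into U \<phi> (x \<tau>))) has_real_derivative
      (\<Sum>k<mdim M. pd k (\<lambda>x. h (inv_into U \<phi> x)) (\<phi> p) * v (xs k))) (at 0)"
    using x U(2) by simp
  moreover have "v h = (\<Sum>k<mdim M. pd k (\<lambda>x. h (inv_into U \<phi> x)) (\<phi> p) * v (xs k))"
    by (rule tangent_vector_chart[where b = b, OF M U b v h])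
  ultimately show ?thesis by simp
qed

text \<open>A straight line in a chart whose velocity has the components
  \<open>v (xs k)\<close>.\<close>

lemma curve_of_tangent_vector:
  assumes M: "is_manifold M" and v: "tangent_vector (whole M) p v"
  obtains c where "c 0 = p" "eventually (\<lambda>\<tau>. c \<tau> \<in> mpoints M) (nhds 0)"
    "\<And>h. h \<in> fns (whole M) \<Longrightarrow> ((\<lambda>\<tau>. h (c \<tau>)) has_real_derivative v h) (at 0)"
proof -
  note cM = is_manifold_charted[OF M]
  have pM: "p \<in> mpoints M" using tangent_vector_pts[OF v] by simp
  from charted_obtain[OF cM this] obtain U \<phi> where U: "(U, \<phi>) \<in> atlas M" "p \<in> U" .
  obtain b xs where b: "b \<in> fns (whole M)" "\<And>k. k < mdim M \<Longrightarrow> xs k \<in> fns (whole M)" "b p = 1"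
    "\<And>x. b x \<noteq> 0 \<Longrightarrow> x \<in> U \<and> x \<in> mpoints M \<and> (\<forall>k<mdim M. xs k x = \<phi> x k)"
    by (rule chart_functions[OF M U(1) openin_topspace U(2) pM]) blast
  define x where "x \<tau> = (\<lambda>k. if k < mdim M then \<phi> p k + \<tau> * v (xs k) else 0)" for \<tau>
  have x0: "x 0 = \<phi> p" using chart_coordinate_ge[OF cM U] by (auto simp: x_def fun_eq_iff)
  have xz: "x \<tau> k = 0" if "k \<ge> mdim M" for \<tau> k using that by (simp add: x_def)
  have xd: "((\<lambda>\<tau>. x \<tau> k) has_real_derivative v (xs k)) (at 0)" if "k < mdim M" for k
    unfolding x_def using that by (auto intro!: derivative_eq_intros)
  have "eventually (\<lambda>\<tau>. x \<tau> \<in> \<phi> ` U) (nhds 0)"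
  proof (rule eventually_in_openE[OF chart_image_open[OF cM U(1)]])
    show "\<phi> p \<in> \<phi> ` U" using U(2) by simp
    show "((\<lambda>\<tau>. x \<tau> k) \<longlongrightarrow> \<phi> p k) (nhds 0)" if "k < mdim M" for k
      using DERIV_isCont[OF xd[OF that]] tendsto_at_iff_tendsto_nhds[of "\<lambda>\<tau>. x \<tau> k" 0] x0 by (simp add: isCont_def)
  qed (simp add: xz)
  then have "eventually (\<lambda>\<tau>. inv_into U \<phi> (x \<tau>) \<in> mpoints M) (nhds 0)"
  proof eventually_elim
    fix \<tau> assume "x \<tau> \<in> \<phi> ` U"
    from inv_into_into[OF this] show "inv_into U \<phi> (x \<tau>) \<in> mpoints M" using chart_subset[OF cM U(1)] by (rule subsetD[rotated])
  qed
  then show ?thesis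
  proof (rule that[rotated])
    show "inv_into U \<phi> (x 0) = p" by (simp add: x0 chart_inv[OF cM U])
    show "((\<lambda>\<tau>. h (inv_into U \<phi> (x \<tau>))) has_real_derivative v h) (at 0)" if "h \<in> fns (whole M)" for h
      by (rule chart_curve_velocity[where xs = xs and b = b and x = x, OF cM U b v that x0 xz xd])
  qed
qed

lemma eventually_nonzero_curve:
  assumes "((\<lambda>\<tau>. h (c \<tau>)) has_real_derivative d) (at 0)" "h (c 0) \<noteq> (0::real)"
  shows "eventually (\<lambda>\<tau>. h (c \<tau>) \<noteq> 0) (nhds (0::real))"
proof -
  have "((\<lambda>\<tau>. h (c \<tau>)) \<longlongrightarrow> h (c 0)) (nhds 0)"
    using DERIV_isCont[OF assms(1)] tendsto_at_iff_tendsto_nhds[of "\<lambda>\<tau>. h (c \<tau>)" 0] by (simp add: isCont_def)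
  then show ?thesis using assms(2) by (rule tendsto_imp_eventually_ne)
qed

text \<open>A curve in the base whose velocity is the image of \<open>w\<close> lifts to a curve
  with velocity \<open>w\<close>. Submersions are given by surjectivity on tangent vectors, and
  lifts \<open>v l\<close> of the coordinate vectors at \<open>T g\<close> supply the right inverse
  of the derivative in charts that the Euclidean lifting takes as \<open>B\<close>.\<close>

lemma submersion_lift_curve:
  assumes M: "is_manifold M" and Q: "is_manifold Q" and T: "submersion M Q T" and w: "tangent_vector (whole M) g w"
    and y0: "y 0 = T g" and y: "\<And>k. k \<in> fns (whole Q) \<Longrightarrow>
       ((\<lambda>\<tau>. k (y \<tau>)) has_real_derivative w (pullback (whole M) T k)) (at 0)"
  obtains c where "c 0 = g" "eventually (\<lambda>\<tau>. c \<tau> \<in> mpoints M \<and> T (c \<tau>) = y \<tau>) (nhds 0)"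
    "\<And>h. h \<in> fns (whole M) \<Longrightarrow> ((\<lambda>\<tau>. h (c \<tau>)) has_real_derivative w h) (at 0)"
proof -
  note cM = is_manifold_charted[OF M] and cQ = is_manifold_charted[OF Q]
  let ?n = "mdim M" and ?m = "mdim Q"
  have smT: "smooth_between (whole M) (whole Q) T"
    by (rule smooth_map_smooth_between[OF cM presented_whole cQ]) (use T in \<open>simp_all add: submersion_def\<close>)
  note Tp = smooth_between_fns[OF smT]
  have gM: "g \<in> mpoints M" using tangent_vector_pts[OF w] by simp
  then have TgQ: "T g \<in> topspace (mtop Q)" using smooth_between_pts[OF smT] by simp
  from charted_obtain[OF cM gM] obtain U \<phi> where U: "(U, \<phi>) \<in> atlas M" "g \<in> U" .
  from charted_obtain[OF cQ TgQ] obtain V \<psi> where V: "(V, \<psi>) \<in> atlas Q" "T g \<in> V" .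
  obtain b xs where b: "b \<in> fns (whole M)" "\<And>k. k < ?n \<Longrightarrow> xs k \<in> fns (whole M)" "b g = 1"
    "\<And>x. b x \<noteq> 0 \<Longrightarrow> x \<in> U \<and> x \<in> mpoints M \<and> (\<forall>k<?n. xs k x = \<phi> x k)"
    by (rule chart_functions[OF M U(1) openin_topspace U(2) gM]) blast
  obtain b' ys where b': "b' \<in> fns (whole Q)" "\<And>k. k < ?m \<Longrightarrow> ys k \<in> fns (whole Q)" "b' (T g) = 1"
    "\<And>x. b' x \<noteq> 0 \<Longrightarrow> x \<in> V \<and> x \<in> topspace (mtop Q) \<and> (\<forall>k<?m. ys k x = \<psi> x k)"
    by (rule chart_functions[OF Q V(1) openin_topspace V(2) TgQ]) blast
  define Ty where "Ty j = pullback (whole M) T (ys j)" for j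
  have Ty: "Ty j \<in> fns (whole M)" if "j < ?m" for j unfolding Ty_def by (rule Tp[OF b'(2)[OF that]])
  define \<Phi> where "\<Phi> x j = Ty j (inv_into U \<phi> x)" for x j
  have \<Phi>: "smooth_on ?n (\<phi> ` U) (\<lambda>x. \<Phi> x j)" if "j < ?m" for j
    unfolding \<Phi>_def by (rule whole_smooth_on_chart[OF cM Ty[OF that] U(1)])
  have "\<exists>v. tangent_vector (whole M) g v \<and>
      (\<forall>h\<in>fns (whole Q). v (pullback (whole M) T h) = pd l (\<lambda>x. h (inv_into V \<psi> x)) (\<psi> (T g)))" if "l < ?m" for l
    using T gM chart_partial_tangent_vector[OF cQ V that] unfolding submersion_def by blast
  then obtain v where v: "\<And>l. l < ?m \<Longrightarrow> tangent_vector (whole M) g (v l)"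
    "\<And>l h. l < ?m \<Longrightarrow> h \<in> fns (whole Q) \<Longrightarrow> v l (pullback (whole M) T h) = pd l (\<lambda>x. h (inv_into V \<psi> x)) (\<psi> (T g))"
    by metis
  \<comment> \<open>Near \<open>T g\<close> the function \<open>ys i\<close> is the i-th coordinate,
    so its partial derivatives there form the identity matrix.\<close>
  have pdy: "pd l (\<lambda>x. ys i (inv_into V \<psi> x)) (\<psi> (T g)) = (if i = l then 1 else 0)" if "i < ?m" "l < ?m" for i l
  proof -
    let ?W = "{x \<in> topspace (mtop Q). b' x \<noteq> 0}"
    have o: "openin (\<E> ?m) (\<psi> ` (V \<inter> ?W))" by (rule chart_Int_image_open[OF cQ V(1) openin_nonzero_preimage[OF cQ b'(1)]])
    have "pd l (\<lambda>x. ys i (inv_into V \<psi> x)) (\<psi> (T g)) = pd l (\<lambda>x. x i) (\<psi> (T g))"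
    proof (rule pd_cong[OF o _ that(2)])
      show "\<psi> (T g) \<in> \<psi> ` (V \<inter> ?W)" using V(2) TgQ b'(3) by auto
      fix z assume "z \<in> \<psi> ` (V \<inter> ?W)"
      then obtain x where x: "x \<in> V" "b' x \<noteq> 0" "z = \<psi> x" by auto
      then show "ys i (inv_into V \<psi> z) = z i" using b'(4)[OF x(2)] that(1) by (simp add: chart_inv[OF cQ V(1)])
    qed
    also have "\<dots> = (if i = l then 1 else 0)" by (rule pd_eqI) (cases "i = l", auto intro!: derivative_eq_intros)
    finally show ?thesis .
  qed
  have B: "(\<Sum>k<?n. pd k (\<lambda>x. \<Phi> x i) (\<phi> g) * v l (xs k)) = (if i = l then 1 else 0)" if "i < ?m" "l < ?m" for i l
  proof -
    have "v l (Ty i) = (\<Sum>k<?n. pd k (\<lambda>x. \<Phi> x i) (\<phi> g) * v l (xs k))"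
      unfolding \<Phi>_def by (rule tangent_vector_chart[where b = b, OF cM U b v(1)[OF that(2)] Ty[OF that(1)]])
    moreover have "v l (Ty i) = (if i = l then 1 else 0)" unfolding Ty_def v(2)[OF that(2) b'(2)[OF that(1)]] by (rule pdy[OF that])
    ultimately show ?thesis by simp
  qed
  have \<eta>: "((\<lambda>\<tau>. ys j (y \<tau>)) has_real_derivative (\<Sum>k<?n. pd k (\<lambda>x. \<Phi> x j) (\<phi> g) * w (xs k))) (at 0)" if j: "j < ?m" for j
  proof -
    have "w (Ty j) = (\<Sum>k<?n. pd k (\<lambda>x. \<Phi> x j) (\<phi> g) * w (xs k))"
      unfolding \<Phi>_def by (rule tangent_vector_chart[where b = b, OF cM U b w Ty[OF j]])
    then show ?thesis using y[OF b'(2)[OF j]] by (simp only: Ty_def)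
  qed
  have g0: "ys j (y 0) = \<Phi> (\<phi> g) j" for j using gM by (simp add: \<Phi>_def Ty_def y0 chart_inv[OF cM U] pullback_apply)
  have pU: "\<phi> g \<in> \<phi> ` U" using U(2) by simp
  have "\<exists>x. x 0 = \<phi> g \<and> (\<forall>\<tau>. \<forall>k\<ge>?n. x \<tau> k = 0) \<and>
     eventually (\<lambda>\<tau>. x \<tau> \<in> \<phi> ` U \<and> (\<forall>j<?m. \<Phi> (x \<tau>) j = ys j (y \<tau>))) (nhds 0) \<and>
     (\<forall>k<?n. ((\<lambda>\<tau>. x \<tau> k) has_real_derivative w (xs k)) (at 0))"
    by (rule lift_curve_Euclidean[where \<Phi> = \<Phi> and B = "\<lambda>k l. v l (xs k)" and \<eta> = "\<lambda>\<tau> j. ys j (y \<tau>)",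
        OF chart_image_open[OF cM U(1)] pU \<Phi> B g0 \<eta>])
  then obtain x where x: "x 0 = \<phi> g" "\<forall>\<tau>. \<forall>k\<ge>?n. x \<tau> k = 0"
     "eventually (\<lambda>\<tau>. x \<tau> \<in> \<phi> ` U \<and> (\<forall>j<?m. \<Phi> (x \<tau>) j = ys j (y \<tau>))) (nhds 0)"
     "\<forall>k<?n. ((\<lambda>\<tau>. x \<tau> k) has_real_derivative w (xs k)) (at 0)" by (elim exE conjE)
  define c where "c \<tau> = inv_into U \<phi> (x \<tau>)" for \<tau>
  have c0: "c 0 = g" by (simp add: c_def x(1) chart_inv[OF cM U])
  have cd: "((\<lambda>\<tau>. h (c \<tau>)) has_real_derivative w h) (at 0)" if "h \<in> fns (whole M)" for h
    unfolding c_def by (rule chart_curve_velocity[where xs = xs and b = b and x = x, OF cM U b w that x(1)]) (use x in simp_all)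
  \<comment> \<open>Both \<open>T (c \<tau>)\<close> and \<open>y \<tau>\<close> have to stay where
    \<open>b'\<close> is nonzero, because only there equality of the functions \<open>ys\<close>
    means equality of coordinates and hence of points.\<close>
  have "eventually (\<lambda>\<tau>. pullback (whole M) T b' (c \<tau>) \<noteq> 0) (nhds 0)"
    by (rule eventually_nonzero_curve[where h = "pullback (whole M) T b'", OF cd[OF Tp[OF b'(1)]]])
      (use gM b'(3) in \<open>simp add: c0 pullback_apply\<close>)
  moreover have "eventually (\<lambda>\<tau>. b' (y \<tau>) \<noteq> 0) (nhds 0)"
    by (rule eventually_nonzero_curve[where h = b', OF y[OF b'(1)]]) (simp add: y0 b'(3))
  ultimately have "eventually (\<lambda>\<tau>. c \<tau> \<in> mpoints M \<and> T (c \<tau>) = y \<tau>) (nhds 0)" using x(3)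
  proof eventually_elim
    fix \<tau> assume *: "pullback (whole M) T b' (c \<tau>) \<noteq> 0" "b' (y \<tau>) \<noteq> 0"
      "x \<tau> \<in> \<phi> ` U \<and> (\<forall>j<?m. \<Phi> (x \<tau>) j = ys j (y \<tau>))"
    have cU: "c \<tau> \<in> mpoints M" using *(3) chart_subset[OF cM U(1)] unfolding c_def by (meson inv_into_into subsetD)
    then have "b' (T (c \<tau>)) \<noteq> 0" using *(1) by (simp add: pullback_apply)
    note Tc = b'(4)[OF this] and yc = b'(4)[OF *(2)]
    have "\<psi> (T (c \<tau>)) j = \<psi> (y \<tau>) j" for j
    proof (cases "j < ?m")
      case True
      have "ys j (T (c \<tau>)) = \<Phi> (x \<tau>) j" using cU by (simp add: \<Phi>_def c_def[symmetric] Ty_def pullback_apply)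
      also have "\<dots> = ys j (y \<tau>)" using *(3) True by simp
      finally show ?thesis using Tc yc True by simp
    qed (use Tc yc chart_coordinate_ge[OF cQ V(1)] in simp)
    then have "\<psi> (T (c \<tau>)) = \<psi> (y \<tau>)" by (rule ext)
    then have "T (c \<tau>) = y \<tau>" using inj_onD[OF chart_inj[OF cQ V(1)]] Tc yc by simp
    then show "c \<tau> \<in> mpoints M \<and> T (c \<tau>) = y \<tau>" using cU by simp
  qed
  then show ?thesis using c0 cd by (intro that)
qed

section \<open>Lie groupoids and their nerves\<close>

lemma smooth_at_cong: "smooth_at M S p f \<Longrightarrow> (\<And>x. x \<in> S \<Longrightarrow> f x = g x) \<Longrightarrow> smooth_at M S p g"
  by (simp add: smooth_at_def)

lemma smooth_between_id: "differential_space N \<Longrightarrow> smooth_between N N (\<lambda>x. x)"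
proof -
  assume N: "differential_space N"
  have "pullback N (\<lambda>x. x) h = h" if "h \<in> fns N" for h using fns_outside[OF N that] by (simp add: pullback_def fun_eq_iff)
  then show ?thesis by (simp add: smooth_between_def)
qed

lemma smooth_between_const: "differential_space N \<Longrightarrow> p \<in> pts N' \<Longrightarrow> smooth_between N N' (\<lambda>_. p)"
  by (simp add: smooth_between_def pullback_def fns_const)

lemma pullback_cong: "(\<And>x. x \<in> pts N \<Longrightarrow> f (F x) = f' (F' x)) \<Longrightarrow> pullback N F f = pullback N F' f'"
  by (simp add: pullback_def fun_eq_iff)

lemma pullback_eqI: "differential_space N \<Longrightarrow> g \<in> fns N \<Longrightarrow> (\<And>x. x \<in> pts N \<Longrightarrow> f (F x) = g x) \<Longrightarrow> pullback N F f = g"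
  by (simp add: pullback_def fun_eq_iff fns_outside)

lemma relatedD: "related N N' F D D' \<Longrightarrow> h \<in> fns N' \<Longrightarrow> D (pullback N F h) = pullback N F (D' h)"
  by (simp add: related_def)

lemma last_vertex_Nil [simp]: "last_vertex G (x, []) = x" by (simp add: last_vertex_def)

lemma last_vertex_Cons [simp]: "last_vertex G (x, g # gs) = last_vertex G (src G g, gs)" by (simp add: last_vertex_def)

lemma last_vertex_append [simp]: "last_vertex G (x, gs @ hs) = last_vertex G (last_vertex G (x, gs), hs)"
  by (induction gs arbitrary: x) simp_all

text \<open>The recursion carries the vertex at which the string starts. Concatenation then splits
  at the last vertex of the first part, and the empty string over an object needs no separate
  treatment.\<close>

primrec composable :: "('m, 'g) groupoid \<Rightarrow> 'm \<Rightarrow> 'g list \<Rightarrow> bool" where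
  "composable G x [] \<longleftrightarrow> x \<in> objs G"
| "composable G x (g # gs) \<longleftrightarrow> g \<in> arrows G \<and> tgt G g = x \<and> composable G (src G g) gs"

lemma face_0: "face G 0 (x, g # gs) = (src G g, gs)" by (simp add: face_def)

lemma face_last: "face G (Suc (length gs)) (x, gs @ [g]) = (x, gs)" by (simp add: face_def)

lemma face_mid: "face G (Suc (length u)) (x, u @ a # b # v) = (x, u @ mul G a b # v)" by (simp add: face_def Let_def nth_append)

lemma degeneracy_append: "degeneracy G (length u) (x, u @ v) = (x, u @ idt G (last_vertex G (x, u)) # v)" by (simp add: degeneracy_def)

lemma list_split_at:
  assumes "0 < i" "i < length gs"
  obtains u a b v where "gs = u @ a # b # v" "i = Suc (length u)"
proof -
  obtain j where j: "i = Suc j" using assms(1) by (cases i) auto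
  have "gs = take j gs @ gs ! j # gs ! Suc j # drop (Suc (Suc j)) gs" using assms(2) j by (metis Cons_nth_drop_Suc Suc_lessD append_take_drop_id)
  then show ?thesis using assms(2) j by (intro that[of "take j gs" "gs ! j" "gs ! Suc j"]) simp_all
qed

locale lie_groupoid_locale =
  fixes G :: "('m, 'g) groupoid"
  assumes G: "lie_groupoid G"
begin

abbreviation (input) "s \<equiv> src G"
abbreviation (input) "t \<equiv> tgt G"
abbreviation (input) "e \<equiv> idt G"
abbreviation (input) "lv x gs \<equiv> last_vertex G (x, gs)"
abbreviation (input) "\<N> \<equiv> nerve G"
abbreviation (input) "\<F> \<equiv> tfibre G"
abbreviation (input) "\<I> q \<equiv> restrict_last G (Suc q)"
abbreviation (input) "\<C> \<equiv> normalized G"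
abbreviation (input) "\<V> \<equiv> van_est G"
abbreviation (input) "\<M> \<equiv> mult_lift G"
abbreviation (input) "\<X> \<equiv> last_lift G"
abbreviation (input) "\<P> \<equiv> cochain_prod G"
abbreviation (input) "\<A> \<equiv> whole (Arr G)"
abbreviation (input) "\<O> \<equiv> whole (Obj G)"

lemma manifold_obj: "is_manifold (Obj G)" using G unfolding lie_groupoid_def by (elim conjE)

lemma manifold_arr: "is_manifold (Arr G)" using G unfolding lie_groupoid_def by (elim conjE)

lemma submersion_src: "submersion (Arr G) (Obj G) s" using G unfolding lie_groupoid_def by (elim conjE)

lemma submersion_tgt: "submersion (Arr G) (Obj G) t" using G unfolding lie_groupoid_def by (elim conjE)

lemma charted_obj: "charted (Obj G)" and charted_arr: "charted (Arr G)"
  by (rule is_manifold_charted[OF manifold_obj], rule is_manifold_charted[OF manifold_arr])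

lemma ds_obj: "differential_space \<O>" and ds_arr: "differential_space \<A>"
  by (rule presented_differential_space[OF charted_obj presented_whole],
      rule presented_differential_space[OF charted_arr presented_whole])

lemma smooth_src: "smooth_between \<A> \<O> s" by (rule smooth_map_smooth_between[OF charted_arr presented_whole charted_obj])
    (use submersion_src in \<open>simp_all add: submersion_def\<close>)

lemma smooth_tgt: "smooth_between \<A> \<O> t" by (rule smooth_map_smooth_between[OF charted_arr presented_whole charted_obj])
    (use submersion_tgt in \<open>simp_all add: submersion_def\<close>)

lemma smooth_idt: "smooth_between \<O> \<A> e"
proof (rule smooth_map_smooth_between[OF charted_obj presented_whole charted_arr])
  show "smooth_map (Obj G) (objs G) (Arr G) e" using G unfolding lie_groupoid_def by (elim conjE)
qed simp

lemma src_obj [simp]: "g \<in> arrows G \<Longrightarrow> s g \<in> objs G" and tgt_obj [simp]: "g \<in> arrows G \<Longrightarrow> t g \<in> objs G"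
  and idt_arr [simp]: "x \<in> objs G \<Longrightarrow> e x \<in> arrows G"
  using smooth_between_pts[OF smooth_src] smooth_between_pts[OF smooth_tgt] smooth_between_pts[OF smooth_idt] by simp_all

lemma src_idt [simp]: "x \<in> objs G \<Longrightarrow> s (e x) = x" and tgt_idt [simp]: "x \<in> objs G \<Longrightarrow> t (e x) = x"
proof -
  have "\<forall>x\<in>objs G. s (e x) = x \<and> t (e x) = x" using G unfolding lie_groupoid_def by (elim conjE)
  then show "x \<in> objs G \<Longrightarrow> s (e x) = x" "x \<in> objs G \<Longrightarrow> t (e x) = x" by simp_all
qed

lemma src_mul [simp]: "g \<in> arrows G \<Longrightarrow> h \<in> arrows G \<Longrightarrow> s g = t h \<Longrightarrow> s (mul G g h) = s h"
  and tgt_mul [simp]: "g \<in> arrows G \<Longrightarrow> h \<in> arrows G \<Longrightarrow> s g = t h \<Longrightarrow> t (mul G g h) = t g"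
proof -
  have "\<forall>g\<in>arrows G. \<forall>h\<in>arrows G. s g = t h \<longrightarrow> s (mul G g h) = s h \<and> t (mul G g h) = t g"
    using G unfolding lie_groupoid_def by (elim conjE)
  then show "g \<in> arrows G \<Longrightarrow> h \<in> arrows G \<Longrightarrow> s g = t h \<Longrightarrow> s (mul G g h) = s h"
    "g \<in> arrows G \<Longrightarrow> h \<in> arrows G \<Longrightarrow> s g = t h \<Longrightarrow> t (mul G g h) = t g" by simp_all
qed

lemma mul_idt_left [simp]: "g \<in> arrows G \<Longrightarrow> mul G (e (t g)) g = g"
  and mul_idt_right [simp]: "g \<in> arrows G \<Longrightarrow> mul G g (e (s g)) = g"
proof -
  have "\<forall>g\<in>arrows G. mul G (e (t g)) g = g \<and> mul G g (e (s g)) = g" using G unfolding lie_groupoid_def by (elim conjE)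
  then show "g \<in> arrows G \<Longrightarrow> mul G (e (t g)) g = g" "g \<in> arrows G \<Longrightarrow> mul G g (e (s g)) = g" by simp_all
qed

subsection \<open>Composable strings\<close>

lemma composable_obj: "composable G x gs \<Longrightarrow> x \<in> objs G" by (cases gs) auto

lemma composable_append [simp]: "composable G x (gs @ hs) \<longleftrightarrow> composable G x gs \<and> composable G (lv x gs) hs"
  by (induction gs arbitrary: x) (auto dest: composable_obj)

lemma composable_last_obj: "composable G x gs \<Longrightarrow> lv x gs \<in> objs G" using composable_append[of x gs "[]"] by simp

lemma composable_iff_strings:
  "gs \<noteq> [] \<Longrightarrow> composable G x gs \<longleftrightarrow> x = t (hd gs) \<and> gs \<in> strings G (length gs)"
proof (induction gs arbitrary: x)
  case (Cons g gs)
  show ?case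
  proof (cases gs)
    case Nil
    then show ?thesis by (auto simp: strings_def)
  next
    case (Cons h hs)
    have "(\<forall>i. Suc i < length (g # gs) \<longrightarrow> s ((g # gs) ! i) = t ((g # gs) ! Suc i)) \<longleftrightarrow>
       s g = t (hd gs) \<and> (\<forall>i. Suc i < length gs \<longrightarrow> s (gs ! i) = t (gs ! Suc i))" (is "?L \<longleftrightarrow> ?R")
    proof
      assume L: ?L
      show ?R
      proof (intro conjI allI impI)
        show "s g = t (hd gs)" using L[rule_format, of 0] Cons by simp
        show "s (gs ! i) = t (gs ! Suc i)" if "Suc i < length gs" for i using L[rule_format, of "Suc i"] that by simp
      qed
    next
      assume R: ?R
      show ?L
      proof (intro allI impI)
        fix i assume "Suc i < length (g # gs)"
        then show "s ((g # gs) ! i) = t ((g # gs) ! Suc i)" using R Cons by (cases i) simp_all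
      qed
    qed
    moreover have "composable G (s g) gs \<longleftrightarrow> s g = t (hd gs) \<and> gs \<in> strings G (length gs)" using Cons.IH Cons by simp
    ultimately show ?thesis by (auto simp: strings_def)
  qed
qed simp

lemma nerve_pts_iff [simp]: "(x, gs) \<in> nerve_pts G q \<longleftrightarrow> length gs = q \<and> composable G x gs"
proof (cases "q = 0")
  case True
  then show ?thesis by (auto simp: nerve_pts_def)
next
  case False
  then have "(x, gs) \<in> nerve_pts G q \<longleftrightarrow> x = t (hd gs) \<and> gs \<in> strings G q" by (simp add: nerve_pts_def)
  also have "\<dots> \<longleftrightarrow> length gs = q \<and> composable G x gs"
  proof (cases "length gs = q")
    case True
    then have "gs \<noteq> []" using False by auto
    from composable_iff_strings[OF this, of x] show ?thesis using True by simp
  qed (auto simp: strings_def)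
  finally show ?thesis .
qed

lemma pts_nerve [simp]: "pts (\<N> q) = nerve_pts G q" by (simp add: nerve_def)

lemma nerve_ptsE:
  assumes "z \<in> nerve_pts G q"
  obtains x gs where "z = (x, gs)" "length gs = q" "composable G x gs" using assms by (cases z) auto

lemma presented_nerve_0: "presented (\<N> 0) (Obj G) (objs G) (\<lambda>x. (x, []))" by (auto simp: presented_def nerve_def nerve_pts_def)

lemma presented_nerve:
  assumes "q > 0"
  shows "presented (\<N> q) (mpower q (Arr G)) (strings G q) (\<lambda>gs. (t (hd gs), gs))"
  using assms by (auto simp: presented_def nerve_def nerve_pts_def topspace_mpower strings_def)

lemma ds_nerve: "differential_space (\<N> q)"
proof (cases "q = 0")
  case True
  then show ?thesis using presented_differential_space[OF charted_obj presented_nerve_0] by simp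
next
  case False
  then show ?thesis using presented_differential_space[OF charted_mpower[OF charted_arr] presented_nerve] by simp
qed

lemma smooth_component: "i < q \<Longrightarrow> smooth_between (\<N> q) \<A> (component i)"
  using smooth_between_component[OF charted_arr presented_nerve[of q], of snd i] by (simp add: component_def[abs_def])

definition component_functions :: "nat \<Rightarrow> (('m, 'g) nsimplex \<Rightarrow> real) set" where
  "component_functions q = {pullback (\<N> q) (component i) h | i h. i < q \<and> h \<in> fns \<A>}"

lemma component_functionsE:
  assumes "k \<in> component_functions q"
  obtains i h where "k = pullback (\<N> q) (component i) h" "i < q" "h \<in> fns \<A>" using assms by (auto simp: component_functions_def)

lemma generated_nerve: "q > 0 \<Longrightarrow> generated_by (\<N> q) (component_functions q)"
  using generated_by_components[OF manifold_arr presented_nerve[of q], of snd] by (simp add: component_functions_def component_def[abs_def])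

section \<open>Smooth maps into and between the spaces of composable strings\<close>

lemma smooth_into_nerve:
  assumes N: "differential_space N" and q: "q > 0" and F: "\<And>z. z \<in> pts N \<Longrightarrow> F z \<in> nerve_pts G q"
    and c: "\<And>i. i < q \<Longrightarrow> \<exists>c. smooth_between N \<A> c \<and> (\<forall>z\<in>pts N. component i (F z) = c z)"
  shows "smooth_between N (\<N> q) F"
proof (rule smooth_between_generated[OF N generated_nerve[OF q]])
  show "F z \<in> pts (\<N> q)" if "z \<in> pts N" for z using F[OF that] by simp
  fix k assume "k \<in> component_functions q"
  then obtain i h where k: "k = pullback (\<N> q) (component i) h" "i < q" "h \<in> fns \<A>" by (rule component_functionsE)
  obtain c where c: "smooth_between N \<A> c" "\<And>z. z \<in> pts N \<Longrightarrow> component i (F z) = c z" using c[OF k(2)] by blast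
  have "pullback N F k = pullback N c h" unfolding k(1) using F c(2) by (simp add: pullback_def fun_eq_iff)
  then show "pullback N F k \<in> fns N" using smooth_between_fns[OF c(1) k(3)] by simp
qed

lemma smooth_fst_0: "smooth_between (\<N> 0) \<O> fst" unfolding smooth_between_def
proof (intro conjI ballI)
  show "fst z \<in> pts \<O>" if "z \<in> pts (\<N> 0)" for z using that by (cases z) auto
  fix h assume h: "h \<in> fns \<O>"
  show "pullback (\<N> 0) fst h \<in> fns (\<N> 0)"
  proof (rule presented_fnsI[OF presented_nerve_0])
    show "pullback (\<N> 0) fst h z = 0" if "z \<notin> pts (\<N> 0)" for z using that by (rule pullback_outside)
    show "smooth_at (Obj G) (objs G) p (\<lambda>x. pullback (\<N> 0) fst h (x, []))" if "p \<in> objs G" for p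
      by (rule smooth_at_cong[OF presented_smooth_at[OF presented_whole h that]]) (simp add: pullback_def)
  qed
qed

lemma smooth_vertex: "smooth_between \<O> (\<N> 0) (\<lambda>x. (x, []))" unfolding smooth_between_def
proof (intro conjI ballI)
  show "(x, []) \<in> pts (\<N> 0)" if "x \<in> pts \<O>" for x using that by simp
  fix h assume h: "h \<in> fns (\<N> 0)"
  show "pullback \<O> (\<lambda>x. (x, [])) h \<in> fns \<O>"
  proof (rule presented_fnsI[OF presented_whole])
    show "pullback \<O> (\<lambda>x. (x, [])) h z = 0" if "z \<notin> pts \<O>" for z using that by (rule pullback_outside)
    show "smooth_at (Obj G) (objs G) p (pullback \<O> (\<lambda>x. (x, [])) h)" if "p \<in> objs G" for p
      by (rule smooth_at_cong[OF presented_smooth_at[OF presented_nerve_0 h that]]) (simp add: pullback_def)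
  qed
qed

lemma smooth_into_nerve_0:
  assumes N: "differential_space N" and F: "\<And>z. z \<in> pts N \<Longrightarrow> F z \<in> nerve_pts G 0"
    and c: "smooth_between N \<O> c" "\<And>z. z \<in> pts N \<Longrightarrow> fst (F z) = c z"
  shows "smooth_between N (\<N> 0) F"
proof (rule smooth_between_cong[OF smooth_between_comp[OF c(1) smooth_vertex]])
  fix z assume "z \<in> pts N"
  then show "(c z, []) = F z" using F[of z] c(2)[of z] by (cases "F z") simp
qed

lemma component_append [simp]:
  "i < length gs \<Longrightarrow> component i (x, gs @ hs) = component i (y, gs)"
  "component (length gs) (x, gs @ h # hs) = h" by (simp_all add: component_def nth_append)

lemma smooth_mul: "smooth_between (\<N> 2) \<A> (\<lambda>z. mul G (component 0 z) (component 1 z))"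
proof (rule smooth_map_smooth_between[OF charted_mpower[OF charted_arr] presented_nerve charted_arr])
  show "smooth_map (mpower 2 (Arr G)) (strings G 2) (Arr G) (\<lambda>gs. mul G (gs ! 0) (gs ! 1))" using G unfolding lie_groupoid_def by (elim conjE)
qed (simp_all add: component_def)

lemma mul_arr [simp]: "g \<in> arrows G \<Longrightarrow> h \<in> arrows G \<Longrightarrow> s g = t h \<Longrightarrow> mul G g h \<in> arrows G"
  using smooth_between_pts[OF smooth_mul, of "(t g, [g, h])"] by (simp add: component_def)

lemma smooth_pair:
  assumes N: "differential_space N" and a: "smooth_between N \<A> a" and b: "smooth_between N \<A> b"
    and c: "\<And>z. z \<in> pts N \<Longrightarrow> s (a z) = t (b z)"
  shows "smooth_between N (\<N> 2) (\<lambda>z. (t (a z), [a z, b z]))"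
proof (rule smooth_into_nerve[OF N])
  show "(t (a z), [a z, b z]) \<in> nerve_pts G 2" if "z \<in> pts N" for z using smooth_between_pts[OF a that] smooth_between_pts[OF b that] c[OF that] by simp
  show "\<exists>c. smooth_between N \<A> c \<and> (\<forall>z\<in>pts N. component i (t (a z), [a z, b z]) = c z)" if "i < 2" for i
  proof (cases "i = 0")
    case True
    then show ?thesis using a by (intro exI[of _ a]) (simp add: component_def)
  next
    case False
    then have "i = 1" using that by simp
    then show ?thesis using b by (intro exI[of _ b]) (simp add: component_def)
  qed
qed simp

lemma smooth_mul_maps:
  assumes N: "differential_space N" and a: "smooth_between N \<A> a" and b: "smooth_between N \<A> b"
    and c: "\<And>z. z \<in> pts N \<Longrightarrow> s (a z) = t (b z)"
  shows "smooth_between N \<A> (\<lambda>z. mul G (a z) (b z))" using smooth_between_comp[OF smooth_pair[OF assms] smooth_mul] by (simp add: component_def)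

lemma smooth_fst: "smooth_between (\<N> q) \<O> fst"
proof (cases "q = 0")
  case True then show ?thesis using smooth_fst_0 by simp
next
  case False
  show ?thesis
  proof (rule smooth_between_cong[OF smooth_between_comp[OF smooth_component smooth_tgt]])
    show "0 < q" using False by simp
    fix z assume "z \<in> pts (\<N> q)"
    then obtain x gs where "z = (x, gs)" "length gs = q" "composable G x gs" by (auto elim: nerve_ptsE)
    then show "t (component 0 z) = fst z" using False by (cases gs) (simp_all add: component_def)
  qed
qed

lemma smooth_last_vertex: "smooth_between (\<N> q) \<O> (last_vertex G)"
proof (cases q)
  case 0
  show ?thesis unfolding 0 by (rule smooth_between_cong[OF smooth_fst]) (auto elim: nerve_ptsE)
next
  case (Suc r)
  show ?thesis
  proof (rule smooth_between_cong[OF smooth_between_comp[OF smooth_component smooth_src]])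
    show "r < q" using Suc by simp
    fix z assume "z \<in> pts (\<N> q)"
    then obtain x gs where "z = (x, gs)" "length gs = q" "composable G x gs" by (auto elim: nerve_ptsE)
    then show "s (component r z) = last_vertex G z" using Suc by (cases gs rule: rev_cases) (simp_all add: component_def nth_append)
  qed
qed

lemma smooth_take: "q \<le> r \<Longrightarrow> smooth_between (\<N> r) (\<N> q) (\<lambda>z. (fst z, take q (snd z)))"
proof (cases "q = 0")
  case True
  show ?thesis unfolding True by (rule smooth_into_nerve_0[OF ds_nerve _ smooth_fst]) (auto elim!: nerve_ptsE dest: composable_obj)
next
  case False
  assume qr: "q \<le> r"
  show ?thesis
  proof (rule smooth_into_nerve[OF ds_nerve])
    show "q > 0" using False by simp
    show "(fst z, take q (snd z)) \<in> nerve_pts G q" if "z \<in> pts (\<N> r)" for z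
    proof -
      from that obtain x gs where z: "z = (x, gs)" "length gs = r" "composable G x gs" by (auto elim: nerve_ptsE)
      then have "composable G x (take q gs @ drop q gs)" by simp
      then show ?thesis using z qr unfolding composable_append by simp
    qed
    fix i assume "i < q"
    then show "\<exists>c. smooth_between (\<N> r) \<A> c \<and> (\<forall>z\<in>pts (\<N> r). component i (fst z, take q (snd z)) = c z)"
      using qr smooth_component[of i r] by (intro exI[of _ "component i"]) (simp add: component_def)
  qed
qed

lemma smooth_drop:
  "q + q' = r \<Longrightarrow> smooth_between (\<N> r) (\<N> q') (\<lambda>z. (last_vertex G (fst z, take q (snd z)), drop q (snd z)))"
proof (cases "q' = 0")
  case True
  assume qr: "q + q' = r"
  show ?thesis unfolding True
  proof (rule smooth_into_nerve_0[OF ds_nerve _ smooth_last_vertex])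
    fix z assume "z \<in> pts (\<N> r)"
    then obtain x gs where z: "z = (x, gs)" "length gs = r" "composable G x gs" by (auto elim: nerve_ptsE)
    then show "(last_vertex G (fst z, take q (snd z)), drop q (snd z)) \<in> nerve_pts G 0"
      "fst (last_vertex G (fst z, take q (snd z)), drop q (snd z)) = last_vertex G z" using True qr by (simp_all add: composable_last_obj)
  qed
next
  case False
  assume qr: "q + q' = r"
  show ?thesis
  proof (rule smooth_into_nerve[OF ds_nerve])
    show "q' > 0" using False by simp
    show "(last_vertex G (fst z, take q (snd z)), drop q (snd z)) \<in> nerve_pts G q'" if "z \<in> pts (\<N> r)" for z
    proof -
      from that obtain x gs where z: "z = (x, gs)" "length gs = r" "composable G x gs" by (auto elim: nerve_ptsE)
      then have "composable G x (take q gs @ drop q gs)" by simp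
      then show ?thesis using z qr unfolding composable_append by simp
    qed
    fix i assume "i < q'"
    then show "\<exists>c. smooth_between (\<N> r) \<A> c \<and>
       (\<forall>z\<in>pts (\<N> r). component i (last_vertex G (fst z, take q (snd z)), drop q (snd z)) = c z)"
      using qr smooth_component[of "q + i" r] by (intro exI[of _ "component (q + i)"]) (auto simp: component_def elim!: nerve_ptsE)
  qed
qed

lemma composable_face:
  assumes "composable G x gs" "length gs = Suc q" "i \<le> Suc q"
  shows "face G i (x, gs) \<in> nerve_pts G q"
proof -
  consider "i = 0" | "0 < i" "i < length gs" | "i = length gs" "i > 0" using assms by linarith
  then show ?thesis
  proof cases
    case 1
    then show ?thesis using assms by (cases gs) (simp_all add: face_0)
  next
    case 2
    then obtain u a b v where "gs = u @ a # b # v" "i = Suc (length u)" by (rule list_split_at)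
    then show ?thesis using assms by (simp add: face_mid)
  next
    case 3
    then show ?thesis using assms face_last[of G "butlast gs" x "last gs"] by (cases gs rule: rev_cases) simp_all
  qed
qed

lemma smooth_face:
  assumes i: "i \<le> Suc q"
  shows "smooth_between (\<N> (Suc q)) (\<N> q) (face G i)"
proof (cases "q = 0")
  case True
  have F: "face G i z \<in> nerve_pts G 0" if "z \<in> pts (\<N> (Suc 0))" for z using that composable_face i True by (auto elim!: nerve_ptsE)
  show ?thesis
  proof (cases "i = 0")
    case i0: True
    show ?thesis unfolding True
    proof (rule smooth_into_nerve_0[OF ds_nerve F smooth_between_comp[OF smooth_component smooth_src]])
      show "fst (face G i z) = s (component 0 z)" if "z \<in> pts (\<N> (Suc 0))" for z
        using that i0 by (auto elim!: nerve_ptsE simp: face_def component_def length_Suc_conv)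
    qed simp_all
  next
    case False
    show ?thesis unfolding True
    proof (rule smooth_into_nerve_0[OF ds_nerve F smooth_fst])
      show "fst (face G i z) = fst z" if "z \<in> pts (\<N> (Suc 0))" for z using that False by (auto elim!: nerve_ptsE simp: face_def Let_def)
    qed
  qed
next
  case False
  show ?thesis
  proof (rule smooth_into_nerve[OF ds_nerve])
    show "q > 0" using False by simp
    show "face G i z \<in> nerve_pts G q" if "z \<in> pts (\<N> (Suc q))" for z using that composable_face i by (auto elim!: nerve_ptsE)
    fix j assume j: "j < q"
    \<comment> \<open>Components are numbered from 0, so an inner face \<open>i\<close> multiplies
      components \<open>i - 1\<close> and \<open>i\<close>; those after it move down by one, and the
      last face \<open>Suc q\<close> leaves all remaining components alone.\<close>
    have comp: "j < i - 1 \<or> i = Suc q \<Longrightarrow> component j (face G i z) = component j z"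
      "i \<noteq> 0 \<and> i \<noteq> Suc q \<and> j = i - 1 \<Longrightarrow> component j (face G i z) = mul G (component j z) (component (Suc j) z)"
      "i \<le> j \<Longrightarrow> component j (face G i z) = component (Suc j) z"
      if "z \<in> pts (\<N> (Suc q))" for z
    proof -
      from that obtain x gs where z: "z = (x, gs)" "length gs = Suc q" "composable G x gs" by (auto elim: nerve_ptsE)
      show "j < i - 1 \<or> i = Suc q \<Longrightarrow> component j (face G i z) = component j z"
        "i \<noteq> 0 \<and> i \<noteq> Suc q \<and> j = i - 1 \<Longrightarrow> component j (face G i z) = mul G (component j z) (component (Suc j) z)"
        "i \<le> j \<Longrightarrow> component j (face G i z) = component (Suc j) z"
        using z j i by (auto simp: face_def Let_def component_def nth_append nth_butlast nth_tl)
    qed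
    consider "j < i - 1 \<or> i = Suc q" | "i \<noteq> 0 \<and> i \<noteq> Suc q \<and> j = i - 1" | "i \<le> j" by linarith
    then show "\<exists>c. smooth_between (\<N> (Suc q)) \<A> c \<and> (\<forall>z\<in>pts (\<N> (Suc q)). component j (face G i z) = c z)"
    proof cases
      case 1
      then show ?thesis using comp(1) smooth_component[of j "Suc q"] j by (intro exI[of _ "component j"]) simp
    next
      case 2
      have "smooth_between (\<N> (Suc q)) \<A> (\<lambda>z. mul G (component j z) (component (Suc j) z))"
      proof (rule smooth_mul_maps[OF ds_nerve])
        show "smooth_between (\<N> (Suc q)) \<A> (component j)" "smooth_between (\<N> (Suc q)) \<A> (component (Suc j))"
          using j by (simp_all add: smooth_component)
        fix z assume "z \<in> pts (\<N> (Suc q))"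
        then obtain x gs where z: "z = (x, gs)" "length gs = Suc q" "composable G x gs" by (auto elim: nerve_ptsE)
        have "0 < Suc j" "Suc j < length gs" using z j by simp_all
        then obtain u a b v where "gs = u @ a # b # v" "Suc j = Suc (length u)" by (rule list_split_at)
        then show "s (component j z) = t (component (Suc j) z)" using z by (simp add: component_def nth_append)
      qed
      then show ?thesis using comp(2) 2 by (intro exI conjI) auto
    next
      case 3
      then show ?thesis using comp(3) smooth_component[of "Suc j" "Suc q"] j by (intro exI[of _ "component (Suc j)"]) simp
    qed
  qed
qed

lemma smooth_degeneracy:
  assumes i: "i \<le> q"
  shows "smooth_between (\<N> q) (\<N> (Suc q)) (degeneracy G i)"
proof (rule smooth_into_nerve[OF ds_nerve])
  have lvt: "smooth_between (\<N> q) \<A> (\<lambda>z. e (last_vertex G (fst z, take i (snd z))))"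
    using smooth_between_comp[OF smooth_between_comp[OF smooth_take[OF i] smooth_last_vertex] smooth_idt] by simp
  show "degeneracy G i z \<in> nerve_pts G (Suc q)" if "z \<in> pts (\<N> q)" for z
  proof -
    from that obtain x gs where z: "z = (x, gs)" "length gs = q" "composable G x gs" by (auto elim: nerve_ptsE)
    then have "composable G x (take i gs @ drop i gs)" by simp
    then show ?thesis using z i unfolding composable_append degeneracy_def by (simp add: composable_last_obj)
  qed
  fix j assume j: "j < Suc q"
  consider "j < i" | "j = i" | "i < j" by linarith
  then show "\<exists>c. smooth_between (\<N> q) \<A> c \<and> (\<forall>z\<in>pts (\<N> q). component j (degeneracy G i z) = c z)"
  proof cases
    case 1
    then show ?thesis using i smooth_component[of j q] by (intro exI[of _ "component j"]) (auto simp: degeneracy_def component_def nth_append elim!: nerve_ptsE)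
  next
    case 2
    then show ?thesis using i lvt by (intro exI[of _ "\<lambda>z. e (last_vertex G (fst z, take i (snd z)))"])
        (auto simp: degeneracy_def component_def nth_append elim!: nerve_ptsE)
  next
    case 3
    then show ?thesis using i j smooth_component[of "j - 1" q]
      by (intro exI[of _ "component (j - 1)"]) (auto simp: degeneracy_def component_def nth_append elim!: nerve_ptsE)
  qed
qed simp

subsection \<open>Fibres of the target map\<close>

lemma tfibre_pts [simp]: "pts (\<F> y) = {g \<in> arrows G. t g = y}" by (simp add: tfibre_def)

lemma ds_tfibre: "differential_space (\<F> y)"
  unfolding tfibre_def by (rule presented_differential_space[OF charted_arr presented_subspace]) auto

lemma smooth_tfibre: "smooth_between (\<F> y) \<A> id" unfolding tfibre_def id_def by (rule smooth_between_subspace[OF charted_arr]) auto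

text \<open>In terms of tangent vectors: a vector tangent to the fibre is determined by its image in
  the tangent space of \<open>G\<close>.\<close>

lemma generated_tfibre: "generated_by (\<F> y) (pullback (\<F> y) id ` fns \<A>)"
  unfolding tfibre_def id_def by (rule generated_by_restrictions[OF manifold_arr]) auto

lemma smooth_translation:
  assumes "g \<in> arrows G"
  shows "smooth_between (\<F> (s g)) \<A> (mul G g)"
  using smooth_mul_maps[OF ds_tfibre smooth_between_const[OF ds_tfibre] smooth_tfibre, of g "s g"] assms by simp

text \<open>With the beginning of a string fixed, the fibre over its last vertex parametrizes the
  possible last arrows. Pushing fibre vectors forward along this map moves the last component
  without breaking composability.\<close>

lemma smooth_append:
  assumes "composable G x gs"
  shows "smooth_between (\<F> (lv x gs)) (\<N> (Suc (length gs))) (\<lambda>k. (x, gs @ [k]))"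
proof (rule smooth_into_nerve[OF ds_tfibre])
  show "(x, gs @ [k]) \<in> nerve_pts G (Suc (length gs))" if "k \<in> pts (\<F> (lv x gs))" for k using that assms by simp
  fix i assume i: "i < Suc (length gs)"
  show "\<exists>c. smooth_between (\<F> (lv x gs)) \<A> c \<and> (\<forall>k\<in>pts (\<F> (lv x gs)). component i (x, gs @ [k]) = c k)"
  proof (cases "i = length gs")
    case True
    then show ?thesis using smooth_tfibre by (intro exI[of _ id]) simp
  next
    case False
    then have i: "i < length gs" using i by simp
    have "component i (x, gs) \<in> arrows G" using smooth_between_pts[OF smooth_component[OF i], of "(x, gs)"] assms by simp
    then have "smooth_between (\<F> (lv x gs)) \<A> (\<lambda>_. component i (x, gs))" by (intro smooth_between_const[OF ds_tfibre]) simp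
    then show ?thesis using i by (intro exI[of _ "\<lambda>_. component i (x, gs)"] conjI) (simp_all add: component_def nth_append)
  qed
qed simp

end

lemma vfield_combination:
  assumes N: "differential_space N" and D: "D \<in> vector_fields N" "D' \<in> vector_fields N"
  shows "(\<lambda>f x. D f x + D' f x) \<in> vector_fields N" unfolding vector_fields_def mem_Collect_eq by (intro conjI ballI allI impI)
    (simp_all add: fns_add[OF N] vfield_fns[OF D(1)] vfield_fns[OF D(2)] vfield_not_fns[OF D(1)]
      vfield_not_fns[OF D(2)] vfield_lincomb[OF D(1)] vfield_lincomb[OF D(2)]
      vfield_mult[OF D(1)] vfield_mult[OF D(2)] algebra_simps)

lemma vfield_multiple:
  assumes N: "differential_space N" and D: "D \<in> vector_fields N" and u: "u \<in> fns N"
  shows "(\<lambda>f x. u x * D f x) \<in> vector_fields N" unfolding vector_fields_def mem_Collect_eq by (intro conjI ballI allI impI)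
    (simp_all add: fns_mult[OF N u] vfield_fns[OF D] vfield_not_fns[OF D] vfield_lincomb[OF D]
      vfield_mult[OF D] algebra_simps)

context lie_groupoid_locale
begin

subsection \<open>Left-invariant vector fields\<close>

abbreviation (input) "\<L> \<equiv> left_invariant G"

lemma left_invariant_vfield: "X \<in> \<L> \<Longrightarrow> X \<in> vector_fields \<A>" by (simp add: left_invariant_def)

lemma left_invariant_exists:
  assumes "X \<in> \<L>" "g \<in> arrows G" "h \<in> arrows G" "s g = t h"
  shows "\<exists>v. tangent_vector (\<F> (s g)) h v \<and> (\<forall>f\<in>fns \<A>. v (pullback (\<F> (s g)) id f) = X f h \<and>
               v (pullback (\<F> (s g)) (mul G g) f) = X f (mul G g h))"
  using assms unfolding left_invariant_def mem_Collect_eq by blast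

lemma tfibre_tangent_vector_eqI:
  assumes "tangent_vector (\<F> y) h v" "tangent_vector (\<F> y) h w"
    and "\<And>f. f \<in> fns \<A> \<Longrightarrow> v (pullback (\<F> y) id f) = w (pullback (\<F> y) id f)" "f \<in> fns (\<F> y)"
  shows "v f = w f" by (rule tangent_vector_eqI[OF ds_tfibre generated_tfibre assms(1,2) _ assms(4)]) (use assms(3) in auto)

text \<open>The value of \<open>X\<close> at \<open>h\<close> as a vector tangent to the
  \<open>t\<close>-fibre. For left-invariant \<open>X\<close> it exists, as left invariance applied
  to the unit at \<open>t h\<close> and \<open>h\<close> shows, and it is unique as a functional on
  the functions of the fibre.\<close>

definition fibre_vector :: "'g vfield \<Rightarrow> 'g \<Rightarrow> ('g \<Rightarrow> real) \<Rightarrow> real" where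
  "fibre_vector X h = (SOME v. tangent_vector (\<F> (t h)) h v \<and> (\<forall>f\<in>fns \<A>. v (pullback (\<F> (t h)) id f) = X f h))"

lemma
  assumes X: "X \<in> \<L>" and h: "h \<in> arrows G"
  shows fibre_vector_tangent: "tangent_vector (\<F> (t h)) h (fibre_vector X h)"
    and fibre_vector_restriction: "f \<in> fns \<A> \<Longrightarrow> fibre_vector X h (pullback (\<F> (t h)) id f) = X f h"
proof -
  have "\<exists>v. tangent_vector (\<F> (t h)) h v \<and> (\<forall>f\<in>fns \<A>. v (pullback (\<F> (t h)) id f) = X f h)"
    using left_invariant_exists[OF X, of "e (t h)" h] h by auto
  from someI_ex[OF this] show "tangent_vector (\<F> (t h)) h (fibre_vector X h)"
    "f \<in> fns \<A> \<Longrightarrow> fibre_vector X h (pullback (\<F> (t h)) id f) = X f h" unfolding fibre_vector_def by blast+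
qed

text \<open>Left invariance offers some fibre vector that represents \<open>X\<close> at
  \<open>h\<close> and translates correctly. Since fibre vectors are determined by restrictions of
  functions on \<open>G\<close>, any representative translates in the same way.\<close>

lemma left_invariant_translate:
  assumes X: "X \<in> \<L>" and gh: "g \<in> arrows G" "h \<in> arrows G" "s g = t h" and f: "f \<in> fns \<A>"
    and v: "tangent_vector (\<F> (s g)) h v" "\<And>f. f \<in> fns \<A> \<Longrightarrow> v (pullback (\<F> (s g)) id f) = X f h"
  shows "v (pullback (\<F> (s g)) (mul G g) f) = X f (mul G g h)"
proof -
  obtain w where w: "tangent_vector (\<F> (s g)) h w"
    "\<forall>f\<in>fns \<A>. w (pullback (\<F> (s g)) id f) = X f h \<and> w (pullback (\<F> (s g)) (mul G g) f) = X f (mul G g h)"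
    using left_invariant_exists[OF X gh] by (elim exE conjE)
  have "v (pullback (\<F> (s g)) (mul G g) f) = w (pullback (\<F> (s g)) (mul G g) f)"
    by (rule tfibre_tangent_vector_eqI[OF v(1) w(1)]) (use v(2) w(2) smooth_between_fns[OF smooth_translation[OF gh(1)] f] in auto)
  then show ?thesis using w(2) f by simp
qed

text \<open>The restriction of a left-invariant field to a fibre, as a field there. Left invariance
  becomes relatedness along the inclusion and along the translations.\<close>

definition fibre_field :: "'g vfield \<Rightarrow> 'm \<Rightarrow> 'g vfield" where
  "fibre_field X y = (\<lambda>f h. if f \<in> fns (\<F> y) \<and> h \<in> pts (\<F> y) then fibre_vector X h f else 0)"

lemma
  assumes X: "X \<in> \<L>"
  shows fibre_field_vfield: "fibre_field X y \<in> vector_fields (\<F> y)" and fibre_field_restriction: "related (\<F> y) \<A> id (fibre_field X y) X"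
    and fibre_field_translation: "g \<in> arrows G \<Longrightarrow> related (\<F> (s g)) \<A> (mul G g) (fibre_field X (s g)) X"
proof -
  have T: "tangent_vector (\<F> y) h (fibre_vector X h)" if "h \<in> pts (\<F> y)" for h y using fibre_vector_tangent[OF X, of h] that by auto
  have R: "fibre_vector X h (pullback (\<F> y) id f) = X f h" if "h \<in> pts (\<F> y)" "f \<in> fns \<A>" for h y f
    using fibre_vector_restriction[OF X, of h f] that by auto
  show "fibre_field X y \<in> vector_fields (\<F> y)" unfolding fibre_field_def
  proof (rule vfield_of_tangent_vectors[OF ds_tfibre generated_tfibre T])
    fix k assume "k \<in> pullback (\<F> y) id ` fns \<A>"
    then obtain f where f: "f \<in> fns \<A>" "k = pullback (\<F> y) id f" by auto
    have "(\<lambda>p. if p \<in> pts (\<F> y) then fibre_vector X p k else 0) = pullback (\<F> y) id (X f)"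
      using R[OF _ f(1)] unfolding f(2) pullback_def[of _ _ "X f"] by (auto simp: fun_eq_iff)
    then show "(\<lambda>p. if p \<in> pts (\<F> y) then fibre_vector X p k else 0) \<in> fns (\<F> y)"
      using smooth_between_fns[OF smooth_tfibre vfield_fns[OF left_invariant_vfield[OF X] f(1)]] by simp
  qed
  show "related (\<F> y) \<A> id (fibre_field X y) X" unfolding related_def
  proof
    fix f assume f: "f \<in> fns \<A>"
    show "fibre_field X y (pullback (\<F> y) id f) = pullback (\<F> y) id (X f)" using R[OF _ f] smooth_between_fns[OF smooth_tfibre f]
      unfolding fibre_field_def pullback_def[of _ _ "X f"] by (auto simp: fun_eq_iff)
  qed
  show "related (\<F> (s g)) \<A> (mul G g) (fibre_field X (s g)) X" if g: "g \<in> arrows G" unfolding related_def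
  proof
    fix f assume f: "f \<in> fns \<A>"
    have "fibre_vector X h (pullback (\<F> (s g)) (mul G g) f) = X f (mul G g h)" if "h \<in> pts (\<F> (s g))" for h
      using that by (intro left_invariant_translate[OF X g _ _ f T[OF that] R[OF that]]) auto
    then show "fibre_field X (s g) (pullback (\<F> (s g)) (mul G g) f) = pullback (\<F> (s g)) (mul G g) (X f)"
      using smooth_between_fns[OF smooth_translation[OF g] f] unfolding fibre_field_def pullback_def[of _ _ "X f"] by (auto simp: fun_eq_iff)
  qed
qed

text \<open>The definition speaks of single vectors; here these are the values of fields on the
  fibres. In this form closure under brackets follows from the behaviour of brackets of related
  fields.\<close>

lemma left_invariantI:
  assumes X: "X \<in> vector_fields \<A>" and F: "\<And>y. F y \<in> vector_fields (\<F> y)"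
    "\<And>y. related (\<F> y) \<A> id (F y) X" "\<And>g. g \<in> arrows G \<Longrightarrow> related (\<F> (s g)) \<A> (mul G g) (F (s g)) X"
  shows "X \<in> \<L>" unfolding left_invariant_def mem_Collect_eq
proof (intro conjI ballI impI X)
  fix g h assume gh: "g \<in> arrows G" "h \<in> arrows G" "s g = t h"
  then have h: "h \<in> pts (\<F> (s g))" by simp
  show "\<exists>v. tangent_vector (\<F> (s g)) h v \<and> (\<forall>f\<in>fns \<A>. v (pullback (\<F> (s g)) id f) = X f h \<and>
      v (pullback (\<F> (s g)) (mul G g) f) = X f (mul G g h))"
  proof (intro exI[of _ "\<lambda>f. F (s g) f h"] conjI ballI)
    show "tangent_vector (\<F> (s g)) h (\<lambda>f. F (s g) f h)" by (rule vfield_tangent_vector[OF F(1) h])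
    fix f assume f: "f \<in> fns \<A>"
    show "F (s g) (pullback (\<F> (s g)) id f) h = X f h" by (simp add: relatedD[OF F(2) f] pullback_apply[OF h])
    show "F (s g) (pullback (\<F> (s g)) (mul G g) f) h = X f (mul G g h)" by (simp add: relatedD[OF F(3)[OF gh(1)] f] pullback_apply[OF h])
  qed
qed

lemma lie_bracket_left_invariant:
  assumes X: "X \<in> \<L>" and Y: "Y \<in> \<L>"
  shows "lie_bracket X Y \<in> \<L>"
proof (rule left_invariantI[where F = "\<lambda>y. lie_bracket (fibre_field X y) (fibre_field Y y)"])
  note XY = left_invariant_vfield[OF X] left_invariant_vfield[OF Y]
  show "lie_bracket X Y \<in> vector_fields \<A>" by (rule lie_bracket_vfield[OF ds_arr XY])
  show "lie_bracket (fibre_field X y) (fibre_field Y y) \<in> vector_fields (\<F> y)" for y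
    by (rule lie_bracket_vfield[OF ds_tfibre fibre_field_vfield[OF X] fibre_field_vfield[OF Y]])
  show "related (\<F> y) \<A> id (lie_bracket (fibre_field X y) (fibre_field Y y)) (lie_bracket X Y)" for y
    by (rule related_lie_bracket[OF fibre_field_restriction[OF X] fibre_field_restriction[OF Y] XY])
  show "related (\<F> (s g)) \<A> (mul G g) (lie_bracket (fibre_field X (s g)) (fibre_field Y (s g))) (lie_bracket X Y)"
    if "g \<in> arrows G" for g by (rule related_lie_bracket[OF fibre_field_translation[OF X that] fibre_field_translation[OF Y that] XY])
qed

lemma section_add_left_invariant:
  assumes X: "X \<in> \<L>" and Y: "Y \<in> \<L>"
  shows "section_add X Y \<in> \<L>"
proof (rule left_invariantI[where F = "\<lambda>y f g. fibre_field X y f g + fibre_field Y y f g"])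
  show "section_add X Y \<in> vector_fields \<A>" unfolding section_add_def
    by (rule vfield_combination[OF ds_arr left_invariant_vfield[OF X] left_invariant_vfield[OF Y]])
  show "(\<lambda>f g. fibre_field X y f g + fibre_field Y y f g) \<in> vector_fields (\<F> y)" for y
    by (rule vfield_combination[OF ds_tfibre fibre_field_vfield[OF X] fibre_field_vfield[OF Y]])
  show "related (\<F> y) \<A> id (\<lambda>f g. fibre_field X y f g + fibre_field Y y f g) (section_add X Y)" for y
    using fibre_field_restriction[OF X, of y] fibre_field_restriction[OF Y, of y] by (simp add: related_def section_add_def pullback_add)
  show "related (\<F> (s g)) \<A> (mul G g) (\<lambda>f h. fibre_field X (s g) f h + fibre_field Y (s g) f h) (section_add X Y)"
    if "g \<in> arrows G" for g using fibre_field_translation[OF X that] fibre_field_translation[OF Y that]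
    by (simp add: related_def section_add_def pullback_add)
qed

lemma section_scale_left_invariant:
  assumes X: "X \<in> \<L>" and a: "a \<in> fns \<O>"
  shows "section_scale G a X \<in> \<L>"
proof (rule left_invariantI[where F = "\<lambda>y f g. pullback (\<F> y) s a g * fibre_field X y f g"])
  note Xv = left_invariant_vfield[OF X]
  have "section_scale G a X = (\<lambda>f g. pullback \<A> s a g * X f g)"
    using vfield_outside[OF ds_arr Xv] by (auto simp: section_scale_def pullback_def fun_eq_iff)
  then show "section_scale G a X \<in> vector_fields \<A>" using vfield_multiple[OF ds_arr Xv smooth_between_fns[OF smooth_src a]] by simp
  have ss: "smooth_between (\<F> y) \<O> s" for y using smooth_between_comp[OF smooth_tfibre smooth_src] by simp
  show "(\<lambda>f g. pullback (\<F> y) s a g * fibre_field X y f g) \<in> vector_fields (\<F> y)" for y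
    by (rule vfield_multiple[OF ds_tfibre fibre_field_vfield[OF X] smooth_between_fns[OF ss a]])
  show "related (\<F> y) \<A> id (\<lambda>f g. pullback (\<F> y) s a g * fibre_field X y f g) (section_scale G a X)" for y
    using fibre_field_restriction[OF X, of y] by (simp add: related_def section_scale_def) (simp add: pullback_def fun_eq_iff)
  show "related (\<F> (s g)) \<A> (mul G g) (\<lambda>f h. pullback (\<F> (s g)) s a h * fibre_field X (s g) f h) (section_scale G a X)"
    if "g \<in> arrows G" for g using fibre_field_translation[OF X that] that by (simp add: related_def section_scale_def) (simp add: pullback_def fun_eq_iff)
qed

text \<open>Left translation does not change the source, so translating by \<open>g\<close> from the
  unit at \<open>s g\<close> to \<open>g\<close> leaves the derivative of a function of the source
  unchanged.\<close>

lemma left_invariant_pullback_src: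
  assumes X: "X \<in> \<L>" and a: "a \<in> fns \<O>" and g: "g \<in> arrows G"
  shows "X (pullback \<A> s a) g = X (pullback \<A> s a) (e (s g))"
proof -
  note f = smooth_between_fns[OF smooth_src a]
  have 1: "e (s g) \<in> pts (\<F> (s g))" using g by simp
  have "pullback (\<F> (s g)) (mul G g) (pullback \<A> s a) = pullback (\<F> (s g)) id (pullback \<A> s a)"
    using g by (intro pullback_cong) (simp add: pullback_def)
  then have "fibre_field X (s g) (pullback (\<F> (s g)) (mul G g) (pullback \<A> s a)) (e (s g)) =
     fibre_field X (s g) (pullback (\<F> (s g)) id (pullback \<A> s a)) (e (s g))" by simp
  then show ?thesis unfolding relatedD[OF fibre_field_translation[OF X g] f] relatedD[OF fibre_field_restriction[OF X] f] pullback_apply[OF 1] using g by simp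
qed

text \<open>The only candidate for the anchor is the derivative of the pullback along
  \<open>s\<close>, evaluated at units, because \<open>s\<close> maps the unit at \<open>x\<close>
  to \<open>x\<close>. It is \<open>s\<close>-related to \<open>X\<close> because such a derivative
  depends on the source alone.\<close>

lemma
  assumes X: "X \<in> \<L>"
  shows anchor_vfield: "anchor G X \<in> vector_fields \<O>" and anchor_related: "related \<A> \<O> s X (anchor G X)"
proof -
  let ?P = "\<lambda>Y. Y \<in> vector_fields \<O> \<and> related \<A> \<O> s X Y"
  let ?Y = "\<lambda>a x. if a \<in> fns \<O> \<and> x \<in> pts \<O> then X (pullback \<A> s a) (e x) else 0"
  note Xv = left_invariant_vfield[OF X]
  have "?P ?Y"
  proof
    show "?Y \<in> vector_fields \<O>"
    proof (rule vfield_of_tangent_vectors[OF ds_obj generated_by_fns])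
      show "tangent_vector \<O> x (\<lambda>a. X (pullback \<A> s a) (e x))" if "x \<in> pts \<O>" for x
        using tangent_vector_push[OF ds_arr vfield_tangent_vector[OF Xv, of "e x"] smooth_src] that by simp
      fix a assume a: "a \<in> fns \<O>"
      have "(\<lambda>x. if x \<in> pts \<O> then X (pullback \<A> s a) (e x) else 0) = pullback \<O> e (X (pullback \<A> s a))"
        by (simp add: pullback_def[of \<O>])
      then show "(\<lambda>x. if x \<in> pts \<O> then X (pullback \<A> s a) (e x) else 0) \<in> fns \<O>"
        using smooth_between_fns[OF smooth_idt vfield_fns[OF Xv smooth_between_fns[OF smooth_src a]]] by simp
    qed
    show "related \<A> \<O> s X ?Y" unfolding related_def
    proof
      fix a assume a: "a \<in> fns \<O>"
      show "X (pullback \<A> s a) = pullback \<A> s (?Y a)"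
      proof
        fix g show "X (pullback \<A> s a) g = pullback \<A> s (?Y a) g"
          using left_invariant_pullback_src[OF X a, of g] vfield_outside[OF ds_arr Xv, of g] a
          by (cases "g \<in> pts \<A>") (simp_all add: pullback_apply pullback_outside)
      qed
    qed
  qed
  moreover have "Y = ?Y" if "?P Y" for Y
  proof (rule vfield_eqI[OF ds_obj generated_by_fns])
    show "Y \<in> vector_fields \<O>" "?Y \<in> vector_fields \<O>" using that \<open>?P ?Y\<close> by blast+
    fix a assume a: "a \<in> fns \<O>"
    have "Y a x = ?Y a x" for x
    proof (cases "x \<in> objs G")
      case True
      have "X (pullback \<A> s a) (e x) = pullback \<A> s (Y a) (e x)" using that a by (simp add: related_def)
      then show ?thesis using True a by (simp add: pullback_apply)
    next
      case False
      then show ?thesis using vfield_outside[OF ds_obj conjunct1[OF that], of x a] by simp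
    qed
    then show "Y a = ?Y a" by (rule ext)
  qed
  ultimately have "?P (anchor G X)" unfolding anchor_def by (rule theI)
  then show "anchor G X \<in> vector_fields \<O>" "related \<A> \<O> s X (anchor G X)" by blast+
qed

lemma anchor_apply: "X \<in> \<L> \<Longrightarrow> a \<in> fns \<O> \<Longrightarrow> x \<in> objs G \<Longrightarrow> anchor G X a x = X (pullback \<A> s a) (e x)"
  using relatedD[OF anchor_related, of X a] by (simp add: pullback_apply)

subsection \<open>Vector fields acting on the last component\<close>

lemma nerve_tangent_vector_eqI:
  assumes "q > 0" "tangent_vector (\<N> q) z v" "tangent_vector (\<N> q) z w"
    and "\<And>i h. i < q \<Longrightarrow> h \<in> fns \<A> \<Longrightarrow> v (pullback (\<N> q) (component i) h) = w (pullback (\<N> q) (component i) h)"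
    and "f \<in> fns (\<N> q)"
  shows "v f = w f" by (rule tangent_vector_eqI[OF ds_nerve generated_nerve[OF assms(1)] assms(2,3) _ assms(5)])
    (use assms(4) in \<open>auto elim!: component_functionsE\<close>)

lemma nerve_vector_field_eqI:
  assumes "q > 0" "D \<in> vector_fields (\<N> q)" "D' \<in> vector_fields (\<N> q)"
    and "\<And>i. i < q \<Longrightarrow> related (\<N> q) \<A> (component i) D (Y i)"
    and "\<And>i. i < q \<Longrightarrow> related (\<N> q) \<A> (component i) D' (Y i)"
  shows "D = D'" by (rule vfield_eqI[OF ds_nerve generated_nerve[OF assms(1)] assms(2,3)])
    (use relatedD[OF assms(4)] relatedD[OF assms(5)] in \<open>auto elim!: component_functionsE\<close>)

lemma nerve_fun_eqI:
  assumes "\<And>x gs. length gs = q \<Longrightarrow> composable G x gs \<Longrightarrow> f (x, gs) = g (x, gs)"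
    and "\<And>z. z \<notin> nerve_pts G q \<Longrightarrow> f z = 0" "\<And>z. z \<notin> nerve_pts G q \<Longrightarrow> g z = 0"
  shows "f = g"
proof
  fix z show "f z = g z"
  proof (cases "z \<in> nerve_pts G q")
    case True then show ?thesis using assms(1) by (auto elim: nerve_ptsE)
  qed (simp add: assms(2,3))
qed

lemma nerve_fns_outside: "f \<in> fns (\<N> q) \<Longrightarrow> z \<notin> nerve_pts G q \<Longrightarrow> f z = 0"
  using fns_outside[OF ds_nerve, of f q z] by simp

lemma zero_field_vfield: "zero_field \<in> vector_fields \<A>" by (simp add: vector_fields_def zero_field_def fns_zero[OF ds_arr])

text \<open>Uniqueness holds because functions of single components generate. Existence is a
  pointwise condition: the prescribed velocities of the components must come from a tangent vector
  of the space of composable strings, which is a compatibility requirement on neighbouring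
  components.\<close>

lemma nerve_vector_field_ex1:
  assumes q: "q > 0" and Y: "\<And>i. i < q \<Longrightarrow> Y i \<in> vector_fields \<A>"
    and ex: "\<And>z. z \<in> nerve_pts G q \<Longrightarrow> \<exists>v. tangent_vector (\<N> q) z v \<and>
      (\<forall>i<q. \<forall>h\<in>fns \<A>. v (pullback (\<N> q) (component i) h) = Y i h (component i z))"
  shows "\<exists>!D. D \<in> vector_fields (\<N> q) \<and> (\<forall>i<q. related (\<N> q) \<A> (component i) D (Y i))"
proof (rule ex_ex1I)
  let ?N = "\<N> q"
  define T where "T z = (SOME v. tangent_vector ?N z v \<and> (\<forall>i<q. \<forall>h\<in>fns \<A>. v (pullback ?N (component i) h) = Y i h (component i z)))" for z
  have T: "tangent_vector ?N z (T z)" "\<And>i h. i < q \<Longrightarrow> h \<in> fns \<A> \<Longrightarrow> T z (pullback ?N (component i) h) = Y i h (component i z)"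
    if "z \<in> pts ?N" for z using someI_ex[OF ex, of z] that unfolding T_def by simp_all
  let ?D = "\<lambda>f z. if f \<in> fns ?N \<and> z \<in> pts ?N then T z f else 0"
  have D: "?D \<in> vector_fields ?N"
  proof (rule vfield_of_tangent_vectors[OF ds_nerve generated_nerve[OF q] T(1)])
    fix k assume "k \<in> component_functions q"
    then obtain i h where k: "k = pullback ?N (component i) h" "i < q" "h \<in> fns \<A>" by (rule component_functionsE)
    have "(\<lambda>z. if z \<in> pts ?N then T z k else 0) = pullback ?N (component i) (Y i h)"
      using T(2)[OF _ k(2,3)] by (auto simp: k(1) pullback_def[of _ _ "Y i h"] fun_eq_iff)
    then show "(\<lambda>z. if z \<in> pts ?N then T z k else 0) \<in> fns ?N"
      using smooth_between_fns[OF smooth_component[OF k(2)] vfield_fns[OF Y[OF k(2)] k(3)]] by simp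
  qed
  have R: "related ?N \<A> (component i) ?D (Y i)" if i: "i < q" for i unfolding related_def
  proof
    fix h assume h: "h \<in> fns \<A>"
    show "?D (pullback ?N (component i) h) = pullback ?N (component i) (Y i h)"
      using T(2)[OF _ i h] smooth_between_fns[OF smooth_component[OF i] h] by (auto simp: pullback_def[of _ _ "Y i h"] fun_eq_iff)
  qed
  show "\<exists>D. D \<in> vector_fields ?N \<and> (\<forall>i<q. related ?N \<A> (component i) D (Y i))" using D R by (intro exI[of _ ?D]) simp
  show "D = D'" if "D \<in> vector_fields ?N \<and> (\<forall>i<q. related ?N \<A> (component i) D (Y i))"
    "D' \<in> vector_fields ?N \<and> (\<forall>i<q. related ?N \<A> (component i) D' (Y i))" for D D'
    by (rule nerve_vector_field_eqI[OF q, of D D' Y]) (use that in simp_all)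
qed

text \<open>The value of the lift at a string is the push-forward of the fibre vector of
  \<open>X\<close> at the last arrow. Since that vector is tangent to the \<open>t\<close>-fibre,
  the string stays composable while the other components are constant.\<close>

lemma last_lift_unique:
  assumes X: "X \<in> \<L>"
  shows "\<exists>!D. D \<in> vector_fields (\<N> (Suc q)) \<and>
     (\<forall>i<Suc q. related (\<N> (Suc q)) \<A> (component i) D (if Suc i = Suc q then X else zero_field))"
proof (rule nerve_vector_field_ex1)
  let ?N = "\<N> (Suc q)"
  show "(if Suc i = Suc q then X else zero_field) \<in> vector_fields \<A>" for i by (simp add: left_invariant_vfield[OF X] zero_field_vfield)
  fix z assume z: "z \<in> nerve_pts G (Suc q)"
  then obtain x gs' where z': "z = (x, gs')" "length gs' = Suc q" "composable G x gs'" by (rule nerve_ptsE)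
  then obtain gs k where gs: "gs' = gs @ [k]" by (cases gs' rule: rev_cases) auto
  have l: "length gs = q" and c: "composable G x gs" and k: "k \<in> arrows G" "t k = lv x gs" using z' by (simp_all add: gs)
  let ?F = "\<F> (lv x gs)" and ?a = "\<lambda>k. (x, gs @ [k])"
  have fv: "tangent_vector ?F k (fibre_vector X k)" using fibre_vector_tangent[OF X k(1)] k(2) by simp
  show "\<exists>v. tangent_vector ?N z v \<and> (\<forall>i<Suc q. \<forall>h\<in>fns \<A>.
    v (pullback ?N (component i) h) = (if Suc i = Suc q then X else zero_field) h (component i z))"
  proof (intro exI conjI allI impI ballI)
    show "tangent_vector ?N z (\<lambda>f. fibre_vector X k (pullback ?F ?a f))"
      unfolding z'(1) gs by (rule tangent_vector_push[OF ds_tfibre fv smooth_append[OF c, unfolded l]])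
    fix i h assume i: "i < Suc q" and h: "h \<in> fns \<A>"
    show "fibre_vector X k (pullback ?F ?a (pullback ?N (component i) h)) = (if Suc i = Suc q then X else zero_field) h (component i z)"
    proof (cases "i = q")
      case True
      have "pullback ?F ?a (pullback ?N (component i) h) = pullback ?F id h" using c by (auto simp: pullback_def True l[symmetric])
      then show ?thesis using fibre_vector_restriction[OF X k(1) h] True k(2) l component_append(2)[of gs x k "[]"] by (simp add: z'(1) gs)
    next
      case False
      then have iq: "i < length gs" using i l by simp
      have "pullback ?F ?a (pullback ?N (component i) h) = (\<lambda>k. if k \<in> pts ?F then h (gs ! i) else 0)"
        using iq c l by (simp add: pullback_def component_def nth_append fun_eq_iff)
      then show ?thesis using tangent_vector_at_const[OF ds_tfibre fv] False by (simp add: zero_field_def)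
    qed
  qed
qed simp

lemma
  assumes X: "X \<in> \<L>"
  shows last_lift_vfield: "\<X> (Suc q) X \<in> vector_fields (\<N> (Suc q))" and last_lift_related: "i < Suc q \<Longrightarrow>
      related (\<N> (Suc q)) \<A> (component i) (\<X> (Suc q) X) (if i = q then X else zero_field)"
  using theI'[OF last_lift_unique[OF X, of q]] unfolding last_lift_def by simp_all

lemma last_lift_eqI:
  assumes X: "X \<in> \<L>" and D: "D \<in> vector_fields (\<N> (Suc q))"
    "\<And>i. i < Suc q \<Longrightarrow> related (\<N> (Suc q)) \<A> (component i) D (if i = q then X else zero_field)"
  shows "\<X> (Suc q) X = D" unfolding last_lift_def by (rule the1_equality[OF last_lift_unique[OF X]]) (use D in simp)

text \<open>The vector \<open>v\<close> may be any representative of \<open>X\<close> at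
  \<open>k\<close> on the fibre. This freedom allows sums and multiples of fibre vectors as well as
  left translates to be inserted.\<close>

lemma last_lift_append:
  assumes X: "X \<in> \<L>" and c: "composable G x gs" "length gs = q" and k: "k \<in> arrows G" "t k = lv x gs" and f: "f \<in> fns (\<N> (Suc q))"
    and v: "tangent_vector (\<F> (lv x gs)) k v" "\<And>f. f \<in> fns \<A> \<Longrightarrow> v (pullback (\<F> (lv x gs)) id f) = X f k"
  shows "\<X> (Suc q) X f (x, gs @ [k]) = v (pullback (\<F> (lv x gs)) (\<lambda>k. (x, gs @ [k])) f)"
proof (rule nerve_tangent_vector_eqI[where z = "(x, gs @ [k])", OF _ _ _ _ f])
  have z: "(x, gs @ [k]) \<in> pts (\<N> (Suc q))" using c k by simp
  show "tangent_vector (\<N> (Suc q)) (x, gs @ [k]) (\<lambda>f. \<X> (Suc q) X f (x, gs @ [k]))"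
    by (rule vfield_tangent_vector[OF last_lift_vfield[OF X] z])
  note sm = smooth_append[OF c(1), unfolded c(2)]
  show "tangent_vector (\<N> (Suc q)) (x, gs @ [k]) (\<lambda>f. v (pullback (\<F> (lv x gs)) (\<lambda>k. (x, gs @ [k])) f))"
    by (rule tangent_vector_push[OF ds_tfibre v(1) sm])
  fix i h assume i: "i < Suc q" and h: "h \<in> fns \<A>"
  show "\<X> (Suc q) X (pullback (\<N> (Suc q)) (component i) h) (x, gs @ [k]) =
     v (pullback (\<F> (lv x gs)) (\<lambda>k. (x, gs @ [k])) (pullback (\<N> (Suc q)) (component i) h))"
  proof (cases "i = q")
    case True
    have "pullback (\<F> (lv x gs)) (\<lambda>k. (x, gs @ [k])) (pullback (\<N> (Suc q)) (component i) h) = pullback (\<F> (lv x gs)) id h"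
      using c(1) by (auto simp: pullback_def True c(2)[symmetric])
    then show ?thesis using relatedD[OF last_lift_related[OF X i] h] v(2)[OF h] z True c(2) component_append(2)[of gs x k "[]"] by (simp add: pullback_apply)
  next
    case False
    then have iq: "i < length gs" using i c(2) by simp
    have "pullback (\<F> (lv x gs)) (\<lambda>k. (x, gs @ [k])) (pullback (\<N> (Suc q)) (component i) h) =
         (\<lambda>k. if k \<in> pts (\<F> (lv x gs)) then h (gs ! i) else 0)"
        using iq c by (simp add: pullback_def component_def nth_append fun_eq_iff)
    then show ?thesis using relatedD[OF last_lift_related[OF X i] h] tangent_vector_at_const[OF ds_tfibre v(1)] False by (simp add: zero_field_def pullback_def)
  qed
qed simp

lemma last_lift_fibre_vector:
  assumes X: "X \<in> \<L>" and c: "composable G x gs" "length gs = q" and k: "k \<in> arrows G" "t k = lv x gs" and f: "f \<in> fns (\<N> (Suc q))"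
  shows "\<X> (Suc q) X f (x, gs @ [k]) = fibre_vector X k (pullback (\<F> (lv x gs)) (\<lambda>k. (x, gs @ [k])) f)" by (rule last_lift_append[OF X c k f])
    (use fibre_vector_tangent[OF X k(1)] fibre_vector_restriction[OF X k(1)] k(2) in simp_all)

section \<open>Contraction of a cochain with a section\<close>

lemma restrict_last_outside: "z \<notin> nerve_pts G q \<Longrightarrow> \<I> q X f z = 0" by (simp add: restrict_last_def pullback_outside)

lemma restrict_last_fns: "X \<in> \<L> \<Longrightarrow> f \<in> fns (\<N> (Suc q)) \<Longrightarrow> \<I> q X f \<in> fns (\<N> q)"
  unfolding restrict_last_def using smooth_between_fns[OF smooth_degeneracy[of q q] vfield_fns[OF last_lift_vfield]] by simp

lemma restrict_last_apply:
  "composable G x gs \<Longrightarrow> length gs = q \<Longrightarrow> \<I> q X f (x, gs) = \<X> (Suc q) X f (x, gs @ [e (lv x gs)])"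
  using degeneracy_append[of G gs x "[]"] by (simp add: restrict_last_def pullback_apply)

lemma restrict_last_append:
  assumes X: "X \<in> \<L>" and c: "composable G x gs" "length gs = q" and f: "f \<in> fns (\<N> (Suc q))"
    and v: "tangent_vector (\<F> (lv x gs)) (e (lv x gs)) v"
      "\<And>f. f \<in> fns \<A> \<Longrightarrow> v (pullback (\<F> (lv x gs)) id f) = X f (e (lv x gs))"
  shows "\<I> q X f (x, gs) = v (pullback (\<F> (lv x gs)) (\<lambda>k. (x, gs @ [k])) f)" unfolding restrict_last_apply[OF c]
  by (rule last_lift_append[OF X c _ _ f v]) (simp_all add: composable_last_obj[OF c(1)])

lemma
  assumes X: "X \<in> \<L>" and y: "y \<in> objs G"
  shows unit_vector_tangent: "tangent_vector (\<F> y) (e y) (fibre_vector X (e y))"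
    and unit_vector_restriction: "f \<in> fns \<A> \<Longrightarrow> fibre_vector X (e y) (pullback (\<F> y) id f) = X f (e y)"
  using fibre_vector_tangent[OF X idt_arr[OF y]] fibre_vector_restriction[OF X idt_arr[OF y], of f] y by simp_all

lemma restrict_last_fibre_vector:
  assumes X: "X \<in> \<L>" and c: "composable G x gs" "length gs = q" and f: "f \<in> fns (\<N> (Suc q))"
  shows "\<I> q X f (x, gs) = fibre_vector X (e (lv x gs)) (pullback (\<F> (lv x gs)) (\<lambda>k. (x, gs @ [k])) f)"
  by (rule restrict_last_append[OF X c f])
    (simp_all add: unit_vector_tangent unit_vector_restriction X composable_last_obj[OF c(1)])

lemma restrict_last_lincomb:
  assumes X: "X \<in> \<L>" and f: "f \<in> fns (\<N> (Suc q))" "g \<in> fns (\<N> (Suc q))"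
  shows "\<I> q X (\<lambda>z. a * f z + b * g z) = (\<lambda>z. a * \<I> q X f z + b * \<I> q X g z)"
  unfolding restrict_last_def vfield_lincomb[OF last_lift_vfield[OF X] f] pullback_lincomb by simp

lemma restrict_last_sum:
  assumes X: "X \<in> \<L>" and f: "\<And>i. i \<in> I \<Longrightarrow> f i \<in> fns (\<N> (Suc q))"
  shows "\<I> q X (\<lambda>z. \<Sum>i\<in>I. f i z) = (\<lambda>z. \<Sum>i\<in>I. \<I> q X (f i) z)"
  unfolding restrict_last_def using vfield_sum[OF ds_nerve last_lift_vfield[OF X], of I f q] f by (simp add: pullback_sum)

lemma restrict_last_section_add:
  assumes X: "X \<in> \<L>" "Y \<in> \<L>" and f: "f \<in> fns (\<N> (Suc q))"
  shows "\<I> q (section_add X Y) f = (\<lambda>z. \<I> q X f z + \<I> q Y f z)"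
proof (rule nerve_fun_eqI)
  fix x gs assume c: "length gs = q" "composable G x gs"
  let ?y = "lv x gs"
  have y: "?y \<in> objs G" by (rule composable_last_obj[OF c(2)])
  have v: "tangent_vector (\<F> ?y) (e ?y) (\<lambda>f. 1 * fibre_vector X (e ?y) f + 1 * fibre_vector Y (e ?y) f)"
    by (rule tangent_vector_add[OF unit_vector_tangent[OF X(1) y] unit_vector_tangent[OF X(2) y]])
  show "\<I> q (section_add X Y) f (x, gs) = \<I> q X f (x, gs) + \<I> q Y f (x, gs)"
    unfolding restrict_last_fibre_vector[OF X(1) c(2,1) f] restrict_last_fibre_vector[OF X(2) c(2,1) f]
    by (subst restrict_last_append[OF section_add_left_invariant[OF X] c(2,1) f v])
      (simp_all add: unit_vector_restriction[OF X(1) y] unit_vector_restriction[OF X(2) y] section_add_def)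
qed (simp_all add: restrict_last_outside)

lemma restrict_last_section_scale:
  assumes X: "X \<in> \<L>" and a: "a \<in> fns \<O>" and f: "f \<in> fns (\<N> (Suc q))"
  shows "\<I> q (section_scale G a X) f = (\<lambda>z. a (last_vertex G z) * \<I> q X f z)"
proof (rule nerve_fun_eqI)
  fix x gs assume c: "length gs = q" "composable G x gs"
  let ?y = "lv x gs"
  have y: "?y \<in> objs G" by (rule composable_last_obj[OF c(2)])
  \<comment> \<open>The summand with coefficient 0 only brings a multiple of a single vector into
    the form of a combination of two.\<close>
  have v: "tangent_vector (\<F> ?y) (e ?y) (\<lambda>f. a ?y * fibre_vector X (e ?y) f + 0 * fibre_vector X (e ?y) f)"
    by (rule tangent_vector_add[OF unit_vector_tangent[OF X y] unit_vector_tangent[OF X y]])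
  show "\<I> q (section_scale G a X) f (x, gs) = a ?y * \<I> q X f (x, gs)" unfolding restrict_last_fibre_vector[OF X c(2,1) f]
    by (subst restrict_last_append[OF section_scale_left_invariant[OF X a] c(2,1) f v])
      (simp_all add: unit_vector_restriction[OF X y] section_scale_def y)
qed (simp_all add: restrict_last_outside)

end

context lie_groupoid_locale
begin

subsection \<open>Normalized cochains\<close>

text \<open>A face whose index is below the length of \<open>gs\<close> does not reach an appended
  arrow, and it keeps the last vertex; hence it commutes with differentiation in the last
  component.\<close>

lemma face_append:
  assumes "i < length gs"
  obtains x' gs' where "face G i (x, gs) = (x', gs')" "\<And>k. face G i (x, gs @ [k]) = (x', gs' @ [k])"
    "composable G x gs \<Longrightarrow> composable G x' gs' \<and> lv x' gs' = lv x gs \<and> Suc (length gs') = length gs"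
proof (cases "i = 0")
  case True
  with assms obtain g hs where gs: "gs = g # hs" by (cases gs) auto
  show ?thesis by (rule that[of "s g" hs]) (simp_all add: True gs face_0)
next
  case False
  then have "0 < i" by simp
  then obtain u a b v where gs: "gs = u @ a # b # v" "i = Suc (length u)" using assms by (rule list_split_at)
  show ?thesis by (rule that[of x "u @ mul G a b # v"]) (simp_all add: gs face_mid)
qed

lemma normalized_fns: "f \<in> \<C> q \<Longrightarrow> f \<in> fns (\<N> q)" by (simp add: normalized_def)

lemma normalizedD:
  assumes f: "f \<in> \<C> q" and c: "composable G x (u @ v)" "Suc (length u + length v) = q"
  shows "f (x, u @ e (lv x u) # v) = 0"
proof -
  have "pullback (\<N> (q - 1)) (degeneracy G (length u)) f = (\<lambda>_. 0)" using f c(2) by (auto simp: normalized_def)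
  from fun_cong[OF this, of "(x, u @ v)"] show ?thesis using c by (auto simp: pullback_def degeneracy_append)
qed

lemma normalizedI:
  assumes f: "f \<in> fns (\<N> q)"
    and d: "\<And>x u v. composable G x u \<Longrightarrow> composable G (lv x u) v \<Longrightarrow> Suc (length u + length v) = q \<Longrightarrow> f (x, u @ e (lv x u) # v) = 0"
  shows "f \<in> \<C> q" unfolding normalized_def mem_Collect_eq
proof (intro conjI allI impI f)
  fix i assume i: "i < q"
  show "pullback (\<N> (q - 1)) (degeneracy G i) f = (\<lambda>_. 0)"
  proof (rule nerve_fun_eqI)
    fix x gs assume gs: "length gs = q - 1" "composable G x gs"
    have "composable G x (take i gs @ drop i gs)" using gs by simp
    then have "f (x, take i gs @ e (lv x (take i gs)) # drop i gs) = 0" using gs i unfolding composable_append by (intro d) auto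
    moreover have "degeneracy G i (x, gs) = (x, take i gs @ e (lv x (take i gs)) # drop i gs)" by (simp add: degeneracy_def)
    ultimately show "pullback (\<N> (q - 1)) (degeneracy G i) f (x, gs) = 0" by (simp add: pullback_def)
  qed (simp_all add: pullback_outside)
qed

lemma normalized_0: "f \<in> fns (\<N> 0) \<Longrightarrow> f \<in> \<C> 0" by (simp add: normalized_def)

lemma normalized_lincomb:
  assumes "f \<in> \<C> q" "g \<in> \<C> q"
  shows "(\<lambda>z. a * f z + b * g z) \<in> \<C> q"
proof (rule normalizedI)
  show "(\<lambda>z. a * f z + b * g z) \<in> fns (\<N> q)" by (rule fns_lincomb[OF ds_nerve normalized_fns[OF assms(1)] normalized_fns[OF assms(2)]])
qed (simp add: normalizedD[OF assms(1)] normalizedD[OF assms(2)])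

lemma restrict_last_zero_on:
  assumes X: "X \<in> \<L>" and c: "composable G x gs" "length gs = q" and k: "k \<in> arrows G" "t k = lv x gs"
    and f: "f \<in> fns (\<N> (Suc q))" and z: "\<And>k. k \<in> arrows G \<Longrightarrow> t k = lv x gs \<Longrightarrow> f (x, gs @ [k]) = 0"
  shows "\<X> (Suc q) X f (x, gs @ [k]) = 0"
proof -
  have "pullback (\<F> (lv x gs)) (\<lambda>k. (x, gs @ [k])) f = (\<lambda>_. 0)" using z by (simp add: pullback_def fun_eq_iff)
  moreover have "fibre_vector X k (\<lambda>_. 0) = 0" by (rule tangent_vector_at_0[OF ds_tfibre fibre_vector_tangent[OF X k(1)]])
  ultimately show ?thesis by (simp add: last_lift_fibre_vector[OF X c k f])
qed

text \<open>The inserted unit precedes the last arrow, as \<open>v\<close> is nonempty. Moving the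
  last arrow therefore stays among degenerate strings, where \<open>f\<close> is zero.\<close>

lemma last_lift_degenerate:
  assumes X: "X \<in> \<L>" and f: "f \<in> \<C> (Suc q)" and c: "composable G x (u @ v)" "v \<noteq> []" "length u + length v = q"
  shows "\<X> (Suc q) X f (x, u @ e (lv x u) # v) = 0"
proof -
  from c(2) obtain w k where v: "v = w @ [k]" by (cases v rule: rev_cases) auto
  have o: "lv x u \<in> objs G" using c(1) composable_last_obj[of x u] by simp
  have "\<X> (Suc q) X f (x, (u @ e (lv x u) # w) @ [k]) = 0"
  proof (rule restrict_last_zero_on[OF X _ _ _ _ normalized_fns[OF f]])
    fix k assume "k \<in> arrows G" "t k = lv x (u @ e (lv x u) # w)"
    then show "f (x, (u @ e (lv x u) # w) @ [k]) = 0" using normalizedD[OF f, of x u "w @ [k]"] c v o by simp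
  qed (use c v o in simp_all)
  then show ?thesis by (simp add: v)
qed

lemma restrict_last_normalized:
  assumes X: "X \<in> \<L>" and f: "f \<in> \<C> (Suc q)"
  shows "\<I> q X f \<in> \<C> q"
proof (rule normalizedI[OF restrict_last_fns[OF X normalized_fns[OF f]]])
  fix x u v assume c: "composable G x u" "composable G (lv x u) v" "Suc (length u + length v) = q"
  have o: "lv x u \<in> objs G" by (rule composable_last_obj[OF c(1)])
  have o': "lv (lv x u) v \<in> objs G" by (rule composable_last_obj[OF c(2)])
  have "\<I> q X f (x, u @ e (lv x u) # v) = \<X> (Suc q) X f (x, u @ e (lv x u) # (v @ [e (lv (lv x u) v)]))"
    using restrict_last_apply[of x "u @ e (lv x u) # v" q X f] c o by simp
  also have "\<dots> = 0" by (rule last_lift_degenerate[OF X f]) (use c o' in simp_all)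
  finally show "\<I> q X f (x, u @ e (lv x u) # v) = 0" .
qed

text \<open>The product rule has a second term, with the derivative of \<open>a\<close> along
  \<open>X\<close>. Its other factor is the value of \<open>f\<close> at a string ending in a unit,
  which is zero for a normalized cochain.\<close>

lemma restrict_last_multiple:
  assumes X: "X \<in> \<L>" and f: "f \<in> \<C> (Suc q)" and a: "a \<in> fns \<O>"
  shows "\<I> q X (\<lambda>z. a (last_vertex G z) * f z) = (\<lambda>z. a (last_vertex G z) * \<I> q X f z)"
proof (rule nerve_fun_eqI)
  let ?N = "\<N> (Suc q)"
  let ?a = "pullback ?N (last_vertex G) a"
  have af: "?a \<in> fns ?N" by (rule smooth_between_fns[OF smooth_last_vertex a])
  note ff = normalized_fns[OF f]
  have eq: "(\<lambda>z. a (last_vertex G z) * f z) = (\<lambda>z. ?a z * f z)" using nerve_fns_outside[OF ff] by (auto simp: pullback_def fun_eq_iff)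
  fix x gs assume c: "length gs = q" "composable G x gs"
  have o: "lv x gs \<in> objs G" by (rule composable_last_obj[OF c(2)])
  have "f (x, gs @ [e (lv x gs)]) = 0" using normalizedD[OF f, of x gs "[]"] c by simp
  then show "\<I> q X (\<lambda>z. a (last_vertex G z) * f z) (x, gs) = a (lv x gs) * \<I> q X f (x, gs)"
    unfolding eq restrict_last_apply[OF c(2,1)] vfield_mult[OF last_lift_vfield[OF X] af ff] using c o by (simp add: pullback_def)
qed (simp_all add: restrict_last_outside)

subsection \<open>Products\<close>

lemma cochain_prod_apply:
  "length gs = q + q' \<Longrightarrow> composable G x gs \<Longrightarrow> \<P> q q' f g (x, gs) = f (x, take q gs) * g (lv x (take q gs), drop q gs)"
  by (simp add: cochain_prod_def)

lemma cochain_prod_outside: "z \<notin> nerve_pts G (q + q') \<Longrightarrow> \<P> q q' f g z = 0"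
  by (cases z) (simp add: cochain_prod_def del: nerve_pts_iff)

lemma cochain_prod_fns:
  assumes f: "f \<in> fns (\<N> q)" and g: "g \<in> fns (\<N> q')"
  shows "\<P> q q' f g \<in> fns (\<N> (q + q'))"
proof -
  let ?N = "\<N> (q + q')"
  have "smooth_between ?N (\<N> q) (\<lambda>z. (fst z, take q (snd z)))" by (rule smooth_take) simp
  note 1 = smooth_between_fns[OF this f]
  have "smooth_between ?N (\<N> q') (\<lambda>z. (lv (fst z) (take q (snd z)), drop q (snd z)))" by (rule smooth_drop) simp
  note 2 = smooth_between_fns[OF this g]
  have "\<P> q q' f g = (\<lambda>z. pullback ?N (\<lambda>z. (fst z, take q (snd z))) f z *
      pullback ?N (\<lambda>z. (lv (fst z) (take q (snd z)), drop q (snd z))) g z)"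
    by (auto simp: cochain_prod_def pullback_def fun_eq_iff)
  then show ?thesis using fns_mult[OF ds_nerve 1 2] by simp
qed

lemma cochain_prod_normalized:
  assumes f: "f \<in> \<C> q" and g: "g \<in> \<C> q'"
  shows "\<P> q q' f g \<in> \<C> (q + q')"
proof (rule normalizedI[OF cochain_prod_fns[OF normalized_fns[OF f] normalized_fns[OF g]]])
  fix x u v assume c: "composable G x u" "composable G (lv x u) v" "Suc (length u + length v) = q + q'"
  have o: "lv x u \<in> objs G" by (rule composable_last_obj[OF c(1)])
  let ?gs = "u @ e (lv x u) # v"
  have eq: "\<P> q q' f g (x, ?gs) = f (x, take q ?gs) * g (lv x (take q ?gs), drop q ?gs)" by (rule cochain_prod_apply) (use c o in simp_all)
  show "\<P> q q' f g (x, ?gs) = 0"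
  \<comment> \<open>The cut after \<open>q\<close> components lies either before the inserted unit,
    which then belongs to the second factor, or behind it.\<close>
  proof (cases "q \<le> length u")
    case True
    have "composable G x (take q u @ drop q u)" using c(1) by simp
    then have d: "composable G (lv x (take q u)) (drop q u)" unfolding composable_append by simp
    have l: "lv (lv x (take q u)) (drop q u) = lv x u" using last_vertex_append[of G x "take q u" "drop q u"] by simp
    have "g (lv x (take q u), drop q u @ e (lv (lv x (take q u)) (drop q u)) # v) = 0" by (rule normalizedD[OF g]) (use d c True l in simp_all)
    then show ?thesis unfolding eq using True l by simp
  next
    case False
    then obtain r where r: "q = Suc (length u + r)" using less_iff_Suc_add[of "length u" q] by auto
    have "composable G (lv x u) (take r v @ drop r v)" using c(2) by simp
    then have d: "composable G (lv x u) (take r v)" unfolding composable_append by simp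
    have "f (x, u @ e (lv x u) # take r v) = 0" by (rule normalizedD[OF f]) (use c d r in simp_all)
    then show ?thesis unfolding eq using r by simp
  qed
qed

text \<open>The last component enters only the second factor, so the value of \<open>f\<close> is a
  constant under the differentiation.\<close>

lemma restrict_last_cochain_prod:
  assumes X: "X \<in> \<L>" and f: "f \<in> fns (\<N> q)" and g: "g \<in> fns (\<N> (Suc q'))"
  shows "\<I> (q + q') X (\<P> q (Suc q') f g) = \<P> q q' f (\<I> q' X g)"
proof (rule nerve_fun_eqI)
  have fg: "\<P> q (Suc q') f g \<in> fns (\<N> (Suc (q + q')))" using cochain_prod_fns[OF f g] by simp
  fix x gs assume c: "length gs = q + q'" "composable G x gs"
  let ?u = "take q gs" and ?v = "drop q gs"
  have "composable G x (?u @ ?v)" using c by simp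
  then have cv: "composable G (lv x ?u) ?v" unfolding composable_append by simp
  have l: "lv (lv x ?u) ?v = lv x gs" using last_vertex_append[of G x ?u ?v] by simp
  have o: "lv x gs \<in> objs G" by (rule composable_last_obj[OF c(2)])
  have lv': "length ?v = q'" using c by simp
  have sm: "pullback (\<F> (lv x gs)) (\<lambda>k. (lv x ?u, ?v @ [k])) g \<in> fns (\<F> (lv x gs))"
    using smooth_between_fns[OF smooth_append[OF cv, unfolded lv' l] g] .
  have "pullback (\<F> (lv x gs)) (\<lambda>k. (x, gs @ [k])) (\<P> q (Suc q') f g) =
     (\<lambda>k. f (x, ?u) * pullback (\<F> (lv x gs)) (\<lambda>k. (lv x ?u, ?v @ [k])) g k)"
    using c by (auto simp: pullback_def fun_eq_iff cochain_prod_apply)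
  then have "\<I> (q + q') X (\<P> q (Suc q') f g) (x, gs) =
     f (x, ?u) * fibre_vector X (e (lv x gs)) (pullback (\<F> (lv x gs)) (\<lambda>k. (lv x ?u, ?v @ [k])) g)"
    unfolding restrict_last_fibre_vector[OF X c(2,1) fg] using tangent_vector_at_scale[OF ds_tfibre unit_vector_tangent[OF X o] sm] by simp
  also have "\<dots> = f (x, ?u) * \<I> q' X g (lv x ?u, ?v)" using restrict_last_fibre_vector[OF X cv lv' g] by (simp add: l)
  also have "\<dots> = \<P> q q' f (\<I> q' X g) (x, gs)" by (rule cochain_prod_apply[OF c, symmetric])
  finally show "\<I> (q + q') X (\<P> q (Suc q') f g) (x, gs) = \<P> q q' f (\<I> q' X g) (x, gs)" .
qed (simp_all add: restrict_last_outside cochain_prod_outside)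

text \<open>After all contractions of the second factor a function of the last vertex remains; in
  this form it can be moved through the contractions of the first factor.\<close>

lemma cochain_prod_0:
  assumes f: "f \<in> fns (\<N> q)"
  shows "\<P> q 0 f g = (\<lambda>z. g (last_vertex G z, []) * f z)"
proof (rule nerve_fun_eqI)
  show "\<P> q 0 f g (x, gs) = g (lv x gs, []) * f (x, gs)" if "length gs = q" "composable G x gs" for x gs using that by (simp add: cochain_prod_apply)
  show "\<P> q 0 f g z = 0" if "z \<notin> nerve_pts G q" for z using cochain_prod_outside[of z q 0] that by simp
qed (simp add: nerve_fns_outside[OF f])

subsection \<open>The coboundary\<close>

lemma face_fns: "i \<le> Suc q \<Longrightarrow> f \<in> fns (\<N> q) \<Longrightarrow> pullback (\<N> (Suc q)) (face G i) f \<in> fns (\<N> (Suc q))"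
  by (rule smooth_between_fns[OF smooth_face])

lemma coboundary_fns: "f \<in> fns (\<N> q) \<Longrightarrow> coboundary G q f \<in> fns (\<N> (Suc q))"
  unfolding coboundary_def by (intro fns_sum[OF ds_nerve] fns_scale[OF ds_nerve] face_fns) simp_all

lemma coboundary_apply:
  "length gs = Suc q \<Longrightarrow> composable G x gs \<Longrightarrow> coboundary G q f (x, gs) = (\<Sum>i\<le>Suc q. (- 1) ^ i * f (face G i (x, gs)))"
  by (simp add: coboundary_def pullback_def)

text \<open>On a string with a unit in position \<open>?i\<close> the two faces \<open>?i\<close>
  and \<open>Suc ?i\<close> both remove the unit, give the same string and enter with opposite
  signs. All other faces keep a unit in the string.\<close>

lemma coboundary_normalized:
  assumes f: "f \<in> \<C> q"
  shows "coboundary G q f \<in> \<C> (Suc q)"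
proof (rule normalizedI[OF coboundary_fns[OF normalized_fns[OF f]]])
  fix x u v assume c: "composable G x u" "composable G (lv x u) v" "Suc (length u + length v) = Suc q"
  let ?E = "e (lv x u)" and ?i = "length u"
  let ?w = "u @ ?E # v"
  have o: "lv x u \<in> objs G" by (rule composable_last_obj[OF c(1)])
  have lt: "f (face G j (x, ?w)) = 0" if j: "j < ?i" for j
  proof (cases "j = 0")
    case True
    with j obtain g u' where u: "u = g # u'" by (cases u) auto
    have "f (s g, u' @ e (lv (s g) u') # v) = 0" by (rule normalizedD[OF f]) (use c u in simp_all)
    then show ?thesis by (simp add: True u face_0)
  next
    case False
    then have "0 < j" by simp
    then obtain p a b r where u: "u = p @ a # b # r" "j = Suc (length p)" using j by (rule list_split_at)
    have "f (x, (p @ mul G a b # r) @ e (lv x (p @ mul G a b # r)) # v) = 0" by (rule normalizedD[OF f]) (use c u in simp_all)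
    then show ?thesis using c u by (simp add: face_mid)
  qed
  have gt: "f (face G j (x, ?w)) = 0" if j: "Suc ?i < j" "j \<le> Suc q" for j
  proof (cases "j = Suc q")
    case True
    then obtain v' g where v: "v = v' @ [g]" using j c(3) by (cases v rule: rev_cases) auto
    have "face G (Suc (length (u @ ?E # v'))) (x, (u @ ?E # v') @ [g]) = (x, u @ ?E # v')" by (rule face_last)
    moreover have "f (x, u @ ?E # v') = 0" by (rule normalizedD[OF f]) (use c v in simp_all)
    ultimately show ?thesis using True c(3) v by simp
  next
    case False
    then have "0 < j - Suc ?i" "j - Suc ?i < length v" using j c(3) by linarith+
    then obtain p a b r where v: "v = p @ a # b # r" "j - Suc ?i = Suc (length p)" by (rule list_split_at)
    have "f (x, u @ ?E # (p @ mul G a b # r)) = 0" by (rule normalizedD[OF f]) (use c v in simp_all)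
    moreover have "face G (Suc (length (u @ ?E # p))) (x, (u @ ?E # p) @ a # b # r) = (x, (u @ ?E # p) @ mul G a b # r)" by (rule face_mid)
    moreover have "Suc (length (u @ ?E # p)) = j" using v(2) j by simp
    ultimately show ?thesis by (simp add: v)
  qed
  have i1: "face G ?i (x, ?w) = (x, u @ v)"
  proof (cases u rule: rev_cases)
    case Nil
    then show ?thesis using o by (simp add: face_0)
  next
    case (snoc u' g)
    then show ?thesis using c face_mid[of G u' x g "e (s g)" v] by simp
  qed
  have i2: "face G (Suc ?i) (x, ?w) = (x, u @ v)"
  proof (cases v)
    case Nil
    then show ?thesis using face_last[of G u x ?E] by simp
  next
    case (Cons h v')
    then have "mul G ?E h = h" using c(2) mul_idt_left[of h] by simp
    then show ?thesis using Cons face_mid[of G u x ?E h v'] by simp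
  qed
  have "coboundary G q f (x, ?w) = (\<Sum>j\<le>Suc q. (- 1) ^ j * f (face G j (x, ?w)))" by (rule coboundary_apply) (use c o in simp_all)
  also have "\<dots> = (\<Sum>j\<in>{?i, Suc ?i}. (- 1) ^ j * f (face G j (x, ?w)))"
  proof (rule sum.mono_neutral_right)
    show "\<forall>j\<in>{..Suc q} - {?i, Suc ?i}. (- 1) ^ j * f (face G j (x, ?w)) = 0"
    proof
      fix j assume "j \<in> {..Suc q} - {?i, Suc ?i}"
      then have "j < ?i \<or> Suc ?i < j" "j \<le> Suc q" by auto
      then show "(- 1) ^ j * f (face G j (x, ?w)) = 0" using lt gt by auto
    qed
  qed (use c(3) in auto)
  also have "\<dots> = 0" by (simp add: i1 i2)
  finally show "coboundary G q f (x, ?w) = 0" .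
qed

section \<open>Contraction of the faces of a cochain and the resulting defect\<close>

lemma restrict_last_face_low:
  assumes X: "X \<in> \<L>" and f: "f \<in> fns (\<N> (Suc q))" and i: "i \<le> q"
  shows "\<I> (Suc q) X (pullback (\<N> (Suc (Suc q))) (face G i) f) = pullback (\<N> (Suc q)) (face G i) (\<I> q X f)"
proof (rule nerve_fun_eqI)
  have ff: "pullback (\<N> (Suc (Suc q))) (face G i) f \<in> fns (\<N> (Suc (Suc q)))" using i by (intro face_fns f) simp
  fix x gs assume c: "length gs = Suc q" "composable G x gs"
  have "i < length gs" using i c by simp
  then obtain x' gs' where F: "face G i (x, gs) = (x', gs')" "\<And>k. face G i (x, gs @ [k]) = (x', gs' @ [k])"
    "composable G x gs \<Longrightarrow> composable G x' gs' \<and> lv x' gs' = lv x gs \<and> Suc (length gs') = length gs" by (rule face_append) blast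
  have F': "composable G x' gs'" "lv x' gs' = lv x gs" "length gs' = q" using F(3)[OF c(2)] c(1) by simp_all
  have "pullback (\<F> (lv x gs)) (\<lambda>k. (x, gs @ [k])) (pullback (\<N> (Suc (Suc q))) (face G i) f) =
    pullback (\<F> (lv x' gs')) (\<lambda>k. (x', gs' @ [k])) f"
    using c F(2) by (auto simp: pullback_def fun_eq_iff F'(2))
  then show "\<I> (Suc q) X (pullback (\<N> (Suc (Suc q))) (face G i) f) (x, gs) = pullback (\<N> (Suc q)) (face G i) (\<I> q X f) (x, gs)"
    unfolding restrict_last_fibre_vector[OF X c(2,1) ff] using c F(1) restrict_last_fibre_vector[OF X F'(1,3) f] by (simp add: pullback_apply F'(2))
qed (simp_all add: restrict_last_outside pullback_outside)

text \<open>The last face forgets the component that is being moved, so a constant is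
  differentiated.\<close>

lemma restrict_last_face_last:
  assumes X: "X \<in> \<L>" and f: "f \<in> fns (\<N> q)"
  shows "\<I> q X (pullback (\<N> (Suc q)) (face G (Suc q)) f) = (\<lambda>_. 0)"
proof (rule nerve_fun_eqI)
  have ff: "pullback (\<N> (Suc q)) (face G (Suc q)) f \<in> fns (\<N> (Suc q))" by (rule face_fns[OF _ f]) simp
  fix x gs assume c: "length gs = q" "composable G x gs"
  have o: "lv x gs \<in> objs G" by (rule composable_last_obj[OF c(2)])
  have "pullback (\<F> (lv x gs)) (\<lambda>k. (x, gs @ [k])) (pullback (\<N> (Suc q)) (face G (Suc q)) f) =
    (\<lambda>k. if k \<in> pts (\<F> (lv x gs)) then f (x, gs) else 0)"
    using c face_last[of G gs x] by (auto simp: pullback_def fun_eq_iff)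
  then show "\<I> q X (pullback (\<N> (Suc q)) (face G (Suc q)) f) (x, gs) = 0" unfolding restrict_last_fibre_vector[OF X c(2,1) ff]
    using tangent_vector_at_const[OF ds_tfibre unit_vector_tangent[OF X o]] by simp
qed (simp_all add: restrict_last_outside)

lemma smooth_translation_tfibre:
  assumes g: "g \<in> arrows G"
  shows "smooth_between (\<F> (s g)) (\<F> (t g)) (mul G g)"
proof (rule smooth_between_generated[OF ds_tfibre generated_tfibre])
  show "mul G g h \<in> pts (\<F> (t g))" if "h \<in> pts (\<F> (s g))" for h using that g by simp
  fix k assume "k \<in> pullback (\<F> (t g)) id ` fns \<A>"
  then obtain f where f: "f \<in> fns \<A>" "k = pullback (\<F> (t g)) id f" by auto
  have "pullback (\<F> (s g)) (mul G g) k = pullback (\<F> (s g)) (mul G g) f" using g by (auto simp: f(2) pullback_def fun_eq_iff)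
  then show "pullback (\<F> (s g)) (mul G g) k \<in> fns (\<F> (s g))" using smooth_between_fns[OF smooth_translation[OF g] f(1)] by simp
qed

text \<open>Left invariance: multiplying the last component by a varying arrow moves it along the left-invariant field.\<close>

lemma restrict_last_face_mid:
  assumes X: "X \<in> \<L>" and f: "f \<in> fns (\<N> (Suc q))"
  shows "\<I> (Suc q) X (pullback (\<N> (Suc (Suc q))) (face G (Suc q)) f) = \<X> (Suc q) X f"
proof (rule nerve_fun_eqI)
  have ff: "pullback (\<N> (Suc (Suc q))) (face G (Suc q)) f \<in> fns (\<N> (Suc (Suc q)))" by (intro face_fns f) simp
  show "\<X> (Suc q) X f z = 0" if "z \<notin> nerve_pts G (Suc q)" for z using vfield_outside[OF ds_nerve last_lift_vfield[OF X]] that by simp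
  fix x gs' assume c': "length gs' = Suc q" "composable G x gs'"
  then obtain gs g where gs: "gs' = gs @ [g]" by (cases gs' rule: rev_cases) auto
  have c: "composable G x gs" "length gs = q" and g: "g \<in> arrows G" "t g = lv x gs" using c' gs by simp_all
  have eg: "t (e (s g)) = s g" "e (s g) \<in> arrows G" using g by simp_all
  let ?v = "fibre_vector X (e (s g))"
  have v: "tangent_vector (\<F> (s g)) (e (s g)) ?v" using unit_vector_tangent[OF X, of "s g"] g by simp
  have vr: "?v (pullback (\<F> (s g)) id h) = X h (e (s g))" if "h \<in> fns \<A>" for h using unit_vector_restriction[OF X _ that, of "s g"] g by simp
  \<comment> \<open>The translate by \<open>g\<close> of the unit vector at \<open>s g\<close>
    represents \<open>X\<close> at \<open>g\<close>, hence may be used to compute the last lift at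
    \<open>gs @ [g]\<close>. The same vector computes the contraction, because the face multiplies
    \<open>g\<close> with the moving arrow.\<close>
  have w: "tangent_vector (\<F> (lv x gs)) g (\<lambda>h. ?v (pullback (\<F> (s g)) (mul G g) h))"
    using tangent_vector_push[OF ds_tfibre v smooth_translation_tfibre[OF g(1)]] g by simp
  have wr: "?v (pullback (\<F> (s g)) (mul G g) (pullback (\<F> (lv x gs)) id h)) = X h g" if h: "h \<in> fns \<A>" for h
  proof -
    have "pullback (\<F> (s g)) (mul G g) (pullback (\<F> (lv x gs)) id h) = pullback (\<F> (s g)) (mul G g) h" using g by (auto simp: pullback_def fun_eq_iff)
    then show ?thesis using left_invariant_translate[OF X g(1) eg(2) _ h v vr] g by simp
  qed
  have "\<X> (Suc q) X f (x, gs @ [g]) = ?v (pullback (\<F> (s g)) (mul G g) (pullback (\<F> (lv x gs)) (\<lambda>k. (x, gs @ [k])) f))"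
    by (rule last_lift_append[OF X c g f w wr])
  also have "pullback (\<F> (s g)) (mul G g) (pullback (\<F> (lv x gs)) (\<lambda>k. (x, gs @ [k])) f) =
     pullback (\<F> (lv x gs')) (\<lambda>k. (x, gs' @ [k])) (pullback (\<N> (Suc (Suc q))) (face G (Suc q)) f)"
    using c g face_mid[of G gs x g _ "[]"] by (auto simp: pullback_def fun_eq_iff gs)
  also have "?v \<dots> = \<I> (Suc q) X (pullback (\<N> (Suc (Suc q))) (face G (Suc q)) f) (x, gs')"
    unfolding restrict_last_fibre_vector[OF X c'(2,1) ff] by (simp add: gs)
  finally show "\<I> (Suc q) X (pullback (\<N> (Suc (Suc q))) (face G (Suc q)) f) (x, gs') = \<X> (Suc q) X f (x, gs')" by (simp add: gs)
qed (simp add: restrict_last_outside)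

text \<open>The part of the last lift that is left after subtracting its value on degenerate strings.\<close>

definition lift_defect :: "nat \<Rightarrow> 'g vfield \<Rightarrow> (('m, 'g) nsimplex \<Rightarrow> real) \<Rightarrow> ('m, 'g) nsimplex \<Rightarrow> real" where
  "lift_defect q X f = (\<lambda>z. \<X> (Suc q) X f z - pullback (\<N> (Suc q)) (face G (Suc q)) (\<I> q X f) z)"

lemma lift_defect_fns: "X \<in> \<L> \<Longrightarrow> f \<in> fns (\<N> (Suc q)) \<Longrightarrow> lift_defect q X f \<in> fns (\<N> (Suc q))"
  unfolding lift_defect_def by (intro fns_diff[OF ds_nerve] face_fns restrict_last_fns vfield_fns[OF last_lift_vfield]) simp_all

text \<open>On a string ending in a unit the last lift is by definition the contraction that is
  subtracted. With the unit in an earlier position both terms vanish separately.\<close>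

lemma lift_defect_normalized:
  assumes X: "X \<in> \<L>" and f: "f \<in> \<C> (Suc q)"
  shows "lift_defect q X f \<in> \<C> (Suc q)"
proof (rule normalizedI[OF lift_defect_fns[OF X normalized_fns[OF f]]])
  fix x u v assume c: "composable G x u" "composable G (lv x u) v" "Suc (length u + length v) = Suc q"
  let ?w = "u @ e (lv x u) # v"
  have o: "lv x u \<in> objs G" by (rule composable_last_obj[OF c(1)])
  have p: "pullback (\<N> (Suc q)) (face G (Suc q)) (\<I> q X f) (x, ?w) = \<I> q X f (face G (Suc q) (x, ?w))"
    using c o by (simp add: pullback_apply)
  show "lift_defect q X f (x, ?w) = 0"
  proof (cases v rule: rev_cases)
    case Nil
    then show ?thesis using c face_last[of G u x "e (lv x u)"] restrict_last_apply[OF c(1), of q X f] p by (simp add: lift_defect_def)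
  next
    case (snoc v' g)
    have "\<X> (Suc q) X f (x, ?w) = 0" by (rule last_lift_degenerate[OF X f]) (use c snoc in simp_all)
    moreover have "face G (Suc (length (u @ e (lv x u) # v'))) (x, (u @ e (lv x u) # v') @ [g]) = (x, u @ e (lv x u) # v')" by (rule face_last)
    moreover have "\<I> q X f (x, u @ e (lv x u) # v') = 0" by (rule normalizedD[OF restrict_last_normalized[OF X f]]) (use c snoc in simp_all)
    ultimately show ?thesis using c snoc p by (simp add: lift_defect_def)
  qed
qed

text \<open>The faces up to \<open>q\<close> commute with the contraction, the face
  \<open>Suc q\<close> turns into the last lift, and the last face vanishes. The last face of the
  contracted cochain, absent from this sum, is added to complete its coboundary and subtracted again
  inside \<open>lift_defect\<close>.\<close>

lemma restrict_last_coboundary: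
  assumes X: "X \<in> \<L>" and f: "f \<in> fns (\<N> (Suc q))"
  shows "\<I> (Suc q) X (coboundary G (Suc q) f) = (\<lambda>z. coboundary G q (\<I> q X f) z + (- 1) ^ Suc q * lift_defect q X f z)"
proof -
  let ?F = "\<lambda>i. pullback (\<N> (Suc (Suc q))) (face G i) f"
  let ?P = "\<lambda>i. pullback (\<N> (Suc q)) (face G i) (\<I> q X f)"
  have F: "?F i \<in> fns (\<N> (Suc (Suc q)))" if "i \<le> Suc (Suc q)" for i by (rule face_fns[OF that f])
  have sc: "\<I> (Suc q) X (\<lambda>z. (- 1) ^ i * ?F i z) = (\<lambda>z. (- 1) ^ i * \<I> (Suc q) X (?F i) z)"
    if "i \<le> Suc (Suc q)" for i using restrict_last_lincomb[OF X F[OF that] F[OF that], of "(- 1) ^ i" 0] by simp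
  have "\<I> (Suc q) X (coboundary G (Suc q) f) = (\<lambda>z. \<Sum>i\<le>Suc (Suc q). \<I> (Suc q) X (\<lambda>z. (- 1) ^ i * ?F i z) z)"
    unfolding coboundary_def by (rule restrict_last_sum[OF X]) (intro fns_scale[OF ds_nerve] F, simp)
  also have "\<dots> = (\<lambda>z. \<Sum>i\<le>Suc (Suc q). (- 1) ^ i * \<I> (Suc q) X (?F i) z)" by (intro ext sum.cong refl) (simp add: sc)
  also have "\<dots> = (\<lambda>z. (\<Sum>i\<le>q. (- 1) ^ i * ?P i z) + (- 1) ^ Suc q * \<X> (Suc q) X f z)"
    by (simp add: restrict_last_face_mid[OF X f] restrict_last_face_last[OF X f] restrict_last_face_low[OF X f])
  also have "\<dots> = (\<lambda>z. coboundary G q (\<I> q X f) z + (- 1) ^ Suc q * lift_defect q X f z)"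
    by (simp add: coboundary_def lift_defect_def algebra_simps)
  finally show ?thesis .
qed

text \<open>The coboundary of a function on \<open>M\<close> is its pullback along \<open>s\<close>
  minus that along \<open>t\<close>. The second part is killed by the contraction, the first gives
  the derivative along the anchor.\<close>

lemma restrict_last_coboundary_0:
  assumes X: "X \<in> \<L>" and f: "f \<in> fns (\<N> 0)" and x: "x \<in> objs G"
  shows "restrict_last G 1 X (coboundary G 0 f) (x, []) = anchor G X (\<lambda>x. f (x, [])) x"
proof -
  let ?a = "\<lambda>x. f (x, [])"
  have "pullback \<O> (\<lambda>x. (x, [])) f = ?a" using nerve_fns_outside[OF f] by (auto simp: pullback_def fun_eq_iff)
  then have a: "?a \<in> fns \<O>" using smooth_between_fns[OF smooth_vertex f] by simp
  have F: "pullback (\<N> (Suc 0)) (face G i) f \<in> fns (\<N> (Suc 0))" if "i \<le> Suc 0" for i by (rule face_fns[OF that f])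
  have "coboundary G 0 f = (\<lambda>z. 1 * pullback (\<N> (Suc 0)) (face G 0) f z + (- 1) * pullback (\<N> (Suc 0)) (face G (Suc 0)) f z)"
    by (simp add: coboundary_def)
  then have "\<I> 0 X (coboundary G 0 f) (x, []) = \<I> 0 X (pullback (\<N> (Suc 0)) (face G 0) f) (x, [])"
    using restrict_last_lincomb[OF X F[of 0] F[of "Suc 0"], of 1 "- 1"] restrict_last_face_last[OF X f] by simp
  also have "\<dots> = fibre_vector X (e x) (pullback (\<F> x) (\<lambda>k. (x, [k])) (pullback (\<N> (Suc 0)) (face G 0) f))"
    using restrict_last_fibre_vector[OF X _ _ F[of 0], of x "[]"] x by simp
  also have "pullback (\<F> x) (\<lambda>k. (x, [k])) (pullback (\<N> (Suc 0)) (face G 0) f) = pullback (\<F> x) id (pullback \<A> s ?a)"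
    by (auto simp: pullback_def fun_eq_iff face_0)
  also have "fibre_vector X (e x) \<dots> = X (pullback \<A> s ?a) (e x)" by (rule unit_vector_restriction[OF X x smooth_between_fns[OF smooth_src a]])
  also have "\<dots> = anchor G X ?a x" by (rule anchor_apply[OF X a x, symmetric])
  finally show ?thesis by simp
qed

lemma last_lift_lie_bracket:
  assumes X: "X \<in> \<L>" and Y: "Y \<in> \<L>"
  shows "\<X> (Suc q) (lie_bracket X Y) = lie_bracket (\<X> (Suc q) X) (\<X> (Suc q) Y)"
proof (rule last_lift_eqI[OF lie_bracket_left_invariant[OF X Y]])
  note XY = left_invariant_vfield[OF X] left_invariant_vfield[OF Y]
  show "lie_bracket (\<X> (Suc q) X) (\<X> (Suc q) Y) \<in> vector_fields (\<N> (Suc q))"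
    by (rule lie_bracket_vfield[OF ds_nerve last_lift_vfield[OF X] last_lift_vfield[OF Y]])
  fix i assume i: "i < Suc q"
  have z: "zero_field \<in> vector_fields \<A>" by (simp add: vector_fields_def zero_field_def fns_zero[OF ds_arr])
  have b: "lie_bracket zero_field zero_field = zero_field" by (simp add: lie_bracket_def zero_field_def)
  note R = related_lie_bracket[OF last_lift_related[OF X i] last_lift_related[OF Y i]]
  show "related (\<N> (Suc q)) \<A> (component i) (lie_bracket (\<X> (Suc q) X) (\<X> (Suc q) Y)) (if i = q then lie_bracket X Y else zero_field)"
    using R XY z by (cases "i = q") (simp_all add: b)
qed

text \<open>The term subtracted in the defect is a pullback along the last face and so is killed by
  a further contraction. What remains are the two composites of last lifts on strings ending in a
  unit, and their difference is the commutator, that is, the lift of the bracket.\<close>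

lemma restrict_last_lift_defect:
  assumes X: "X \<in> \<L>" and Y: "Y \<in> \<L>" and f: "f \<in> fns (\<N> (Suc q))"
  shows "\<I> q X (lift_defect q Y f) z - \<I> q Y (lift_defect q X f) z = \<I> q (lie_bracket X Y) f z"
proof -
  have *: "\<I> q X (lift_defect q Y f) = pullback (\<N> q) (degeneracy G q) (\<X> (Suc q) X (\<X> (Suc q) Y f))"
    if X: "X \<in> \<L>" and Y: "Y \<in> \<L>" for X Y
  proof -
    have L: "\<X> (Suc q) Y f \<in> fns (\<N> (Suc q))" by (rule vfield_fns[OF last_lift_vfield[OF Y] f])
    have r: "\<I> q Y f \<in> fns (\<N> q)" by (rule restrict_last_fns[OF Y f])
    have F: "pullback (\<N> (Suc q)) (face G (Suc q)) (\<I> q Y f) \<in> fns (\<N> (Suc q))" by (rule face_fns[OF _ r]) simp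
    have "lift_defect q Y f = (\<lambda>z. 1 * \<X> (Suc q) Y f z + (- 1) * pullback (\<N> (Suc q)) (face G (Suc q)) (\<I> q Y f) z)"
      by (simp add: lift_defect_def)
    then show ?thesis using restrict_last_lincomb[OF X L F, of 1 "- 1"] restrict_last_face_last[OF X r] by (simp add: restrict_last_def)
  qed
  show ?thesis unfolding *[OF X Y] *[OF Y X] unfolding restrict_last_def last_lift_lie_bracket[OF X Y] by (simp add: lie_bracket_def pullback_def)
qed

end

lemma related_comp:
  assumes F: "smooth_between N N' F" and F': "smooth_between N' N'' F'" and R: "related N N' F D D'" "related N' N'' F' D' D''"
  shows "related N N'' (\<lambda>x. F' (F x)) D D''" unfolding related_def
proof
  fix h assume h: "h \<in> fns N''"
  have "D (pullback N F (pullback N' F' h)) = pullback N F (pullback N' F' (D'' h))"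
    by (simp add: relatedD[OF R(1) smooth_between_fns[OF F' h]] relatedD[OF R(2) h])
  then show "D (pullback N (\<lambda>x. F' (F x)) h) = pullback N (\<lambda>x. F' (F x)) (D'' h)" by (simp add: pullback_comp smooth_between_pts[OF F])
qed

lemma related_cong:
  assumes "related N N' F D D'" "\<And>x. x \<in> pts N \<Longrightarrow> F x = F' x"
  shows "related N N' F' D D'"
proof -
  have "pullback N F' h = pullback N F h" for h using assms(2) by (simp add: pullback_def fun_eq_iff)
  then show ?thesis using assms(1) by (simp add: related_def)
qed

lemma has_real_derivative_cong:
  assumes "(f has_real_derivative d) (at 0)" "eventually (\<lambda>\<tau>. f \<tau> = g \<tau>) (nhds 0)"
  shows "(g has_real_derivative d) (at 0)" using assms by (subst (asm) DERIV_cong_ev[OF refl _ refl])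

context lie_groupoid_locale
begin

section \<open>Multiplicative vector fields\<close>

lemma multiplicative_vfield: "\<psi> \<in> multiplicative G \<Longrightarrow> \<psi> \<in> vector_fields \<A>"
  by (simp add: multiplicative_def)

lemma multiplicativeE:
  assumes "\<psi> \<in> multiplicative G"
  obtains D where "D \<in> vector_fields (\<N> 2)" "related (\<N> 2) \<A> (component 0) D \<psi>"
    "related (\<N> 2) \<A> (component 1) D \<psi>" "related (\<N> 2) \<A> (\<lambda>z. mul G (component 0 z) (component 1 z)) D \<psi>"
  using assms unfolding multiplicative_def by blast

lemma nerve_2_iff: "z \<in> nerve_pts G 2 \<longleftrightarrow> (\<exists>g h. z = (t g, [g, h]) \<and> g \<in> arrows G \<and> h \<in> arrows G \<and> s g = t h)"
proof (cases z)
  case (Pair x gs)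
  show ?thesis
  proof
    assume "z \<in> nerve_pts G 2"
    then have "length gs = Suc (Suc 0)" "composable G x gs" using Pair by simp_all
    then show "\<exists>g h. z = (t g, [g, h]) \<and> g \<in> arrows G \<and> h \<in> arrows G \<and> s g = t h" using Pair by (auto simp: length_Suc_conv)
  qed auto
qed

text \<open>An identity between two functions on the composable pairs may be differentiated along
  \<open>D\<close>; relatedness expresses both derivatives by \<open>\<psi>\<close>. This is how the
  identities for source, target and product act on a multiplicative field.\<close>

lemma related_nerve_2_eq:
  assumes R: "related (\<N> 2) \<A> F D \<psi>" "related (\<N> 2) \<A> F' D \<psi>" and f: "f \<in> fns \<A>" "f' \<in> fns \<A>"
    and eq: "\<And>g h. g \<in> arrows G \<Longrightarrow> h \<in> arrows G \<Longrightarrow> s g = t h \<Longrightarrow> f (F (t g, [g, h])) = f' (F' (t g, [g, h]))"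
    and z: "z \<in> pts (\<N> 2)"
  shows "\<psi> f (F z) = \<psi> f' (F' z)"
proof -
  have "pullback (\<N> 2) F f = pullback (\<N> 2) F' f'"
  proof (rule pullback_cong)
    fix z assume "z \<in> pts (\<N> 2)"
    then show "f (F z) = f' (F' z)" unfolding pts_nerve nerve_2_iff using eq by (elim exE conjE) simp
  qed
  then have "pullback (\<N> 2) F (\<psi> f) = pullback (\<N> 2) F' (\<psi> f')" using relatedD[OF R(1) f(1)] relatedD[OF R(2) f(2)] by simp
  from fun_cong[OF this, of z] show ?thesis unfolding pullback_apply[OF z] .
qed

text \<open>Three identities are differentiated: the source of a product at the pair of
  \<open>g\<close> and a unit, the target of a product at the pair of a unit and \<open>g\<close>,
  and equality of the middle source and target at a pair of units.\<close>

lemma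
  assumes \<psi>: "\<psi> \<in> multiplicative G" and a: "a \<in> fns \<O>"
  shows multiplicative_src: "g \<in> arrows G \<Longrightarrow> \<psi> (pullback \<A> s a) g = \<psi> (pullback \<A> s a) (e (s g))"
    and multiplicative_tgt: "g \<in> arrows G \<Longrightarrow> \<psi> (pullback \<A> t a) g = \<psi> (pullback \<A> s a) (e (t g))"
proof -
  let ?m = "\<lambda>z. mul G (component 0 z) (component 1 z)"
  obtain D where D: "D \<in> vector_fields (\<N> 2)" "related (\<N> 2) \<A> (component 0) D \<psi>"
    "related (\<N> 2) \<A> (component 1) D \<psi>" "related (\<N> 2) \<A> ?m D \<psi>" by (rule multiplicativeE[OF \<psi>])
  note fs = smooth_between_fns[OF smooth_src a] and ft = smooth_between_fns[OF smooth_tgt a]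
  assume g: "g \<in> arrows G"
  have "\<psi> (pullback \<A> s a) (?m (t g, [g, e (s g)])) = \<psi> (pullback \<A> s a) (component 1 (t g, [g, e (s g)]))"
    by (rule related_nerve_2_eq[OF D(4,3) fs fs]) (use g in \<open>simp_all add: component_def pullback_apply\<close>)
  then show "\<psi> (pullback \<A> s a) g = \<psi> (pullback \<A> s a) (e (s g))" using g by (simp add: component_def)
  have "\<psi> (pullback \<A> t a) (?m (t g, [e (t g), g])) = \<psi> (pullback \<A> t a) (component 0 (t g, [e (t g), g]))"
    by (rule related_nerve_2_eq[OF D(4,2) ft ft]) (use g in \<open>simp_all add: component_def pullback_apply\<close>)
  moreover have "\<psi> (pullback \<A> s a) (component 0 (t g, [e (t g), e (t g)])) = \<psi> (pullback \<A> t a) (component 1 (t g, [e (t g), e (t g)]))"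
    by (rule related_nerve_2_eq[OF D(2,3) fs ft]) (use g in \<open>simp_all add: component_def pullback_apply\<close>)
  ultimately show "\<psi> (pullback \<A> t a) g = \<psi> (pullback \<A> s a) (e (t g))" using g by (simp add: component_def)
qed

text \<open>As for the anchor, the candidate is forced by evaluation at units; the preceding
  identities make the same field related along both \<open>s\<close> and \<open>t\<close>.\<close>

lemma
  assumes \<psi>: "\<psi> \<in> multiplicative G"
  shows base_field_vfield: "base_field G \<psi> \<in> vector_fields \<O>" and base_field_src: "related \<A> \<O> s \<psi> (base_field G \<psi>)"
    and base_field_tgt: "related \<A> \<O> t \<psi> (base_field G \<psi>)"
proof -
  let ?P = "\<lambda>\<phi>. \<phi> \<in> vector_fields \<O> \<and> related \<A> \<O> s \<psi> \<phi> \<and> related \<A> \<O> t \<psi> \<phi>"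
  let ?Y = "\<lambda>a x. if a \<in> fns \<O> \<and> x \<in> pts \<O> then \<psi> (pullback \<A> s a) (e x) else 0"
  note \<psi>v = multiplicative_vfield[OF \<psi>]
  have "?P ?Y"
  proof (intro conjI)
    show "?Y \<in> vector_fields \<O>"
    proof (rule vfield_of_tangent_vectors[OF ds_obj generated_by_fns])
      show "tangent_vector \<O> x (\<lambda>a. \<psi> (pullback \<A> s a) (e x))" if "x \<in> pts \<O>" for x
        using tangent_vector_push[OF ds_arr vfield_tangent_vector[OF \<psi>v, of "e x"] smooth_src] that by simp
      fix a assume a: "a \<in> fns \<O>"
      have "(\<lambda>x. if x \<in> pts \<O> then \<psi> (pullback \<A> s a) (e x) else 0) = pullback \<O> e (\<psi> (pullback \<A> s a))"
        by (simp add: pullback_def[of \<O>])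
      then show "(\<lambda>x. if x \<in> pts \<O> then \<psi> (pullback \<A> s a) (e x) else 0) \<in> fns \<O>"
        using smooth_between_fns[OF smooth_idt vfield_fns[OF \<psi>v smooth_between_fns[OF smooth_src a]]] by simp
    qed
    have "related \<A> \<O> r \<psi> ?Y" if r: "r = s \<or> r = t" for r unfolding related_def
    proof (intro ballI ext)
      fix a g assume a: "a \<in> fns \<O>"
      show "\<psi> (pullback \<A> r a) g = pullback \<A> r (?Y a) g"
      proof (cases "g \<in> pts \<A>")
        case True
        then show ?thesis using multiplicative_src[OF \<psi> a, of g] multiplicative_tgt[OF \<psi> a, of g] r a by (auto simp: pullback_apply)
      next
        case False
        then show ?thesis using vfield_outside[OF ds_arr \<psi>v, of g] by (simp add: pullback_outside)
      qed
    qed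
    then show "related \<A> \<O> s \<psi> ?Y" "related \<A> \<O> t \<psi> ?Y" by simp_all
  qed
  moreover have "\<phi> = ?Y" if "?P \<phi>" for \<phi>
  proof (rule vfield_eqI[OF ds_obj generated_by_fns])
    show "\<phi> \<in> vector_fields \<O>" "?Y \<in> vector_fields \<O>" using that \<open>?P ?Y\<close> by blast+
    fix a assume a: "a \<in> fns \<O>"
    have "\<phi> a x = ?Y a x" for x
    proof (cases "x \<in> objs G")
      case True
      have "\<psi> (pullback \<A> s a) (e x) = pullback \<A> s (\<phi> a) (e x)" using that a by (simp add: related_def)
      then show ?thesis using True a by (simp add: pullback_apply)
    next
      case False
      then show ?thesis using vfield_outside[OF ds_obj conjunct1[OF that], of x a] by simp
    qed
    then show "\<phi> a = ?Y a" by (rule ext)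
  qed
  ultimately have "?P (base_field G \<psi>)" unfolding base_field_def by (rule theI)
  then show "base_field G \<psi> \<in> vector_fields \<O>" "related \<A> \<O> s \<psi> (base_field G \<psi>)" "related \<A> \<O> t \<psi> (base_field G \<psi>)"
    by blast+
qed

text \<open>At a unit, \<open>(\<psi>, e\<^sub>*\<phi>) + (e\<^sub>*\<phi>, \<psi>) = (\<psi>, \<psi>) + (e\<^sub>*\<phi>, e\<^sub>*\<phi>)\<close> as tangent vectors of \<open>G\<^sup>(\<^sup>2\<^sup>)\<close>;
  applying the multiplication gives \<open>2\<psi> = \<psi> + e\<^sub>*\<phi>\<close>.\<close>

lemma base_field_idt:
  assumes \<psi>: "\<psi> \<in> multiplicative G"
  shows "related \<O> \<A> e (base_field G \<psi>) \<psi>" unfolding related_def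
proof
  fix h assume h: "h \<in> fns \<A>"
  let ?\<phi> = "base_field G \<psi>" and ?m = "\<lambda>z. mul G (component 0 z) (component 1 z)" and ?N = "\<N> 2"
  note \<psi>v = multiplicative_vfield[OF \<psi>]
  obtain D where D: "D \<in> vector_fields ?N" "related ?N \<A> (component 0) D \<psi>"
    "related ?N \<A> (component 1) D \<psi>" "related ?N \<A> ?m D \<psi>" by (rule multiplicativeE[OF \<psi>])
  have x: "?\<phi> (pullback \<O> e h) x = \<psi> h (e x)" if x: "x \<in> objs G" for x
  proof -
    let ?z = "(x, [e x, e x])"
    have z: "?z \<in> pts ?N" using x by simp
    have ex: "e x \<in> pts \<A>" using x by simp
    \<comment> \<open>\<open>?F1\<close> and \<open>?F2\<close> pair an arrow with a unit on either
      side, so multiplication inverts them. Their push-forwards of \<open>\<psi>\<close> have one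
      component \<open>\<psi>\<close> and one component coming from the base field;
      \<open>?F4\<close> gives the pair of units.\<close>
    let ?F1 = "\<lambda>g. (t g, [g, e (s g)])" and ?F2 = "\<lambda>g. (t (e (t g)), [e (t g), g])" and ?F4 = "\<lambda>y. (t (e y), [e y, e y])"
    have id: "smooth_between \<A> \<A> (\<lambda>g. g)" by (rule smooth_between_id[OF ds_arr])
    have F1: "smooth_between \<A> ?N ?F1" by (rule smooth_pair[OF ds_arr id smooth_between_comp[OF smooth_src smooth_idt]]) simp
    have F2: "smooth_between \<A> ?N ?F2" by (rule smooth_pair[OF ds_arr smooth_between_comp[OF smooth_tgt smooth_idt] id]) simp
    have F4: "smooth_between \<O> ?N ?F4" by (rule smooth_pair[OF ds_obj smooth_idt smooth_idt]) simp
    let ?v = "\<lambda>f. 1 * \<psi> (pullback \<A> ?F1 f) (e x) + 1 * \<psi> (pullback \<A> ?F2 f) (e x)"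
    let ?w = "\<lambda>f. 1 * D f ?z + 1 * ?\<phi> (pullback \<O> ?F4 f) x"
    have v: "tangent_vector ?N ?z ?v"
    proof (rule tangent_vector_add)
      show "tangent_vector ?N ?z (\<lambda>f. \<psi> (pullback \<A> ?F1 f) (e x))"
        using tangent_vector_push[OF ds_arr vfield_tangent_vector[OF \<psi>v ex] F1] x by simp
      show "tangent_vector ?N ?z (\<lambda>f. \<psi> (pullback \<A> ?F2 f) (e x))"
        using tangent_vector_push[OF ds_arr vfield_tangent_vector[OF \<psi>v ex] F2] x by simp
    qed
    have w: "tangent_vector ?N ?z ?w"
    proof (rule tangent_vector_add[OF vfield_tangent_vector[OF D(1) z]])
      show "tangent_vector ?N ?z (\<lambda>f. ?\<phi> (pullback \<O> ?F4 f) x)"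
        using tangent_vector_push[OF ds_obj vfield_tangent_vector[OF base_field_vfield[OF \<psi>], of x] F4] x by simp
    qed
    have a: "pullback \<A> (\<lambda>g. g) f = f" if "f \<in> fns \<A>" for f by (rule pullback_eqI[OF ds_arr that]) simp
    have es: "\<psi> (pullback \<A> (\<lambda>g. e (s g)) f) (e x) = ?\<phi> (pullback \<O> e f) x"
      and et: "\<psi> (pullback \<A> (\<lambda>g. e (t g)) f) (e x) = ?\<phi> (pullback \<O> e f) x" if f: "f \<in> fns \<A>" for f
    proof -
      have "pullback \<A> s (pullback \<O> e f) = pullback \<A> (\<lambda>g. e (s g)) f" "pullback \<A> t (pullback \<O> e f) = pullback \<A> (\<lambda>g. e (t g)) f"
        by (rule pullback_comp, simp)+
      then show "\<psi> (pullback \<A> (\<lambda>g. e (s g)) f) (e x) = ?\<phi> (pullback \<O> e f) x" "\<psi> (pullback \<A> (\<lambda>g. e (t g)) f) (e x) = ?\<phi> (pullback \<O> e f) x"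
        using relatedD[OF base_field_src[OF \<psi>] smooth_between_fns[OF smooth_idt f]]
          relatedD[OF base_field_tgt[OF \<psi>] smooth_between_fns[OF smooth_idt f]] x by (simp_all add: pullback_apply)
    qed
    have vw: "?v (pullback ?N ?m h) = ?w (pullback ?N ?m h)"
    proof (rule nerve_tangent_vector_eqI[OF _ v w _ smooth_between_fns[OF smooth_mul h]])
      fix i f assume i: "i < (2::nat)" and f: "f \<in> fns \<A>"
      have p1: "pullback \<A> ?F1 (pullback ?N (component i) f) = pullback \<A> (\<lambda>g. component i (?F1 g)) f"
        by (rule pullback_comp[OF smooth_between_pts[OF F1]])
      have p2: "pullback \<A> ?F2 (pullback ?N (component i) f) = pullback \<A> (\<lambda>g. component i (?F2 g)) f"
        by (rule pullback_comp[OF smooth_between_pts[OF F2]])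
      have p4: "pullback \<O> ?F4 (pullback ?N (component i) f) = pullback \<O> (\<lambda>g. component i (?F4 g)) f"
        by (rule pullback_comp[OF smooth_between_pts[OF F4]])
      have "i = 0 \<or> i = 1" using i by auto
      then show "?v (pullback ?N (component i) f) = ?w (pullback ?N (component i) f)"
      proof
        assume i0: "i = 0"
        show ?thesis
          unfolding p1 p2 p4 using relatedD[OF D(2) f] pullback_apply[OF z, of "component 0" "\<psi> f"] by (simp add: i0 component_def a[OF f] et[OF f] pullback_apply)
      next
        assume i1: "i = 1"
        show ?thesis
          unfolding p1 p2 p4 using relatedD[OF D(3) f] pullback_apply[OF z, of "component 1" "\<psi> f"] by (simp add: i1 component_def a[OF f] es[OF f] pullback_apply)
      qed
    qed simp
    have "pullback \<A> ?F1 (pullback ?N ?m h) = h"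
    proof (rule pullback_eqI[OF ds_arr h])
      fix g assume "g \<in> pts \<A>"
      then show "pullback ?N ?m h (?F1 g) = h g" by (simp add: pullback_def component_def)
    qed
    moreover have "pullback \<A> ?F2 (pullback ?N ?m h) = h"
    proof (rule pullback_eqI[OF ds_arr h])
      fix g assume "g \<in> pts \<A>"
      then show "pullback ?N ?m h (?F2 g) = h g" by (simp add: pullback_def component_def)
    qed
    moreover have "pullback \<O> ?F4 (pullback ?N ?m h) = pullback \<O> e h"
    proof (rule pullback_eqI[OF ds_obj smooth_between_fns[OF smooth_idt h]])
      fix y assume "y \<in> pts \<O>"
      then show "pullback ?N ?m h (?F4 y) = pullback \<O> e h y" using mul_idt_left[of "e y"] by (simp add: pullback_def component_def)
    qed
    moreover have "D (pullback ?N ?m h) ?z = \<psi> h (e x)" using relatedD[OF D(4) h] z mul_idt_left[of "e x"] x by (simp add: pullback_apply component_def)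
    ultimately show ?thesis using vw by simp
  qed
  show "?\<phi> (pullback \<O> e h) = pullback \<O> e (\<psi> h)"
  proof
    fix y show "?\<phi> (pullback \<O> e h) y = pullback \<O> e (\<psi> h) y"
      using x[of y] vfield_outside[OF ds_obj base_field_vfield[OF \<psi>], of y]
      by (cases "y \<in> pts \<O>") (simp_all add: pullback_apply pullback_outside)
  qed
qed

subsection \<open>Lifts to the nerve\<close>

text \<open>A string is extended on the right by an arrow whose target has to follow the source of
  the last arrow of the curve found so far. That \<open>\<psi>\<close> is related to one base field
  along both \<open>s\<close> and \<open>t\<close> says that this prescribed motion has the velocity
  \<open>t\<close> gives to \<open>\<psi>\<close> at the new arrow, so the submersion
  \<open>t\<close> lifts it.\<close>

lemma multiplicative_curve:
  assumes \<psi>: "\<psi> \<in> multiplicative G"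
  shows "gs \<noteq> [] \<Longrightarrow> composable G x gs \<Longrightarrow> \<exists>c. c 0 = gs \<and>
    eventually (\<lambda>\<tau>. length (c \<tau>) = length gs \<and> composable G (t (hd (c \<tau>))) (c \<tau>)) (nhds 0) \<and>
    (\<forall>i<length gs. \<forall>h\<in>fns \<A>. ((\<lambda>\<tau>. h (c \<tau> ! i)) has_real_derivative \<psi> h (gs ! i)) (at 0))"
proof (induction gs rule: rev_induct)
  case (snoc g gs)
  note \<psi>v = multiplicative_vfield[OF \<psi>]
  have g: "g \<in> arrows G" "t g = lv x gs" and cgs: "composable G x gs" using snoc.prems by simp_all
  have w: "tangent_vector \<A> g (\<lambda>h. \<psi> h g)" using vfield_tangent_vector[OF \<psi>v, of g] g by simp
  show ?case
  proof (cases "gs = []")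
    case True
    obtain c where c: "c 0 = g" "eventually (\<lambda>\<tau>. c \<tau> \<in> arrows G) (nhds 0)"
      "\<And>h. h \<in> fns \<A> \<Longrightarrow> ((\<lambda>\<tau>. h (c \<tau>)) has_real_derivative \<psi> h g) (at 0)"
      by (rule curve_of_tangent_vector[OF manifold_arr w]) blast
    show ?thesis
    proof (intro exI[of _ "\<lambda>\<tau>. [c \<tau>]"] conjI allI impI ballI)
      show "eventually (\<lambda>\<tau>. length [c \<tau>] = length (gs @ [g]) \<and> composable G (t (hd [c \<tau>])) [c \<tau>]) (nhds 0)"
        using c(2) by eventually_elim (simp add: True)
    qed (use c True in simp_all)
  next
    case False
    obtain c where c: "c 0 = gs"
      "eventually (\<lambda>\<tau>. length (c \<tau>) = length gs \<and> composable G (t (hd (c \<tau>))) (c \<tau>)) (nhds 0)"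
      "\<forall>i<length gs. \<forall>h\<in>fns \<A>. ((\<lambda>\<tau>. h (c \<tau> ! i)) has_real_derivative \<psi> h (gs ! i)) (at 0)"
      using snoc.IH[OF False cgs] by (elim exE conjE)
    let ?n = "length gs - 1"
    have n: "?n < length gs" using False by simp
    have lst: "last l = l ! ?n" if "length l = length gs" for l :: "'g list" using that False by (metis last_conv_nth length_0_conv)
    have lvc: "last_vertex G (y, l) = s (l ! ?n)" if "length l = length gs" for y and l :: "'g list"
      using that False lst[OF that] by (auto simp: last_vertex_def)
    have arr: "l ! ?n \<in> arrows G" if "length l = length gs" "composable G y l" for y l
      using smooth_between_pts[OF smooth_component[OF n], of "(y, l)"] that by (simp add: component_def)
    define y where "y \<tau> = s (c \<tau> ! ?n)" for \<tau>
    have y0: "y 0 = t g" using g(2) lvc[of gs x] by (simp add: y_def c(1))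
    have yd: "((\<lambda>\<tau>. a (y \<tau>)) has_real_derivative \<psi> (pullback \<A> t a) g) (at 0)" if a: "a \<in> fns \<O>" for a
    proof -
      note sa = smooth_between_fns[OF smooth_src a]
      have "\<psi> (pullback \<A> s a) (gs ! ?n) = \<psi> (pullback \<A> t a) g"
        using relatedD[OF base_field_src[OF \<psi>] a] relatedD[OF base_field_tgt[OF \<psi>] a] g lvc[of gs x] arr[OF refl cgs] by (simp add: pullback_apply)
      moreover have "((\<lambda>\<tau>. pullback \<A> s a (c \<tau> ! ?n)) has_real_derivative \<psi> (pullback \<A> s a) (gs ! ?n)) (at 0)"
        using c(3) n sa by blast
      ultimately have "((\<lambda>\<tau>. pullback \<A> s a (c \<tau> ! ?n)) has_real_derivative \<psi> (pullback \<A> t a) g) (at 0)" by (simp only:)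
      then show ?thesis
      proof (rule has_real_derivative_cong)
        show "eventually (\<lambda>\<tau>. pullback \<A> s a (c \<tau> ! ?n) = a (y \<tau>)) (nhds 0)" using c(2)
        proof eventually_elim
          fix \<tau> assume "length (c \<tau>) = length gs \<and> composable G (t (hd (c \<tau>))) (c \<tau>)"
          then have "c \<tau> ! ?n \<in> arrows G" using arr by blast
          then show "pullback \<A> s a (c \<tau> ! ?n) = a (y \<tau>)" by (simp add: pullback_apply y_def)
        qed
      qed
    qed
    obtain k where k: "k 0 = g" "eventually (\<lambda>\<tau>. k \<tau> \<in> arrows G \<and> t (k \<tau>) = y \<tau>) (nhds 0)"
      "\<And>h. h \<in> fns \<A> \<Longrightarrow> ((\<lambda>\<tau>. h (k \<tau>)) has_real_derivative \<psi> h g) (at 0)"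
      by (rule submersion_lift_curve[OF manifold_arr manifold_obj submersion_tgt w y0 yd]) blast+
    show ?thesis
    proof (intro exI[of _ "\<lambda>\<tau>. c \<tau> @ [k \<tau>]"] conjI allI impI ballI)
      show "c 0 @ [k 0] = gs @ [g]" by (simp add: c(1) k(1))
      show "eventually (\<lambda>\<tau>. length (c \<tau> @ [k \<tau>]) = length (gs @ [g]) \<and> composable G (t (hd (c \<tau> @ [k \<tau>]))) (c \<tau> @ [k \<tau>])) (nhds 0)"
        using c(2) k(2)
      proof eventually_elim
        fix \<tau> assume *: "length (c \<tau>) = length gs \<and> composable G (t (hd (c \<tau>))) (c \<tau>)" "k \<tau> \<in> arrows G \<and> t (k \<tau>) = y \<tau>"
        then have "c \<tau> \<noteq> []" using False by auto
        then show "length (c \<tau> @ [k \<tau>]) = length (gs @ [g]) \<and> composable G (t (hd (c \<tau> @ [k \<tau>]))) (c \<tau> @ [k \<tau>])"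
          using * lvc[of "c \<tau>"] by (simp add: y_def)
      qed
      fix i h assume i: "i < length (gs @ [g])" and h: "h \<in> fns \<A>"
      show "((\<lambda>\<tau>. h ((c \<tau> @ [k \<tau>]) ! i)) has_real_derivative \<psi> h ((gs @ [g]) ! i)) (at 0)"
      proof (cases "i < length gs")
        case True
        have "((\<lambda>\<tau>. h (c \<tau> ! i)) has_real_derivative \<psi> h ((gs @ [g]) ! i)) (at 0)" using c(3) True h by (simp add: nth_append)
        then show ?thesis by (rule has_real_derivative_cong) (use c(2) True in \<open>auto elim!: eventually_mono simp: nth_append\<close>)
      next
        case False
        then have il: "i = length gs" using i by simp
        have "((\<lambda>\<tau>. h (k \<tau>)) has_real_derivative \<psi> h ((gs @ [g]) ! i)) (at 0)" using k(3)[OF h] by (simp add: il)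
        then show ?thesis by (rule has_real_derivative_cong) (use c(2) il in \<open>auto elim!: eventually_mono simp: nth_append\<close>)
      qed
    qed
  qed
qed simp

lemma multiplicative_tangent_vector:
  assumes \<psi>: "\<psi> \<in> multiplicative G" and q: "q > 0" and z: "z \<in> nerve_pts G q"
  shows "\<exists>v. tangent_vector (\<N> q) z v \<and>
    (\<forall>i<q. \<forall>h\<in>fns \<A>. v (pullback (\<N> q) (component i) h) = \<psi> h (component i z))"
proof -
  from z obtain x gs where z': "z = (x, gs)" "length gs = q" "composable G x gs" by (rule nerve_ptsE)
  have ne: "gs \<noteq> []" using z'(2) q by auto
  obtain c where c: "c 0 = gs"
      "eventually (\<lambda>\<tau>. length (c \<tau>) = length gs \<and> composable G (t (hd (c \<tau>))) (c \<tau>)) (nhds 0)"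
      "\<forall>i<length gs. \<forall>h\<in>fns \<A>. ((\<lambda>\<tau>. h (c \<tau> ! i)) has_real_derivative \<psi> h (gs ! i)) (at 0)"
    using multiplicative_curve[OF \<psi> ne z'(3)] by (elim exE conjE)
  \<comment> \<open>The base point of a simplex is the target of its first arrow and has to move
    with it.\<close>
  define C where "C \<tau> = (t (hd (c \<tau>)), c \<tau>)" for \<tau>
  have C0: "C 0 = z" using ne z' by (cases gs) (simp_all add: C_def c(1))
  have ev: "eventually (\<lambda>\<tau>. C \<tau> \<in> pts (\<N> q)) (nhds 0)" using c(2) by eventually_elim (simp add: C_def z'(2))
  have d: "((\<lambda>\<tau>. pullback (\<N> q) (component i) h (C \<tau>)) has_real_derivative \<psi> h (component i z)) (at 0)"
    if "i < q" "h \<in> fns \<A>" for i h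
  proof (rule has_real_derivative_cong)
    show "((\<lambda>\<tau>. h (c \<tau> ! i)) has_real_derivative \<psi> h (component i z)) (at 0)" using c(3) that z' by (simp add: component_def)
    show "eventually (\<lambda>\<tau>. h (c \<tau> ! i) = pullback (\<N> q) (component i) h (C \<tau>)) (nhds 0)"
      using ev by eventually_elim (simp only: pullback_apply component_def, simp add: C_def)
  qed
  have "tangent_vector (\<N> q) (C 0) (\<lambda>f. deriv (\<lambda>\<tau>. f (C \<tau>)) 0)"
  proof (rule tangent_vector_curve[OF ds_nerve generated_nerve[OF q] _ ev])
    show "C 0 \<in> pts (\<N> q)" using C0 z by simp
    fix k assume "k \<in> component_functions q"
    then obtain i h where "k = pullback (\<N> q) (component i) h" "i < q" "h \<in> fns \<A>" by (rule component_functionsE)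
    then show "(\<lambda>\<tau>. k (C \<tau>)) differentiable at 0" using d unfolding real_differentiable_def by blast
  qed
  then show ?thesis unfolding C0 using DERIV_imp_deriv[OF d] by (intro exI[of _ "\<lambda>f. deriv (\<lambda>\<tau>. f (C \<tau>)) 0"] conjI) simp_all
qed

lemma mult_lift_unique:
  assumes \<psi>: "\<psi> \<in> multiplicative G"
  shows "\<exists>!D. D \<in> vector_fields (\<N> q) \<and> (if q = 0 then related (\<N> 0) \<O> fst D (base_field G \<psi>)
      else \<forall>i<q. related (\<N> q) \<A> (component i) D \<psi>)"
proof (cases "q = 0")
  case True
  let ?\<phi> = "base_field G \<psi>" and ?N = "\<N> 0"
  let ?V = "\<lambda>x. (x, [])"
  note \<phi>v = base_field_vfield[OF \<psi>]
  let ?D = "\<lambda>f z. if f \<in> fns ?N \<and> z \<in> pts ?N then ?\<phi> (pullback \<O> ?V f) (fst z) else 0"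
  have pV: "pullback \<O> ?V (pullback ?N fst a) = a" if "a \<in> fns \<O>" for a by (rule pullback_eqI[OF ds_obj that]) (simp add: pullback_def)
  have pF: "pullback ?N fst (pullback \<O> ?V f) = f" if "f \<in> fns ?N" for f
  proof (rule pullback_eqI[OF ds_nerve that])
    fix z assume "z \<in> pts ?N"
    then obtain x where "z = (x, [])" "x \<in> objs G" by (auto elim!: nerve_ptsE)
    then show "pullback \<O> ?V f (fst z) = f z" by (simp add: pullback_def)
  qed
  have D: "?D \<in> vector_fields ?N"
  proof (rule vfield_of_tangent_vectors[OF ds_nerve generated_by_fns])
    fix z assume "z \<in> pts ?N"
    then obtain x where x: "z = (x, [])" "x \<in> objs G" by (auto elim!: nerve_ptsE)
    then show "tangent_vector ?N z (\<lambda>f. ?\<phi> (pullback \<O> ?V f) (fst z))"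
      using tangent_vector_push[OF ds_obj vfield_tangent_vector[OF \<phi>v, of x] smooth_vertex] by simp
  next
    fix f assume f: "f \<in> fns ?N"
    have "(\<lambda>z. if z \<in> pts ?N then ?\<phi> (pullback \<O> ?V f) (fst z) else 0) = pullback ?N fst (?\<phi> (pullback \<O> ?V f))"
      by (simp add: pullback_def[of ?N])
    then show "(\<lambda>z. if z \<in> pts ?N then ?\<phi> (pullback \<O> ?V f) (fst z) else 0) \<in> fns ?N"
      using smooth_between_fns[OF smooth_fst_0 vfield_fns[OF \<phi>v smooth_between_fns[OF smooth_vertex f]]] by simp
  qed
  have R: "related ?N \<O> fst ?D ?\<phi>" unfolding related_def
  proof
    fix a assume a: "a \<in> fns \<O>"
    show "?D (pullback ?N fst a) = pullback ?N fst (?\<phi> a)"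
    proof -
      have "?D (pullback ?N fst a) = (\<lambda>z. if z \<in> pts ?N then ?\<phi> a (fst z) else 0)"
        unfolding pV[OF a] using smooth_between_fns[OF smooth_fst_0 a] by simp
      also have "\<dots> = pullback ?N fst (?\<phi> a)" by (simp add: pullback_def)
      finally show ?thesis .
    qed
  qed
  have U: "D = D'" if "D \<in> vector_fields ?N" "related ?N \<O> fst D ?\<phi>" "D' \<in> vector_fields ?N" "related ?N \<O> fst D' ?\<phi>" for D D'
  proof (rule vfield_eqI[OF ds_nerve generated_by_fns that(1,3)])
    fix f assume f: "f \<in> fns ?N"
    show "D f = D' f" using relatedD[OF that(2) smooth_between_fns[OF smooth_vertex f]] relatedD[OF that(4) smooth_between_fns[OF smooth_vertex f]]
      by (simp add: pF[OF f])
  qed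
  show ?thesis unfolding True using D R U by (intro ex_ex1I) (auto intro!: exI[of _ ?D])
next
  case False
  then have q: "q > 0" by simp
  show ?thesis using nerve_vector_field_ex1[OF q multiplicative_vfield[OF \<psi>] multiplicative_tangent_vector[OF \<psi> q]] False by simp
qed

lemma
  assumes \<psi>: "\<psi> \<in> multiplicative G"
  shows mult_lift_vfield: "\<M> q \<psi> \<in> vector_fields (\<N> q)"
    and mult_lift_component: "i < q \<Longrightarrow> related (\<N> q) \<A> (component i) (\<M> q \<psi>) \<psi>"
    and mult_lift_fst_0: "related (\<N> 0) \<O> fst (\<M> 0 \<psi>) (base_field G \<psi>)"
  using theI'[OF mult_lift_unique[OF \<psi>, of q]] theI'[OF mult_lift_unique[OF \<psi>, of 0]]
  unfolding mult_lift_def[symmetric] by (simp_all split: if_splits)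

text \<open>The field \<open>D\<close> from the definition of multiplicativity is related to
  \<open>\<psi>\<close> along both components, so uniqueness identifies it with the lift.\<close>

lemma mult_lift_mul:
  assumes \<psi>: "\<psi> \<in> multiplicative G"
  shows "related (\<N> 2) \<A> (\<lambda>z. mul G (component 0 z) (component 1 z)) (\<M> 2 \<psi>) \<psi>"
proof -
  obtain D where D: "D \<in> vector_fields (\<N> 2)" "related (\<N> 2) \<A> (component 0) D \<psi>"
    "related (\<N> 2) \<A> (component 1) D \<psi>" "related (\<N> 2) \<A> (\<lambda>z. mul G (component 0 z) (component 1 z)) D \<psi>"
    by (rule multiplicativeE[OF \<psi>])
  have "\<M> 2 \<psi> = D"
  proof (rule nerve_vector_field_eqI[OF _ mult_lift_vfield[OF \<psi>] D(1), of "\<lambda>_. \<psi>"])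
    show "related (\<N> 2) \<A> (component i) D \<psi>" if "i < 2" for i using that D(2,3) by (cases "i = 0") (simp_all add: less_2_cases_iff)
  qed (simp_all add: mult_lift_component[OF \<psi>])
  then show ?thesis using D(4) by simp
qed

lemma mult_lift_fst:
  assumes \<psi>: "\<psi> \<in> multiplicative G"
  shows "related (\<N> q) \<O> fst (\<M> q \<psi>) (base_field G \<psi>)"
proof (cases "q = 0")
  case True
  then show ?thesis using mult_lift_fst_0[OF \<psi>] by simp
next
  case False
  then have q: "0 < q" by simp
  show ?thesis
  proof (rule related_cong[OF related_comp[OF smooth_component[OF q] smooth_tgt mult_lift_component[OF \<psi> q] base_field_tgt[OF \<psi>]]])
    fix z assume "z \<in> pts (\<N> q)"
    then obtain x gs where "z = (x, gs)" "length gs = q" "composable G x gs" by (auto elim: nerve_ptsE)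
    then show "t (component 0 z) = fst z" using False by (cases gs) (simp_all add: component_def)
  qed
qed

text \<open>The inserted arrow is the unit over a vertex, which moves along the base field; by
  \<open>base_field_idt\<close> the unit then moves along \<open>\<psi>\<close>, like every other
  component.\<close>

lemma mult_lift_degeneracy:
  assumes \<psi>: "\<psi> \<in> multiplicative G" and i: "i \<le> q"
  shows "related (\<N> q) (\<N> (Suc q)) (degeneracy G i) (\<M> q \<psi>) (\<M> (Suc q) \<psi>)" unfolding related_def
proof
  let ?d = "degeneracy G i" and ?N = "\<N> q" and ?N' = "\<N> (Suc q)"
  note sd = smooth_degeneracy[OF i]
  have R: "related ?N \<A> (\<lambda>z. component j (?d z)) (\<M> q \<psi>) \<psi>" if j: "j < Suc q" for j
  proof -
    \<comment> \<open>The inserted unit sits over the base point if \<open>i = 0\<close>, and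
      otherwise over the source of component \<open>i - 1\<close>.\<close>
    consider "j < i" | "i < j" | "j = i" "i = 0" | r where "j = i" "i = Suc r" by (cases i) (use nat_neq_iff in auto)
    then show ?thesis
    proof cases
      case 1
      then have "j < q" using i by simp
      then show ?thesis using 1 i by (intro related_cong[OF mult_lift_component[OF \<psi>]])
          (auto simp: degeneracy_def component_def nth_append elim!: nerve_ptsE)
    next
      case 2
      then have "j - 1 < q" using j by simp
      then show ?thesis using 2 i by (intro related_cong[OF mult_lift_component[OF \<psi>]])
          (auto simp: degeneracy_def component_def nth_append elim!: nerve_ptsE)
    next
      case 3
      show ?thesis by (rule related_cong[OF related_comp[OF smooth_fst smooth_idt mult_lift_fst[OF \<psi>] base_field_idt[OF \<psi>]]])
          (use 3 in \<open>auto simp: degeneracy_def component_def elim!: nerve_ptsE\<close>)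
    next
      case (4 r)
      have r: "r < q" using 4 i by simp
      have "related ?N \<O> (\<lambda>z. s (component r z)) (\<M> q \<psi>) (base_field G \<psi>)"
        by (rule related_comp[OF smooth_component[OF r] smooth_src mult_lift_component[OF \<psi> r] base_field_src[OF \<psi>]])
      from related_comp[OF smooth_between_comp[OF smooth_component[OF r] smooth_src] smooth_idt this base_field_idt[OF \<psi>]]
      show ?thesis
      proof (rule related_cong)
        fix z assume "z \<in> pts ?N"
        then obtain x gs where z: "z = (x, gs)" "length gs = q" "composable G x gs" by (auto elim: nerve_ptsE)
        have "take (Suc r) gs = take r gs @ [gs ! r]" using r z(2) by (simp add: take_Suc_conv_app_nth)
        then show "e (s (component r z)) = component j (?d z)" using 4 r z by (simp add: degeneracy_def component_def nth_append)
      qed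
    qed
  qed
  fix f assume f: "f \<in> fns ?N'"
  show "\<M> q \<psi> (pullback ?N ?d f) = pullback ?N ?d (\<M> (Suc q) \<psi> f)"
  proof
    fix z
    show "\<M> q \<psi> (pullback ?N ?d f) z = pullback ?N ?d (\<M> (Suc q) \<psi> f) z"
    proof (cases "z \<in> pts ?N")
      case True
      have "\<M> q \<psi> (pullback ?N ?d f) z = \<M> (Suc q) \<psi> f (?d z)"
      proof (rule nerve_tangent_vector_eqI[OF _ _ _ _ f])
        show "tangent_vector ?N' (?d z) (\<lambda>f. \<M> q \<psi> (pullback ?N ?d f) z)"
          by (rule tangent_vector_push[OF ds_nerve vfield_tangent_vector[OF mult_lift_vfield[OF \<psi>] True] sd])
        show "tangent_vector ?N' (?d z) (\<lambda>f. \<M> (Suc q) \<psi> f (?d z))"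
          by (rule vfield_tangent_vector[OF mult_lift_vfield[OF \<psi>] smooth_between_pts[OF sd True]])
        fix j h assume j: "j < Suc q" and h: "h \<in> fns \<A>"
        have "pullback ?N ?d (pullback ?N' (component j) h) = pullback ?N (\<lambda>z. component j (?d z)) h"
          by (rule pullback_comp[OF smooth_between_pts[OF sd]])
        then show "\<M> q \<psi> (pullback ?N ?d (pullback ?N' (component j) h)) z = \<M> (Suc q) \<psi> (pullback ?N' (component j) h) (?d z)"
          using relatedD[OF R[OF j] h] relatedD[OF mult_lift_component[OF \<psi> j] h] True smooth_between_pts[OF sd True]
          by (simp add: pullback_apply del: pts_nerve)
      qed simp
      then show ?thesis using True by (simp add: pullback_apply)
    next
      case False
      then show ?thesis using vfield_outside[OF ds_nerve mult_lift_vfield[OF \<psi>]] by (simp add: pullback_outside)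
    qed
  qed
qed

lemma mult_lift_normalized:
  assumes \<psi>: "\<psi> \<in> multiplicative G" and f: "f \<in> \<C> q"
  shows "\<M> q \<psi> f \<in> \<C> q" unfolding normalized_def mem_Collect_eq
proof (intro conjI allI impI)
  note ff = normalized_fns[OF f] and v = mult_lift_vfield[OF \<psi>]
  show "\<M> q \<psi> f \<in> fns (\<N> q)" by (rule vfield_fns[OF v ff])
  fix i assume i: "i < q"
  then obtain r where q: "q = Suc r" by (cases q) auto
  have "pullback (\<N> r) (degeneracy G i) (\<M> q \<psi> f) = \<M> r \<psi> (pullback (\<N> r) (degeneracy G i) f)"
    using relatedD[OF mult_lift_degeneracy[OF \<psi>, of i r]] i ff by (simp add: q)
  also have "pullback (\<N> r) (degeneracy G i) f = (\<lambda>_. 0)" using f i by (simp add: normalized_def q)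
  also have "\<M> r \<psi> (\<lambda>_. 0) = (\<lambda>_. 0)" using vfield_lincomb[OF v fns_zero[OF ds_nerve] fns_zero[OF ds_nerve], of r 0 0] by simp
  finally show "pullback (\<N> (q - 1)) (degeneracy G i) (\<M> q \<psi> f) = (\<lambda>_. 0)" by (simp add: q)
qed

lemma mult_lift_0_apply:
  assumes \<psi>: "\<psi> \<in> multiplicative G" and f: "f \<in> fns (\<N> 0)" and x: "x \<in> objs G"
  shows "\<M> 0 \<psi> f (x, []) = base_field G \<psi> (\<lambda>x. f (x, [])) x"
proof -
  let ?a = "\<lambda>x. f (x, [])"
  have pa: "pullback \<O> (\<lambda>x. (x, [])) f = ?a" using nerve_fns_outside[OF f] by (auto simp: pullback_def fun_eq_iff)
  then have a: "?a \<in> fns \<O>" using smooth_between_fns[OF smooth_vertex f] by simp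
  have "pullback (\<N> 0) fst ?a = f" by (rule pullback_eqI[OF ds_nerve f]) (auto elim!: nerve_ptsE)
  then show ?thesis using relatedD[OF mult_lift_fst_0[OF \<psi>] a] x by (simp add: pullback_apply)
qed

section \<open>Commutators of multiplicative with left-invariant fields\<close>

lemma last_lift_mul:
  assumes X: "X \<in> \<L>"
  shows "related (\<N> 2) \<A> (\<lambda>z. mul G (component 0 z) (component 1 z)) (\<X> 2 X) X" unfolding related_def
proof
  let ?m = "\<lambda>z. mul G (component 0 z) (component 1 z)"
  have 2: "2 = Suc (Suc 0)" by simp
  fix f assume f: "f \<in> fns \<A>"
  note mf = smooth_between_fns[OF smooth_mul f]
  show "\<X> 2 X (pullback (\<N> 2) ?m f) = pullback (\<N> 2) ?m (X f)"
  proof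
    fix z
    show "\<X> 2 X (pullback (\<N> 2) ?m f) z = pullback (\<N> 2) ?m (X f) z"
    proof (cases "z \<in> nerve_pts G 2")
      case True
      then obtain g h where z: "z = (t g, [g, h])" and gh: "g \<in> arrows G" "h \<in> arrows G" "s g = t h" unfolding nerve_2_iff by blast
      have "\<X> (Suc (Suc 0)) X (pullback (\<N> 2) ?m f) (t g, [g] @ [h]) =
        fibre_vector X h (pullback (\<F> (lv (t g) [g])) (\<lambda>k. (t g, [g] @ [k])) (pullback (\<N> 2) ?m f))"
        by (rule last_lift_fibre_vector[OF X]) (use gh mf in \<open>simp_all add: 2[symmetric]\<close>)
      also have "pullback (\<F> (lv (t g) [g])) (\<lambda>k. (t g, [g] @ [k])) (pullback (\<N> 2) ?m f) = pullback (\<F> (s g)) (mul G g) f"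
        using gh by (auto simp: pullback_def fun_eq_iff component_def)
      \<comment> \<open>By left invariance, moving the second arrow of a pair along \<open>X\<close>
        moves the product along \<open>X\<close>.\<close>
      also have "fibre_vector X h \<dots> = X f (mul G g h)" by (rule left_invariant_translate[OF X gh f])
          (use fibre_vector_tangent[OF X gh(2)] fibre_vector_restriction[OF X gh(2)] gh in simp_all)
      finally show ?thesis using True by (simp add: z 2[symmetric] pullback_apply component_def)
    next
      case False
      then show ?thesis using vfield_outside[OF ds_nerve last_lift_vfield[OF X], of z 1] by (simp add: pullback_outside 2[symmetric])
    qed
  qed
qed

lemma vfield_zero: "D \<in> vector_fields \<A> \<Longrightarrow> lie_bracket D zero_field = zero_field"
  using vfield_lincomb[of D \<A> "\<lambda>_. 0" "\<lambda>_. 0" 0 0] fns_zero[OF ds_arr] by (simp add: lie_bracket_def zero_field_def)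

lemma related_lie_bracket_lifts:
  assumes \<psi>: "\<psi> \<in> multiplicative G" and X: "X \<in> \<L>" and i: "i < Suc q"
  shows "related (\<N> (Suc q)) \<A> (component i) (lie_bracket (\<M> (Suc q) \<psi>) (\<X> (Suc q) X))
     (if i = q then lie_bracket \<psi> X else zero_field)"
  using related_lie_bracket[OF mult_lift_component[OF \<psi> i] last_lift_related[OF X i] multiplicative_vfield[OF \<psi>]]
    left_invariant_vfield[OF X] zero_field_vfield by (cases "i = q") (simp_all add: vfield_zero[OF multiplicative_vfield[OF \<psi>]])

text \<open>Left invariance demands derivations on the functions of the fibre, and
  \<open>\<psi>\<close> itself is not tangent to the fibres. The bracket annihilates functions of
  the target, so its value at \<open>h\<close> is the velocity of a curve inside the fibre.
  Compatibility with translation comes from the commutator of the two lifts on composable pairs,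
  which is zero on the first component and is related to the bracket along the second component and
  along multiplication.\<close>

lemma lie_bracket_multiplicative_left_invariant:
  assumes \<psi>: "\<psi> \<in> multiplicative G" and X: "X \<in> \<L>"
  shows "lie_bracket \<psi> X \<in> \<L>" unfolding left_invariant_def mem_Collect_eq
proof (intro conjI ballI impI)
  note \<psi>v = multiplicative_vfield[OF \<psi>] and Xv = left_invariant_vfield[OF X]
  note bv = lie_bracket_vfield[OF ds_arr \<psi>v Xv]
  show "lie_bracket \<psi> X \<in> vector_fields \<A>" by (rule bv)
  fix g h assume gh: "g \<in> arrows G" "h \<in> arrows G" "s g = t h"
  let ?F = "\<F> (s g)"
  have w: "tangent_vector \<A> h (\<lambda>f. lie_bracket \<psi> X f h)" using vfield_tangent_vector[OF bv, of h] gh by simp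
  \<comment> \<open>A function of the target is constant on each \<open>t\<close>-fibre, to which
    \<open>X\<close> is tangent.\<close>
  have Xt: "X (pullback \<A> t a) = (\<lambda>_. 0)" if a: "a \<in> fns \<O>" for a
  proof
    fix k show "X (pullback \<A> t a) k = 0"
    proof (cases "k \<in> arrows G")
      case True
      have "pullback (\<F> (t k)) id (pullback \<A> t a) = (\<lambda>l. if l \<in> pts (\<F> (t k)) then a (t k) else 0)"
        by (auto simp: pullback_def fun_eq_iff)
      then show ?thesis using fibre_vector_restriction[OF X True smooth_between_fns[OF smooth_tgt a]]
          tangent_vector_at_const[OF ds_tfibre fibre_vector_tangent[OF X True]] by simp
    qed (use vfield_outside[OF ds_arr Xv] in simp)
  qed
  have wt: "lie_bracket \<psi> X (pullback \<A> t a) h = 0" if a: "a \<in> fns \<O>" for a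
  proof -
    have "\<psi> (pullback \<A> t a) = pullback \<A> t (base_field G \<psi> a)" by (rule relatedD[OF base_field_tgt[OF \<psi>] a])
    moreover have "\<psi> (\<lambda>_. 0) = (\<lambda>_. 0)" using vfield_lincomb[OF \<psi>v fns_zero[OF ds_arr] fns_zero[OF ds_arr], of 0 0] by simp
    ultimately show ?thesis using Xt[OF a] Xt[OF vfield_fns[OF base_field_vfield[OF \<psi>] a]] by (simp add: lie_bracket_def)
  qed
  \<comment> \<open>The constant curve at \<open>t h\<close> is lifted through \<open>t\<close>; its
    lift therefore runs inside the fibre.\<close>
  obtain c where c: "c 0 = h" "eventually (\<lambda>\<tau>. c \<tau> \<in> arrows G \<and> t (c \<tau>) = t h) (nhds 0)"
    "\<And>f. f \<in> fns \<A> \<Longrightarrow> ((\<lambda>\<tau>. f (c \<tau>)) has_real_derivative lie_bracket \<psi> X f h) (at 0)"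
  proof (rule submersion_lift_curve[OF manifold_arr manifold_obj submersion_tgt w, of "\<lambda>_. t h"])
    show "((\<lambda>\<tau>. k (t h)) has_real_derivative lie_bracket \<psi> X (pullback \<A> t k) h) (at 0)" if "k \<in> fns \<O>" for k
      using wt[OF that] by simp
  qed (use that in blast)+
  have ev: "eventually (\<lambda>\<tau>. c \<tau> \<in> pts ?F) (nhds 0)" using c(2) by eventually_elim (simp add: gh)
  have d: "((\<lambda>\<tau>. pullback ?F id f (c \<tau>)) has_real_derivative lie_bracket \<psi> X f h) (at 0)" if "f \<in> fns \<A>" for f
    by (rule has_real_derivative_cong[OF c(3)[OF that]], rule eventually_mono[OF ev]) (simp add: pullback_apply)
  let ?v = "\<lambda>f. deriv (\<lambda>\<tau>. f (c \<tau>)) 0"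
  have v: "tangent_vector ?F h ?v" unfolding c(1)[symmetric]
  proof (rule tangent_vector_curve[OF ds_tfibre generated_tfibre _ ev])
    show "c 0 \<in> pts ?F" using c(1) gh by simp
    fix k assume "k \<in> pullback ?F id ` fns \<A>"
    then show "(\<lambda>\<tau>. k (c \<tau>)) differentiable at 0" using d unfolding real_differentiable_def by blast
  qed
  have vr: "?v (pullback ?F id f) = lie_bracket \<psi> X f h" if "f \<in> fns \<A>" for f by (rule DERIV_imp_deriv[OF d[OF that]])
  have 2: "2 = Suc (Suc 0)" by simp
  let ?N = "\<N> 2" and ?m = "\<lambda>z. mul G (component 0 z) (component 1 z)"
  let ?B = "lie_bracket (\<M> 2 \<psi>) (\<X> 2 X)" and ?z = "(t g, [g, h])"
  have z: "?z \<in> pts ?N" using gh by simp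
  have Bv: "?B \<in> vector_fields ?N" by (rule lie_bracket_vfield[OF ds_nerve mult_lift_vfield[OF \<psi>]])
      (use last_lift_vfield[OF X, of 1] in \<open>simp add: 2[symmetric]\<close>)
  \<comment> \<open>Both lifts are related along multiplication, to \<open>\<psi>\<close> and to
    \<open>X\<close>; hence so is their commutator, to the bracket.\<close>
  have Bm: "related ?N \<A> ?m ?B (lie_bracket \<psi> X)" by (rule related_lie_bracket[OF mult_lift_mul[OF \<psi>] last_lift_mul[OF X] \<psi>v Xv])
  have BR: "related ?N \<A> (component i) ?B (if i = 1 then lie_bracket \<psi> X else zero_field)" if "i < 2" for i
    using related_lie_bracket_lifts[OF \<psi> X, of i 1] that by (simp add: 2[symmetric])
  have cg: "composable G (t g) [g]" using gh by simp
  have sm: "smooth_between ?F ?N (\<lambda>k. (t g, [g, k]))" using smooth_append[OF cg] by (simp add: 2[symmetric])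
  have eqv: "?B f ?z = ?v (pullback ?F (\<lambda>k. (t g, [g, k])) f)" if f: "f \<in> fns ?N" for f
  proof (rule nerve_tangent_vector_eqI[OF _ vfield_tangent_vector[OF Bv z] tangent_vector_push[OF ds_tfibre v sm] _ f])
    fix i f assume i: "i < (2::nat)" and f: "f \<in> fns \<A>"
    show "?B (pullback ?N (component i) f) ?z = ?v (pullback ?F (\<lambda>k. (t g, [g, k])) (pullback ?N (component i) f))"
    proof (cases "i = 1")
      case True
      have "pullback ?F (\<lambda>k. (t g, [g, k])) (pullback ?N (component i) f) = pullback ?F id f"
        using gh by (auto simp: pullback_def fun_eq_iff component_def True)
      then show ?thesis using relatedD[OF BR[OF i] f] vr[OF f] z True by (simp add: pullback_apply component_def)
    next
      case False
      then have i0: "i = 0" using i by simp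
      have "pullback ?F (\<lambda>k. (t g, [g, k])) (pullback ?N (component i) f) = (\<lambda>k. if k \<in> pts ?F then f g else 0)"
        using gh by (auto simp: pullback_def fun_eq_iff component_def i0)
      then show ?thesis using relatedD[OF BR[OF i] f] tangent_vector_at_const[OF ds_tfibre v, of "f g"] i0 by (simp add: zero_field_def pullback_def)
    qed
  qed simp
  show "\<exists>v. tangent_vector ?F h v \<and> (\<forall>f\<in>fns \<A>. v (pullback ?F id f) = lie_bracket \<psi> X f h \<and>
      v (pullback ?F (mul G g) f) = lie_bracket \<psi> X f (mul G g h))"
  proof (intro exI[of _ ?v] conjI ballI v)
    fix f assume f: "f \<in> fns \<A>"
    show "?v (pullback ?F id f) = lie_bracket \<psi> X f h" by (rule vr[OF f])
    have "pullback ?F (\<lambda>k. (t g, [g, k])) (pullback ?N ?m f) = pullback ?F (mul G g) f" using gh by (auto simp: pullback_def fun_eq_iff component_def)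
    then show "?v (pullback ?F (mul G g) f) = lie_bracket \<psi> X f (mul G g h)"
      using eqv[OF smooth_between_fns[OF smooth_mul f]] relatedD[OF Bm f] z by (simp add: pullback_apply component_def)
  qed
qed

text \<open>Uniqueness identifies the last lift of the bracket with the commutator of the lifts. The
  part in which the lift of \<open>\<psi>\<close> is applied last is moved through the degeneracy,
  to which it is related.\<close>

lemma restrict_last_mult_lift:
  assumes \<psi>: "\<psi> \<in> multiplicative G" and X: "X \<in> \<L>" and f: "f \<in> fns (\<N> (Suc q))"
  shows "\<I> q X (\<M> (Suc q) \<psi> f) = (\<lambda>z. \<M> q \<psi> (\<I> q X f) z - \<I> q (lie_bracket \<psi> X) f z)"
proof -
  note bL = lie_bracket_multiplicative_left_invariant[OF \<psi> X]
  have L: "\<X> (Suc q) (lie_bracket \<psi> X) = lie_bracket (\<M> (Suc q) \<psi>) (\<X> (Suc q) X)"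
    by (rule last_lift_eqI[OF bL lie_bracket_vfield[OF ds_nerve mult_lift_vfield[OF \<psi>] last_lift_vfield[OF X]]])
      (rule related_lie_bracket_lifts[OF \<psi> X])
  have M: "\<M> q \<psi> (pullback (\<N> q) (degeneracy G q) (\<X> (Suc q) X f)) =
     pullback (\<N> q) (degeneracy G q) (\<M> (Suc q) \<psi> (\<X> (Suc q) X f))"
    by (rule relatedD[OF mult_lift_degeneracy[OF \<psi>] vfield_fns[OF last_lift_vfield[OF X] f]]) simp
  show ?thesis unfolding restrict_last_def L diff_Suc_1 M by (simp add: lie_bracket_def pullback_def fun_eq_iff)
qed

end

section \<open>Antisymmetrization\<close>

abbreviation (input) "transpos \<equiv> Transposition.transpose"

abbreviation (input) "\<epsilon> p \<equiv> of_int (sign p) :: real"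

text \<open>Antisymmetrization without division by a factorial, as in the van Est sum, and for
  arbitrary functions of lists. Lists make it possible to remove, insert and split
  arguments.\<close>

definition alt :: "('a list \<Rightarrow> real) \<Rightarrow> 'a list \<Rightarrow> real" where
  "alt \<Phi> xs = (\<Sum>\<gamma> | \<gamma> permutes {..<length xs}. \<epsilon> \<gamma> * \<Phi> (permute_list \<gamma> xs))"

lemma alt_Nil [simp]: "alt \<Phi> [] = \<Phi> []" by (simp add: alt_def sign_id)

lemma alt_cong:
  assumes "\<And>ys. length ys = length xs \<Longrightarrow> set ys = set xs \<Longrightarrow> \<Phi> ys = \<Psi> ys"
  shows "alt \<Phi> xs = alt \<Psi> xs" unfolding alt_def using assms by (intro sum.cong) simp_all

lemma alt_sum: "alt (\<lambda>ys. \<Sum>i\<in>I. \<Phi> i ys) xs = (\<Sum>i\<in>I. alt (\<Phi> i) xs)"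
  unfolding alt_def sum_distrib_left by (rule sum.swap)

lemma alt_add: "alt (\<lambda>ys. \<Phi> ys + \<Psi> ys) xs = alt \<Phi> xs + alt \<Psi> xs" by (simp add: alt_def distrib_left sum.distrib)

lemma alt_scale: "alt (\<lambda>ys. c * \<Phi> ys) xs = c * alt \<Phi> xs" by (simp add: alt_def sum_distrib_left algebra_simps)

lemma alt_diff: "alt (\<lambda>ys. \<Phi> ys - \<Psi> ys) xs = alt \<Phi> xs - alt \<Psi> xs"
  using alt_add[of \<Phi> "\<lambda>ys. - 1 * \<Psi> ys"] alt_scale[of "- 1" \<Psi>] by simp

lemma permutation_lessThan: "\<pi> permutes {..<n::nat} \<Longrightarrow> permutation \<pi>" by (rule permutes_imp_permutation) simp_all

lemma sign_square: "\<epsilon> p * (\<epsilon> p * x) = (x::real)" by (cases p rule: sign_cases) simp_all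

text \<open>Composing the summation index with \<open>\<pi>\<close> on the left rearranges the
  arguments.\<close>

lemma alt_permute_args:
  assumes \<pi>: "\<pi> permutes {..<length xs}"
  shows "alt \<Phi> (permute_list \<pi> xs) = \<epsilon> \<pi> * alt \<Phi> xs"
proof -
  have "alt \<Phi> xs = (\<Sum>\<gamma> | \<gamma> permutes {..<length xs}. \<epsilon> (\<pi> \<circ> \<gamma>) * \<Phi> (permute_list (\<pi> \<circ> \<gamma>) xs))"
    unfolding alt_def by (rule setum_permutations_compose_left[OF \<pi>])
  also have "\<dots> = (\<Sum>\<gamma> | \<gamma> permutes {..<length xs}. \<epsilon> \<pi> * (\<epsilon> \<gamma> * \<Phi> (permute_list \<gamma> (permute_list \<pi> xs))))"
    by (rule sum.cong) (simp_all add: permute_list_compose sign_compose permutation_lessThan[OF \<pi>] permutation_lessThan)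
  also have "\<dots> = \<epsilon> \<pi> * alt \<Phi> (permute_list \<pi> xs)" by (simp add: alt_def sum_distrib_left)
  finally show ?thesis by (simp add: sign_square)
qed

text \<open>Composing the summation index with \<open>\<pi>\<close> on the right rearranges the
  slots of the function.\<close>

lemma alt_permute_slots:
  assumes \<pi>: "\<pi> permutes {..<length xs}"
  shows "alt (\<lambda>ys. \<Phi> (permute_list \<pi> ys)) xs = \<epsilon> \<pi> * alt \<Phi> xs"
proof -
  have "alt \<Phi> xs = (\<Sum>\<gamma> | \<gamma> permutes {..<length xs}. \<epsilon> (\<gamma> \<circ> \<pi>) * \<Phi> (permute_list (\<gamma> \<circ> \<pi>) xs))"
    unfolding alt_def by (rule sum_permutations_compose_right[OF \<pi>])
  also have "\<dots> = (\<Sum>\<gamma> | \<gamma> permutes {..<length xs}. \<epsilon> \<pi> * (\<epsilon> \<gamma> * \<Phi> (permute_list \<pi> (permute_list \<gamma> xs))))"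
    by (rule sum.cong) (simp_all add: permute_list_compose \<pi> sign_compose permutation_lessThan[OF \<pi>] permutation_lessThan)
  also have "\<dots> = \<epsilon> \<pi> * alt (\<lambda>ys. \<Phi> (permute_list \<pi> ys)) xs" by (simp add: alt_def sum_distrib_left)
  finally show ?thesis by (simp add: sign_square)
qed

lemma permute_list_transpose:
  assumes "i < length xs" "j < length xs"
  shows "permute_list (transpos i j) xs = xs[i := xs ! j, j := xs ! i]"
  using assms by (intro nth_equalityI) (auto simp: permute_list_def nth_list_update Transposition.transpose_def)

lemma transpose_permutes: "i < n \<Longrightarrow> j < n \<Longrightarrow> transpos i j permutes {..<n::nat}"
  by (rule permutes_swap_id) simp_all

lemma alt_eq_0:
  assumes "i < length xs" "j < length xs" "i \<noteq> j" "xs ! i = xs ! j"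
  shows "alt \<Phi> xs = 0"
proof -
  have "permute_list (transpos i j) xs = xs" using assms by (simp add: permute_list_transpose list_update_overwrite) (metis list_update_id)
  then show ?thesis using alt_permute_args[OF transpose_permutes[OF assms(1,2)], of \<Phi>] assms(3) by (simp add: sign_swap_id)
qed

lemma list_update_append_Cons: "(as @ y # z # bs)[Suc (length as) := x] = as @ y # x # bs"
  using list_update_length[of "as @ [y]" z bs x] by simp

lemma permute_list_adjacent: "permute_list (transpos (length as) (Suc (length as))) (as @ x # y # bs) = as @ y # x # bs"
  by (subst permute_list_transpose) (simp_all add: nth_append list_update_append_Cons)

lemma alt_swap_args: "alt \<Phi> (as @ x # y # bs) = - alt \<Phi> (as @ y # x # bs)"
  using alt_permute_args[OF transpose_permutes, of "length as" "as @ y # x # bs" "Suc (length as)" \<Phi>] by (simp add: permute_list_adjacent sign_swap_id)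

lemma alt_move_arg: "alt \<Phi> (as @ x # bs) = (- 1) ^ length bs * alt \<Phi> (as @ bs @ [x])"
proof (induction bs arbitrary: as)
  case (Cons b bs)
  then show ?case using alt_swap_args[of \<Phi> as x b bs] Cons.IH[of "as @ [b]"] by simp
qed simp

lemma alt_swap_slots:
  assumes k: "Suc k < length xs"
  shows "alt (\<lambda>ys. \<Phi> (take k ys @ ys ! Suc k # ys ! k # drop (Suc (Suc k)) ys)) xs = - alt \<Phi> xs"
proof -
  have "take k ys @ ys ! Suc k # ys ! k # drop (Suc (Suc k)) ys = permute_list (transpos k (Suc k)) ys"
    if ys: "length ys = length xs" for ys :: "'a list"
  proof -
    have e: "ys = take k ys @ ys ! k # ys ! Suc k # drop (Suc (Suc k)) ys" and l: "length (take k ys) = k" using k ys by (simp_all add: Cons_nth_drop_Suc)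
    have "permute_list (transpos k (Suc k)) (take k ys @ ys ! k # ys ! Suc k # drop (Suc (Suc k)) ys)
       = take k ys @ ys ! Suc k # ys ! k # drop (Suc (Suc k)) ys"
      using permute_list_adjacent[of "take k ys"] unfolding l .
    then show ?thesis unfolding e[symmetric] by simp
  qed
  then have "alt (\<lambda>ys. \<Phi> (take k ys @ ys ! Suc k # ys ! k # drop (Suc (Suc k)) ys)) xs = alt (\<lambda>ys. \<Phi> (permute_list (transpos k (Suc k)) ys)) xs"
    by (intro alt_cong) simp
  then show ?thesis using k by (simp add: alt_permute_slots transpose_permutes sign_swap_id)
qed

definition insert_at :: "nat \<Rightarrow> 'a \<Rightarrow> 'a list \<Rightarrow> 'a list" where
  "insert_at k x ys = take k ys @ x # drop k ys"

lemma length_insert_at [simp]: "length (insert_at k x ys) = Suc (length ys)" by (simp add: insert_at_def)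

lemma insert_at_0 [simp]: "insert_at 0 x ys = x # ys" by (simp add: insert_at_def)

lemma insert_at_Suc_Cons [simp]: "insert_at (Suc k) x (y # ys) = y # insert_at k x ys" by (simp add: insert_at_def)

text \<open>Moving the first slot to position \<open>k\<close> takes \<open>k\<close> exchanges of
  neighbouring slots.\<close>

lemma alt_move_slot:
  assumes "k < length xs"
  shows "alt (\<lambda>ys. \<Phi> (insert_at k (hd ys) (tl ys))) xs = (- 1) ^ k * alt \<Phi> xs" using assms
proof (induction k arbitrary: \<Phi>)
  case 0
  then show ?case by (simp, intro alt_cong) (metis hd_Cons_tl length_0_conv less_not_refl)
next
  case (Suc k)
  let ?s = "\<lambda>ys. take k ys @ ys ! Suc k # ys ! k # drop (Suc (Suc k)) ys"
  have "insert_at (Suc k) (hd ys) (tl ys) = ?s (insert_at k (hd ys) (tl ys))" if "length ys = length xs" for ys :: "'a list"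
  proof -
    have "k < length (tl ys)" using that Suc.prems by simp
    then show ?thesis by (simp add: insert_at_def nth_append take_Suc_conv_app_nth min_def Cons_nth_drop_Suc[symmetric])
  qed
  then have "alt (\<lambda>ys. \<Phi> (insert_at (Suc k) (hd ys) (tl ys))) xs = alt (\<lambda>ys. \<Phi> (?s (insert_at k (hd ys) (tl ys)))) xs"
    by (intro alt_cong) simp
  also have "\<dots> = (- 1) ^ k * alt (\<lambda>ys. \<Phi> (?s ys)) xs" using Suc.IH[of "\<lambda>ys. \<Phi> (?s ys)"] Suc.prems by simp
  also have "\<dots> = (- 1) ^ Suc k * alt \<Phi> xs" using alt_swap_slots[OF Suc.prems, of \<Phi>] by simp
  finally show ?case .
qed

section \<open>Expansion along an argument or along a slot\<close>

lemma length_omit: "i < length xs \<Longrightarrow> length (omit i xs) = length xs - 1" by (simp add: omit_def)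

lemma set_omit: "set (omit i xs) \<subseteq> set xs" using set_take_subset set_drop_subset by (fastforce simp: omit_def)

lemma permute_list_append:
  assumes "\<gamma> permutes {..<length xs}"
  shows "permute_list \<gamma> (xs @ ys) = permute_list \<gamma> xs @ ys"
proof (rule nth_equalityI)
  fix i assume i: "i < length (permute_list \<gamma> (xs @ ys))"
  have "i < length xs \<Longrightarrow> \<gamma> i < length xs" using permutes_in_image[OF assms, of i] by simp
  then show "permute_list \<gamma> (xs @ ys) ! i = (permute_list \<gamma> xs @ ys) ! i"
    using i permutes_not_in[OF assms, of i] by (simp add: permute_list_def nth_append)
qed simp

text \<open>A Laplace expansion. Permutations are grouped by the argument \<open>xs ! j\<close> that
  reaches the last slot, each group being a coset of the permutations that fix the last
  index.\<close>

lemma alt_expand_last: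
  assumes n: "length xs = Suc n"
  shows "alt \<Phi> xs = (\<Sum>j\<le>n. (- 1) ^ (n - j) * alt (\<lambda>ys. \<Phi> (ys @ [xs ! j])) (omit j xs))"
proof -
  let ?F = "\<lambda>\<gamma>. \<epsilon> \<gamma> * \<Phi> (permute_list \<gamma> xs) :: real"
  have "alt \<Phi> xs = sum ?F {\<gamma>. \<gamma> permutes (insert n {..<n})}" by (simp add: alt_def n lessThan_Suc)
  also have "\<dots> = (\<Sum>j\<in>insert n {..<n}. \<Sum>\<gamma> | \<gamma> permutes {..<n}. ?F (transpos n j \<circ> \<gamma>))"
    by (rule sum_over_permutations_insert) simp_all
  also have "\<dots> = (\<Sum>j\<in>insert n {..<n}. (- 1) ^ (n - j) * alt (\<lambda>ys. \<Phi> (ys @ [xs ! j])) (omit j xs))"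
  proof (rule sum.cong[OF refl])
    fix j assume j: "j \<in> insert n {..<n}"
    have tp: "transpos n j permutes {..<Suc n}" using j by (intro transpose_permutes) auto
    \<comment> \<open>The transposition puts \<open>xs ! n\<close> into position \<open>j\<close>,
      whereas \<open>omit j xs\<close> has it at the end. Moving it there passes
      \<open>n - j - 1\<close> arguments, and the transposition contributes one more sign.\<close>
    obtain us where us: "permute_list (transpos n j) xs = us @ [xs ! j]" "length us = n"
      and sg: "\<epsilon> (transpos n j) * alt \<Psi> us = (- 1) ^ (n - j) * alt \<Psi> (omit j xs)" for \<Psi>
    proof (cases "j = n")
      case True
      show ?thesis by (rule that[of "omit j xs"]) (use n in \<open>simp_all add: True omit_def take_Suc_conv_app_nth[symmetric]\<close>)
    next
      case False
      then have jn: "j < n" using j by simp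
      define as bs where "as = take j xs" and "bs = drop (Suc j) (take n xs)"
      have la: "length as = j" "length bs = n - Suc j" using jn n by (simp_all add: as_def bs_def)
      have "take n xs = as @ xs ! j # bs" using jn n id_take_nth_drop[of j "take n xs"] by (simp add: as_def bs_def min_def)
      moreover have "xs = take n xs @ [xs ! n]" using n by (simp add: take_Suc_conv_app_nth[symmetric])
      ultimately have e: "xs = as @ xs ! j # bs @ [xs ! n]" by simp
      have nl: "n = Suc (length as + length bs)" using la jn by simp
      have "permute_list (transpos n j) xs = xs[n := xs ! j, j := xs ! n]" using jn n by (intro permute_list_transpose) simp_all
      also have "\<dots> = as @ xs ! n # bs @ [xs ! j]" using la(1) nl by (subst (1) e) (simp add: list_update_append)
      finally have 1: "permute_list (transpos n j) xs = (as @ xs ! n # bs) @ [xs ! j]" by simp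
      have o: "omit j xs = as @ bs @ [xs ! n]" by (subst e) (simp add: omit_def la(1))
      show ?thesis
      proof (rule that[OF 1])
        show "length (as @ xs ! n # bs) = n" using nl by simp
        have "n - j = Suc (length bs)" using nl la(1) by simp
        then show "\<epsilon> (transpos n j) * alt \<Psi> (as @ xs ! n # bs) = (- 1) ^ (n - j) * alt \<Psi> (omit j xs)" for \<Psi>
          using False by (simp add: o alt_move_arg sign_swap_id)
      qed
    qed
    have "(\<Sum>\<gamma> | \<gamma> permutes {..<n}. ?F (transpos n j \<circ> \<gamma>)) =
      (\<Sum>\<gamma> | \<gamma> permutes {..<n}. \<epsilon> (transpos n j) * (\<epsilon> \<gamma> * \<Phi> (permute_list \<gamma> us @ [xs ! j])))"
    proof (rule sum.cong[OF refl])
      fix \<gamma> assume "\<gamma> \<in> {\<gamma>. \<gamma> permutes {..<n}}"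
      then have \<gamma>: "\<gamma> permutes {..<n}" by simp
      have "\<gamma> permutes {..<length xs}" by (rule permutes_subset[OF \<gamma>]) (simp add: n)
      then have "permute_list (transpos n j \<circ> \<gamma>) xs = permute_list \<gamma> us @ [xs ! j]"
        using permute_list_append[of \<gamma> us "[xs ! j]"] \<gamma> by (simp add: permute_list_compose us)
      then show "?F (transpos n j \<circ> \<gamma>) = \<epsilon> (transpos n j) * (\<epsilon> \<gamma> * \<Phi> (permute_list \<gamma> us @ [xs ! j]))"
        by (simp add: sign_compose permutation_lessThan[OF tp] permutation_lessThan[OF \<gamma>])
    qed
    also have "\<dots> = \<epsilon> (transpos n j) * alt (\<lambda>ys. \<Phi> (ys @ [xs ! j])) us" by (simp add: alt_def us(2) sum_distrib_left)
    finally show "(\<Sum>\<gamma> | \<gamma> permutes {..<n}. ?F (transpos n j \<circ> \<gamma>)) = (- 1) ^ (n - j) * alt (\<lambda>ys. \<Phi> (ys @ [xs ! j])) (omit j xs)"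
      by (simp only: sg)
  qed
  also have "insert n {..<n} = {..n}" by auto
  finally show ?thesis .
qed

text \<open>The first slot is rotated to the end, at the cost of \<open>n\<close> signs, before
  expanding along the last one; \<open>n + (n - j)\<close> has the parity of
  \<open>j\<close>.\<close>

lemma alt_expand:
  assumes n: "length xs = Suc n"
  shows "alt \<Phi> xs = (\<Sum>j\<le>n. (- 1) ^ j * alt (\<lambda>ys. \<Phi> (xs ! j # ys)) (omit j xs))"
proof -
  let ?\<Psi> = "\<lambda>ys. \<Phi> (last ys # butlast ys)"
  have "alt \<Phi> xs = alt (\<lambda>ys. ?\<Psi> (insert_at n (hd ys) (tl ys))) xs"
  proof (rule alt_cong)
    fix ys :: "'a list" assume "length ys = length xs"
    then show "\<Phi> ys = ?\<Psi> (insert_at n (hd ys) (tl ys))" using n by (cases ys) (simp_all add: insert_at_def)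
  qed
  also have "\<dots> = (- 1) ^ n * alt ?\<Psi> xs" using n by (intro alt_move_slot) simp
  also have "\<dots> = (\<Sum>j\<le>n. (- 1) ^ j * alt (\<lambda>ys. \<Phi> (xs ! j # ys)) (omit j xs))"
    unfolding alt_expand_last[OF n, of ?\<Psi>] sum_distrib_left
  proof (rule sum.cong[OF refl])
    fix j assume "j \<in> {..n}"
    then have "n + (n - j) = j + 2 * (n - j)" by simp
    then have "(- 1) ^ n * (- 1) ^ (n - j) = ((- 1) ^ j :: real)" by (metis power_add power_mult mult.right_neutral power_one power2_minus power_one)
    then show "(- 1) ^ n * ((- 1) ^ (n - j) * alt (\<lambda>ys. ?\<Psi> (ys @ [xs ! j])) (omit j xs)) = (- 1) ^ j * alt (\<lambda>ys. \<Phi> (xs ! j # ys)) (omit j xs)"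
      by (simp add: mult.assoc[symmetric])
  qed
  finally show ?thesis .
qed

lemma alt_expand_slot:
  assumes n: "length xs = Suc n" and k: "k \<le> n"
  shows "alt \<Phi> xs = (- 1) ^ k * (\<Sum>j\<le>n. (- 1) ^ j * alt (\<lambda>ys. \<Phi> (insert_at k (xs ! j) ys)) (omit j xs))"
proof -
  have "(- 1) ^ k * alt \<Phi> xs = (\<Sum>j\<le>n. (- 1) ^ j * alt (\<lambda>ys. \<Phi> (insert_at k (xs ! j) ys)) (omit j xs))"
    using alt_move_slot[of k xs \<Phi>] alt_expand[OF n, of "\<lambda>ys. \<Phi> (insert_at k (hd ys) (tl ys))"] n k by simp
  then have "(- 1) ^ k * ((- 1) ^ k * alt \<Phi> xs) = (- 1) ^ k * (\<Sum>j\<le>n. (- 1) ^ j * alt (\<lambda>ys. \<Phi> (insert_at k (xs ! j) ys)) (omit j xs))"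
    by simp
  then show ?thesis by (simp add: mult.assoc[symmetric] power_mult_distrib[symmetric])
qed

lemma omit_0_Cons [simp]: "omit 0 (x # xs) = xs"
  and omit_Suc_Cons [simp]: "omit (Suc i) (x # xs) = x # omit i xs" by (simp_all add: omit_def)

text \<open>The dual expansion, along the argument \<open>b\<close>, which is inserted into each
  slot in turn. It is the identity that collects brackets sitting in all possible slots into a
  single form with the bracket as first argument.\<close>

lemma alt_Cons:
  "alt \<Phi> (b # xs) = (\<Sum>k\<le>length xs. (- 1) ^ k * alt (\<lambda>ys. \<Phi> (insert_at k b ys)) xs)"
proof (induction "length xs" arbitrary: xs \<Phi>)
  case 0
  have "alt \<Phi> [b] = \<Phi> [b]" using alt_expand[of "[b]" 0 \<Phi>] by simp
  then show ?case using 0 by simp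
next
  case (Suc n)
  have n: "length xs = Suc n" using Suc.hyps(2) by simp
  have "alt \<Phi> (b # xs) = (\<Sum>j\<le>Suc n. (- 1) ^ j * alt (\<lambda>ys. \<Phi> ((b # xs) ! j # ys)) (omit j (b # xs)))"
    using n by (intro alt_expand) simp
  also have "\<dots> = alt (\<lambda>ys. \<Phi> (b # ys)) xs + (\<Sum>j\<le>n. (- 1) ^ Suc j * alt (\<lambda>ys. \<Phi> (xs ! j # ys)) (b # omit j xs))"
    by (subst sum.atMost_Suc_shift) simp
  also have "(\<Sum>j\<le>n. (- 1) ^ Suc j * alt (\<lambda>ys. \<Phi> (xs ! j # ys)) (b # omit j xs)) =
    (\<Sum>j\<le>n. \<Sum>k\<le>n. (- 1) ^ Suc j * ((- 1) ^ k * alt (\<lambda>ys. \<Phi> (xs ! j # insert_at k b ys)) (omit j xs)))"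
  proof (rule sum.cong[OF refl])
    fix j assume "j \<in> {..n}"
    then have l: "length (omit j xs) = n" using n by (simp add: length_omit)
    show "(- 1) ^ Suc j * alt (\<lambda>ys. \<Phi> (xs ! j # ys)) (b # omit j xs) =
      (\<Sum>k\<le>n. (- 1) ^ Suc j * ((- 1) ^ k * alt (\<lambda>ys. \<Phi> (xs ! j # insert_at k b ys)) (omit j xs)))"
      using Suc.hyps(1)[OF l[symmetric], of "\<lambda>ys. \<Phi> (xs ! j # ys)"] unfolding l by (simp only: sum_distrib_left)
  qed
  also have "\<dots> = (\<Sum>k\<le>n. (- 1) ^ Suc k * (\<Sum>j\<le>n. (- 1) ^ j * alt (\<lambda>ys. \<Phi> (insert_at (Suc k) b (xs ! j # ys))) (omit j xs)))"
    by (subst sum.swap) (simp add: sum_distrib_left mult.left_commute)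
  also have "\<dots> = (\<Sum>k\<le>n. (- 1) ^ Suc k * alt (\<lambda>ys. \<Phi> (insert_at (Suc k) b ys)) xs)" by (simp only: alt_expand[OF n])
  also have "alt (\<lambda>ys. \<Phi> (b # ys)) xs + (\<Sum>k\<le>n. (- 1) ^ Suc k * alt (\<lambda>ys. \<Phi> (insert_at (Suc k) b ys)) xs) =
    (\<Sum>k\<le>Suc n. (- 1) ^ k * alt (\<lambda>ys. \<Phi> (insert_at k b ys)) xs)"
    by (subst sum.atMost_Suc_shift) simp
  finally show ?case by (simp add: n)
qed

lemma permute_list_update:
  assumes \<gamma>: "\<gamma> permutes {..<length xs}"
  shows "permute_list \<gamma> (xs[\<gamma> i := w]) = (permute_list \<gamma> xs)[i := w]"
proof (rule nth_equalityI)
  fix k assume k: "k < length (permute_list \<gamma> (xs[\<gamma> i := w]))"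
  then have "\<gamma> k < length xs" using permutes_in_image[OF \<gamma>] by auto
  moreover have "\<gamma> i = \<gamma> k \<longleftrightarrow> i = k" using permutes_inj[OF \<gamma>] by (simp add: inj_eq)
  ultimately show "permute_list \<gamma> (xs[\<gamma> i := w]) ! k = (permute_list \<gamma> xs)[i := w] ! k"
    using k by (cases "i = k") (simp_all add: permute_list_def)
qed simp

text \<open>Since permutations carry the changed argument to any slot, the linear relation is
  assumed for every splitting of the list around it. Scaling and sign rules are obtained with
  \<open>d = 0\<close>.\<close>

lemma alt_update:
  assumes i: "i < length xs"
    and eq: "\<And>us vs. set us \<subseteq> set xs \<Longrightarrow> set vs \<subseteq> set xs \<Longrightarrow> Suc (length us + length vs) = length xs \<Longrightarrow>
      \<Phi> (us @ z # vs) = c * \<Phi> (us @ x # vs) + d * \<Phi> (us @ y # vs)"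
  shows "alt \<Phi> (xs[i := z]) = c * alt \<Phi> (xs[i := x]) + d * alt \<Phi> (xs[i := y])"
proof -
  have "\<Phi> (permute_list \<gamma> (xs[i := z])) = c * \<Phi> (permute_list \<gamma> (xs[i := x])) + d * \<Phi> (permute_list \<gamma> (xs[i := y]))"
    if \<gamma>: "\<gamma> permutes {..<length xs}" for \<gamma>
  proof -
    let ?j = "inv \<gamma> i" and ?p = "permute_list \<gamma> xs"
    have j: "?j < length xs" using permutes_in_image[OF permutes_inv[OF \<gamma>], of i] i by simp
    have p: "permute_list \<gamma> (xs[i := w]) = take ?j ?p @ w # drop (Suc ?j) ?p" for w
      using permute_list_update[OF \<gamma>, of ?j w] j permutes_inverses(1)[OF \<gamma>, of i] by (simp add: upd_conv_take_nth_drop)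
    have "set (take ?j ?p) \<subseteq> set xs" "set (drop (Suc ?j) ?p) \<subseteq> set xs"
      using set_take_subset[of ?j ?p] set_drop_subset[of "Suc ?j" ?p] \<gamma> by simp_all
    then show ?thesis unfolding p using j by (intro eq) simp_all
  qed
  then show ?thesis by (simp add: alt_def distrib_left sum.distrib sum_distrib_left mult.left_commute)
qed

text \<open>Changing one argument in all positions in turn is symmetric in the positions, so the sum
  of these changes commutes with permutations. This is the pattern of a derivation acting on a
  form.\<close>

lemma alt_sum_update:
  "alt (\<lambda>ys. \<Sum>i<length ys. \<Phi> (ys[i := F (ys ! i)])) xs = (\<Sum>i<length xs. alt \<Phi> (xs[i := F (xs ! i)]))"
proof -
  have "(\<Sum>i<length xs. \<Phi> ((permute_list \<gamma> xs)[i := F (permute_list \<gamma> xs ! i)])) = (\<Sum>i<length xs. \<Phi> (permute_list \<gamma> (xs[i := F (xs ! i)])))"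
    if \<gamma>: "\<gamma> permutes {..<length xs}" for \<gamma>
  proof -
    have "(\<Sum>i<length xs. \<Phi> (permute_list \<gamma> (xs[i := F (xs ! i)]))) = (\<Sum>i<length xs. \<Phi> (permute_list \<gamma> (xs[\<gamma> i := F (xs ! \<gamma> i)])))"
      using sum.permute[OF \<gamma>, of "\<lambda>i. \<Phi> (permute_list \<gamma> (xs[i := F (xs ! i)]))"] by (simp add: o_def)
    also have "\<dots> = (\<Sum>i<length xs. \<Phi> ((permute_list \<gamma> xs)[i := F (permute_list \<gamma> xs ! i)]))"
      by (intro sum.cong refl) (simp add: permute_list_update[OF \<gamma>] permute_list_nth[OF \<gamma>])
    finally show ?thesis by simp
  qed
  then have "alt (\<lambda>ys. \<Sum>i<length ys. \<Phi> (ys[i := F (ys ! i)])) xs =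
     (\<Sum>\<gamma> | \<gamma> permutes {..<length xs}. \<Sum>i<length xs. \<epsilon> \<gamma> * \<Phi> (permute_list \<gamma> (xs[i := F (xs ! i)])))"
    by (simp add: alt_def sum_distrib_left)
  also have "\<dots> = (\<Sum>i<length xs. alt \<Phi> (xs[i := F (xs ! i)]))" by (subst sum.swap) (simp add: alt_def)
  finally show ?thesis .
qed

section \<open>Antisymmetrization over two blocks, and sums over pairs of arguments\<close>

lemma alt_take_permute:
  assumes "\<alpha> permutes {..<p}" "p \<le> length xs"
  shows "alt (\<lambda>ys. \<Phi> (permute_list \<alpha> (take p ys)) (drop p ys)) xs = \<epsilon> \<alpha> * alt (\<lambda>ys. \<Phi> (take p ys) (drop p ys)) xs"
proof -
  have "alt (\<lambda>ys. \<Phi> (permute_list \<alpha> (take p ys)) (drop p ys)) xs = alt (\<lambda>ys. \<Phi> (take p (permute_list \<alpha> ys)) (drop p (permute_list \<alpha> ys))) xs"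
  proof (rule alt_cong)
    fix ys :: "'a list" assume "length ys = length xs"
    then have l: "length (take p ys) = p" using assms(2) by simp
    have "permute_list \<alpha> (take p ys @ drop p ys) = permute_list \<alpha> (take p ys) @ drop p ys" using assms(1) l by (intro permute_list_append) simp
    then show "\<Phi> (permute_list \<alpha> (take p ys)) (drop p ys) = \<Phi> (take p (permute_list \<alpha> ys)) (drop p (permute_list \<alpha> ys))"
      using l by simp
  qed
  also have "\<dots> = \<epsilon> \<alpha> * alt (\<lambda>ys. \<Phi> (take p ys) (drop p ys)) xs"
    using assms by (intro alt_permute_slots permutes_subset[OF assms(1)]) simp
  finally show ?thesis .
qed

text \<open>Permuting the second block means shifting the permutation by \<open>p\<close>. Building
  it from transpositions reduces this to shifting two indices at a time.\<close>

lemma alt_drop_permute: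
  assumes "\<beta> permutes {..<q}" "length xs = p + q"
  shows "alt (\<lambda>ys. \<Phi> (take p ys) (permute_list \<beta> (drop p ys))) xs = \<epsilon> \<beta> * alt (\<lambda>ys. \<Phi> (take p ys) (drop p ys)) xs"
proof -
  have fin: "finite {..<q}" by simp
  from assms(1) fin show ?thesis
  proof (induction arbitrary: \<Phi> rule: permutes_induct)
    case id
    then show ?case by simp
  next
    case (swap a b \<gamma>)
    let ?t = "transpos (p + a) (p + b)"
    have ab: "a < q" "b < q" using swap.hyps by simp_all
    have "alt (\<lambda>ys. \<Phi> (take p ys) (permute_list (transpos a b \<circ> \<gamma>) (drop p ys))) xs =
      alt (\<lambda>ys. (\<lambda>us vs. \<Phi> us (permute_list \<gamma> vs)) (take p (permute_list ?t ys)) (drop p (permute_list ?t ys))) xs"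
    proof (rule alt_cong)
      fix ys :: "'a list" assume "length ys = length xs"
      then have l: "length ys = p + q" using assms(2) by simp
      have "permute_list ?t ys = take p ys @ permute_list (transpos a b) (drop p ys)"
        using l ab by (subst permute_list_transpose; simp?)+ (rule nth_equalityI, auto simp: nth_list_update nth_append)
      moreover have "permute_list (transpos a b \<circ> \<gamma>) (drop p ys) = permute_list \<gamma> (permute_list (transpos a b) (drop p ys))"
        using swap.hyps l by (intro permute_list_compose) simp
      ultimately show "\<Phi> (take p ys) (permute_list (transpos a b \<circ> \<gamma>) (drop p ys)) =
        (\<lambda>us vs. \<Phi> us (permute_list \<gamma> vs)) (take p (permute_list ?t ys)) (drop p (permute_list ?t ys))"
        using l by simp
    qed
    also have "\<dots> = \<epsilon> ?t * alt (\<lambda>ys. (\<lambda>us vs. \<Phi> us (permute_list \<gamma> vs)) (take p ys) (drop p ys)) xs"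
      using ab assms(2) by (intro alt_permute_slots transpose_permutes) simp_all
    also have "\<dots> = \<epsilon> (transpos a b) * (\<epsilon> \<gamma> * alt (\<lambda>ys. \<Phi> (take p ys) (drop p ys)) xs)"
      using swap.IH by (simp add: sign_swap_id)
    also have "\<dots> = \<epsilon> (transpos a b \<circ> \<gamma>) * alt (\<lambda>ys. \<Phi> (take p ys) (drop p ys)) xs"
      using permutation_lessThan[OF swap.hyps(4)] by (simp add: sign_compose permutation_swap_id)
    finally show ?case .
  qed
qed

text \<open>Each pair of permutations of the two blocks contributes the same amount.\<close>

lemma alt_product:
  assumes xs: "length xs = p + q"
  shows "alt (\<lambda>ys. alt \<Phi> (take p ys) * alt \<Psi> (drop p ys)) xs = fact p * fact q * alt (\<lambda>ys. \<Phi> (take p ys) * \<Psi> (drop p ys)) xs"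
proof -
  have card: "real (card {\<gamma>. \<gamma> permutes {..<n}}) = fact n" for n by (simp add: card_permutations[of "{..<n}" n])
  have "alt (\<lambda>ys. alt \<Phi> (take p ys) * alt \<Psi> (drop p ys)) xs =
    alt (\<lambda>ys. \<Sum>\<alpha> | \<alpha> permutes {..<p}. \<epsilon> \<alpha> * (\<Phi> (permute_list \<alpha> (take p ys)) * alt \<Psi> (drop p ys))) xs"
  proof (rule alt_cong)
    fix ys :: "'a list" assume "length ys = length xs"
    then have l: "length (take p ys) = p" using xs by simp
    show "alt \<Phi> (take p ys) * alt \<Psi> (drop p ys) =
      (\<Sum>\<alpha> | \<alpha> permutes {..<p}. \<epsilon> \<alpha> * (\<Phi> (permute_list \<alpha> (take p ys)) * alt \<Psi> (drop p ys)))"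
      unfolding alt_def[of \<Phi>] l sum_distrib_right mult.assoc by (rule refl)
  qed
  also have "\<dots> = (\<Sum>\<alpha> | \<alpha> permutes {..<p}. \<epsilon> \<alpha> * (\<epsilon> \<alpha> * alt (\<lambda>ys. \<Phi> (take p ys) * alt \<Psi> (drop p ys)) xs))"
    unfolding alt_sum alt_scale
    by (rule sum.cong) (use xs in \<open>simp_all add: alt_take_permute[of _ p xs "\<lambda>us vs. \<Phi> us * alt \<Psi> vs"]\<close>)
  also have "\<dots> = fact p * alt (\<lambda>ys. \<Phi> (take p ys) * alt \<Psi> (drop p ys)) xs" by (simp add: sign_square card)
  also have "alt (\<lambda>ys. \<Phi> (take p ys) * alt \<Psi> (drop p ys)) xs =
    alt (\<lambda>ys. \<Sum>\<beta> | \<beta> permutes {..<q}. \<epsilon> \<beta> * (\<Phi> (take p ys) * \<Psi> (permute_list \<beta> (drop p ys)))) xs"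
  proof (rule alt_cong)
    fix ys :: "'a list" assume "length ys = length xs"
    then have l: "length (drop p ys) = q" using xs by simp
    show "\<Phi> (take p ys) * alt \<Psi> (drop p ys) =
      (\<Sum>\<beta> | \<beta> permutes {..<q}. \<epsilon> \<beta> * (\<Phi> (take p ys) * \<Psi> (permute_list \<beta> (drop p ys))))"
      unfolding alt_def[of \<Psi>] l sum_distrib_left by (simp only: mult.left_commute)
  qed
  also have "\<dots> = (\<Sum>\<beta> | \<beta> permutes {..<q}. \<epsilon> \<beta> * (\<epsilon> \<beta> * alt (\<lambda>ys. \<Phi> (take p ys) * \<Psi> (drop p ys)) xs))"
    unfolding alt_sum alt_scale
    by (rule sum.cong) (use xs in \<open>simp_all add: alt_drop_permute[of _ q xs p "\<lambda>us vs. \<Phi> us * \<Psi> vs"]\<close>)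
  also have "\<dots> = fact q * alt (\<lambda>ys. \<Phi> (take p ys) * \<Psi> (drop p ys)) xs" by (simp add: sign_square card)
  finally show ?thesis by simp
qed

lemma omit_nth: "j < length xs \<Longrightarrow> omit j xs ! i = xs ! (if i < j then i else Suc i)"
  by (simp add: omit_def nth_append min_def)

lemma omit_omit: "j \<le> i \<Longrightarrow> i < length xs \<Longrightarrow> omit i (omit j xs) = omit j (omit (Suc i) xs)"
proof (induction xs arbitrary: i j)
  case (Cons x xs)
  show ?case
  proof (cases j)
    case (Suc k)
    then obtain l where "i = Suc l" using Cons.prems by (cases i) simp_all
    then show ?thesis using Cons.IH[of k l] Cons.prems Suc by simp
  qed simp
qed simp

text \<open>The left sum runs over ordered pairs of positions: \<open>j\<close> and the place
  \<open>i\<close> in the list without \<open>j\<close>, which is position \<open>i\<close> if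
  \<open>i < j\<close> and \<open>Suc i\<close> otherwise. Each unordered pair thus occurs twice,
  and both occurrences give the same term with a minus sign.\<close>

lemma sum_omit_pairs:
  assumes n: "length xs = Suc (Suc r)"
    and E: "\<And>a b zs. a \<in> set xs \<Longrightarrow> b \<in> set xs \<Longrightarrow> set zs \<subseteq> set xs \<Longrightarrow> E b a zs = - E a b zs"
  shows "(\<Sum>j\<le>Suc r. \<Sum>i\<le>r. (- 1) ^ (i + j) * E (xs ! j) (omit j xs ! i) (omit i (omit j xs)))
    = - 2 * (\<Sum>j\<le>Suc r. \<Sum>i<j. (- 1) ^ (i + j) * (E (xs ! i) (xs ! j) (omit i (omit j xs)) :: real))"
proof -
  let ?S = "\<Sum>j\<le>Suc r. \<Sum>i<j. (- 1) ^ (i + j) * E (xs ! i) (xs ! j) (omit i (omit j xs))"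
  let ?F = "\<lambda>j i. (- 1) ^ (i + j) * E (xs ! j) (omit j xs ! i) (omit i (omit j xs))"
  have "(\<Sum>i\<le>r. ?F j i) = (\<Sum>i<j. ?F j i) + (\<Sum>i=j..<Suc r. ?F j i)" if "j \<le> Suc r" for j
  proof -
    have "(\<Sum>i\<in>{0..<j}. ?F j i) + (\<Sum>i=j..<Suc r. ?F j i) = (\<Sum>i=0..<Suc r. ?F j i)" using that by (intro sum.atLeastLessThan_concat) simp_all
    then show ?thesis by (simp add: atLeast0LessThan lessThan_Suc_atMost)
  qed
  then have "(\<Sum>j\<le>Suc r. \<Sum>i\<le>r. ?F j i) = (\<Sum>j\<le>Suc r. (\<Sum>i<j. ?F j i) + (\<Sum>i=j..<Suc r. ?F j i))" by (intro sum.cong) simp_all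
  also have "\<dots> = (\<Sum>j\<le>Suc r. \<Sum>i<j. ?F j i) + (\<Sum>j\<le>Suc r. \<Sum>i=j..<Suc r. ?F j i)" by (rule sum.distrib)
  also have "(\<Sum>j\<le>Suc r. \<Sum>i<j. ?F j i) = - ?S" unfolding sum_negf[symmetric]
  proof (intro sum.cong refl)
    fix j i assume "j \<in> {..Suc r}" "i \<in> {..<j}"
    then have l: "j < length xs" "i < j" using n by simp_all
    have "E (xs ! j) (xs ! i) (omit i (omit j xs)) = - E (xs ! i) (xs ! j) (omit i (omit j xs))"
      using l set_omit[of i "omit j xs"] set_omit[of j xs] by (intro E) auto
    then show "?F j i = - ((- 1) ^ (i + j) * E (xs ! i) (xs ! j) (omit i (omit j xs)))" using l by (simp add: omit_nth)
  qed
  \<comment> \<open>Here the pair is already in increasing order, and the sign comes from the index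
    shift between \<open>i\<close> and \<open>Suc i\<close>; in the other half it came from
    antisymmetry of \<open>E\<close>.\<close>
  also have "(\<Sum>j\<le>Suc r. \<Sum>i=j..<Suc r. ?F j i) = - ?S"
  proof -
    have "(\<Sum>j\<le>Suc r. \<Sum>i=j..<Suc r. ?F j i) = (\<Sum>j<Suc r. \<Sum>i=j..r. ?F j i)"
      by (simp add: lessThan_Suc_atMost atLeastLessThanSuc_atLeastAtMost)
    also have "\<dots> = (\<Sum>j<Suc r. \<Sum>i=Suc j..Suc r. - ((- 1) ^ (j + i) * E (xs ! j) (xs ! i) (omit j (omit i xs))))"
    proof (rule sum.cong[OF refl])
      fix j assume "j \<in> {..<Suc r}"
      then have j: "j < length xs" using n by simp
      show "(\<Sum>i=j..r. ?F j i) = (\<Sum>i=Suc j..Suc r. - ((- 1) ^ (j + i) * E (xs ! j) (xs ! i) (omit j (omit i xs))))"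
        unfolding sum.shift_bounds_cl_Suc_ivl
      proof (rule sum.cong[OF refl])
        fix i assume "i \<in> {j..r}"
        then have "j \<le> i" "i < length xs" using n by simp_all
        then show "?F j i = - ((- 1) ^ (j + Suc i) * E (xs ! j) (xs ! Suc i) (omit j (omit (Suc i) xs)))"
          using omit_omit[of j i xs] j by (simp add: omit_nth add.commute)
      qed
    qed
    also have "\<dots> = - ?S" by (simp only: sum_negf sum.nested_swap')
    finally show ?thesis .
  qed
  finally show ?thesis by simp
qed

context lie_groupoid_locale
begin

section \<open>Iterated contractions\<close>

text \<open>Lowers the degree from \<open>k + length Ys\<close> to \<open>k\<close>, the last
  section acting first. The starting degree is a parameter so that a chain of contractions can be
  cut at any slot.\<close>

primrec contract :: "nat \<Rightarrow> 'g vfield list \<Rightarrow> (('m, 'g) nsimplex \<Rightarrow> real) \<Rightarrow> ('m, 'g) nsimplex \<Rightarrow> real" where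
  "contract k [] f = f"
| "contract k (Y # Ys) f = \<I> k Y (contract (Suc k) Ys f)"

lemma contract_append: "contract k (us @ vs) f = contract k us (contract (k + length us) vs f)" by (induction us arbitrary: k) simp_all

lemma iterate_last_contract: "iterate_last G q Y f = contract 0 (map Y [0..<q]) f"
  by (induction q arbitrary: f) (simp_all add: contract_append)

lemma contract_normalized:
  "set Ys \<subseteq> \<L> \<Longrightarrow> f \<in> \<C> (k + length Ys) \<Longrightarrow> contract k Ys f \<in> \<C> k"
  by (induction Ys arbitrary: k) (simp_all add: restrict_last_normalized)

lemma contract_fns:
  "set Ys \<subseteq> \<L> \<Longrightarrow> f \<in> \<C> (k + length Ys) \<Longrightarrow> contract k Ys f \<in> fns (\<N> k)"
  by (rule normalized_fns[OF contract_normalized])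

lemma contract_lincomb:
  assumes "set Ys \<subseteq> \<L>" "f \<in> \<C> (k + length Ys)" "g \<in> \<C> (k + length Ys)"
  shows "contract k Ys (\<lambda>z. a * f z + b * g z) = (\<lambda>z. a * contract k Ys f z + b * contract k Ys g z)"
  using assms by (induction Ys arbitrary: k) (simp_all add: restrict_last_lincomb contract_fns)

lemma contract_multiple:
  assumes "set Ys \<subseteq> \<L>" "f \<in> \<C> (k + length Ys)" "a \<in> fns \<O>"
  shows "contract k Ys (\<lambda>z. a (last_vertex G z) * f z) = (\<lambda>z. a (last_vertex G z) * contract k Ys f z)"
  using assms by (induction Ys arbitrary: k) (simp_all add: restrict_last_multiple contract_normalized)

lemma contract_slot:
  "contract 0 (us @ Z # vs) f = contract 0 us (\<I> (length us) Z (contract (Suc (length us)) vs f))" by (simp add: contract_append)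

lemma vertex_fns: "f \<in> fns (\<N> 0) \<Longrightarrow> (\<lambda>x. f (x, [])) \<in> fns \<O>"
proof -
  assume f: "f \<in> fns (\<N> 0)"
  have "pullback \<O> (\<lambda>x. (x, [])) f = (\<lambda>x. f (x, []))" using nerve_fns_outside[OF f] by (auto simp: pullback_def fun_eq_iff)
  then show ?thesis using smooth_between_fns[OF smooth_vertex f] by simp
qed

text \<open>Scaling the section yields a factor that is a function of the last vertex. It passes
  through the contractions to the left because these act on normalized cochains.\<close>

lemma contract_slot_scale:
  assumes us: "set us \<subseteq> \<L>" and vs: "set vs \<subseteq> \<L>" and X: "X \<in> \<L>" and a: "a \<in> fns \<O>"
    and f: "f \<in> \<C> (Suc (length us + length vs))"
  shows "contract 0 (us @ section_scale G a X # vs) f z = a (last_vertex G z) * contract 0 (us @ X # vs) f z"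
proof -
  let ?n = "length us" and ?h = "contract (Suc (length us)) vs f"
  have h: "?h \<in> \<C> (Suc ?n)" using f vs by (simp add: contract_normalized)
  have "contract 0 us (\<lambda>z. a (last_vertex G z) * \<I> ?n X ?h z) = (\<lambda>z. a (last_vertex G z) * contract 0 us (\<I> ?n X ?h) z)"
    using us h X a by (intro contract_multiple) (simp_all add: restrict_last_normalized)
  then show ?thesis by (simp add: contract_slot restrict_last_section_scale[OF X a normalized_fns[OF h]])
qed

lemma contract_slot_lincomb:
  assumes us: "set us \<subseteq> \<L>" and vs: "set vs \<subseteq> \<L>" and X: "X \<in> \<L>" "Y \<in> \<L>"
    and f: "f \<in> \<C> (Suc (length us + length vs))"
    and Z: "\<And>h z. h \<in> \<C> (Suc (length us)) \<Longrightarrow> \<I> (length us) Z h z = a * \<I> (length us) X h z + b * \<I> (length us) Y h z"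
  shows "contract 0 (us @ Z # vs) f z = a * contract 0 (us @ X # vs) f z + b * contract 0 (us @ Y # vs) f z"
proof -
  let ?n = "length us" and ?h = "contract (Suc (length us)) vs f"
  have h: "?h \<in> \<C> (Suc ?n)" using f vs by (simp add: contract_normalized)
  have "\<I> ?n Z ?h = (\<lambda>z. a * \<I> ?n X ?h z + b * \<I> ?n Y ?h z)" by (rule ext) (rule Z[OF h])
  moreover have "contract 0 us (\<lambda>z. a * \<I> ?n X ?h z + b * \<I> ?n Y ?h z) = (\<lambda>z. a * contract 0 us (\<I> ?n X ?h) z + b * contract 0 us (\<I> ?n Y ?h) z)"
    using us h X by (intro contract_lincomb) (simp_all add: restrict_last_normalized)
  ultimately show ?thesis by (simp add: contract_slot)
qed

lemma contract_slot_add: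
  assumes "set us \<subseteq> \<L>" "set vs \<subseteq> \<L>" and X: "X \<in> \<L>" "Y \<in> \<L>" and "f \<in> \<C> (Suc (length us + length vs))"
  shows "contract 0 (us @ section_add X Y # vs) f z = 1 * contract 0 (us @ X # vs) f z + 1 * contract 0 (us @ Y # vs) f z"
  by (rule contract_slot_lincomb[OF assms]) (simp add: restrict_last_section_add[OF X normalized_fns])

text \<open>Antisymmetry of the bracket under contraction is read off from the defect formula with
  the two fields exchanged; the summand with coefficient 0 fits the shape of
  \<open>alt_update\<close>.\<close>

lemma contract_slot_lie_bracket:
  assumes us: "set us \<subseteq> \<L>" and vs: "set vs \<subseteq> \<L>" and X: "X \<in> \<L>" "Y \<in> \<L>"
    and f: "f \<in> \<C> (Suc (length us + length vs))"
  shows "contract 0 (us @ lie_bracket Y X # vs) f z = - 1 * contract 0 (us @ lie_bracket X Y # vs) f z + 0 * contract 0 (us @ lie_bracket X Y # vs) f z"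
proof (rule contract_slot_lincomb[OF us vs _ _ f])
  fix h z assume h: "h \<in> \<C> (Suc (length us))"
  show "\<I> (length us) (lie_bracket Y X) h z = - 1 * \<I> (length us) (lie_bracket X Y) h z + 0 * \<I> (length us) (lie_bracket X Y) h z"
    using restrict_last_lift_defect[OF X normalized_fns[OF h], of z] restrict_last_lift_defect[OF X(2,1) normalized_fns[OF h], of z] by simp
qed (simp_all add: lie_bracket_left_invariant X)

lemma contract_cochain_prod:
  assumes "set Ys \<subseteq> \<L>" "f \<in> fns (\<N> q)" "g \<in> \<C> (k + length Ys)"
  shows "contract (q + k) Ys (\<P> q (k + length Ys) f g) = \<P> q k f (contract k Ys g)" using assms
proof (induction Ys arbitrary: k)
  case (Cons Y Ys)
  then have "contract (q + Suc k) Ys (\<P> q (Suc k + length Ys) f g) = \<P> q (Suc k) f (contract (Suc k) Ys g)" by (intro Cons.IH) simp_all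
  then show ?case using Cons.prems by (simp add: restrict_last_cochain_prod contract_fns)
qed simp

text \<open>The contractions with \<open>vs\<close> act on \<open>g\<close> alone and leave a
  function on \<open>M\<close>, placed at the last vertex of the string for \<open>f\<close>. It
  passes through the contractions with \<open>us\<close>, and in degree 0 the last vertex is
  \<open>x\<close> itself.\<close>

lemma contract_product:
  assumes "set us \<subseteq> \<L>" "set vs \<subseteq> \<L>" "f \<in> \<C> (length us)" "g \<in> \<C> (length vs)"
  shows "contract 0 (us @ vs) (\<P> (length us) (length vs) f g) (x, []) = contract 0 us f (x, []) * contract 0 vs g (x, [])"
proof -
  let ?a = "\<lambda>x. contract 0 vs g (x, [])"
  have a: "?a \<in> fns \<O>" using assms by (intro vertex_fns contract_fns) simp_all
  have "contract 0 (us @ vs) (\<P> (length us) (length vs) f g) = contract 0 us (\<P> (length us) 0 f (contract 0 vs g))"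
    using contract_cochain_prod[of vs f "length us" g 0] assms normalized_fns by (simp add: contract_append)
  also have "\<dots> = contract 0 us (\<lambda>z. ?a (last_vertex G z) * f z)" by (simp add: cochain_prod_0[OF normalized_fns[OF assms(3)]])
  also have "\<dots> = (\<lambda>z. ?a (last_vertex G z) * contract 0 us f z)" using assms a by (intro contract_multiple) simp_all
  finally show ?thesis by (simp add: last_vertex_def)
qed

lemma restrict_last_alternating_sum:
  assumes X: "X \<in> \<L>" and f: "f \<in> fns (\<N> (Suc q))" and g: "\<And>i. i \<in> I \<Longrightarrow> g i \<in> fns (\<N> (Suc q))"
  shows "\<I> q X (\<lambda>z. f z + (\<Sum>i\<in>I. c i * g i z)) = (\<lambda>z. \<I> q X f z + (\<Sum>i\<in>I. c i * \<I> q X (g i) z))"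
proof -
  have cg: "(\<lambda>z. c i * g i z) \<in> fns (\<N> (Suc q))" if "i \<in> I" for i by (rule fns_scale[OF ds_nerve g[OF that]])
  have "\<I> q X (\<lambda>z. c i * g i z) = (\<lambda>z. c i * \<I> q X (g i) z)" if "i \<in> I" for i
    using restrict_last_lincomb[OF X g[OF that] g[OF that], of "c i" 0] by simp
  moreover have "\<I> q X (\<lambda>z. \<Sum>i\<in>I. c i * g i z) = (\<lambda>z. \<Sum>i\<in>I. \<I> q X (\<lambda>z. c i * g i z) z)"
    by (rule restrict_last_sum[OF X]) (rule cg)
  ultimately have 1: "\<I> q X (\<lambda>z. \<Sum>i\<in>I. c i * g i z) = (\<lambda>z. \<Sum>i\<in>I. c i * \<I> q X (g i) z)" by simp
  have sg: "(\<lambda>z. \<Sum>i\<in>I. c i * g i z) \<in> fns (\<N> (Suc q))" by (rule fns_sum[OF ds_nerve]) (rule cg)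
  show ?thesis using restrict_last_lincomb[OF X f sg, of 1 1] by (simp add: 1)
qed

lemma contract_lift_defect_fns:
  assumes vs: "set vs \<subseteq> \<L>" and f: "f \<in> \<C> (k + length vs)" and m: "m < length vs"
  shows "contract (Suc k) (take m vs) (lift_defect (k + m) (vs ! m) (contract (Suc (k + m)) (drop (Suc m) vs) f)) \<in> fns (\<N> (Suc k))"
proof (rule contract_fns)
  show "set (take m vs) \<subseteq> \<L>" using vs set_take_subset[of m vs] by blast
  have "vs ! m \<in> \<L>" using vs m by (auto simp: subset_iff)
  moreover have "contract (Suc (k + m)) (drop (Suc m) vs) f \<in> \<C> (Suc (k + m))"
  proof (rule contract_normalized)
    show "set (drop (Suc m) vs) \<subseteq> \<L>" using vs set_drop_subset[of "Suc m" vs] by blast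
    have "Suc (k + m) + length (drop (Suc m) vs) = k + length vs" using m by simp
    then show "f \<in> \<C> (Suc (k + m) + length (drop (Suc m) vs))" using f by (simp only:)
  qed
  ultimately show "lift_defect (k + m) (vs ! m) (contract (Suc (k + m)) (drop (Suc m) vs) f) \<in> \<C> (Suc k + length (take m vs))"
    using m lift_defect_normalized by simp
qed

text \<open>Each contraction that is moved past the coboundary leaves one defect. In the summand
  \<open>m\<close> the sections behind \<open>vs ! m\<close> have acted on \<open>f\<close> before,
  in its own degrees, and those in front act on the defect, one degree higher.\<close>

lemma contract_coboundary:
  assumes "set vs \<subseteq> \<L>" "f \<in> \<C> (k + length vs)"
  shows "contract (Suc k) vs (coboundary G (k + length vs) f) =
    (\<lambda>z. coboundary G k (contract k vs f) z + (\<Sum>m<length vs. (- 1) ^ Suc (k + m) *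
       contract (Suc k) (take m vs) (lift_defect (k + m) (vs ! m) (contract (Suc (k + m)) (drop (Suc m) vs) f)) z))"
  using assms
proof (induction vs arbitrary: k)
  case (Cons V vs)
  have V: "V \<in> \<L>" and vs: "set vs \<subseteq> \<L>" and f: "f \<in> \<C> (Suc k + length vs)" using Cons.prems by simp_all
  let ?h = "contract (Suc k) vs f"
  let ?g = "\<lambda>m. contract (Suc (Suc k)) (take m vs) (lift_defect (Suc k + m) (vs ! m) (contract (Suc (Suc k + m)) (drop (Suc m) vs) f))"
  have h: "?h \<in> fns (\<N> (Suc k))" by (rule contract_fns[OF vs f])
  have g: "?g m \<in> fns (\<N> (Suc (Suc k)))" if "m \<in> {..<length vs}" for m by (rule contract_lift_defect_fns[OF vs f]) (use that in simp)
  have "contract (Suc k) (V # vs) (coboundary G (k + length (V # vs)) f) =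
    \<I> (Suc k) V (\<lambda>z. coboundary G (Suc k) ?h z + (\<Sum>m<length vs. (- 1) ^ Suc (Suc k + m) * ?g m z))"
    using Cons.IH[OF vs f] by simp
  also have "\<dots> = (\<lambda>z. \<I> (Suc k) V (coboundary G (Suc k) ?h) z + (\<Sum>m<length vs. (- 1) ^ Suc (Suc k + m) * \<I> (Suc k) V (?g m) z))"
    by (rule restrict_last_alternating_sum[OF V coboundary_fns[OF h]]) (rule g)
  also have "\<dots> = (\<lambda>z. coboundary G k (contract k (V # vs) f) z + (\<Sum>m<length (V # vs). (- 1) ^ Suc (k + m) *
       contract (Suc k) (take m (V # vs)) (lift_defect (k + m) ((V # vs) ! m) (contract (Suc (k + m)) (drop (Suc m) (V # vs)) f)) z))"
    unfolding restrict_last_coboundary[OF V h] list.size add_0_right add_Suc_right sum.lessThan_Suc_shift by (simp add: fun_eq_iff)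
  finally show ?case .
qed simp

text \<open>The first section is the one that meets the coboundary in degree 0 and gives the anchor
  term. In the summand \<open>m\<close> the sections \<open>Ys ! m\<close> and
  \<open>Ys ! Suc m\<close> act next to each other, the latter through the defect and the former by
  contracting it.\<close>

lemma contract_coboundary_0:
  assumes Ys: "set Ys \<subseteq> \<L>" "length Ys = Suc q" and f: "f \<in> \<C> q" and x: "x \<in> objs G"
  shows "contract 0 Ys (coboundary G q f) (x, []) = anchor G (hd Ys) (\<lambda>y. contract 0 (tl Ys) f (y, [])) x +
    (\<Sum>m<q. (- 1) ^ Suc m * contract 0 (take (Suc m) Ys) (lift_defect m (Ys ! Suc m) (contract (Suc m) (drop (Suc (Suc m)) Ys) f)) (x, []))"
proof -
  obtain Y vs where Y: "Ys = Y # vs" using Ys(2) by (cases Ys) simp_all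
  have YL: "Y \<in> \<L>" and vs: "set vs \<subseteq> \<L>" and q: "length vs = q" using Ys by (simp_all add: Y)
  let ?g = "\<lambda>m. contract (Suc 0) (take m vs) (lift_defect m (vs ! m) (contract (Suc m) (drop (Suc m) vs) f))"
  have h: "contract 0 vs f \<in> fns (\<N> 0)" using vs f q by (intro contract_fns) simp_all
  have g: "?g m \<in> fns (\<N> (Suc 0))" if "m \<in> {..<q}" for m using contract_lift_defect_fns[OF vs, of f 0 m] that q f by simp
  have "contract 0 Ys (coboundary G q f) = \<I> 0 Y (\<lambda>z. coboundary G 0 (contract 0 vs f) z + (\<Sum>m<q. (- 1) ^ Suc m * ?g m z))"
    using contract_coboundary[OF vs, of f 0] f q by (simp add: Y)
  also have "\<dots> = (\<lambda>z. \<I> 0 Y (coboundary G 0 (contract 0 vs f)) z + (\<Sum>m<q. (- 1) ^ Suc m * \<I> 0 Y (?g m) z))"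
    by (rule restrict_last_alternating_sum[OF YL coboundary_fns[OF h]]) (rule g)
  finally show ?thesis using restrict_last_coboundary_0[OF YL h x] by (simp add: Y)
qed

text \<open>Moving the lift of \<open>\<psi>\<close> past the contraction in one slot costs a
  contraction with the bracket in that slot.\<close>

lemma contract_mult_lift:
  assumes \<psi>: "\<psi> \<in> multiplicative G" and "set Ys \<subseteq> \<L>" "f \<in> \<C> (k + length Ys)"
  shows "contract k Ys (\<M> (k + length Ys) \<psi> f) =
    (\<lambda>z. \<M> k \<psi> (contract k Ys f) z - (\<Sum>i<length Ys. contract k (Ys[i := lie_bracket \<psi> (Ys ! i)]) f z))"
  using assms(2,3)
proof (induction Ys arbitrary: k)
  case (Cons Y Ys)
  have Y: "Y \<in> \<L>" and Ys: "set Ys \<subseteq> \<L>" and f: "f \<in> \<C> (Suc k + length Ys)" using Cons.prems by simp_all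
  let ?h = "contract (Suc k) Ys f" and ?g = "\<lambda>i. contract (Suc k) (Ys[i := lie_bracket \<psi> (Ys ! i)]) f"
  have h: "?h \<in> fns (\<N> (Suc k))" by (rule contract_fns[OF Ys f])
  have g: "?g i \<in> fns (\<N> (Suc k))" if "i \<in> {..<length Ys}" for i
  proof (rule contract_fns)
    have "Ys ! i \<in> \<L>" using Ys that by (auto simp: subset_iff)
    then show "set (Ys[i := lie_bracket \<psi> (Ys ! i)]) \<subseteq> \<L>"
      using set_update_subset_insert[of Ys i] Ys lie_bracket_multiplicative_left_invariant[OF \<psi>] by blast
  qed (use f in simp)
  have "contract k (Y # Ys) (\<M> (k + length (Y # Ys)) \<psi> f) =
    \<I> k Y (\<lambda>z. \<M> (Suc k) \<psi> ?h z + (\<Sum>i<length Ys. - 1 * ?g i z))"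
    using Cons.IH[OF Ys f] by (simp add: sum_negf)
  also have "\<dots> = (\<lambda>z. \<I> k Y (\<M> (Suc k) \<psi> ?h) z + (\<Sum>i<length Ys. - 1 * \<I> k Y (?g i) z))"
    by (rule restrict_last_alternating_sum[where c = "\<lambda>_. - 1", OF Y vfield_fns[OF mult_lift_vfield[OF \<psi>] h]]) (rule g)
  also have "\<dots> = (\<lambda>z. \<M> k \<psi> (contract k (Y # Ys) f) z - (\<Sum>i<length (Y # Ys). contract k ((Y # Ys)[i := lie_bracket \<psi> ((Y # Ys) ! i)]) f z))"
    unfolding restrict_last_mult_lift[OF \<psi> Y h] list.size add_0_right add_Suc_right sum.lessThan_Suc_shift by (simp add: sum_negf diff_diff_eq)
  finally show ?case .
qed simp

section \<open>The van Est map\<close>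

lemma sectionsD: "Xs \<in> sections G q \<Longrightarrow> length Xs = q" "Xs \<in> sections G q \<Longrightarrow> set Xs \<subseteq> \<L>"
  by (simp_all add: sections_def)

lemma sections_cong: "Xs \<in> sections G q \<Longrightarrow> length Ys = length Xs \<Longrightarrow> set Ys = set Xs \<Longrightarrow> Ys \<in> sections G q"
  by (simp add: sections_def)

lemma sections_update: "Xs \<in> sections G q \<Longrightarrow> X \<in> \<L> \<Longrightarrow> Xs[i := X] \<in> sections G q"
  using set_update_subset_insert[of Xs i X] by (auto simp: sections_def)

lemma sections_omit: "Xs \<in> sections G (Suc q) \<Longrightarrow> i \<le> q \<Longrightarrow> omit i Xs \<in> sections G q"
  using set_omit[of i Xs] by (auto simp: sections_def length_omit)

lemma van_est_alt: "Xs \<in> sections G q \<Longrightarrow> \<V> q f Xs x = alt (\<lambda>Ys. contract 0 Ys f (x, [])) Xs"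
  by (simp add: van_est_def alt_def iterate_last_contract permute_list_def sectionsD)

lemma van_est_alt_fun: "Xs \<in> sections G q \<Longrightarrow> \<V> q f Xs = (\<lambda>x. alt (\<lambda>Ys. contract 0 Ys f (x, [])) Xs)"
  by (rule ext) (rule van_est_alt)

lemma van_est_not_sections: "Xs \<notin> sections G q \<Longrightarrow> \<V> q f Xs x = 0" by (simp add: van_est_def)

lemma contract_vertex_fns:
  "f \<in> \<C> q \<Longrightarrow> Ys \<in> sections G q \<Longrightarrow> (\<lambda>x. contract 0 Ys f (x, [])) \<in> fns \<O>"
  by (intro vertex_fns contract_fns) (simp_all add: sectionsD)

lemma alt_fns:
  assumes "\<And>Ys. length Ys = length Xs \<Longrightarrow> set Ys = set Xs \<Longrightarrow> (\<lambda>x. \<Phi> x Ys) \<in> fns \<O>"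
  shows "(\<lambda>x. alt (\<Phi> x) Xs) \<in> fns \<O>" unfolding alt_def using assms by (intro fns_sum[OF ds_obj] fns_scale[OF ds_obj]) simp

lemma vfield_alt:
  assumes D: "D \<in> vector_fields \<O>"
    and \<Phi>: "\<And>Ys. length Ys = length Xs \<Longrightarrow> set Ys = set Xs \<Longrightarrow> (\<lambda>x. \<Phi> x Ys) \<in> fns \<O>"
  shows "D (\<lambda>x. alt (\<Phi> x) Xs) x = alt (\<lambda>Ys. D (\<lambda>x. \<Phi> x Ys) x) Xs"
proof -
  let ?P = "{\<gamma>. \<gamma> permutes {..<length Xs}}"
  have f: "(\<lambda>x. \<Phi> x (permute_list \<gamma> Xs)) \<in> fns \<O>" if "\<gamma> \<in> ?P" for \<gamma> using that by (intro \<Phi>) simp_all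
  have "D (\<lambda>x. alt (\<Phi> x) Xs) = (\<lambda>x. \<Sum>\<gamma>\<in>?P. D (\<lambda>x. \<epsilon> \<gamma> * \<Phi> x (permute_list \<gamma> Xs)) x)"
    unfolding alt_def using f by (intro vfield_sum[OF ds_obj D] fns_scale[OF ds_obj])
  also have "\<dots> = (\<lambda>x. \<Sum>\<gamma>\<in>?P. \<epsilon> \<gamma> * D (\<lambda>x. \<Phi> x (permute_list \<gamma> Xs)) x)"
  proof (intro ext sum.cong refl)
    fix x \<gamma> assume "\<gamma> \<in> ?P"
    from vfield_lincomb[OF D f[OF this] f[OF this], of "\<epsilon> \<gamma>" 0]
    show "D (\<lambda>x. \<epsilon> \<gamma> * \<Phi> x (permute_list \<gamma> Xs)) x = \<epsilon> \<gamma> * D (\<lambda>x. \<Phi> x (permute_list \<gamma> Xs)) x"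
      by simp
  qed
  finally show ?thesis by (simp add: alt_def)
qed

lemma van_est_fns:
  assumes "f \<in> \<C> q"
  shows "\<V> q f Xs \<in> fns \<O>"
proof (cases "Xs \<in> sections G q")
  case True
  have "(\<lambda>x. alt (\<lambda>Ys. contract 0 Ys f (x, [])) Xs) \<in> fns \<O>"
    by (rule alt_fns) (rule contract_vertex_fns[OF assms sections_cong[OF True]])
  then show ?thesis by (simp only: van_est_alt_fun[OF True])
next
  case False
  then show ?thesis using fns_zero[OF ds_obj] by (simp add: van_est_def)
qed

lemma van_est_forms:
  assumes f: "f \<in> \<C> q"
  shows "\<V> q f \<in> forms G q" unfolding forms_def mem_Collect_eq
proof (intro conjI ballI allI impI)
  show "\<V> q f Xs = (\<lambda>_. 0)" if "Xs \<notin> sections G q" for Xs using that by (simp add: van_est_def)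
  fix Xs assume Xs: "Xs \<in> sections G q"
  note l = sectionsD[OF Xs]
  show "\<V> q f Xs \<in> fns \<O>" by (rule van_est_fns[OF f])
  show "\<V> q f Xs = (\<lambda>_. 0)" if "i < q" "j < q" "i \<noteq> j" "Xs ! i = Xs ! j" for i j
    using that l by (simp add: fun_eq_iff van_est_alt[OF Xs] alt_eq_0[of i Xs j])
  let ?\<Phi> = "\<lambda>x Ys. contract 0 Ys f (x, [])"
  fix i X assume i: "i < q" and X: "X \<in> \<L>"
  show "\<V> q f (Xs[i := section_add X Y]) = (\<lambda>x. \<V> q f (Xs[i := X]) x + \<V> q f (Xs[i := Y]) x)"
    if Y: "Y \<in> \<L>" for Y
  proof
    fix x
    have "alt (?\<Phi> x) (Xs[i := section_add X Y]) = 1 * alt (?\<Phi> x) (Xs[i := X]) + 1 * alt (?\<Phi> x) (Xs[i := Y])"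
    proof (rule alt_update)
      fix us vs assume "set us \<subseteq> set Xs" "set vs \<subseteq> set Xs" "Suc (length us + length vs) = length Xs"
      then show "contract 0 (us @ section_add X Y # vs) f (x, []) = 1 * contract 0 (us @ X # vs) f (x, []) + 1 * contract 0 (us @ Y # vs) f (x, [])"
        using l f X Y contract_slot_add[of us vs X Y f] by simp
    qed (use i l in simp)
    then show "\<V> q f (Xs[i := section_add X Y]) x = \<V> q f (Xs[i := X]) x + \<V> q f (Xs[i := Y]) x"
      by (simp add: van_est_alt sections_update[OF Xs] X Y section_add_left_invariant)
  qed
  show "\<V> q f (Xs[i := section_scale G a X]) = (\<lambda>x. a x * \<V> q f (Xs[i := X]) x)"
    if a: "a \<in> fns \<O>" for a
  proof
    fix x
    have "alt (?\<Phi> x) (Xs[i := section_scale G a X]) = a x * alt (?\<Phi> x) (Xs[i := X]) + 0 * alt (?\<Phi> x) (Xs[i := X])"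
    proof (rule alt_update)
      fix us vs assume "set us \<subseteq> set Xs" "set vs \<subseteq> set Xs" "Suc (length us + length vs) = length Xs"
      then show "contract 0 (us @ section_scale G a X # vs) f (x, []) = a x * contract 0 (us @ X # vs) f (x, []) + 0 * contract 0 (us @ X # vs) f (x, [])"
        using l f X a contract_slot_scale[of us vs X a f "(x, [])"] by (simp add: last_vertex_def)
    qed (use i l in simp)
    then show "\<V> q f (Xs[i := section_scale G a X]) x = a x * \<V> q f (Xs[i := X]) x"
      by (simp add: van_est_alt sections_update[OF Xs] X a section_scale_left_invariant)
  qed
qed

lemma van_est_lincomb:
  assumes f: "f \<in> \<C> q" and g: "g \<in> \<C> q"
  shows "\<V> q (\<lambda>z. a * f z + b * g z) = (\<lambda>Xs x. a * \<V> q f Xs x + b * \<V> q g Xs x)"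
proof (intro ext)
  fix Xs x
  show "\<V> q (\<lambda>z. a * f z + b * g z) Xs x = a * \<V> q f Xs x + b * \<V> q g Xs x"
  proof (cases "Xs \<in> sections G q")
    case True
    have "alt (\<lambda>Ys. contract 0 Ys (\<lambda>z. a * f z + b * g z) (x, [])) Xs =
      alt (\<lambda>Ys. a * contract 0 Ys f (x, []) + b * contract 0 Ys g (x, [])) Xs"
      using sectionsD[OF True] f g by (intro alt_cong) (simp add: contract_lincomb)
    then show ?thesis using True by (simp add: van_est_alt alt_add alt_scale)
  qed (simp add: van_est_not_sections)
qed

lemma van_est_unit: "cochain_unit G \<in> \<C> 0" "\<V> 0 (cochain_unit G) = form_unit G"
proof -
  show "cochain_unit G \<in> \<C> 0" using fns_const[OF ds_nerve, of 0 1] by (intro normalized_0) (simp add: cochain_unit_def)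
  show "\<V> 0 (cochain_unit G) = form_unit G"
  proof (intro ext)
    fix Xs x show "\<V> 0 (cochain_unit G) Xs x = form_unit G Xs x"
    proof (cases "Xs = []")
      case True
      then have "Xs \<in> sections G 0" by (simp add: sections_def)
      then show ?thesis using True by (simp add: van_est_alt form_unit_def cochain_unit_def)
    next
      case False
      then show ?thesis by (simp add: van_est_def form_unit_def sections_def)
    qed
  qed
qed

section \<open>Compatibility with products\<close>

lemma wedge_alt:
  assumes "Xs \<in> sections G (p + q)"
  shows "wedge G p q \<omega> \<eta> Xs x = alt (\<lambda>Ys. \<omega> (take p Ys) x * \<eta> (drop p Ys) x) Xs / (fact p * fact q)"
proof -
  have "take p (permute_list \<gamma> Xs) = map (\<lambda>i. Xs ! \<gamma> i) [0..<p]" "drop p (permute_list \<gamma> Xs) = map (\<lambda>i. Xs ! \<gamma> i) [p..<p + q]" for \<gamma>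
    using sectionsD(1)[OF assms] by (simp_all add: permute_list_def take_map drop_map)
  then show ?thesis using assms by (simp add: wedge_def alt_def sectionsD mult.assoc)
qed

lemma van_est_cochain_prod:
  assumes f: "f \<in> \<C> p" and g: "g \<in> \<C> q"
  shows "\<V> (p + q) (\<P> p q f g) = wedge G p q (\<V> p f) (\<V> q g)"
proof (intro ext)
  fix Xs x
  show "\<V> (p + q) (\<P> p q f g) Xs x = wedge G p q (\<V> p f) (\<V> q g) Xs x"
  proof (cases "Xs \<in> sections G (p + q)")
    case True
    note l = sectionsD[OF True]
    let ?\<Phi> = "\<lambda>Ys. contract 0 Ys f (x, [])" and ?\<Psi> = "\<lambda>Ys. contract 0 Ys g (x, [])"
    have "wedge G p q (\<V> p f) (\<V> q g) Xs x = alt (\<lambda>Ys. alt ?\<Phi> (take p Ys) * alt ?\<Psi> (drop p Ys)) Xs / (fact p * fact q)"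
      unfolding wedge_alt[OF True]
    proof (rule arg_cong[where f = "\<lambda>r. r / (fact p * fact q)"], rule alt_cong)
      fix Ys assume Ys: "length Ys = length Xs" "set Ys = set Xs"
      have "take p Ys \<in> sections G p" "drop p Ys \<in> sections G q"
        using l Ys set_take_subset[of p Ys] set_drop_subset[of p Ys] by (auto simp: sections_def)
      then show "\<V> p f (take p Ys) x * \<V> q g (drop p Ys) x = alt ?\<Phi> (take p Ys) * alt ?\<Psi> (drop p Ys)" by (simp add: van_est_alt)
    qed
    \<comment> \<open>The factorials produced by antisymmetrizing the two blocks cancel the
      denominators in \<open>wedge\<close>.\<close>
    also have "\<dots> = alt (\<lambda>Ys. ?\<Phi> (take p Ys) * ?\<Psi> (drop p Ys)) Xs" using alt_product[OF l(1)] by simp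
    also have "\<dots> = alt (\<lambda>Ys. contract 0 Ys (\<P> p q f g) (x, [])) Xs"
    proof (rule alt_cong)
      fix Ys assume Ys: "length Ys = length Xs" "set Ys = set Xs"
      then have "length (take p Ys) = p" "length (drop p Ys) = q" using l by simp_all
      then show "?\<Phi> (take p Ys) * ?\<Psi> (drop p Ys) = contract 0 Ys (\<P> p q f g) (x, [])"
        using contract_product[of "take p Ys" "drop p Ys" f g x] f g l Ys set_take_subset[of p Ys] set_drop_subset[of p Ys] by simp
    qed
    finally show ?thesis using van_est_alt[OF True] by simp
  qed (simp add: van_est_not_sections wedge_def)
qed

section \<open>The bracket part of the differential\<close>

lemma alt_lift_defect:
  assumes Xs: "set Xs \<subseteq> \<L>" "length Xs = Suc q" and m: "m < q" and f: "f \<in> \<C> q"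
  shows "2 * alt (\<lambda>Ys. contract 0 (take (Suc m) Ys) (lift_defect m (Ys ! Suc m) (contract (Suc m) (drop (Suc (Suc m)) Ys) f)) z) Xs =
    alt (\<lambda>Ys. contract 0 (take m Ys @ lie_bracket (Ys ! m) (Ys ! Suc m) # drop (Suc (Suc m)) Ys) f z) Xs"
proof -
  let ?D = "\<lambda>Ys. contract 0 (take (Suc m) Ys) (lift_defect m (Ys ! Suc m) (contract (Suc m) (drop (Suc (Suc m)) Ys) f)) z"
  let ?s = "\<lambda>Ys. take m Ys @ Ys ! Suc m # Ys ! m # drop (Suc (Suc m)) Ys"
  \<comment> \<open>Exchanging the neighbouring slots \<open>m\<close> and \<open>Suc m\<close>
    changes the sign of the antisymmetrization, so twice that of \<open>?D\<close> is that of this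
    difference, which the defect formula turns into a bracket in slot \<open>m\<close>.\<close>
  have "?D Ys - ?D (?s Ys) = contract 0 (take m Ys @ lie_bracket (Ys ! m) (Ys ! Suc m) # drop (Suc (Suc m)) Ys) f z"
    if Ys: "length Ys = length Xs" "set Ys = set Xs" for Ys
  proof -
    let ?us = "take m Ys" and ?X = "Ys ! m" and ?Y = "Ys ! Suc m" and ?h = "contract (Suc m) (drop (Suc (Suc m)) Ys) f"
    have l: "length ?us = m" "m < length Ys" "Suc m < length Ys" using Ys Xs m by simp_all
    have us: "set ?us \<subseteq> \<L>" using Xs Ys set_take_subset[of m Ys] by simp
    have X: "?X \<in> \<L>" and Y: "?Y \<in> \<L>" using Xs Ys l nth_mem[of m Ys] nth_mem[of "Suc m" Ys] by auto
    have h: "?h \<in> \<C> (Suc m)" using f Xs Ys m set_drop_subset[of "Suc (Suc m)" Ys] by (intro contract_normalized) simp_all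
    have 1: "?D Ys = contract 0 ?us (\<I> m ?X (lift_defect m ?Y ?h)) z" using l by (simp add: take_Suc_conv_app_nth contract_append)
    have 2: "?D (?s Ys) = contract 0 ?us (\<I> m ?Y (lift_defect m ?X ?h)) z" using l by (simp add: contract_append nth_append)
    have "\<I> m (lie_bracket ?X ?Y) ?h = (\<lambda>z. 1 * \<I> m ?X (lift_defect m ?Y ?h) z + - 1 * \<I> m ?Y (lift_defect m ?X ?h) z)"
      using restrict_last_lift_defect[OF X Y normalized_fns[OF h]] by (simp add: fun_eq_iff)
    moreover have "contract 0 ?us (\<lambda>z. 1 * \<I> m ?X (lift_defect m ?Y ?h) z + - 1 * \<I> m ?Y (lift_defect m ?X ?h) z) =
      (\<lambda>z. 1 * contract 0 ?us (\<I> m ?X (lift_defect m ?Y ?h)) z + - 1 * contract 0 ?us (\<I> m ?Y (lift_defect m ?X ?h)) z)"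
      using us l X Y h by (intro contract_lincomb) (simp_all add: restrict_last_normalized lift_defect_normalized)
    ultimately show ?thesis unfolding 1 2 contract_slot l(1) by simp
  qed
  then have "alt (\<lambda>Ys. contract 0 (take m Ys @ lie_bracket (Ys ! m) (Ys ! Suc m) # drop (Suc (Suc m)) Ys) f z) Xs = alt (\<lambda>Ys. ?D Ys - ?D (?s Ys)) Xs"
    by (intro alt_cong) simp
  also have "\<dots> = 2 * alt ?D Xs" using alt_swap_slots[of m Xs ?D] m Xs(2) by (simp add: alt_diff)
  finally show ?thesis by simp
qed

text \<open>Expanding along slot \<open>m\<close> takes out the first entry of the bracket, and
  expanding what is left along slot \<open>m\<close> again takes out the second. Both expansions
  carry the sign \<open>(- 1) ^ m\<close>, so these signs cancel.\<close>

lemma alt_lie_bracket_slots: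
  fixes Xs :: "'a vfield list"
  assumes Xs: "length Xs = Suc (Suc r)" and m: "m \<le> r"
  shows "alt (\<lambda>Ys. \<Phi> (take m Ys @ lie_bracket (Ys ! m) (Ys ! Suc m) # drop (Suc (Suc m)) Ys)) Xs =
    (\<Sum>j\<le>Suc r. \<Sum>i\<le>r. (- 1) ^ (i + j) * alt (\<lambda>zs. \<Phi> (insert_at m (lie_bracket (Xs ! j) (omit j Xs ! i)) zs)) (omit i (omit j Xs)))"
proof -
  let ?b = "\<lambda>j i zs. \<Phi> (insert_at m (lie_bracket (Xs ! j) (omit j Xs ! i)) zs)"
  let ?B = "\<lambda>Ys. \<Phi> (take m Ys @ lie_bracket (Ys ! m) (Ys ! Suc m) # drop (Suc (Suc m)) Ys)"
  have "alt ?B Xs = (- 1) ^ m * (\<Sum>j\<le>Suc r. (- 1) ^ j * alt (\<lambda>ys. ?B (insert_at m (Xs ! j) ys)) (omit j Xs))"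
    using Xs m by (intro alt_expand_slot) simp_all
  also have "\<dots> = (- 1) ^ m * (\<Sum>j\<le>Suc r. (- 1) ^ j * ((- 1) ^ m * (\<Sum>i\<le>r. (- 1) ^ i * alt (?b j i) (omit i (omit j Xs)))))"
  proof (intro arg_cong[where f = "\<lambda>r. (- 1) ^ m * r"] sum.cong refl)
    fix j assume "j \<in> {..Suc r}"
    then have l: "length (omit j Xs) = Suc r" using Xs by (simp add: length_omit)
    have "alt (\<lambda>ys. ?B (insert_at m (Xs ! j) ys)) (omit j Xs) = (- 1) ^ m * (\<Sum>i\<le>r. (- 1) ^ i *
      alt (\<lambda>zs. ?B (insert_at m (Xs ! j) (insert_at m (omit j Xs ! i) zs))) (omit i (omit j Xs)))"
      using l m by (intro alt_expand_slot)
    also have "\<dots> = (- 1) ^ m * (\<Sum>i\<le>r. (- 1) ^ i * alt (?b j i) (omit i (omit j Xs)))"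
    proof (intro arg_cong[where f = "\<lambda>r. (- 1) ^ m * r"] sum.cong refl arg_cong2[where f = "(*)"] alt_cong)
      fix i and zs :: "'a vfield list" assume "i \<in> {..r}" "length zs = length (omit i (omit j Xs))"
      then have "m \<le> length zs" using m l by (simp add: length_omit)
      then show "?B (insert_at m (Xs ! j) (insert_at m (omit j Xs ! i) zs)) = ?b j i zs" by (simp add: insert_at_def nth_append)
    qed
    finally show "(- 1) ^ j * alt (\<lambda>ys. ?B (insert_at m (Xs ! j) ys)) (omit j Xs) = (- 1) ^ j * ((- 1) ^ m * (\<Sum>i\<le>r. (- 1) ^ i *
      alt (?b j i) (omit i (omit j Xs))))" by simp
  qed
  also have "\<dots> = (- 1) ^ m * ((- 1) ^ m * (\<Sum>j\<le>Suc r. \<Sum>i\<le>r. (- 1) ^ (i + j) * alt (?b j i) (omit i (omit j Xs))))"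
    unfolding sum_distrib_left by (intro sum.cong refl) (simp only: power_add mult.assoc mult.left_commute)
  finally show ?thesis by (simp add: mult.assoc[symmetric] power_mult_distrib[symmetric])
qed

text \<open>The alternating sum over \<open>m\<close> of brackets in slot \<open>m\<close> is, by
  \<open>alt_Cons\<close>, the antisymmetrization with the bracket as first argument. Summing over
  ordered pairs gives -2 times the sum over increasing pairs; the minus sign meets the one in
  \<open>Suc m\<close>, and the 2 the one from antisymmetrizing neighbouring slots.\<close>

lemma sum_alt_lift_defect:
  assumes Xs: "Xs \<in> sections G (Suc q)" and f: "f \<in> \<C> q"
  shows "(\<Sum>m<q. (- 1) ^ Suc m * alt (\<lambda>Ys. contract 0 (take (Suc m) Ys) (lift_defect m (Ys ! Suc m) (contract (Suc m) (drop (Suc (Suc m)) Ys) f)) (x, [])) Xs) =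
    (\<Sum>j\<le>q. \<Sum>i<j. (- 1) ^ (i + j) * \<V> q f (lie_bracket (Xs ! i) (Xs ! j) # omit i (omit j Xs)) x)"
proof (cases q)
  case 0
  then show ?thesis by simp
next
  case (Suc r)
  note l = sectionsD[OF Xs]
  have n: "length Xs = Suc (Suc r)" using l Suc by simp
  let ?D = "\<lambda>m Ys. contract 0 (take (Suc m) Ys) (lift_defect m (Ys ! Suc m) (contract (Suc m) (drop (Suc (Suc m)) Ys) f)) (x, [])"
  let ?\<Phi> = "\<lambda>Ys. contract 0 Ys f (x, [])"
  let ?W = "\<lambda>i j m. alt (\<lambda>zs. ?\<Phi> (insert_at m (lie_bracket (Xs ! j) (omit j Xs ! i)) zs)) (omit i (omit j Xs))"
  let ?E = "\<lambda>a b zs. alt ?\<Phi> (lie_bracket a b # zs)"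
  have "2 * (\<Sum>m<q. (- 1) ^ Suc m * alt (?D m) Xs) = (\<Sum>m\<le>r. (- 1) ^ Suc m * (2 * alt (?D m) Xs))"
    by (simp add: Suc lessThan_Suc_atMost sum_distrib_left mult.left_commute)
  also have "\<dots> = (\<Sum>m\<le>r. (- 1) ^ Suc m * (\<Sum>j\<le>Suc r. \<Sum>i\<le>r. (- 1) ^ (i + j) * ?W i j m))"
  proof (intro sum.cong refl arg_cong2[where f = "(*)"])
    fix m assume "m \<in> {..r}"
    then have m: "m \<le> r" by simp
    then have "2 * alt (?D m) Xs = alt (\<lambda>Ys. ?\<Phi> (take m Ys @ lie_bracket (Ys ! m) (Ys ! Suc m) # drop (Suc (Suc m)) Ys)) Xs"
      using alt_lift_defect[OF l(2,1) _ f] Suc by simp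
    then show "2 * alt (?D m) Xs = (\<Sum>j\<le>Suc r. \<Sum>i\<le>r. (- 1) ^ (i + j) * ?W i j m)" using alt_lie_bracket_slots[OF n m, of ?\<Phi>] by simp
  qed
  also have "\<dots> = - (\<Sum>m\<le>r. \<Sum>j\<le>Suc r. \<Sum>i\<le>r. (- 1) ^ (i + j) * ((- 1) ^ m * ?W i j m))"
    unfolding sum_negf[symmetric] sum_distrib_left by (intro sum.cong refl) simp
  also have "(\<Sum>m\<le>r. \<Sum>j\<le>Suc r. \<Sum>i\<le>r. (- 1) ^ (i + j) * ((- 1) ^ m * ?W i j m)) =
    (\<Sum>j\<le>Suc r. \<Sum>i\<le>r. (- 1) ^ (i + j) * (\<Sum>m\<le>r. (- 1) ^ m * ?W i j m))"
    unfolding sum_distrib_left by (rule trans[OF sum.swap], rule sum.cong[OF refl], rule sum.swap)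
  also have "\<dots> = (\<Sum>j\<le>Suc r. \<Sum>i\<le>r. (- 1) ^ (i + j) * ?E (Xs ! j) (omit j Xs ! i) (omit i (omit j Xs)))"
  proof (intro sum.cong refl arg_cong2[where f = "(*)"])
    fix j i assume "j \<in> {..Suc r}" "i \<in> {..r}"
    then have "length (omit i (omit j Xs)) = r" using n by (simp add: length_omit)
    then show "(\<Sum>m\<le>r. (- 1) ^ m * ?W i j m) = ?E (Xs ! j) (omit j Xs ! i) (omit i (omit j Xs))"
      using alt_Cons[of ?\<Phi> "lie_bracket (Xs ! j) (omit j Xs ! i)" "omit i (omit j Xs)"] by simp
  qed
  also have "\<dots> = - 2 * (\<Sum>j\<le>Suc r. \<Sum>i<j. (- 1) ^ (i + j) * ?E (Xs ! i) (Xs ! j) (omit i (omit j Xs)))"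
    (is "?S = _")
  proof -
    \<comment> \<open>Antisymmetry in the two fields is available only for lists of the length that
      matches the degree of \<open>f\<close>. The default 0 makes it hold for all lists, and only
      lists of length \<open>r\<close> occur in the sums.\<close>
    let ?E' = "\<lambda>a b zs. if length zs = r then ?E a b zs else 0"
    have "?S = (\<Sum>j\<le>Suc r. \<Sum>i\<le>r. (- 1) ^ (i + j) * ?E' (Xs ! j) (omit j Xs ! i) (omit i (omit j Xs)))"
      using n by (intro sum.cong refl) (simp add: length_omit)
    also have "\<dots> = - 2 * (\<Sum>j\<le>Suc r. \<Sum>i<j. (- 1) ^ (i + j) * ?E' (Xs ! i) (Xs ! j) (omit i (omit j Xs)))"
    proof (rule sum_omit_pairs[OF n])
      fix a b zs assume ab: "a \<in> set Xs" "b \<in> set Xs" and zs: "set zs \<subseteq> set Xs"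
      have ab': "a \<in> \<L>" "b \<in> \<L>" and zs': "set zs \<subseteq> \<L>" using ab zs l(2) by blast+
      note L = ab' zs' lie_bracket_left_invariant[OF ab'(2,1)]
      have "?E b a zs = - ?E a b zs" if z: "length zs = r"
      proof -
        have "alt ?\<Phi> ((lie_bracket b a # zs)[0 := lie_bracket b a]) =
          - 1 * alt ?\<Phi> ((lie_bracket b a # zs)[0 := lie_bracket a b]) + 0 * alt ?\<Phi> ((lie_bracket b a # zs)[0 := lie_bracket a b])"
        proof (rule alt_update)
          fix us vs assume *: "set us \<subseteq> set (lie_bracket b a # zs)" "set vs \<subseteq> set (lie_bracket b a # zs)"
            "Suc (length us + length vs) = length (lie_bracket b a # zs)"
          have "set us \<subseteq> \<L>" "set vs \<subseteq> \<L>" using *(1,2) L by auto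
          moreover have "Suc (length us + length vs) = q" using *(3) z Suc by simp
          ultimately show "contract 0 (us @ lie_bracket b a # vs) f (x, []) =
            - 1 * contract 0 (us @ lie_bracket a b # vs) f (x, []) + 0 * contract 0 (us @ lie_bracket a b # vs) f (x, [])"
            using contract_slot_lie_bracket[of us vs a b f] L(1,2) f by simp
        qed simp
        then show ?thesis by simp
      qed
      then show "?E' b a zs = - ?E' a b zs" by simp
    qed
    also have "\<dots> = - 2 * (\<Sum>j\<le>Suc r. \<Sum>i<j. (- 1) ^ (i + j) * ?E (Xs ! i) (Xs ! j) (omit i (omit j Xs)))"
      using n by (intro arg_cong[where f = "\<lambda>r. - 2 * r"] sum.cong refl) (simp add: length_omit)
    finally show ?thesis .
  qed
  also have "(\<Sum>j\<le>Suc r. \<Sum>i<j. (- 1) ^ (i + j) * ?E (Xs ! i) (Xs ! j) (omit i (omit j Xs))) =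
    (\<Sum>j\<le>q. \<Sum>i<j. (- 1) ^ (i + j) * \<V> q f (lie_bracket (Xs ! i) (Xs ! j) # omit i (omit j Xs)) x)"
    unfolding Suc
  proof (intro sum.cong refl arg_cong2[where f = "(*)"])
    fix j i assume "j \<in> {..Suc r}" "i \<in> {..<j}"
    then have ij: "j \<le> Suc r" "i < j" by simp_all
    then have "omit i (omit j Xs) \<in> sections G r" using Xs Suc sections_omit[of Xs "Suc r" j] sections_omit[of "omit j Xs" r i] by simp
    moreover have "lie_bracket (Xs ! i) (Xs ! j) \<in> \<L>" using ij n l(2) nth_mem[of i Xs] nth_mem[of j Xs] by (intro lie_bracket_left_invariant) auto
    ultimately have "lie_bracket (Xs ! i) (Xs ! j) # omit i (omit j Xs) \<in> sections G (Suc r)" by (simp add: sections_def)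
    then show "?E (Xs ! i) (Xs ! j) (omit i (omit j Xs)) = \<V> (Suc r) f (lie_bracket (Xs ! i) (Xs ! j) # omit i (omit j Xs)) x" by (simp add: van_est_alt)
  qed
  finally show ?thesis by simp
qed

section \<open>Compatibility with the differentials\<close>

lemma van_est_outside: "f \<in> \<C> q \<Longrightarrow> x \<notin> objs G \<Longrightarrow> \<V> q f Xs x = 0"
  using fns_outside[OF ds_obj van_est_fns] by simp

lemma van_est_coboundary:
  assumes f: "f \<in> \<C> q"
  shows "\<V> (Suc q) (coboundary G q f) = algebroid_diff G q (\<V> q f)"
proof (intro ext)
  fix Xs x
  show "\<V> (Suc q) (coboundary G q f) Xs x = algebroid_diff G q (\<V> q f) Xs x"
  proof (cases "Xs \<in> sections G (Suc q)")
    case Xs: True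
    note l = sectionsD[OF Xs]
    have XL: "Xs ! i \<in> \<L>" if "i \<le> q" for i using that l nth_mem[of i Xs] by auto
    show ?thesis
    proof (cases "x \<in> objs G")
      case x: True
      let ?a = "\<lambda>Ys. anchor G (hd Ys) (\<lambda>y. contract 0 (tl Ys) f (y, [])) x"
      let ?D = "\<lambda>m Ys. contract 0 (take (Suc m) Ys) (lift_defect m (Ys ! Suc m) (contract (Suc m) (drop (Suc (Suc m)) Ys) f)) (x, [])"
      have "\<V> (Suc q) (coboundary G q f) Xs x = alt (\<lambda>Ys. ?a Ys + (\<Sum>m<q. (- 1) ^ Suc m * ?D m Ys)) Xs"
        unfolding van_est_alt[OF Xs] using l f x by (intro alt_cong contract_coboundary_0) simp_all
      also have "\<dots> = alt ?a Xs + (\<Sum>m<q. (- 1) ^ Suc m * alt (?D m) Xs)" by (simp only: alt_add alt_sum alt_scale)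
      \<comment> \<open>Expansion along the first slot, which holds the section whose anchor
        differentiates; the anchor then passes through the finite sum over permutations of the
        others.\<close>
      also have "alt ?a Xs = (\<Sum>i\<le>q. (- 1) ^ i * anchor G (Xs ! i) (\<V> q f (omit i Xs)) x)" unfolding alt_expand[OF l(1)]
      proof (intro sum.cong refl arg_cong2[where f = "(*)"])
        fix i assume "i \<in> {..q}"
        then have i: "i \<le> q" by simp
        note o = sections_omit[OF Xs i]
        have "alt (\<lambda>Ys. anchor G (Xs ! i) (\<lambda>y. contract 0 Ys f (y, [])) x) (omit i Xs) =
          anchor G (Xs ! i) (\<lambda>y. alt (\<lambda>Ys. contract 0 Ys f (y, [])) (omit i Xs)) x"
          by (rule vfield_alt[symmetric, OF anchor_vfield[OF XL[OF i]]])
            (rule contract_vertex_fns[OF f sections_cong[OF o]])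
        then show "alt (\<lambda>ys. anchor G (hd (Xs ! i # ys)) (\<lambda>y. contract 0 (tl (Xs ! i # ys)) f (y, [])) x) (omit i Xs) =
          anchor G (Xs ! i) (\<V> q f (omit i Xs)) x"
          by (simp add: van_est_alt_fun[OF o])
      qed
      finally show ?thesis unfolding sum_alt_lift_defect[OF Xs f] using Xs by (simp add: algebroid_diff_def)
    next
      case False
      \<comment> \<open>Off the objects all functions and derivatives have the default value 0, so
        both sides vanish.\<close>
      have "anchor G (Xs ! i) g x = 0" if "i \<le> q" for i g using vfield_outside[OF ds_obj anchor_vfield[OF XL[OF that]], of x g] False by simp
      then show ?thesis using False f Xs by (simp add: algebroid_diff_def van_est_outside coboundary_normalized)
    qed
  qed (simp add: van_est_not_sections algebroid_diff_def)
qed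

section \<open>Equivariance under multiplicative vector fields\<close>

lemma van_est_mult_lift:
  assumes \<psi>: "\<psi> \<in> multiplicative G" and f: "f \<in> \<C> q"
  shows "\<V> q (\<M> q \<psi> f) = induced_derivation G q \<psi> (\<V> q f)"
proof (intro ext)
  fix Xs x
  show "\<V> q (\<M> q \<psi> f) Xs x = induced_derivation G q \<psi> (\<V> q f) Xs x"
  proof (cases "Xs \<in> sections G q")
    case Xs: True
    note l = sectionsD[OF Xs]
    have XL: "lie_bracket \<psi> (Xs ! i) \<in> \<L>" if "i < q" for i
      using that l nth_mem[of i Xs] by (intro lie_bracket_multiplicative_left_invariant[OF \<psi>]) auto
    note \<phi>v = base_field_vfield[OF \<psi>]
    show ?thesis
    proof (cases "x \<in> objs G")
      case x: True
      let ?\<Phi> = "\<lambda>y Ys. contract 0 Ys f (y, [])"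
      have "\<V> q (\<M> q \<psi> f) Xs x =
        alt (\<lambda>Ys. base_field G \<psi> (\<lambda>y. ?\<Phi> y Ys) x - (\<Sum>i<length Ys. ?\<Phi> x (Ys[i := lie_bracket \<psi> (Ys ! i)]))) Xs"
        unfolding van_est_alt[OF Xs]
      proof (rule alt_cong)
        fix Ys assume "length Ys = length Xs" "set Ys = set Xs"
        then have Ys: "length Ys = q" "set Ys \<subseteq> \<L>" using l by simp_all
        then have h: "contract 0 Ys f \<in> fns (\<N> 0)" using f by (intro contract_fns) simp_all
        show "contract 0 Ys (\<M> q \<psi> f) (x, []) = base_field G \<psi> (\<lambda>y. ?\<Phi> y Ys) x - (\<Sum>i<length Ys. ?\<Phi> x (Ys[i := lie_bracket \<psi> (Ys ! i)]))"
          using contract_mult_lift[OF \<psi> Ys(2), of f 0] f Ys(1) mult_lift_0_apply[OF \<psi> h x] by simp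
      qed
      \<comment> \<open>The base field passes through the sum over permutations, and the changes of
        single arguments by the bracket may be made before antisymmetrizing.\<close>
      also have "\<dots> = base_field G \<psi> (\<lambda>y. alt (?\<Phi> y) Xs) x - (\<Sum>i<length Xs. alt (?\<Phi> x) (Xs[i := lie_bracket \<psi> (Xs ! i)]))"
      proof -
        have "base_field G \<psi> (\<lambda>y. alt (?\<Phi> y) Xs) x = alt (\<lambda>Ys. base_field G \<psi> (\<lambda>y. ?\<Phi> y Ys) x) Xs"
          by (rule vfield_alt[OF \<phi>v]) (rule contract_vertex_fns[OF f sections_cong[OF Xs]])
        then show ?thesis by (simp only: alt_diff alt_sum_update[of "?\<Phi> x" "lie_bracket \<psi>" Xs])
      qed
      finally show ?thesis using Xs l XL by (simp add: induced_derivation_def van_est_alt_fun sections_update)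
    next
      case False
      then have "base_field G \<psi> g x = 0" for g using vfield_outside[OF ds_obj \<phi>v, of x g] by simp
      then show ?thesis using False f Xs by (simp add: induced_derivation_def van_est_outside mult_lift_normalized[OF \<psi>])
    qed
  qed (simp add: van_est_not_sections induced_derivation_def)
qed

end

theorem theorem6p2p7:
  fixes G :: "('m, 'g) groupoid"
  assumes "lie_groupoid G"
  shows "(\<forall>q. \<forall>f\<in>normalized G q. van_est G q f \<in> forms G q) \<and>
    (\<forall>q. \<forall>f\<in>normalized G q. \<forall>g\<in>normalized G q. \<forall>a b :: real.
       (\<lambda>z. a * f z + b * g z) \<in> normalized G q \<and>
       van_est G q (\<lambda>z. a * f z + b * g z) =
         (\<lambda>Xs x. a * van_est G q f Xs x + b * van_est G q g Xs x)) \<and>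
    cochain_unit G \<in> normalized G 0 \<and> van_est G 0 (cochain_unit G) = form_unit G \<and>
    (\<forall>q q'. \<forall>f\<in>normalized G q. \<forall>g\<in>normalized G q'.
       cochain_prod G q q' f g \<in> normalized G (q + q') \<and>
       van_est G (q + q') (cochain_prod G q q' f g) =
         wedge G q q' (van_est G q f) (van_est G q' g)) \<and>
    (\<forall>q. \<forall>f\<in>normalized G q.
       coboundary G q f \<in> normalized G (Suc q) \<and>
       van_est G (Suc q) (coboundary G q f) = algebroid_diff G q (van_est G q f)) \<and>
    (\<forall>\<psi>\<in>multiplicative G. \<forall>q. \<forall>f\<in>normalized G q.
       mult_lift G q \<psi> f \<in> normalized G q \<and>
       van_est G q (mult_lift G q \<psi> f) = induced_derivation G q \<psi> (van_est G q f))"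
proof -
  interpret lie_groupoid_locale G by unfold_locales (rule assms)
  show ?thesis by (intro conjI allI ballI van_est_forms normalized_lincomb van_est_lincomb van_est_unit cochain_prod_normalized
        van_est_cochain_prod coboundary_normalized van_est_coboundary mult_lift_normalized van_est_mult_lift)
qed

end
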